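(* Let $\{\mathcal K_q,q\ge 0\}$ be a compact coverage of $\Theta$ and let $\boldsymbol\gamma=\{\gamma_k\}_{k\ge0}$ be a nonincreasing sequence of positive numbers with $\sum_{k=1}^\infty k^{-1/2}\gamma_k<\infty$. Let $\{Z_k=(X_k,\theta_k,\kappa_k,\nu_k),k\ge0\}$ be the time-homogeneous Markov chain with transition probability $R$ described in the context. Assume that there is a measurable function $V:\mathsf X\to[1,\infty)$ with $\sup_{x\in\mathsf K}V(x)<\infty$ such that for every compact set $\mathcal K\subset\Theta$: (a) there exist $\mathsf C\in\mathcal B(\mathsf X)$, $\epsilon>0$ and a probability measure $\varphi$ on $\mathsf X$ (all depending on $\mathcal K$) with $\varphi(\mathsf C)>0$ and $P_\theta(x,\mathsf A)\ge\epsilon\varphi(\mathsf A)$ for all $\mathsf A\in\mathcal B(\mathsf X)$, $\theta\in\mathcal K$, $x\in\mathsf C$; (b) there exist $\lambda\in[0,1)$ and $b\in(0,\infty)$ such that for all $\theta\in\mathcal K$, $P_\theta V(x)\le\lambda V(x)$ for $x\notin\mathsf C$ and $P_\theta V(x)\le b$ for $x\in\mathsf C$; (c) for every $r\in[0,1]$ there is a constant $C$ such that $\|P_\theta f-P_{\theta'}f\|_{V^r}\le C\|f\|_{V^r}|\theta-\theta'|$ for all $\theta,\theta'\in\mathcal K$ and $f\in\mathcal L_{V^r}$. Assume also that $\{H_\theta,\theta\in\Theta\}$ is $V^\beta$-Lipschitz for some $\beta\in[0,1/2]$. Let $f:\mathsf X\to\mathbb R$ be measurable with $f\in\mathcal L_{V^\alpha}$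 for some $\alpha\in[0,(1-\beta)/2)$. For $\theta\in\Theta$ define $$\sigma^2(\theta,f)=\pi\big[\hat f_\theta^2-(P_\theta\hat f_\theta)^2\big],\qquad \hat f_\theta=\sum_{k=0}^\infty[P_\theta^kf-\pi(f)].$$ Assume in addition that there exists a random variable $\theta_\infty\in\Theta$ such that $\int_{\mathsf X}\pi(dx)\hat f_{\theta_\infty}^2(x)<\infty$ and $\int_{\mathsf X}\pi(dx)(P_{\theta_\infty}\hat f_{\theta_\infty}(x))^2<\infty$ $\overline{\mathbb P}_\star$-a.s., and $\limsup_{n\to\infty}|\theta_n-\theta_\infty|=0$ $\overline{\mathbb P}_\star$-a.s. Then, under $\overline{\mathbb P}_\star$, $$n^{-1/2}\sum_{k=1}^n[f(X_k)-\pi(f)]\longrightarrow Z\quad\text{in distribution},$$ where $Z$ has characteristic function $t\mapsto\overline{\mathbb E}_\star[\exp(-\tfrac12\sigma^2(\theta_\infty,f)t^2)]$. If in addition $\sigma(\theta_\infty,f)>0$ $\overline{\mathbb P}_\star$-a.s., then $$\frac1{\sqrt n\,\sigma(\theta_\infty,f)}\sum_{k=1}^n(f(X_k)-\pi(f))\longrightarrow\mathcal N(0,1)\quad\text{in distribution under }\overline{\mathbb P}_\star.$$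
   Context: Setting. $\mathsf X\subset\mathbb R^{n_x}$ is equipped with a countably generated $\sigma$-field $\mathcal B(\mathsf X)$; $\pi$ is a probability measure on $\mathsf X$; $\Theta\subset\mathbb R^{n_\theta}$ is open; $\{P_\theta,\theta\in\Theta\}$ is a family of Markov transition kernels on $\mathsf X$, each $\pi$-irreducible and satisfying $\pi P_\theta=\pi$; $H:\Theta\times\mathsf X\to\mathbb R^{n_\theta}$ is a measurable update function, $H_\theta(x)=H(\theta,x)$; $\mathsf K$ is a fixed subset of $\mathsf X$. Notation: $P_\theta f(x)=\int P_\theta(x,dy)f(y)$, $\pi(f)=\int f\,d\pi$. Norms. For $W:\mathsf X\to[1,\infty)$, $\|f\|_W=\sup_{x\in\mathsf X}|f(x)|/W(x)$ and $\mathcal L_W=\{f:\|f\|_W<\infty\}$. A family $\{f_\theta,\theta\in\Theta\}$ of functions on $\mathsf X$ is $W$-Lipschitz if for every compact $\mathcal K\subset\Theta$, $\sup_{\theta\in\mathcal K}\|f_\theta\|_W<\infty$ and $\sup_{\theta\ne\theta'\in\mathcal K}|\theta-\theta'|^{-1}\|f_\theta-f_{\theta'}\|_W<\infty$. Elementary kernel. Let $\theta_c\notin\Theta$ be a cemetery point and $\overline\Theta=\Theta\cup\{\theta_c\}$. For $\tilde\gamma\ge0$, $(x,\theta)\in\mathsf X\times\Theta$, $A\in\mathcal B(\mathsf X)$, $B\in\mathcal B(\overline\Theta)$, $$Q_{\tilde\gamma}(x,\theta;A\times B)=\int_AP_\theta(x,dy)\mathbb 1\{\theta+\tilde\gamma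 H(\theta,y)\in B\}+\delta_{\theta_c}(B)\int_AP_\theta(x,dy)\mathbb 1\{\theta+\tilde\gamma H(\theta,y)\notin\Theta\}.$$ Compact coverage. Compact subsets $\{\mathcal K_q,q\ge0\}$ of $\Theta$ form a compact coverage of $\Theta$ if $\bigcup_q\mathcal K_q=\Theta$ and $\mathcal K_q\subset\mathrm{int}(\mathcal K_{q+1})$ for all $q\ge0$. Algorithm with reprojections. Let $\Pi:\mathsf X\times\overline\Theta\to\mathsf K\times\mathcal K_0$ be a measurable function. The homogeneous Markov chain $Z_k=(X_k,\theta_k,\kappa_k,\nu_k)$ on $\mathsf Z=\mathsf X\times\overline\Theta\times\mathbb N\times\mathbb N$ has transition probability $R$ defined as follows: from $(x,\theta,\kappa,\nu)$, (1) if $\nu=0$ draw $(X',\theta')\sim Q_{\gamma_\kappa}(\Pi(x,\theta);\cdot)$, otherwise draw $(X',\theta')\sim Q_{\gamma_{\kappa+\nu}}(x,\theta;\cdot)$; (2) if $\theta'\in\mathcal K_\kappa$ set $\kappa'=\kappa$, $\nu'=\nu+1$, otherwise set $\kappa'=\kappa+1$, $\nu'=0$. $\overline{\mathbb P}_\star$ and $\overline{\mathbb E}_\star$ are shorthand for the law $\overline{\mathbb P}_{x,\theta,0,0}$ of the chain started from $(x,\theta,0,0)$ and the associated expectation, for any $(x,\theta)\in\mathsf X\times\Theta$. *)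

theory Defs
  imports "HOL-Probability.Probability"
begin

(* A measurable space (X, B(X)) is represented by a measure S of which only space S and sets S
   are used. *)

definition countably_generated :: "'a measure \<Rightarrow> bool" where
  "countably_generated S \<longleftrightarrow>
     (\<exists>G. countable G \<and> G \<subseteq> Pow (space S) \<and> sets S = sigma_sets (space S) G)"

text \<open>Markov kernels\<close>

abbreviation markov_kernel :: "'a measure \<Rightarrow> ('a \<Rightarrow> 'a measure) \<Rightarrow> bool" where
  "markov_kernel S Q \<equiv> Q \<in> measurable S (prob_algebra S)"

primrec kernel_pow :: "'a measure \<Rightarrow> ('a \<Rightarrow> 'a measure) \<Rightarrow> nat \<Rightarrow> 'a \<Rightarrow> 'a measure" where
  "kernel_pow S Q 0 = (\<lambda>x. return S x)"
| "kernel_pow S Q (Suc n) = (\<lambda>x. bind (kernel_pow S Q n x) Q)"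

definition kernel_irreducible :: "'a measure \<Rightarrow> 'a measure \<Rightarrow> ('a \<Rightarrow> 'a measure) \<Rightarrow> bool" where
  "kernel_irreducible S \<phi> Q \<longleftrightarrow>
     (\<forall>A\<in>sets S. emeasure \<phi> A > 0 \<longrightarrow>
        (\<forall>x\<in>space S. \<exists>n\<ge>1. emeasure (kernel_pow S Q n x) A > 0))"

definition kernel_act :: "('a \<Rightarrow> 'a measure) \<Rightarrow> ('a \<Rightarrow> real) \<Rightarrow> 'a \<Rightarrow> real" where
  "kernel_act Q f x = (\<integral>y. f y \<partial>Q x)"

(* Time-homogeneous Markov chain Z, with respect to its natural filtration, on the probability
   space M; it has transition kernel R and is started from z. The initial condition is stated
   through the law of Z 0 because singletons need not be measurable in S. *)
definition markov_chain ::
  "'w measure \<Rightarrow> 's measure \<Rightarrow> ('s \<Rightarrow> 's measure) \<Rightarrow> 's \<Rightarrow> (nat \<Rightarrow> 'w \<Rightarrow> 's) \<Rightarrow> bool" where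
  "markov_chain M S R z Z \<longleftrightarrow>
     prob_space M \<and> markov_kernel S R \<and> z \<in> space S \<and>
     (\<forall>n. Z n \<in> measurable M S) \<and>
     distr M S (Z 0) = return S z \<and>
     (\<forall>n. \<forall>B\<in>sets (PiM {..n} (\<lambda>_. S)). \<forall>A\<in>sets S.
        emeasure M {\<omega>\<in>space M. (\<lambda>i\<in>{..n}. Z i \<omega>) \<in> B \<and> Z (Suc n) \<omega> \<in> A} =
        (\<integral>\<^sup>+\<omega>. indicator B (\<lambda>i\<in>{..n}. Z i \<omega>) * emeasure (R (Z n \<omega>)) A \<partial>M))"

text \<open>Weighted norms\<close>

definition wnorm :: "'a measure \<Rightarrow> ('a \<Rightarrow> real) \<Rightarrow> ('a \<Rightarrow> 'b::real_normed_vector) \<Rightarrow> ennreal" where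
  "wnorm S W f = (SUP x\<in>space S. ennreal (norm (f x) / W x))"

definition wspace :: "'a measure \<Rightarrow> ('a \<Rightarrow> real) \<Rightarrow> ('a \<Rightarrow> real) set" where
  "wspace S W = {f \<in> borel_measurable S. wnorm S W f < \<infinity>}"

definition W_Lipschitz ::
  "'a measure \<Rightarrow> 'p::real_normed_vector set \<Rightarrow> ('a \<Rightarrow> real) \<Rightarrow> ('p \<Rightarrow> 'a \<Rightarrow> 'b::real_normed_vector) \<Rightarrow> bool" where
  "W_Lipschitz S \<Theta> W g \<longleftrightarrow>
     (\<forall>K. compact K \<and> K \<subseteq> \<Theta> \<longrightarrow>
        (SUP \<theta>\<in>K. wnorm S W (g \<theta>)) < \<infinity> \<and>
        (SUP (\<theta>, \<theta>') \<in> {(\<theta>, \<theta>'). \<theta> \<in> K \<and> \<theta>' \<in> K \<and> \<theta> \<noteq> \<theta>'}.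
           ennreal (1 / norm (\<theta> - \<theta>')) * wnorm S W (\<lambda>x. g \<theta> x - g \<theta>' x)) < \<infinity>)"

text \<open>Parameter space with cemetery point\<close>

(* \<Theta> with the cemetery adjoined: \<theta> in \<Theta> is Some \<theta>, the cemetery is None. The Borel sets
   of the extended space are those whose trace on \<Theta> is Borel, both when the cemetery is an
   isolated point and when it is the point at infinity of a one-point compactification. *)
definition cem_space :: "'p::topological_space set \<Rightarrow> 'p option measure" where
  "cem_space \<Theta> = sigma (insert None (Some ` \<Theta>))
     {B. B \<subseteq> insert None (Some ` \<Theta>) \<and> Some -` B \<in> sets (restrict_space borel \<Theta>)}"

(* |t - \<theta>|, infinite at the cemetery *)
fun cem_dist :: "'p::real_normed_vector option \<Rightarrow> 'p \<Rightarrow> ennreal" where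
  "cem_dist None \<theta> = \<infinity>"
| "cem_dist (Some t) \<theta> = ennreal (norm (t - \<theta>))"

definition compact_coverage :: "'p::topological_space set \<Rightarrow> (nat \<Rightarrow> 'p set) \<Rightarrow> bool" where
  "compact_coverage \<Theta> K \<longleftrightarrow>
     (\<forall>q. compact (K q) \<and> K q \<subseteq> \<Theta>) \<and> (\<Union>q. K q) = \<Theta> \<and> (\<forall>q. K q \<subseteq> interior (K (Suc q)))"

text \<open>Elementary kernel and chain with reprojections\<close>

definition sa_update ::
  "'p::real_normed_vector set \<Rightarrow> ('p \<Rightarrow> 'x \<Rightarrow> 'p) \<Rightarrow> real \<Rightarrow> 'p \<Rightarrow> 'x \<Rightarrow> 'p option" where
  "sa_update \<Theta> H g \<theta> y =
     (if \<theta> + g *\<^sub>R H \<theta> y \<in> \<Theta> then Some (\<theta> + g *\<^sub>R H \<theta> y) else None)"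

(* The law of (y, updated parameter) with y drawn from P \<theta> x; its values on rectangles are
   computed in elem_kernel_rectangle below. *)
definition elem_kernel ::
  "'x measure \<Rightarrow> 'p::real_normed_vector set \<Rightarrow> ('p \<Rightarrow> 'x \<Rightarrow> 'x measure) \<Rightarrow> ('p \<Rightarrow> 'x \<Rightarrow> 'p)
     \<Rightarrow> real \<Rightarrow> 'x \<Rightarrow> 'p \<Rightarrow> ('x \<times> 'p option) measure" where
  "elem_kernel S \<Theta> P H g x \<theta> =
     distr (P \<theta> x) (S \<Otimes>\<^sub>M cem_space \<Theta>) (\<lambda>y. (y, sa_update \<Theta> H g \<theta> y))"

definition state_space ::
  "'x measure \<Rightarrow> 'p::topological_space set \<Rightarrow> ('x \<times> 'p option \<times> nat \<times> nat) measure" where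
  "state_space S \<Theta> =
     S \<Otimes>\<^sub>M (cem_space \<Theta> \<Otimes>\<^sub>M (count_space UNIV \<Otimes>\<^sub>M count_space UNIV))"

(* At states (x, cemetery, \<kappa>, \<nu>) with \<nu> > 0 no kernel is prescribed and the value chosen here
   is immaterial: the cemetery lies in no set K \<kappa>, so it is only ever entered with \<nu> = 0, and
   such states are not reached from (x, \<theta>, 0, 0). *)
definition reproj_kernel ::
  "'x measure \<Rightarrow> 'p::real_normed_vector set \<Rightarrow> ('p \<Rightarrow> 'x \<Rightarrow> 'x measure) \<Rightarrow> ('p \<Rightarrow> 'x \<Rightarrow> 'p)
     \<Rightarrow> ('x \<times> 'p option \<Rightarrow> 'x \<times> 'p) \<Rightarrow> (nat \<Rightarrow> real) \<Rightarrow> (nat \<Rightarrow> 'p set)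
     \<Rightarrow> ('x \<times> 'p option \<times> nat \<times> nat) \<Rightarrow> ('x \<times> 'p option \<times> nat \<times> nat) measure" where
  "reproj_kernel S \<Theta> P H proj \<gamma> K = (\<lambda>(x, \<theta>, \<kappa>, \<nu>).
     distr
       (if \<nu> = 0 then (case proj (x, \<theta>) of (x\<^sub>0, \<theta>\<^sub>0) \<Rightarrow> elem_kernel S \<Theta> P H (\<gamma> \<kappa>) x\<^sub>0 \<theta>\<^sub>0)
        else (case \<theta> of
            Some t \<Rightarrow> elem_kernel S \<Theta> P H (\<gamma> (\<kappa> + \<nu>)) x t
          | None \<Rightarrow> return (S \<Otimes>\<^sub>M cem_space \<Theta>) (x, None)))
       (state_space S \<Theta>)
       (\<lambda>(x', \<theta>'). if \<theta>' \<in> Some ` K \<kappa> then (x', \<theta>', \<kappa>, Suc \<nu>) else (x', \<theta>', Suc \<kappa>, 0)))"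

text \<open>Poisson solution and asymptotic variance\<close>

definition poisson_sol ::
  "'x measure \<Rightarrow> 'x measure \<Rightarrow> ('x \<Rightarrow> 'x measure) \<Rightarrow> ('x \<Rightarrow> real) \<Rightarrow> 'x \<Rightarrow> real" where
  "poisson_sol S \<pi> Q f x = (\<Sum>k. kernel_act (kernel_pow S Q k) f x - (\<integral>y. f y \<partial>\<pi>))"

definition asym_var ::
  "'x measure \<Rightarrow> 'x measure \<Rightarrow> ('x \<Rightarrow> 'x measure) \<Rightarrow> ('x \<Rightarrow> real) \<Rightarrow> real" where
  "asym_var S \<pi> Q f =
     (\<integral>x. (poisson_sol S \<pi> Q f x)\<^sup>2 - (kernel_act Q (poisson_sol S \<pi> Q f) x)\<^sup>2 \<partial>\<pi>)"

text \<open>The elementary kernel on rectangles\<close>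

lemma space_cem_space [simp]: "space (cem_space \<Theta>) = insert None (Some ` \<Theta>)"
  unfolding cem_space_def by (rule space_measure_of) auto

lemma sets_cem_space:
  "sets (cem_space \<Theta>) =
     {B. B \<subseteq> insert None (Some ` \<Theta>) \<and> Some -` B \<in> sets (restrict_space borel \<Theta>)}"
    (is "_ = ?G")
proof -
  let ?U = "insert None (Some ` \<Theta>)" and ?T = "restrict_space borel \<Theta>"
  interpret sigma_algebra ?U ?G
  proof (rule sigma_algebra_iff2[THEN iffD2], intro conjI ballI allI impI)
    fix B assume B: "B \<in> ?G"
    have "Some -` (?U - B) = space ?T - Some -` B"
      by (auto simp: space_restrict_space)
    then show "?U - B \<in> ?G"
      using B by auto
  next
    fix A :: "nat \<Rightarrow> 'a option set" assume A: "range A \<subseteq> ?G"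
    then have "(\<Union>i. Some -` A i) \<in> sets ?T"
      by (intro sets.countable_UN) auto
    then show "(\<Union>i. A i) \<in> ?G"
      using A by (auto simp: vimage_UN)
  qed auto
  show ?thesis
    unfolding cem_space_def by (rule sigma_algebra.sets_measure_of_eq) unfold_locales
qed

lemma elem_kernel_rectangle:
  assumes P: "markov_kernel S (P \<theta>)" and x: "x \<in> space S" and \<theta>: "\<theta> \<in> \<Theta>"
    and H: "(\<lambda>(\<theta>, y). H \<theta> y) \<in> borel_measurable (restrict_space borel \<Theta> \<Otimes>\<^sub>M S)"
    and \<Theta>: "open (\<Theta> :: 'p::euclidean_space set)"
    and A: "A \<in> sets S" and B: "B \<in> sets (cem_space \<Theta>)"
  shows "emeasure (elem_kernel S \<Theta> P H g x \<theta>) (A \<times> B) =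
     (\<integral>\<^sup>+y\<in>A. indicator B (Some (\<theta> + g *\<^sub>R H \<theta> y)) \<partial>P \<theta> x) +
     indicator B None * (\<integral>\<^sup>+y\<in>A. indicator (- \<Theta>) (\<theta> + g *\<^sub>R H \<theta> y) \<partial>P \<theta> x)"
proof -
  define u where "u y = \<theta> + g *\<^sub>R H \<theta> y" for y
  have sets_P: "sets (P \<theta> x) = sets S" and space_P: "space (P \<theta> x) = space S"
    using measurable_space[OF P x]
    by (auto simp: space_prob_algebra dest: sets_eq_imp_space_eq)
  have "(\<lambda>y. (\<theta>, y)) \<in> measurable S (restrict_space borel \<Theta> \<Otimes>\<^sub>M S)"
    using \<theta> by (intro measurable_Pair measurable_const measurable_ident)
      (auto simp: space_restrict_space)
  from measurable_compose[OF this H] have H': "H \<theta> \<in> borel_measurable S"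
    by simp
  have u [measurable]: "u \<in> borel_measurable S"
    unfolding u_def using H' by measurable
  have B': "B \<subseteq> insert None (Some ` \<Theta>)" "Some -` B \<in> sets borel"
    using B \<Theta> by (auto simp: sets_cem_space sets_restrict_space_iff)
  have upd: "sa_update \<Theta> H g \<theta> y = (if u y \<in> \<Theta> then Some (u y) else None)" for y
    by (simp add: sa_update_def u_def)
  have [measurable]: "\<Theta> \<in> sets borel"
    using \<Theta> by simp
  have "sa_update \<Theta> H g \<theta> \<in> measurable S (cem_space \<Theta>)"
  proof (rule measurableI)
    fix C assume C: "C \<in> sets (cem_space \<Theta>)"
    then have [measurable]: "Some -` C \<in> sets borel"
      using \<Theta> by (auto simp: sets_cem_space sets_restrict_space_iff)
    have "sa_update \<Theta> H g \<theta> -` C \<inter> space S =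
        {y\<in>space S. u y \<in> \<Theta> \<and> u y \<in> Some -` C \<or> u y \<notin> \<Theta> \<and> None \<in> C}"
      by (auto simp: upd split: if_splits)
    also have "\<dots> \<in> sets S" by measurable
    finally show "sa_update \<Theta> H g \<theta> -` C \<inter> space S \<in> sets S" .
  qed (auto simp: upd)
  then have m: "(\<lambda>y. (y, sa_update \<Theta> H g \<theta> y)) \<in> measurable (P \<theta> x) (S \<Otimes>\<^sub>M cem_space \<Theta>)"
    by (simp add: measurable_cong_sets[OF sets_P refl])
  have [measurable]: "u \<in> borel_measurable (P \<theta> x)" "A \<in> sets (P \<theta> x)" "Some -` B \<in> sets borel"
    using A B' u by (simp_all add: sets_P measurable_cong_sets[OF sets_P refl])
  let ?E1 = "{y\<in>space (P \<theta> x). y \<in> A \<and> u y \<in> Some -` B}"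
  let ?E2 = "{y\<in>space (P \<theta> x). y \<in> A \<and> u y \<notin> \<Theta> \<and> None \<in> B}"
  have "emeasure (elem_kernel S \<Theta> P H g x \<theta>) (A \<times> B) = emeasure (P \<theta> x) (?E1 \<union> ?E2)"
    unfolding elem_kernel_def using A B B'(1)
    by (subst emeasure_distr[OF m]) (auto simp: upd space_P split: if_splits intro!: arg_cong[where f="emeasure _"])
  also have "\<dots> = emeasure (P \<theta> x) ?E1 + emeasure (P \<theta> x) ?E2"
  proof (rule plus_emeasure[symmetric])
    show "?E1 \<in> sets (P \<theta> x)" "?E2 \<in> sets (P \<theta> x)" by measurable
    show "?E1 \<inter> ?E2 = {}" using B'(1) by auto
  qed
  also have "emeasure (P \<theta> x) ?E1 = (\<integral>\<^sup>+y\<in>A. indicator B (Some (u y)) \<partial>P \<theta> x)"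
    by (subst nn_integral_indicator[symmetric])
      (measurable, auto intro!: nn_integral_cong split: split_indicator)
  also have "emeasure (P \<theta> x) ?E2 =
      indicator B None * (\<integral>\<^sup>+y\<in>A. indicator (- \<Theta>) (u y) \<partial>P \<theta> x)"
  proof (cases "None \<in> B")
    case True
    have E: "{y\<in>space (P \<theta> x). y \<in> A \<and> u y \<notin> \<Theta>} \<in> sets (P \<theta> x)" by measurable
    have "emeasure (P \<theta> x) {y\<in>space (P \<theta> x). y \<in> A \<and> u y \<notin> \<Theta>} =
        (\<integral>\<^sup>+y\<in>A. indicator (- \<Theta>) (u y) \<partial>P \<theta> x)"
      by (subst nn_integral_indicator[OF E, symmetric])
        (rule nn_integral_cong, auto split: split_indicator)
    then show ?thesis
      using True by simp
  qed simp
  finally show ?thesis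
    by (simp add: u_def)
qed

end

theory Submission
  imports Defs
begin

text \<open>By drift and minorization the kernels \<open>P \<theta>\<close>, with \<open>\<theta>\<close> in a compact set, are uniformly
  geometrically ergodic in \<open>V\<^sup>r\<close>-norm, so the Poisson solutions \<open>f\<^sub>\<theta>\<close> exist and, by a resolvent
  identity, depend Lipschitz-continuously on \<open>\<theta>\<close>. Replacing \<open>\<alpha>\<close> by a slightly larger exponent one
  may assume that it is positive.

  Since \<open>\<theta>\<^sub>n\<close> converges in \<open>\<Theta>\<close>, almost surely only finitely many reprojections occur. Hence it is
  enough to study, for large \<open>q\<close>, \<open>m\<close> and \<open>R\<close>, the chain on the events \<open>J k\<close> that \<open>V (X m) \<le> R\<close> and that
  the parameter stays in \<open>K q\<close> without reprojection from time \<open>m\<close> to time \<open>k\<close>; there the moments of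
  \<open>V (X k)\<close> are bounded. Poisson's equation splits the sum of \<open>f (X k) - \<pi>(f)\<close> over \<open>J k\<close> into
  martingale increments \<open>D (k + 1)\<close>, a telescoping term, and a remainder which is bounded by the step sizes and is
  \<open>o(\<surd>n)\<close> in sum by Kronecker's lemma.

  The conditional variance of \<open>D (k + 1)\<close> is \<open>g (\<theta>\<^sub>k, X k)\<close> with \<open>g\<^sub>\<theta> = P\<^sub>\<theta> (f\<^sub>\<theta>)\<^sup>2 - (P\<^sub>\<theta> f\<^sub>\<theta>)\<^sup>2\<close>. Instead of a law of large
  numbers for it, the same decomposition is applied to \<open>g\<close> itself: it equals \<open>\<sigma>\<^sup>2(\<theta>\<^sub>k, f)\<close> plus
  martingale increments, a coboundary and a small remainder. With a corrector for the coboundary, the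
  characteristic functions of the martingale part converge to those of the mixture. They are
  computed with a random argument \<open>\<psi> (\<sigma>\<^sup>2(\<theta>\<^sub>\<infinity>, f))\<close>, \<open>\<psi>\<close> bounded and continuous: a constant \<open>\<psi>\<close> yields the
  mixed limit theorem, and \<open>\<psi> x = t / max (\<surd>x) d\<close> with small \<open>d\<close> the normalised one.\<close>

section \<open>Markov kernels and weighted bounds\<close>

text \<open>The minorization holds for one step on a set \<open>C\<close> that need not be a
  sublevel set of \<open>V\<close>. Contraction is therefore proved for a power of the kernel: time
  spent outside \<open>C\<close> has geometric tails, and \<open>\<phi> C > 0\<close> lets the chain
  wait inside \<open>C\<close>, so high powers are minorized on every sublevel set. The exponent
  must be positive because the drift factor of the r-th power of \<open>V\<close> tends to 1 as r
  tends to 0.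

  Localisation has a price: on leaving \<open>J k\<close> the Poisson solution is not compensated.
  Each path leaves at most once, so \<open>V powr s \<le> n powr (s - 1) * V + n powr s\<close>
  bounds the total expected loss by order \<open>n powr s\<close>. This is below
  \<open>sqrt n\<close> for the exponent \<open>a < 1 / 2\<close> of \<open>f\<close> and below
  \<open>n\<close> for the exponent \<open>2 * a\<close> of the conditional variance, with bounded
  first moments of \<open>V\<close> only.

  The limiting variance is not known at any finite time and cannot serve as a compensator. Argument
  and weight are frozen at a time \<open>m\<close>; first \<open>n\<close> and then \<open>m\<close>
  tends to infinity. A random normalisation fits in once it is a bounded continuous function of the
  variance, since it is then a limit of adapted ones.\<close>

lemma integral_enn2real:
  assumes [measurable]: "p \<in> borel_measurable M" and fin: "(\<integral>\<^sup>+x. p x \<partial>M) < \<infinity>"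
  shows "integrable M (\<lambda>x. enn2real (p x))" "(\<integral>x. enn2real (p x) \<partial>M) = enn2real (\<integral>\<^sup>+x. p x \<partial>M)"
proof -
  have "AE x in M. p x \<noteq> \<infinity>"
    using fin by (intro nn_integral_noteq_infinite) auto
  then have eq: "(\<integral>\<^sup>+x. ennreal (enn2real (p x)) \<partial>M) = (\<integral>\<^sup>+x. p x \<partial>M)"
    by (intro nn_integral_cong_AE) (auto elim!: eventually_mono simp: less_top)
  then show "integrable M (\<lambda>x. enn2real (p x))"
    using fin by (intro integrableI_bounded) auto
  show "(\<integral>x. enn2real (p x) \<partial>M) = enn2real (\<integral>\<^sup>+x. p x \<partial>M)"
    by (subst integral_eq_nn_integral) (auto simp: eq)
qed

text \<open>Fubini for \<open>bind\<close> and unbounded integrands. Positive and negative part are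
  treated with \<open>nn_integral_bind\<close>; the inner Bochner integral is the difference of the
  two parts only almost everywhere, because the inner integrals are finite only outside a null
  set.\<close>

lemma integral_bind_kernel:
  fixes f :: "'b \<Rightarrow> real"
  assumes Q: "Q \<in> measurable M (subprob_algebra S)" and ne: "space M \<noteq> {}"
    and f [measurable]: "f \<in> borel_measurable S"
    and fin: "(\<integral>\<^sup>+x. \<integral>\<^sup>+y. ennreal \<bar>f y\<bar> \<partial>Q x \<partial>M) < \<infinity>"
  shows "integrable (bind M Q) f"
    and "integrable M (\<lambda>x. \<integral>y. f y \<partial>Q x)"
    and "(\<integral>y. f y \<partial>bind M Q) = (\<integral>x. \<integral>y. f y \<partial>Q x \<partial>M)"
proof -
  note [measurable] = Q
  have sets_Q: "sets (Q x) = sets S" if "x \<in> space M" for x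
    using measurable_space[OF Q that] by (simp add: space_subprob_algebra)
  have sets_b: "sets (bind M Q) = sets S"
    using sets_bind[OF sets_Q ne] .
  have fb: "f \<in> borel_measurable (bind M Q)"
    using f by (simp add: measurable_cong_sets[OF sets_b refl])
  have fQ: "f \<in> borel_measurable (Q x)" if "x \<in> space M" for x
    using f by (simp add: measurable_cong_sets[OF sets_Q[OF that] refl])
  show int: "integrable (bind M Q) f"
    using fb fin by (auto simp: integrable_iff_bounded nn_integral_bind[OF _ Q])
  define p where "p x = (\<integral>\<^sup>+y. ennreal (f y) \<partial>Q x)" for x
  define n where "n x = (\<integral>\<^sup>+y. ennreal (- f y) \<partial>Q x)" for x
  have [measurable]: "p \<in> borel_measurable M" "n \<in> borel_measurable M"
    unfolding p_def n_def by measurable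
  have le: "p x \<le> (\<integral>\<^sup>+y. ennreal \<bar>f y\<bar> \<partial>Q x)" "n x \<le> (\<integral>\<^sup>+y. ennreal \<bar>f y\<bar> \<partial>Q x)" for x
    unfolding p_def n_def by (auto intro!: nn_integral_mono ennreal_leI)
  have pfin: "(\<integral>\<^sup>+x. p x \<partial>M) < \<infinity>" and nfin: "(\<integral>\<^sup>+x. n x \<partial>M) < \<infinity>"
    by (rule le_less_trans[OF _ fin], rule nn_integral_mono, rule le)+
  have aeI: "AE x in M. (\<integral>y. f y \<partial>Q x) = enn2real (p x) - enn2real (n x)"
  proof -
    have "AE x in M. (\<integral>\<^sup>+y. ennreal \<bar>f y\<bar> \<partial>Q x) \<noteq> \<infinity>"
      using fin by (intro nn_integral_noteq_infinite) auto
    then show ?thesis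
    proof (rule AE_mp, intro AE_I2 impI)
      fix x assume x: "x \<in> space M" "(\<integral>\<^sup>+y. ennreal \<bar>f y\<bar> \<partial>Q x) \<noteq> \<infinity>"
      then have "integrable (Q x) f"
        using fQ[OF x(1)] by (auto simp: integrable_iff_bounded less_top)
      from real_lebesgue_integral_def[OF this]
      show "(\<integral>y. f y \<partial>Q x) = enn2real (p x) - enn2real (n x)"
        by (simp add: p_def n_def)
    qed
  qed
  have intp: "integrable M (\<lambda>x. enn2real (p x))" and intn: "integrable M (\<lambda>x. enn2real (n x))"
    using pfin nfin by (auto intro!: integral_enn2real)
  have "integrable M (\<lambda>x. enn2real (p x) - enn2real (n x))"
    using intp intn by simp
  then show "integrable M (\<lambda>x. \<integral>y. f y \<partial>Q x)"
    by (subst integrable_cong_AE[OF _ _ aeI]) auto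
  have "(\<integral>x. \<integral>y. f y \<partial>Q x \<partial>M) = (\<integral>x. enn2real (p x) - enn2real (n x) \<partial>M)"
    by (rule integral_cong_AE[OF _ _ aeI]) auto
  also have "\<dots> = (\<integral>x. enn2real (p x) \<partial>M) - (\<integral>x. enn2real (n x) \<partial>M)"
    using intp intn by simp
  also have "(\<integral>x. enn2real (p x) \<partial>M) = enn2real (\<integral>\<^sup>+x. p x \<partial>M)"
    using pfin by (intro integral_enn2real) auto
  also have "(\<integral>x. enn2real (n x) \<partial>M) = enn2real (\<integral>\<^sup>+x. n x \<partial>M)"
    using nfin by (intro integral_enn2real) auto
  finally show "(\<integral>y. f y \<partial>bind M Q) = (\<integral>x. \<integral>y. f y \<partial>Q x \<partial>M)"
    unfolding real_lebesgue_integral_def[OF int] p_def n_def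
    by (subst (1 2) nn_integral_bind[OF _ Q]) auto
qed

text \<open>The weighted norm bound in pointwise form with an explicit real constant. Estimates stay
  within the reals, and the constant can be followed through kernels, powers and Poisson solutions;
  \<open>wnorm\<close> with its values in \<open>ennreal\<close> returns only when the hypotheses
  are translated.\<close>

definition wbound :: "'a measure \<Rightarrow> ('a \<Rightarrow> real) \<Rightarrow> real \<Rightarrow> ('a \<Rightarrow> real) \<Rightarrow> bool" where
  "wbound S W N h \<longleftrightarrow> h \<in> borel_measurable S \<and> (\<forall>x\<in>space S. \<bar>h x\<bar> \<le> N * W x)"

lemma wboundD: "wbound S W N h \<Longrightarrow> x \<in> space S \<Longrightarrow> \<bar>h x\<bar> \<le> N * W x"
  and wbound_measurable: "wbound S W N h \<Longrightarrow> h \<in> borel_measurable S"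
  by (auto simp: wbound_def)

lemma wbound_diff:
  assumes "wbound S W N h" "wbound S W N' h'"
  shows "wbound S W (N + N') (\<lambda>x. h x - h' x)"
  using assms by (fastforce simp: wbound_def distrib_right intro: order_trans[OF abs_triangle_ineq4])

lemma wbound_add:
  assumes "wbound S W N h" "wbound S W N' h'"
  shows "wbound S W (N + N') (\<lambda>x. h x + h' x)"
  using assms by (fastforce simp: wbound_def distrib_right intro: order_trans[OF abs_triangle_ineq])

lemma wbound_cmult: "wbound S W N h \<Longrightarrow> wbound S W (\<bar>c\<bar> * N) (\<lambda>x. c * h x)"
  by (auto simp: wbound_def abs_mult mult.assoc intro!: mult_left_mono)

lemma wbound_mono:
  assumes "wbound S W N h" "N \<le> N'" "\<And>x. x \<in> space S \<Longrightarrow> 0 \<le> W x"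
  shows "wbound S W N' h"
  using assms by (auto simp: wbound_def intro: order_trans[OF _ mult_right_mono])

lemma markov_kernelD:
  assumes "markov_kernel S Q" "x \<in> space S"
  shows "prob_space (Q x)" "sets (Q x) = sets S" "space (Q x) = space S"
  using measurable_space[OF assms] by (auto simp: space_prob_algebra dest: sets_eq_imp_space_eq)

lemma markov_kernel_pow: "markov_kernel S Q \<Longrightarrow> markov_kernel S (kernel_pow S Q n)"
proof (induction n)
  case (Suc n)
  then show ?case
    by (simp add: measurable_bind_prob_space)
qed simp

section \<open>Kernels with a drift condition, and their iterates\<close>

locale drift_kernel =
  fixes S :: "'a measure" and W :: "'a \<Rightarrow> real" and Q :: "'a \<Rightarrow> 'a measure" and l b :: real
  assumes kernel: "markov_kernel S Q"
    and W_measurable [measurable]: "W \<in> borel_measurable S"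
    and W_ge1: "x \<in> space S \<Longrightarrow> 1 \<le> W x"
    and l_nonneg: "0 \<le> l" and b_nonneg: "0 \<le> b"
    and drift: "x \<in> space S \<Longrightarrow> (\<integral>\<^sup>+y. ennreal (W y) \<partial>Q x) \<le> ennreal (l * W x + b)"
begin

lemma W_nonneg: "x \<in> space S \<Longrightarrow> 0 \<le> W x"
  using W_ge1[of x] by simp

lemma wbound_W: "wbound S W 1 W"
  using W_nonneg by (auto simp: wbound_def)

lemma wbound_const: "wbound S W \<bar>c\<bar> (\<lambda>_. c)"
  using mult_left_mono[OF W_ge1, of _ "\<bar>c\<bar>"] by (simp add: wbound_def)

lemma nn_integral_wbound:
  assumes h: "wbound S W N h" and N: "0 \<le> N" and x: "x \<in> space S"
  shows "(\<integral>\<^sup>+y. ennreal \<bar>h y\<bar> \<partial>Q x) \<le> ennreal (N * (l * W x + b))"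
proof -
  note Qx = markov_kernelD[OF kernel x]
  have Wm: "(\<lambda>y. ennreal (W y)) \<in> borel_measurable (Q x)"
    by (simp add: measurable_cong_sets[OF Qx(2) refl])
  have "(\<integral>\<^sup>+y. ennreal \<bar>h y\<bar> \<partial>Q x) \<le> (\<integral>\<^sup>+y. ennreal N * ennreal (W y) \<partial>Q x)"
    using h N by (intro nn_integral_mono)
      (auto simp: wbound_def Qx(3) W_nonneg ennreal_mult[symmetric] intro!: ennreal_leI)
  also have "\<dots> = ennreal N * (\<integral>\<^sup>+y. ennreal (W y) \<partial>Q x)"
    using Wm by (rule nn_integral_cmult)
  also have "\<dots> \<le> ennreal N * ennreal (l * W x + b)"
    using drift[OF x] by (rule mult_left_mono) simp
  finally show ?thesis
    using N l_nonneg b_nonneg W_nonneg[OF x] by (simp add: ennreal_mult)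
qed

lemma integrable_wbound:
  assumes h: "wbound S W N h" and x: "x \<in> space S"
  shows "integrable (Q x) h"
proof -
  note Qx = markov_kernelD[OF kernel x]
  have "0 \<le> N * W x"
    using wboundD[OF h x] by linarith
  then have N: "0 \<le> N"
    using W_ge1[OF x] by (simp add: zero_le_mult_iff)
  have "(\<integral>\<^sup>+y. ennreal \<bar>h y\<bar> \<partial>Q x) < \<infinity>"
    using nn_integral_wbound[OF h N x] by (auto intro: le_less_trans)
  then show ?thesis
    using wbound_measurable[OF h] by (simp add: integrable_iff_bounded measurable_cong_sets[OF Qx(2) refl])
qed

lemma act_W_le: assumes x: "x \<in> space S" shows "kernel_act Q W x \<le> l * W x + b"
proof -
  note Qx = markov_kernelD[OF kernel x]
  have "ennreal (kernel_act Q W x) = (\<integral>\<^sup>+y. ennreal (W y) \<partial>Q x)"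
    unfolding kernel_act_def
    using integrable_wbound[OF wbound_W x] by (intro nn_integral_eq_integral[symmetric]) (auto simp: Qx(3) W_nonneg)
  also note drift[OF x]
  finally show ?thesis
    using l_nonneg b_nonneg W_nonneg[OF x] by (subst (asm) ennreal_le_iff) auto
qed

lemma act_measurable:
  assumes h: "h \<in> borel_measurable S"
  shows "kernel_act Q h \<in> borel_measurable S"
  unfolding kernel_act_def
  using measurable_compose[OF measurable_prob_algebraD[OF kernel] integral_measurable_subprob_algebra[OF h]] .

lemma wbound_act_drift:
  assumes h: "wbound S W N h" and N: "0 \<le> N" and x: "x \<in> space S"
  shows "\<bar>kernel_act Q h x\<bar> \<le> N * (l * W x + b)"
proof -
  have "ennreal \<bar>kernel_act Q h x\<bar> \<le> (\<integral>\<^sup>+y. ennreal \<bar>h y\<bar> \<partial>Q x)"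
    unfolding kernel_act_def
    using integral_norm_bound_ennreal[OF integrable_wbound[OF h x]] by simp
  also have "\<dots> \<le> ennreal (N * (l * W x + b))"
    by (rule nn_integral_wbound[OF h N x])
  finally show ?thesis
    using N l_nonneg b_nonneg W_nonneg[OF x] by (subst (asm) ennreal_le_iff) auto
qed

lemma wbound_act:
  assumes h: "wbound S W N h" and N: "0 \<le> N"
  shows "wbound S W (N * (l + b)) (kernel_act Q h)"
  unfolding wbound_def
proof (intro conjI ballI act_measurable wbound_measurable[OF h])
  fix x assume x: "x \<in> space S"
  note wbound_act_drift[OF h N x]
  also have "N * (l * W x + b) \<le> N * (l * W x + b * W x)"
    using mult_left_mono[OF W_ge1[OF x] b_nonneg] N by (intro mult_left_mono add_left_mono) auto
  finally show "\<bar>kernel_act Q h x\<bar> \<le> N * (l + b) * W x"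
    by (simp add: algebra_simps)
qed

lemma act_diff:
  assumes "wbound S W N h" "wbound S W N' h'" "x \<in> space S"
  shows "kernel_act Q (\<lambda>x. h x - h' x) x = kernel_act Q h x - kernel_act Q h' x"
  unfolding kernel_act_def
  using integrable_wbound[OF assms(1,3)] integrable_wbound[OF assms(2,3)] by simp

lemma act_add:
  assumes "wbound S W N h" "wbound S W N' h'" "x \<in> space S"
  shows "kernel_act Q (\<lambda>x. h x + h' x) x = kernel_act Q h x + kernel_act Q h' x"
  unfolding kernel_act_def
  using integrable_wbound[OF assms(1,3)] integrable_wbound[OF assms(2,3)] by simp

lemma act_cmult: "kernel_act Q (\<lambda>x. c * h x) x = c * kernel_act Q h x"
  by (simp add: kernel_act_def)

lemma act_const: "x \<in> space S \<Longrightarrow> kernel_act Q (\<lambda>x. c) x = c"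
  using markov_kernelD[OF kernel] prob_space.prob_space[of "Q x"] by (simp add: kernel_act_def)

lemma act_cong:
  assumes "\<And>y. y \<in> space S \<Longrightarrow> h y = h' y" "x \<in> space S"
  shows "kernel_act Q h x = kernel_act Q h' x"
  unfolding kernel_act_def
  using assms markov_kernelD(3)[OF kernel assms(2)] by (intro Bochner_Integration.integral_cong) auto

lemma act_mono:
  assumes "wbound S W N h" "wbound S W N' h'" "x \<in> space S" "\<And>y. y \<in> space S \<Longrightarrow> h y \<le> h' y"
  shows "kernel_act Q h x \<le> kernel_act Q h' x"
  unfolding kernel_act_def
  using assms markov_kernelD(3)[OF kernel assms(3)] by (intro integral_mono integrable_wbound) auto

text \<open>The constant \<open>b / (1 - l)\<close> is the fixed point of
  \<open>c \<mapsto> l * c + b\<close>, so it bounds the accumulated drift constants of all powers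
  at once. The zeroth power is included with factor \<open>l ^ 0 = 1\<close>; this is why
  \<open>l < 1\<close> is asked for here and not in the locale.\<close>

lemma drift_kernel_pow:
  assumes l1: "l < 1"
  shows "drift_kernel S W (kernel_pow S Q n) (l ^ n) (b / (1 - l))"
proof
  have bl: "0 \<le> b / (1 - l)" using b_nonneg l1 by simp
  show "markov_kernel S (kernel_pow S Q n)"
    using markov_kernel_pow[OF kernel] .
  show "W \<in> borel_measurable S" "\<And>x. x \<in> space S \<Longrightarrow> 1 \<le> W x" "0 \<le> l ^ n" "0 \<le> b / (1 - l)"
    using W_ge1 l_nonneg bl by auto
  fix x assume x: "x \<in> space S"
  show "(\<integral>\<^sup>+y. ennreal (W y) \<partial>kernel_pow S Q n x) \<le> ennreal (l ^ n * W x + b / (1 - l))"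
  proof (induction n)
    case 0
    show ?case
      using x bl by (simp add: nn_integral_return ennreal_leI)
  next
    case (Suc n)
    note Pn = markov_kernelD[OF markov_kernel_pow[OF kernel, of n] x]
    interpret Pn: prob_space "kernel_pow S Q n x" by fact
    have Wm: "W \<in> borel_measurable (kernel_pow S Q n x)"
      by (simp add: measurable_cong_sets[OF Pn(2) refl])
    have "(\<integral>\<^sup>+y. ennreal (W y) \<partial>kernel_pow S Q (Suc n) x) =
        (\<integral>\<^sup>+z. \<integral>\<^sup>+y. ennreal (W y) \<partial>Q z \<partial>kernel_pow S Q n x)"
      using measurable_prob_algebraD[OF kernel] measurable_cong_sets[OF Pn(2) refl, of "subprob_algebra S"]
      by (simp add: nn_integral_bind[where B=S])
    also have "\<dots> \<le> (\<integral>\<^sup>+z. ennreal l * ennreal (W z) + ennreal b \<partial>kernel_pow S Q n x)"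
      using drift by (intro nn_integral_mono)
        (auto simp: Pn(3) ennreal_mult[symmetric] ennreal_plus[symmetric] W_nonneg l_nonneg b_nonneg simp del: ennreal_plus)
    also have "\<dots> = ennreal l * (\<integral>\<^sup>+z. ennreal (W z) \<partial>kernel_pow S Q n x) + ennreal b"
      using Wm by (simp add: nn_integral_add nn_integral_cmult Pn.emeasure_space_1)
    also have "\<dots> \<le> ennreal l * ennreal (l ^ n * W x + b / (1 - l)) + ennreal b"
      by (intro add_right_mono mult_left_mono Suc) simp
    also have "\<dots> = ennreal (l * (l ^ n * W x + b / (1 - l)) + b)"
      using l_nonneg b_nonneg W_nonneg[OF x] bl by (simp add: ennreal_mult)
    also have "l * (l ^ n * W x + b / (1 - l)) + b = l ^ Suc n * W x + b / (1 - l)"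
      using l1 by (simp add: field_simps)
    finally show ?case .
  qed
qed

lemma act_pow_0: "h \<in> borel_measurable S \<Longrightarrow> x \<in> space S \<Longrightarrow> kernel_act (kernel_pow S Q 0) h x = h x"
  by (simp add: kernel_act_def integral_return)

text \<open>\<open>kernel_pow\<close> appends the last step on the right, so this order of
  composition is Fubini for \<open>bind\<close>. The other order, \<open>act_pow_Suc_left\<close>,
  goes through additivity of the exponents.\<close>

lemma act_pow_Suc:
  assumes l1: "l < 1" and h: "wbound S W N h" and N: "0 \<le> N" and x: "x \<in> space S"
  shows "kernel_act (kernel_pow S Q (Suc n)) h x = kernel_act (kernel_pow S Q n) (kernel_act Q h) x"
proof -
  interpret Pn: drift_kernel S W "kernel_pow S Q n" "l ^ n" "b / (1 - l)"
    by (rule drift_kernel_pow[OF l1])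
  note Pn' = markov_kernelD[OF Pn.kernel x]
  have le: "(\<integral>\<^sup>+z. \<integral>\<^sup>+y. ennreal \<bar>h y\<bar> \<partial>Q z \<partial>kernel_pow S Q n x) \<le>
      (\<integral>\<^sup>+z. ennreal (N * (l + b) * W z) \<partial>kernel_pow S Q n x)"
  proof (intro nn_integral_mono)
    fix z assume "z \<in> space (kernel_pow S Q n x)"
    then have z: "z \<in> space S" by (simp add: Pn'(3))
    note nn_integral_wbound[OF h N z]
    also have "N * (l * W z + b) \<le> N * (l + b) * W z"
      using mult_left_mono[OF mult_left_mono[OF W_ge1[OF z] b_nonneg] N] by (simp add: algebra_simps)
    finally show "(\<integral>\<^sup>+y. ennreal \<bar>h y\<bar> \<partial>Q z) \<le> ennreal (N * (l + b) * W z)"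
      by (simp add: ennreal_leI)
  qed
  also have "\<dots> < \<infinity>"
  proof -
    have b': "wbound S W (N * (l + b)) (\<lambda>z. N * (l + b) * W z)"
      using wbound_cmult[OF wbound_W, of "N * (l+b)"] l_nonneg b_nonneg N by auto
    show ?thesis
      using Pn.nn_integral_wbound[OF b' _ x] l_nonneg b_nonneg N
      by (intro le_less_trans[OF order_trans[OF nn_integral_mono Pn.nn_integral_wbound[OF b' _ x]]])
        (auto intro!: ennreal_leI)
  qed
  finally have fin: "(\<integral>\<^sup>+z. \<integral>\<^sup>+y. ennreal \<bar>h y\<bar> \<partial>Q z \<partial>kernel_pow S Q n x) < \<infinity>" .
  show ?thesis
    unfolding kernel_act_def kernel_pow.simps
    using measurable_prob_algebraD[OF kernel] x
    by (intro integral_bind_kernel(3)[where S=S] fin wbound_measurable[OF h])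
      (auto simp: Pn'(3) measurable_cong_sets[OF Pn'(2) refl, of "subprob_algebra S"])
qed

lemma wbound_act_pow:
  assumes l1: "l < 1" and h: "wbound S W N h" and N: "0 \<le> N"
  shows "wbound S W (N * (1 + b / (1 - l))) (kernel_act (kernel_pow S Q n) h)"
proof -
  interpret Pn: drift_kernel S W "kernel_pow S Q n" "l ^ n" "b / (1 - l)"
    by (rule drift_kernel_pow[OF l1])
  have "l ^ n \<le> 1" using l1 l_nonneg by (simp add: power_le_one)
  then show ?thesis
    using N W_nonneg by (intro wbound_mono[OF Pn.wbound_act[OF h N]] mult_left_mono) auto
qed

lemma act_pow_add:
  assumes l1: "l < 1" and h: "wbound S W N h" and N: "0 \<le> N" and x: "x \<in> space S"
  shows "kernel_act (kernel_pow S Q (m + n)) h x = kernel_act (kernel_pow S Q m) (kernel_act (kernel_pow S Q n) h) x"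
  using h N
proof (induction n arbitrary: h N)
  case 0
  interpret Pm: drift_kernel S W "kernel_pow S Q m" "l ^ m" "b / (1 - l)"
    by (rule drift_kernel_pow[OF l1])
  show ?case
    using x by (simp del: kernel_pow.simps, intro Pm.act_cong) (auto simp: act_pow_0[OF wbound_measurable[OF 0(1)]] simp del: kernel_pow.simps)
next
  case (Suc n)
  interpret Pm: drift_kernel S W "kernel_pow S Q m" "l ^ m" "b / (1 - l)"
    by (rule drift_kernel_pow[OF l1])
  have N': "0 \<le> N * (l + b)" using Suc l_nonneg b_nonneg by auto
  have "kernel_act (kernel_pow S Q (m + Suc n)) h x = kernel_act (kernel_pow S Q (m + n)) (kernel_act Q h) x"
    using act_pow_Suc[OF l1 Suc(2,3) x] by simp
  also have "\<dots> = kernel_act (kernel_pow S Q m) (kernel_act (kernel_pow S Q n) (kernel_act Q h)) x"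
    by (rule Suc.IH[OF wbound_act[OF Suc(2,3)] N'])
  also have "\<dots> = kernel_act (kernel_pow S Q m) (kernel_act (kernel_pow S Q (Suc n)) h) x"
    using act_pow_Suc[OF l1 Suc(2,3)] x by (intro Pm.act_cong) auto
  finally show ?case .
qed

lemma act_pow_Suc_left:
  assumes l1: "l < 1" and h: "wbound S W N h" and N: "0 \<le> N" and x: "x \<in> space S"
  shows "kernel_act (kernel_pow S Q (Suc n)) h x = kernel_act Q (kernel_act (kernel_pow S Q n) h) x"
proof -
  have b: "wbound S W (N * (1 + b / (1 - l))) (kernel_act (kernel_pow S Q n) h)"
    by (rule wbound_act_pow[OF l1 h N])
  show ?thesis
    using act_pow_add[OF l1 h N x, of "Suc 0" n] act_pow_Suc[OF l1 b _ x, of 0]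
      act_pow_0[OF wbound_measurable[OF wbound_act[OF b]] x] N b_nonneg l1
    by simp
qed

end

section \<open>Geometric ergodicity\<close>

locale invariant_kernel = drift_kernel +
  fixes \<pi> :: "'a measure"
  assumes prob_pi: "prob_space \<pi>" and sets_pi: "sets \<pi> = sets S"
    and invariant: "bind \<pi> Q = \<pi>" and l_less: "l < 1"
begin

sublocale \<pi>: prob_space \<pi> by (rule prob_pi)

lemma space_pi: "space \<pi> = space S"
  using sets_pi by (rule sets_eq_imp_space_eq)

lemma pi_measurable: "h \<in> borel_measurable S \<Longrightarrow> h \<in> borel_measurable \<pi>"
  by (simp add: measurable_cong_sets[OF sets_pi refl])

lemma kernel_pi: "Q \<in> measurable \<pi> (subprob_algebra S)"
  using measurable_prob_algebraD[OF kernel] by (simp add: measurable_cong_sets[OF sets_pi refl])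

lemma kernel_pow_pi: "kernel_pow S Q n \<in> measurable \<pi> (subprob_algebra S)"
  using measurable_prob_algebraD[OF markov_kernel_pow[OF kernel]] by (simp add: measurable_cong_sets[OF sets_pi refl])

lemma invariant_pow: "bind \<pi> (kernel_pow S Q n) = \<pi>"
proof (induction n)
  case 0
  show ?case
    using bind_return'[of \<pi>] return_sets_cong[OF sets_pi] by simp
next
  case (Suc n)
  have "bind \<pi> (kernel_pow S Q (Suc n)) = bind (bind \<pi> (kernel_pow S Q n)) Q"
    using measurable_prob_algebraD[OF kernel] by (simp add: bind_assoc[OF kernel_pow_pi])
  then show ?case
    using Suc invariant by simp
qed

definition "B = b / (1 - l)"

lemma B_nonneg: "0 \<le> B"
  using b_nonneg l_less by (simp add: B_def)

text \<open>Integrability of \<open>W\<close> under \<pi> has to be derived. A truncation of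
  \<open>W\<close> is bounded, so invariance under all powers can be used: the mean of
  \<open>min (W x) c\<close> is at most that of \<open>min (l ^ n * W x + B) c\<close>, and the
  summand with \<open>W\<close> vanishes for large n by dominated convergence. Letting c grow
  afterwards bounds the mean of \<open>W\<close> itself.\<close>

lemma pi_trunc_le:
  assumes c: "0 \<le> c"
  shows "(\<integral>\<^sup>+x. ennreal (min (W x) c) \<partial>\<pi>) \<le> ennreal B"
proof -
  have "(\<integral>\<^sup>+x. ennreal (min (W x) c) \<partial>\<pi>) \<le> ennreal (\<integral>x. min (l ^ n * W x + B) c \<partial>\<pi>)" for n
  proof -
    interpret Pn: drift_kernel S W "kernel_pow S Q n" "l ^ n" "b / (1 - l)"
      by (rule drift_kernel_pow[OF l_less])
    have "(\<integral>\<^sup>+x. ennreal (min (W x) c) \<partial>\<pi>) = (\<integral>\<^sup>+x. ennreal (min (W x) c) \<partial>bind \<pi> (kernel_pow S Q n))"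
      by (simp add: invariant_pow)
    also have "\<dots> = (\<integral>\<^sup>+x. \<integral>\<^sup>+y. ennreal (min (W y) c) \<partial>kernel_pow S Q n x \<partial>\<pi>)"
      by (rule nn_integral_bind[OF _ kernel_pow_pi]) simp
    also have "\<dots> \<le> (\<integral>\<^sup>+x. ennreal (min (l ^ n * W x + B) c) \<partial>\<pi>)"
    proof (rule nn_integral_mono)
      fix x assume "x \<in> space \<pi>"
      then have x: "x \<in> space S" by (simp add: space_pi)
      note Px = markov_kernelD[OF Pn.kernel x]
      interpret Px: prob_space "kernel_pow S Q n x" by fact
      have "(\<integral>\<^sup>+y. ennreal (min (W y) c) \<partial>kernel_pow S Q n x) \<le> (\<integral>\<^sup>+y. ennreal (W y) \<partial>kernel_pow S Q n x)"
        by (intro nn_integral_mono ennreal_leI) simp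
      also note Pn.drift[OF x]
      finally have 1: "(\<integral>\<^sup>+y. ennreal (min (W y) c) \<partial>kernel_pow S Q n x) \<le> ennreal (l ^ n * W x + B)"
        by (simp add: B_def)
      have "(\<integral>\<^sup>+y. ennreal (min (W y) c) \<partial>kernel_pow S Q n x) \<le> (\<integral>\<^sup>+y. ennreal c \<partial>kernel_pow S Q n x)"
        by (intro nn_integral_mono ennreal_leI) simp
      then have 2: "(\<integral>\<^sup>+y. ennreal (min (W y) c) \<partial>kernel_pow S Q n x) \<le> ennreal c"
        by (simp add: Px.emeasure_space_1)
      show "(\<integral>\<^sup>+y. ennreal (min (W y) c) \<partial>kernel_pow S Q n x) \<le> ennreal (min (l ^ n * W x + B) c)"
        using 1 2 by (auto simp: min_def)
    qed
    also have "\<dots> = ennreal (\<integral>x. min (l ^ n * W x + B) c \<partial>\<pi>)"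
      using c B_nonneg W_nonneg l_nonneg pi_measurable[OF W_measurable]
      by (intro nn_integral_eq_integral \<pi>.integrable_const_bound[where B=c]) (auto simp: space_pi)
    finally show ?thesis .
  qed
  moreover have "(\<lambda>n. \<integral>x. min (l ^ n * W x + B) c \<partial>\<pi>) \<longlonglongrightarrow> (\<integral>x. min (0 * W x + B) c \<partial>\<pi>)"
    using c B_nonneg W_nonneg l_nonneg pi_measurable[OF W_measurable] l_less
    by (intro integral_dominated_convergence[where w="\<lambda>_. c"] AE_I2 tendsto_intros LIMSEQ_realpow_zero)
      (auto simp: space_pi)
  ultimately have "(\<integral>\<^sup>+x. ennreal (min (W x) c) \<partial>\<pi>) \<le> ennreal (\<integral>x. min (0 * W x + B) c \<partial>\<pi>)"
    by (intro LIMSEQ_le_const[OF tendsto_ennrealI]) auto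
  also have "\<dots> \<le> ennreal B"
    using B_nonneg c by (intro ennreal_leI) (simp add: \<pi>.prob_space)
  finally show ?thesis .
qed

lemma nn_integral_pi_W: "(\<integral>\<^sup>+x. ennreal (W x) \<partial>\<pi>) \<le> ennreal B"
proof -
  note [measurable] = pi_measurable[OF W_measurable]
  have "(\<integral>\<^sup>+x. ennreal (W x) \<partial>\<pi>) = (\<integral>\<^sup>+x. (SUP n. ennreal (min (W x) (real n))) \<partial>\<pi>)"
  proof (rule nn_integral_cong)
    fix x
    obtain n where n: "W x \<le> real n" using real_arch_simple by blast
    show "ennreal (W x) = (SUP n. ennreal (min (W x) (real n)))"
    proof (rule antisym)
      show "ennreal (W x) \<le> (SUP n. ennreal (min (W x) (real n)))"
        using n by (intro SUP_upper2[of n]) auto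
    qed (auto intro!: SUP_least ennreal_leI)
  qed
  also have "\<dots> = (SUP n. \<integral>\<^sup>+x. ennreal (min (W x) (real n)) \<partial>\<pi>)"
    by (intro nn_integral_monotone_convergence_SUP) (auto simp: incseq_def le_fun_def intro!: ennreal_leI)
  also have "\<dots> \<le> ennreal B"
    by (intro SUP_least pi_trunc_le) simp
  finally show ?thesis .
qed

lemma nn_integral_pi_wbound:
  assumes h: "wbound S W N h" and N: "0 \<le> N"
  shows "(\<integral>\<^sup>+y. ennreal \<bar>h y\<bar> \<partial>\<pi>) \<le> ennreal (N * B)"
proof -
  have "(\<integral>\<^sup>+y. ennreal \<bar>h y\<bar> \<partial>\<pi>) \<le> (\<integral>\<^sup>+y. ennreal N * ennreal (W y) \<partial>\<pi>)"
    using h N by (intro nn_integral_mono)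
      (auto simp: wbound_def space_pi W_nonneg ennreal_mult[symmetric] intro!: ennreal_leI)
  also have "\<dots> = ennreal N * (\<integral>\<^sup>+y. ennreal (W y) \<partial>\<pi>)"
    using pi_measurable[OF W_measurable] by (intro nn_integral_cmult) auto
  also have "\<dots> \<le> ennreal N * ennreal B"
    using nn_integral_pi_W by (rule mult_left_mono) simp
  finally show ?thesis
    using N B_nonneg by (simp add: ennreal_mult)
qed

lemma wbound_N_nonneg: "wbound S W N h \<Longrightarrow> 0 \<le> N"
proof -
  assume h: "wbound S W N h"
  obtain x where x: "x \<in> space S"
    using \<pi>.not_empty space_pi by auto
  have "0 \<le> N * W x"
    using wboundD[OF h x] by linarith
  then show ?thesis
    using W_ge1[OF x] by (simp add: zero_le_mult_iff)
qed

lemma integrable_pi: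
  assumes h: "wbound S W N h"
  shows "integrable \<pi> h"
  using nn_integral_pi_wbound[OF h wbound_N_nonneg[OF h]] pi_measurable[OF wbound_measurable[OF h]]
  by (auto simp: integrable_iff_bounded intro: le_less_trans)

lemma abs_pi_le:
  assumes h: "wbound S W N h"
  shows "\<bar>\<integral>x. h x \<partial>\<pi>\<bar> \<le> N * B"
proof -
  have "ennreal \<bar>\<integral>x. h x \<partial>\<pi>\<bar> \<le> ennreal (N * B)"
    using integral_norm_bound_ennreal[OF integrable_pi[OF h]] nn_integral_pi_wbound[OF h wbound_N_nonneg[OF h]]
    by (auto intro: order_trans)
  then show ?thesis
    using wbound_N_nonneg[OF h] B_nonneg by (subst (asm) ennreal_le_iff) auto
qed

lemma pi_act:
  assumes h: "wbound S W N h"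
  shows "(\<integral>x. kernel_act Q h x \<partial>\<pi>) = (\<integral>x. h x \<partial>\<pi>)"
proof -
  have "(\<integral>\<^sup>+x. \<integral>\<^sup>+y. ennreal \<bar>h y\<bar> \<partial>Q x \<partial>\<pi>) = (\<integral>\<^sup>+y. ennreal \<bar>h y\<bar> \<partial>bind \<pi> Q)"
    using wbound_measurable[OF h] by (subst nn_integral_bind[OF _ kernel_pi]) auto
  also have "\<dots> < \<infinity>"
    using nn_integral_pi_wbound[OF h wbound_N_nonneg[OF h]] by (auto simp: invariant intro: le_less_trans)
  finally show ?thesis
    using integral_bind_kernel(3)[OF kernel_pi \<pi>.not_empty wbound_measurable[OF h]]
    by (simp add: invariant kernel_act_def)
qed

text \<open>Restricted to positive powers, because the zeroth has drift factor 1.\<close>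

lemma invariant_kernel_pow: "invariant_kernel S W (kernel_pow S Q (Suc n)) (l ^ Suc n) (b / (1 - l)) \<pi>"
proof -
  interpret Pn: drift_kernel S W "kernel_pow S Q (Suc n)" "l ^ Suc n" "b / (1 - l)"
    by (rule drift_kernel_pow[OF l_less])
  show ?thesis
    by unfold_locales (use prob_pi sets_pi invariant_pow[of "Suc n"] l_less l_nonneg power_Suc_less_one[of l n]
       in \<open>auto simp del: kernel_pow.simps power_Suc simp: power_less_one_iff\<close>)
qed

lemma pi_act_pow:
  assumes h: "wbound S W N h"
  shows "(\<integral>x. kernel_act (kernel_pow S Q n) h x \<partial>\<pi>) = (\<integral>x. h x \<partial>\<pi>)"
proof (cases n)
  case 0
  then show ?thesis
    by (auto intro!: Bochner_Integration.integral_cong act_pow_0[OF wbound_measurable[OF h]] simp: space_pi simp del: kernel_pow.simps)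
next
  case (Suc m)
  interpret Pn: invariant_kernel S W "kernel_pow S Q (Suc m)" "l ^ Suc m" "b / (1 - l)" \<pi>
    by (rule invariant_kernel_pow)
  show ?thesis
    unfolding Suc by (rule Pn.pi_act[OF h])
qed

end

text \<open>Hairer and Mattingly's contraction estimate for the weighted oscillation seminorm.\<close>

lemma (in drift_kernel) oscillation_contraction:
  fixes \<phi> :: "'a measure"
  assumes \<phi>: "prob_space \<phi>" and int: "\<And>N h. wbound S W N h \<Longrightarrow> integrable \<phi> h"
    and minor: "\<And>N h x. wbound S W N h \<Longrightarrow> (\<And>y. y \<in> space S \<Longrightarrow> 0 \<le> h y) \<Longrightarrow> x \<in> space S \<Longrightarrow> W x \<le> R
      \<Longrightarrow> a * (\<integral>y. h y \<partial>\<phi>) \<le> kernel_act Q h x"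
    and sp: "space \<phi> = space S"
    and a: "0 \<le> a" and \<beta>: "0 < \<beta>" "\<beta> * b \<le> a / 2"
    and \<rho>: "1 - a / 2 \<le> \<rho>" "l \<le> \<rho>" "2 + \<beta> * l * R + 2 * \<beta> * b \<le> \<rho> * (2 + \<beta> * R)"
    and h: "wbound S W N' h" and N: "0 \<le> N"
    and osc: "\<And>x y. x \<in> space S \<Longrightarrow> y \<in> space S \<Longrightarrow> \<bar>h x - h y\<bar> \<le> N * (2 + \<beta> * W x + \<beta> * W y)"
    and x: "x \<in> space S" and y: "y \<in> space S"
  shows "\<bar>kernel_act Q h x - kernel_act Q h y\<bar> \<le> \<rho> * N * (2 + \<beta> * W x + \<beta> * W y)"
proof -
  interpret \<phi>: prob_space \<phi> by fact
  \<comment> \<open>The oscillation bound says that the intervals with centre \<open>h z\<close> and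
    radius \<open>N * (1 + \<beta> * W z)\<close> meet pairwise, so they have a common point
    \<open>c\<close>. After subtracting it, the oscillation seminorm becomes a weighted supremum
    norm.\<close>
  define c where "c = (SUP z\<in>space S. h z - N * (1 + \<beta> * W z))"
  define g where "g z = h z - c" for z
  have up: "h z - N * (1 + \<beta> * W z) \<le> h w + N * (1 + \<beta> * W w)" if "z \<in> space S" "w \<in> space S" for z w
    using osc[OF that] by (simp add: algebra_simps)
  have c1: "h z - N * (1 + \<beta> * W z) \<le> c" if z: "z \<in> space S" for z
    unfolding c_def using up[OF _ z] z by (intro cSUP_upper bdd_aboveI2) auto
  have c2: "c \<le> h z + N * (1 + \<beta> * W z)" if z: "z \<in> space S" for z
    unfolding c_def using up[OF _ z] x by (intro cSUP_least) auto
  have Wb: "wbound S W (\<bar>N\<bar> + \<bar>N * \<beta>\<bar>) (\<lambda>z. N + N * \<beta> * W z)"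
    using wbound_add[OF wbound_const[of N] wbound_cmult[OF wbound_W, of "N * \<beta>"]] by simp
  have gb: "wbound S W (N' + \<bar>c\<bar>) g"
    unfolding g_def by (rule wbound_diff[OF h wbound_const])
  note kb = wbound_diff[OF Wb gb] and kb' = wbound_add[OF Wb gb]
  have Qg: "kernel_act Q g z = kernel_act Q h z - c" if "z \<in> space S" for z
    unfolding g_def using act_diff[OF h wbound_const that] act_const[OF that] by simp
  have QW: "kernel_act Q (\<lambda>z. N + N * \<beta> * W z) z = N + N * \<beta> * kernel_act Q W z" if "z \<in> space S" for z
    using act_add[OF wbound_const[of N] wbound_cmult[OF wbound_W, of "N * \<beta>"] that] act_const[OF that] by (simp add: act_cmult)
  have g1: "0 \<le> N + N * \<beta> * W z - g z" and g2: "0 \<le> N + N * \<beta> * W z + g z" if "z \<in> space S" for z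
    using c1[OF that] c2[OF that] by (simp_all add: g_def algebra_simps)
  have one: "kernel_act Q g u - kernel_act Q g v \<le> \<rho> * N * (2 + \<beta> * W u + \<beta> * W v)"
    if u: "u \<in> space S" and v: "v \<in> space S" for u v
  proof -
    have k1: "kernel_act Q (\<lambda>z. N + N * \<beta> * W z - g z) u = N + N * \<beta> * kernel_act Q W u - kernel_act Q g u"
      using act_diff[OF Wb gb u] QW[OF u] by simp
    have k2: "kernel_act Q (\<lambda>z. N + N * \<beta> * W z + g z) v = N + N * \<beta> * kernel_act Q W v + kernel_act Q g v"
      using act_add[OF Wb gb v] QW[OF v] by simp
    have N\<beta>: "0 \<le> N * \<beta>" using N \<beta> by simp
    have drift2: "N * \<beta> * kernel_act Q W u + N * \<beta> * kernel_act Q W v \<le> N * \<beta> * (l * (W u + W v) + 2 * b)"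
      using mult_left_mono[OF act_W_le[OF u] N\<beta>] mult_left_mono[OF act_W_le[OF v] N\<beta>] by (simp add: algebra_simps)
    have S: "0 \<le> W u + W v" using W_nonneg[OF u] W_nonneg[OF v] by simp
    \<comment> \<open>If \<open>W u + W v\<close> is small, both points lie in the sublevel set
      where the minorization takes the common mass \<open>a\<close> out of both measures. If it is
      large, the drift alone contracts, because the weight \<open>\<beta> * (W u + W v)\<close>
      dominates the additive constants.\<close>
    show ?thesis
    proof (cases "W u + W v \<le> R")
      case True
      define I1 I2 where "I1 = (\<integral>z. N + N * \<beta> * W z - g z \<partial>\<phi>)" and "I2 = (\<integral>z. N + N * \<beta> * W z + g z \<partial>\<phi>)"
      have m1: "a * I1 \<le> N + N * \<beta> * kernel_act Q W u - kernel_act Q g u"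
        unfolding k1[symmetric] I1_def using g1 True W_nonneg[OF v] by (intro minor[OF kb _ u]) auto
      have m2: "a * I2 \<le> N + N * \<beta> * kernel_act Q W v + kernel_act Q g v"
        unfolding k2[symmetric] I2_def using g2 True W_nonneg[OF u] by (intro minor[OF kb' _ v]) auto
      \<comment> \<open>In the sum \<open>g\<close> cancels, and what is left is at least
        \<open>2 * N\<close>; times \<open>a\<close>, this is the gain from the
        minorization.\<close>
      have "I1 + I2 = (\<integral>z. 2 * N + 2 * (N * \<beta> * W z) \<partial>\<phi>)"
        unfolding I1_def I2_def
        by (subst Bochner_Integration.integral_add[symmetric]) (auto intro!: int[OF kb] int[OF kb'] Bochner_Integration.integral_cong)
      moreover have "(\<integral>z. 2 * N \<partial>\<phi>) \<le> (\<integral>z. 2 * N + 2 * (N * \<beta> * W z) \<partial>\<phi>)"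
        using N\<beta> W_nonneg int[OF wbound_W] by (intro integral_mono) (auto simp: sp)
      ultimately have "2 * N \<le> I1 + I2"
        by (simp add: \<phi>.prob_space)
      from mult_left_mono[OF this a] have "a * (2 * N) \<le> a * I1 + a * I2"
        by (simp only: distrib_left)
      then have "kernel_act Q g u - kernel_act Q g v \<le> 2 * N + (N * \<beta> * kernel_act Q W u + N * \<beta> * kernel_act Q W v) - a * (2 * N)"
        using m1 m2 by linarith
      also have "\<dots> \<le> N * (2 - 2 * a + \<beta> * l * (W u + W v) + 2 * (\<beta> * b))"
        using drift2 by (simp add: algebra_simps)
      also have "\<dots> \<le> N * (\<rho> * 2 + \<rho> * \<beta> * (W u + W v))"
      proof (rule mult_left_mono[OF _ N])
        have "\<beta> * l * (W u + W v) \<le> \<rho> * \<beta> * (W u + W v)"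
          using \<rho>(2) \<beta>(1) S by (intro mult_right_mono) auto
        then show "2 - 2 * a + \<beta> * l * (W u + W v) + 2 * (\<beta> * b) \<le> \<rho> * 2 + \<rho> * \<beta> * (W u + W v)"
          using \<rho>(1) \<beta>(2) by simp
      qed
      finally show ?thesis by (simp add: algebra_simps)
    next
      case False
      have "0 \<le> kernel_act Q (\<lambda>z. N + N * \<beta> * W z - g z) u"
        using g1 unfolding kernel_act_def by (intro Bochner_Integration.integral_nonneg_AE AE_I2)
          (simp add: markov_kernelD(3)[OF kernel u])
      moreover have "0 \<le> kernel_act Q (\<lambda>z. N + N * \<beta> * W z + g z) v"
        using g2 unfolding kernel_act_def by (intro Bochner_Integration.integral_nonneg_AE AE_I2)
          (simp add: markov_kernelD(3)[OF kernel v])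
      ultimately have "kernel_act Q g u - kernel_act Q g v \<le> 2 * N + (N * \<beta> * kernel_act Q W u + N * \<beta> * kernel_act Q W v)"
        unfolding k1 k2 by simp
      also have "\<dots> \<le> N * (2 + \<beta> * l * (W u + W v) + 2 * \<beta> * b)"
        using drift2 by (simp add: algebra_simps)
      also have "\<dots> \<le> N * (\<rho> * 2 + \<rho> * \<beta> * (W u + W v))"
      proof (rule mult_left_mono[OF _ N])
        have "\<beta> * (\<rho> - l) * R \<le> \<beta> * (\<rho> - l) * (W u + W v)"
          using \<rho>(2) \<beta>(1) False by (intro mult_left_mono) auto
        then show "2 + \<beta> * l * (W u + W v) + 2 * \<beta> * b \<le> \<rho> * 2 + \<rho> * \<beta> * (W u + W v)"
          using \<rho>(3) by (simp add: algebra_simps)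
      qed
      finally show ?thesis by (simp add: algebra_simps)
    qed
  qed
  have "\<bar>kernel_act Q g x - kernel_act Q g y\<bar> \<le> \<rho> * N * (2 + \<beta> * W x + \<beta> * W y)"
    using one[OF x y] one[OF y x] by (simp add: abs_le_iff algebra_simps)
  then show ?thesis
    by (simp add: Qg[OF x] Qg[OF y])
qed

section \<open>From a small set to a minorization of the iterates on sublevel sets\<close>

locale small_kernel = drift_kernel +
  fixes C :: "'a set" and \<phi> :: "'a measure" and e :: real
  assumes C_sets: "C \<in> sets S" and prob_phi: "prob_space \<phi>" and sets_phi: "sets \<phi> = sets S"
    and phi_C: "0 < measure \<phi> C" and e_pos: "0 < e"
    and minorization: "A \<in> sets S \<Longrightarrow> x \<in> C \<Longrightarrow> e * measure \<phi> A \<le> measure (Q x) A"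
    and drift_out: "x \<in> space S - C \<Longrightarrow> (\<integral>\<^sup>+y. ennreal (W y) \<partial>Q x) \<le> ennreal (l * W x)"
    and l_less1: "l < 1"
begin

sublocale \<phi>: prob_space \<phi> by (rule prob_phi)

lemma space_phi: "space \<phi> = space S"
  using sets_phi by (rule sets_eq_imp_space_eq)

lemma C_space: "x \<in> C \<Longrightarrow> x \<in> space S"
  using sets.sets_into_space[OF C_sets] by auto

lemma C_nonempty: "\<exists>x. x \<in> C"
  using phi_C by (cases "C = {}") auto

lemma nn_minorization:
  assumes x: "x \<in> C" and m: "h \<in> borel_measurable \<phi>"
  shows "ennreal e * (\<integral>\<^sup>+y. h y \<partial>\<phi>) \<le> (\<integral>\<^sup>+y. h y \<partial>Q x)"
proof -
  note Qx = markov_kernelD[OF kernel C_space[OF x]]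
  interpret Qx: prob_space "Q x" by fact
  have "scale_measure (ennreal e) \<phi> \<le> Q x"
  proof (subst le_measure_iff, simp add: Qx sets_phi space_phi space_scale_measure, rule le_funI)
    fix A
    show "emeasure (scale_measure (ennreal e) \<phi>) A \<le> emeasure (Q x) A"
    proof (cases "A \<in> sets S")
      case True
      then show ?thesis
        using minorization[OF True x] e_pos
        by (simp add: \<phi>.emeasure_eq_measure Qx.emeasure_eq_measure ennreal_mult[symmetric] ennreal_leI)
    qed (simp add: emeasure_notin_sets sets_phi)
  qed
  then have "(\<integral>\<^sup>+y. h y \<partial>scale_measure (ennreal e) \<phi>) \<le> (\<integral>\<^sup>+y. h y \<partial>Q x)"
    by (intro nn_integral_mono_measure) (simp_all add: Qx sets_phi)
  then show ?thesis
    using m by (simp add: nn_integral_scale_measure)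
qed

text \<open>At any point \<open>x\<close> of \<open>C\<close> the measure \<phi> scaled by
  \<open>e\<close> lies below \<open>Q x\<close>, which integrates \<open>W\<close> by the drift;
  such a point exists because \<phi> charges \<open>C\<close>.\<close>

lemma integrable_phi:
  assumes h: "wbound S W N h"
  shows "integrable \<phi> h"
proof -
  obtain x where x: "x \<in> C" using C_nonempty by auto
  have hm: "h \<in> borel_measurable \<phi>"
    using wbound_measurable[OF h] by (simp add: measurable_cong_sets[OF sets_phi refl])
  have "ennreal e * (\<integral>\<^sup>+y. ennreal \<bar>h y\<bar> \<partial>\<phi>) \<le> (\<integral>\<^sup>+y. ennreal \<bar>h y\<bar> \<partial>Q x)"
    using hm by (intro nn_minorization[OF x]) auto
  also have "\<dots> < \<infinity>"
    using integrable_wbound[OF h C_space[OF x]] by (simp add: integrable_iff_bounded)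
  finally have "(\<integral>\<^sup>+y. ennreal \<bar>h y\<bar> \<partial>\<phi>) < \<infinity>"
    using e_pos by (auto simp: ennreal_mult_less_top less_top)
  then show ?thesis
    using hm by (simp add: integrable_iff_bounded)
qed

lemma minor_act:
  assumes h: "wbound S W N h" and h0: "\<And>y. y \<in> space S \<Longrightarrow> 0 \<le> h y" and x: "x \<in> C"
  shows "e * (\<integral>y. h y \<partial>\<phi>) \<le> kernel_act Q h x"
proof -
  note Qx = markov_kernelD[OF kernel C_space[OF x]]
  have "ennreal e * ennreal (\<integral>y. h y \<partial>\<phi>) = ennreal e * (\<integral>\<^sup>+y. ennreal (h y) \<partial>\<phi>)"
    using h0 by (subst nn_integral_eq_integral[OF integrable_phi[OF h]]) (auto simp: space_phi)
  also have "\<dots> \<le> (\<integral>\<^sup>+y. ennreal (h y) \<partial>Q x)"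
    using wbound_measurable[OF h] by (intro nn_minorization[OF x]) (simp add: measurable_cong_sets[OF sets_phi refl])
  also have "\<dots> = ennreal (kernel_act Q h x)"
    unfolding kernel_act_def
    using h0 by (intro nn_integral_eq_integral integrable_wbound[OF h C_space[OF x]]) (auto simp: Qx)
  finally have "ennreal (e * (\<integral>y. h y \<partial>\<phi>)) \<le> ennreal (kernel_act Q h x)"
    using e_pos by (simp add: ennreal_mult')
  moreover have "0 \<le> kernel_act Q h x"
    unfolding kernel_act_def using h0 Qx by (intro Bochner_Integration.integral_nonneg_AE) auto
  ultimately show ?thesis
    by (simp add: ennreal_le_iff)
qed

text \<open>A lower bound for the probability that the chain, started in \<open>C\<close>, moves
  according to \<phi> and lands in \<open>C\<close> again.\<close>

definition "d = e * measure \<phi> C"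

lemma e_le1: "e \<le> 1"
proof -
  obtain x where x: "x \<in> C" using C_nonempty by auto
  interpret Qx: prob_space "Q x" using markov_kernelD[OF kernel C_space[OF x]] by simp
  show ?thesis
    using minorization[OF sets.top x] \<phi>.prob_space Qx.prob_le_1[of "space S"] by (simp add: space_phi del: Qx.prob_le_1)
qed

lemma d_bounds: "0 < d" "d \<le> e" "d \<le> 1"
proof -
  show "0 < d" using e_pos phi_C by (simp add: d_def)
  show "d \<le> e" using mult_left_mono[OF \<phi>.prob_le_1[of C], of e] e_pos by (simp add: d_def)
  then show "d \<le> 1" using e_le1 by simp
qed

lemma act_pow_nonneg:
  assumes "\<And>y. y \<in> space S \<Longrightarrow> 0 \<le> h y" and x: "x \<in> space S"
  shows "0 \<le> kernel_act (kernel_pow S Q n) h x"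
  unfolding kernel_act_def using assms markov_kernelD(3)[OF markov_kernel_pow[OF kernel] x]
  by (intro Bochner_Integration.integral_nonneg_AE AE_I2) auto

lemma phi_nonneg:
  fixes h :: "'a \<Rightarrow> real"
  shows "(\<And>y. y \<in> space S \<Longrightarrow> 0 \<le> h y) \<Longrightarrow> 0 \<le> (\<integral>y. h y \<partial>\<phi>)"
  by (rule Bochner_Integration.integral_nonneg_AE) (auto simp: space_phi)

text \<open>The chain can wait in \<open>C\<close>: every step but the last returns to
  \<open>C\<close> with probability at least \<open>d\<close>, and the last one follows \<phi> with
  probability at least \<open>e\<close>, which is not below \<open>d\<close>. All lengths are
  possible, so no periodicity can arise.\<close>

lemma minor_act_pow_C:
  assumes h: "wbound S W N h" and N: "0 \<le> N" and h0: "\<And>y. y \<in> space S \<Longrightarrow> 0 \<le> h y"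
  shows "x \<in> C \<Longrightarrow> d ^ Suc n * (\<integral>y. h y \<partial>\<phi>) \<le> kernel_act (kernel_pow S Q (Suc n)) h x"
proof (induction n arbitrary: x)
  case (0 x)
  have "d * (\<integral>y. h y \<partial>\<phi>) \<le> e * (\<integral>y. h y \<partial>\<phi>)"
    using d_bounds phi_nonneg[OF h0] by (intro mult_right_mono) auto
  moreover have "kernel_act (kernel_pow S Q (Suc 0)) h x = kernel_act Q h x"
    using act_pow_Suc[OF l_less1 h N C_space[OF 0], of 0] act_pow_0[OF wbound_measurable[OF wbound_act[OF h N]] C_space[OF 0]]
    by simp
  ultimately show ?case
    using minor_act[OF h h0 0] by simp
next
  case (Suc n x)
  let ?g = "kernel_act (kernel_pow S Q (Suc n)) h" and ?I = "\<integral>y. h y \<partial>\<phi>"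
  have b: "wbound S W (N * (1 + b / (1 - l))) ?g"
    by (rule wbound_act_pow[OF l_less1 h N])
  have "(\<integral>y. indicator C y * (d ^ Suc n * ?I) \<partial>\<phi>) \<le> (\<integral>y. ?g y \<partial>\<phi>)"
  proof (intro integral_mono integrable_phi[OF b] integrable_mult_left integrable_real_indicator)
    fix y assume "y \<in> space \<phi>"
    then show "indicator C y * (d ^ Suc n * ?I) \<le> ?g y"
      using Suc(1)[of y] act_pow_nonneg[where h=h and x=y and n="Suc n"] h0
      by (cases "y \<in> C") (auto simp: space_phi simp del: kernel_pow.simps power_Suc)
  qed (use C_sets sets_phi in \<open>auto simp: less_top[symmetric]\<close>)
  moreover have "(\<integral>y. indicator C y * (d ^ Suc n * ?I) \<partial>\<phi>) = measure \<phi> C * (d ^ Suc n * ?I)"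
    using C_sets sets.sets_into_space[of C S] by (simp add: Int_absorb2 space_phi)
  ultimately have "e * (measure \<phi> C * (d ^ Suc n * ?I)) \<le> e * (\<integral>y. ?g y \<partial>\<phi>)"
    using e_pos by (intro mult_left_mono) auto
  also have "\<dots> \<le> kernel_act Q ?g x"
    by (rule minor_act[OF b act_pow_nonneg[OF h0] Suc(2)])
  also have "\<dots> = kernel_act (kernel_pow S Q (Suc (Suc n))) h x"
    by (rule act_pow_Suc_left[OF l_less1 h N C_space[OF Suc(2)], symmetric])
  finally show ?case
    by (simp add: d_def mult.assoc del: kernel_pow.simps)
qed

lemma act_W_le_out: "x \<in> space S - C \<Longrightarrow> kernel_act Q W x \<le> l * W x"
proof -
  assume x: "x \<in> space S - C"
  then have xS: "x \<in> space S" by simp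
  have "ennreal (kernel_act Q W x) = (\<integral>\<^sup>+y. ennreal (W y) \<partial>Q x)"
    unfolding kernel_act_def using integrable_wbound[OF wbound_W xS]
    by (intro nn_integral_eq_integral[symmetric]) (auto simp: markov_kernelD[OF kernel xS] W_nonneg)
  also note drift_out[OF x]
  finally show ?thesis
    using l_nonneg W_nonneg[OF xS] by (subst (asm) ennreal_le_iff) auto
qed

text \<open>Outside \<open>C\<close> the function \<open>W \<ge> 1\<close> contracts by the factor
  \<open>l\<close> in mean, so \<open>C\<close> is avoided for n steps with probability at most
  \<open>l ^ n * W x\<close>. Otherwise the chain enters \<open>C\<close> and waits there until the
  last step. This minorizes the power on every sublevel set of \<open>W\<close>, whatever the shape
  of \<open>C\<close>. The induction conditions on the first step.\<close>

lemma minor_act_pow: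
  assumes h: "wbound S W N h" and N: "0 \<le> N" and h0: "\<And>y. y \<in> space S \<Longrightarrow> 0 \<le> h y"
  shows "x \<in> space S \<Longrightarrow> d ^ Suc n * (1 - l ^ n * W x) * (\<integral>y. h y \<partial>\<phi>) \<le> kernel_act (kernel_pow S Q (Suc n)) h x"
proof (induction n arbitrary: x)
  case (0 x)
  have "d * (1 - W x) * (\<integral>y. h y \<partial>\<phi>) \<le> 0"
    using W_ge1[OF 0] phi_nonneg[OF h0] d_bounds by (intro mult_nonpos_nonneg mult_nonneg_nonpos) auto
  then show ?case
    using act_pow_nonneg[of h x "Suc 0", OF h0 0] by simp
next
  case (Suc n x)
  let ?g = "kernel_act (kernel_pow S Q (Suc n)) h" and ?I = "\<integral>y. h y \<partial>\<phi>"
  have ph: "0 \<le> ?I" by (rule phi_nonneg[OF h0])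
  have b: "wbound S W (N * (1 + b / (1 - l))) ?g"
    by (rule wbound_act_pow[OF l_less1 h N])
  note eq = act_pow_Suc_left[OF l_less1 h N Suc(2), of "Suc n"]
  consider "1 - l ^ Suc n * W x \<le> 0" | "0 \<le> 1 - l ^ Suc n * W x" "x \<in> C" | "0 \<le> 1 - l ^ Suc n * W x" "x \<notin> C"
    by linarith
  then show ?case
  proof cases
    case 1
    then have "d ^ Suc (Suc n) * (1 - l ^ Suc n * W x) * ?I \<le> 0"
      using ph d_bounds by (intro mult_nonpos_nonneg mult_nonneg_nonpos) auto
    then show ?thesis
      using act_pow_nonneg[of h x "Suc (Suc n)", OF h0 Suc(2)] by linarith
  next
    case 2
    have "d ^ Suc (Suc n) * (1 - l ^ Suc n * W x) * ?I \<le> d ^ Suc (Suc n) * 1 * ?I"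
      using l_nonneg W_nonneg[OF Suc(2)] d_bounds ph by (intro mult_right_mono mult_left_mono) auto
    also have "\<dots> \<le> kernel_act (kernel_pow S Q (Suc (Suc n))) h x"
      using minor_act_pow_C[OF h N h0 2(2), of "Suc n"] by simp
    finally show ?thesis .
  next
    case 3
    \<comment> \<open>The induction hypothesis is a lower bound that is affine in \<open>W\<close>.
      Outside \<open>C\<close>, applying \<open>Q\<close> therefore turns \<open>l ^ n\<close> into
      \<open>l ^ Suc n\<close>; the spare factor \<open>d \<le> 1\<close> is dropped.\<close>
    define c where "c = d ^ Suc n * ?I"
    have c: "0 \<le> c" using d_bounds ph by (simp add: c_def)
    have cb: "wbound S W (\<bar>c\<bar> + \<bar>c * l ^ n\<bar>) (\<lambda>y. c - c * l ^ n * W y)"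
      using wbound_diff[OF wbound_const[of c] wbound_cmult[OF wbound_W, of "c * l ^ n"]] by simp
    have "d ^ Suc (Suc n) * (1 - l ^ Suc n * W x) * ?I = d * ((1 - l ^ Suc n * W x) * c)"
      by (simp add: c_def)
    also have "\<dots> \<le> 1 * ((1 - l ^ Suc n * W x) * c)"
      using 3 c d_bounds by (intro mult_right_mono) auto
    also have "\<dots> = c - c * l ^ n * (l * W x)"
      by (simp add: algebra_simps)
    also have "\<dots> \<le> c - c * l ^ n * kernel_act Q W x"
      using c l_nonneg 3 Suc(2) by (intro diff_left_mono mult_left_mono act_W_le_out) auto
    also have "\<dots> = kernel_act Q (\<lambda>y. c - c * l ^ n * W y) x"
      using act_diff[OF wbound_const[of c] wbound_cmult[OF wbound_W, of "c * l ^ n"] Suc(2)] act_const[OF Suc(2)]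
      by (simp add: act_cmult)
    also have "\<dots> \<le> kernel_act Q ?g x"
    proof (rule act_mono[OF cb b Suc(2)])
      fix y assume "y \<in> space S"
      have "c - c * l ^ n * W y = d ^ Suc n * (1 - l ^ n * W y) * ?I"
        unfolding c_def by (simp only: right_diff_distrib left_diff_distrib mult_1_right mult_ac)
      also have "\<dots> \<le> ?g y" by (rule Suc.IH) fact
      finally show "c - c * l ^ n * W y \<le> ?g y" .
    qed
    finally show ?thesis
      unfolding eq .
  qed
qed

end

text \<open>The constants are built from \<open>l\<close>, \<open>b\<close>, \<open>C\<close>,
  \<open>\<phi>\<close> and \<open>e\<close> alone, hence are common to all parameters in
  \<open>L\<close>. The oscillation contraction is applied to the power \<open>Suc m\<close>, whose
  drift factor is at most 1/2 and which is minorized on a sublevel set of \<open>W\<close>.\<close>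

lemma uniform_geometric_ergodicity:
  fixes S :: "'a measure" and W :: "'a \<Rightarrow> real" and P :: "'t \<Rightarrow> 'a \<Rightarrow> 'a measure" and e l b :: real
  assumes small: "\<And>\<theta>. \<theta> \<in> L \<Longrightarrow> small_kernel S W (P \<theta>) l b C \<phi> e"
    and inv: "\<And>\<theta>. \<theta> \<in> L \<Longrightarrow> invariant_kernel S W (P \<theta>) l b \<pi>"
    and b: "0 < b"
  shows "\<exists>A \<rho>. 0 \<le> A \<and> 0 < \<rho> \<and> \<rho> < 1 \<and> (\<forall>\<theta>\<in>L. \<forall>N h x n. wbound S W N h \<longrightarrow> x \<in> space S \<longrightarrow>
    \<bar>kernel_act (kernel_pow S (P \<theta>) n) h x - (\<integral>y. h y \<partial>\<pi>)\<bar> \<le> A * \<rho> ^ n * N * W x)"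
proof (cases "L = {}")
  case True
  then show ?thesis by (intro exI[of _ 0] exI[of _ "1/2"]) auto
next
  case False
  then obtain \<theta>\<^sub>0 where \<theta>\<^sub>0: "\<theta>\<^sub>0 \<in> L" by auto
  interpret P0: small_kernel S W "P \<theta>\<^sub>0" l b C \<phi> e using small[OF \<theta>\<^sub>0] .
  define d where "d = e * measure \<phi> C"
  have d: "0 < d" "d \<le> 1" using P0.d_bounds by (simp_all add: d_def P0.d_def)
  have l: "0 \<le> l" "l < 1" using P0.l_nonneg P0.l_less1 by auto
  define B where "B = b / (1 - l)"
  have B: "0 < B" using b l by (simp add: B_def)
  \<comment> \<open>The contraction needs \<open>l' * R + 2 * B < R\<close>, and with
    \<open>l' \<le> 1 / 2\<close> any \<open>R > 4 * B\<close> will do. The bound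
    \<open>1 \<le> R\<close> transfers the smallness of \<open>l ^ m * R\<close> to
    \<open>l ^ m\<close>.\<close>
  define R where "R = max 1 (5 * B)"
  have R: "1 \<le> R" "5 * B \<le> R" by (auto simp: R_def)
  have "(\<lambda>n. l ^ n * R) \<longlonglongrightarrow> 0 * R"
    using l by (intro tendsto_intros LIMSEQ_realpow_zero)
  then have "eventually (\<lambda>n. l ^ n * R < 1 / 2) sequentially"
    by (intro order_tendstoD(2)) auto
  then obtain m where m: "l ^ m * R < 1 / 2"
    using eventually_happens by fastforce
  define l' where "l' = l ^ Suc m"
  have "l ^ m \<le> l ^ m * R"
    using R l by (simp add: mult_le_cancel_left1)
  moreover have "l' \<le> l ^ m"
    unfolding l'_def using l by (intro power_decreasing) auto
  ultimately have l': "0 \<le> l'" "l' \<le> 1 / 2"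
    using m l by (auto simp: l'_def)
  \<comment> \<open>By the choice of \<open>m\<close>, the factor \<open>1 - l ^ m * W x\<close> in
    \<open>minor_act_pow\<close> is at least 1/2 wherever \<open>W x \<le> R\<close>.\<close>
  define a where "a = d ^ Suc m / 2"
  have a: "0 < a" "a \<le> 1"
    using d power_le_one[of d "Suc m"] by (auto simp: a_def simp del: power_Suc)
  \<comment> \<open>Small enough for the drift constant to consume only half of the gain
    \<open>a\<close> from the minorization.\<close>
  define \<beta> where "\<beta> = a / (2 * B)"
  have \<beta>: "0 < \<beta>" "\<beta> * B \<le> a / 2" using a B by (auto simp: \<beta>_def)
  define \<rho> where "\<rho> = max (1 - a / 2) (max l' ((2 + \<beta> * l' * R + 2 * \<beta> * B) / (2 + \<beta> * R)))"
  have den: "0 < 2 + \<beta> * R" using \<beta> R by (simp add: add_pos_nonneg)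
  have "\<beta> * l' * R + 2 * \<beta> * B < \<beta> * R"
  proof -
    have "l' * R + 2 * B < R"
      using mult_right_mono[OF l'(2), of R] R B by linarith
    then have "\<beta> * (l' * R + 2 * B) < \<beta> * R"
      using \<beta> by (intro mult_strict_left_mono) auto
    then show ?thesis by (simp add: algebra_simps)
  qed
  then have \<rho>1: "0 < \<rho>" "\<rho> < 1"
    using a l' den by (auto simp: \<rho>_def)
  have \<rho>2: "1 - a / 2 \<le> \<rho>" "l' \<le> \<rho>"
    by (auto simp: \<rho>_def)
  have \<rho>3: "2 + \<beta> * l' * R + 2 * \<beta> * B \<le> \<rho> * (2 + \<beta> * R)"
  proof -
    have "(2 + \<beta> * l' * R + 2 * \<beta> * B) / (2 + \<beta> * R) \<le> \<rho>"
      by (auto simp: \<rho>_def)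
    then show ?thesis
      using den by (simp add: pos_divide_le_eq)
  qed
  \<comment> \<open>The contraction rate \<rho> belongs to a block of \<open>Suc m\<close> steps;
    its root is the rate of a single step.\<close>
  define r where "r = root (Suc m) \<rho>"
  have r: "0 < r" "r < 1" "r ^ Suc m = \<rho>"
    using \<rho>1 real_root_pow_pos2[of "Suc m" \<rho>] unfolding r_def by (auto simp del: power_Suc)
  define A where "A = ((1 + B) / \<beta> * (2 + \<beta> + \<beta> * B)) / \<rho>"
  have A: "0 \<le> A" using B \<beta> \<rho>1 by (simp add: A_def)
  show ?thesis
  proof (rule exI[of _ A], rule exI[of _ r], intro conjI ballI allI impI A r(1,2))
    fix \<theta> N h x n
    assume \<theta>: "\<theta> \<in> L" and h: "wbound S W N h" and x: "x \<in> space S"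
    interpret P: small_kernel S W "P \<theta>" l b C \<phi> e by (rule small[OF \<theta>])
    interpret P: invariant_kernel S W "P \<theta>" l b \<pi> by (rule inv[OF \<theta>])
    interpret Pm: invariant_kernel S W "kernel_pow S (P \<theta>) (Suc m)" l' B \<pi>
      using P.invariant_kernel_pow[of m] by (simp only: l'_def B_def)
    have N: "0 \<le> N" by (rule P.wbound_N_nonneg[OF h])
    have wp: "wbound S W (M * (1 + B)) (kernel_act (kernel_pow S (P \<theta>) j) g)" if "wbound S W M g" for j M g
      using P.wbound_act_pow[OF l(2) that P.wbound_N_nonneg[OF that]] by (simp only: B_def)
    \<comment> \<open>The steps that do not fill a block are absorbed into the function, at the cost
      of the factor \<open>1 + B\<close>.\<close>
    define g where "g = kernel_act (kernel_pow S (P \<theta>) (n mod Suc m)) h"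
    have g: "wbound S W (N * (1 + B)) g"
      unfolding g_def by (rule wp[OF h])
    define G where "G = N * (1 + B) / \<beta>"
    have G: "0 \<le> G" using N B \<beta> by (simp add: G_def)
    have minor: "a * (\<integral>y. h y \<partial>\<phi>) \<le> kernel_act (kernel_pow S (P \<theta>) (Suc m)) h x"
      if "wbound S W N h" "\<And>y. y \<in> space S \<Longrightarrow> 0 \<le> h y" "x \<in> space S" "W x \<le> R" for N h x
    proof -
      have "l ^ m * W x \<le> l ^ m * R"
        using that l by (intro mult_left_mono) auto
      then have "1 / 2 \<le> 1 - l ^ m * W x" using m by simp
      then have "d ^ Suc m * (1 / 2) * (\<integral>y. h y \<partial>\<phi>) \<le> d ^ Suc m * (1 - l ^ m * W x) * (\<integral>y. h y \<partial>\<phi>)"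
        using d P.phi_nonneg[OF that(2)] by (intro mult_right_mono mult_left_mono) auto
      also have "\<dots> \<le> kernel_act (kernel_pow S (P \<theta>) (Suc m)) h x"
        using P.minor_act_pow[OF that(1) P.wbound_N_nonneg[OF that(1)] that(2,3), of m]
        by (simp only: d_def P.d_def)
      finally show ?thesis by (simp add: a_def del: kernel_pow.simps)
    qed
    have osc: "\<bar>kernel_act (kernel_pow S (P \<theta>) (Suc m * k)) g y - kernel_act (kernel_pow S (P \<theta>) (Suc m * k)) g z\<bar>
        \<le> \<rho> ^ k * G * (2 + \<beta> * W y + \<beta> * W z)" if "y \<in> space S" "z \<in> space S" for k y z
      using that
    proof (induction k arbitrary: y z)
      case (0 y z)
      have "\<bar>g y - g z\<bar> \<le> N * (1 + B) * W y + N * (1 + B) * W z"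
        using wboundD[OF g 0(1)] wboundD[OF g 0(2)] by linarith
      also have "\<dots> = G * (\<beta> * W y + \<beta> * W z)"
        using \<beta> by (simp add: G_def field_simps)
      also have "\<dots> \<le> G * (2 + \<beta> * W y + \<beta> * W z)"
        using G by (intro mult_left_mono) auto
      finally show ?case
        using P.act_pow_0[OF wbound_measurable[OF g]] 0 by (simp del: kernel_pow.simps)
    next
      case (Suc k y z)
      let ?g = "kernel_act (kernel_pow S (P \<theta>) (Suc m * k)) g"
      have eq: "kernel_act (kernel_pow S (P \<theta>) (Suc m * Suc k)) g w = kernel_act (kernel_pow S (P \<theta>) (Suc m)) ?g w" if "w \<in> space S" for w
        using P.act_pow_add[OF l(2) g P.wbound_N_nonneg[OF g] that, of "Suc m" "Suc m * k"]
        by (simp only: mult_Suc_right)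
      have "\<bar>kernel_act (kernel_pow S (P \<theta>) (Suc m)) ?g y - kernel_act (kernel_pow S (P \<theta>) (Suc m)) ?g z\<bar>
          \<le> \<rho> * (\<rho> ^ k * G) * (2 + \<beta> * W y + \<beta> * W z)"
      proof (rule Pm.oscillation_contraction[OF P.prob_phi P.integrable_phi minor P.space_phi _ \<beta>(1) _ \<rho>2 \<rho>3 wp[OF g] _ Suc.IH Suc.prems])
        show "0 \<le> a" "\<beta> * B \<le> a / 2" "0 \<le> \<rho> ^ k * G" using a \<beta> \<rho>1 G by auto
      qed
      then show ?case
        unfolding eq[OF Suc.prems(1)] eq[OF Suc.prems(2)] by (simp add: mult.assoc del: kernel_pow.simps mult_Suc)
    qed
    define k where "k = n div Suc m"
    define q where "q = kernel_act (kernel_pow S (P \<theta>) n) h"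
    have q: "wbound S W (N * (1 + B)) q" unfolding q_def by (rule wp[OF h])
    have "n = Suc m * k + n mod Suc m" unfolding k_def by (rule mult_div_mod_eq[symmetric])
    then have nk: "q y = kernel_act (kernel_pow S (P \<theta>) (Suc m * k)) g y" if "y \<in> space S" for y
      unfolding q_def g_def using P.act_pow_add[OF l(2) h N that, of "Suc m * k" "n mod Suc m"] by metis
    define J where "J = (\<integral>y. W y \<partial>\<pi>)"
    have J: "J \<le> B" using P.abs_pi_le[OF P.wbound_W] by (simp add: J_def P.B_def B_def)
    \<comment> \<open>By invariance \<open>q\<close> and \<open>h\<close> have the same mean under
      \<pi>. The deviation from it is thus an average of differences \<open>q x - q y\<close>, to
      which the oscillation bound applies.\<close>
    have "\<bar>q x - (\<integral>y. h y \<partial>\<pi>)\<bar> = \<bar>\<integral>y. q x - q y \<partial>\<pi>\<bar>"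
      using P.integrable_pi[OF q] P.pi_act_pow[OF h, of n] by (simp add: P.\<pi>.prob_space q_def)
    also have "\<dots> \<le> (\<integral>y. \<bar>q x - q y\<bar> \<partial>\<pi>)"
      by (rule integral_abs_bound)
    also have "\<dots> \<le> (\<integral>y. \<rho> ^ k * G * (2 + \<beta> * W x + \<beta> * W y) \<partial>\<pi>)"
      using P.integrable_pi[OF q] P.integrable_pi[OF P.wbound_W] osc[OF x] nk x
      by (intro integral_mono) (auto simp: P.space_pi)
    also have "\<dots> = \<rho> ^ k * G * (2 + \<beta> * W x + \<beta> * J)"
      using P.integrable_pi[OF P.wbound_W] by (simp add: P.\<pi>.prob_space J_def)
    also have "\<dots> \<le> \<rho> ^ k * G * ((2 + \<beta> + \<beta> * B) * W x)"
    proof (rule mult_left_mono)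
      have W: "1 \<le> W x" by (rule P.W_ge1[OF x])
      have "\<beta> * J \<le> \<beta> * B" using J \<beta> by (intro mult_left_mono) auto
      also have "\<dots> \<le> \<beta> * B * W x" using mult_left_mono[OF W, of "\<beta> * B"] \<beta>(1) B by simp
      finally show "2 + \<beta> * W x + \<beta> * J \<le> (2 + \<beta> + \<beta> * B) * W x"
        using W by (simp add: algebra_simps)
      show "0 \<le> \<rho> ^ k * G" using \<rho>1 G by simp
    qed
    also have "\<dots> \<le> (r ^ n / \<rho>) * G * ((2 + \<beta> + \<beta> * B) * W x)"
    proof (intro mult_right_mono G)
      \<comment> \<open>The \<open>k\<close> full blocks fall short of \<open>n\<close> by less than
        one block, which accounts for the divisor \<rho> in \<open>A\<close>.\<close>
      have "\<rho> ^ k * \<rho> = r ^ (Suc m * k + Suc m)"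
        by (simp only: r(3)[symmetric] power_add power_mult)
      also have "\<dots> \<le> r ^ n"
      proof (rule power_decreasing)
        show "n \<le> Suc m * k + Suc m"
          unfolding k_def by (metis add_le_cancel_left less_imp_le mod_less_divisor mult_div_mod_eq zero_less_Suc)
      qed (use r in auto)
      finally show "\<rho> ^ k \<le> r ^ n / \<rho>"
        using \<rho>1 by (simp add: field_simps)
      show "0 \<le> (2 + \<beta> + \<beta> * B) * W x" using P.W_nonneg[OF x] \<beta> B by simp
    qed
    also have "\<dots> = A * r ^ n * N * W x"
      by (simp add: A_def G_def field_simps)
    finally show "\<bar>kernel_act (kernel_pow S (P \<theta>) n) h x - (\<integral>y. h y \<partial>\<pi>)\<bar> \<le> A * r ^ n * N * W x"
      by (simp only: q_def)
  qed
qed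

section \<open>The Poisson equation\<close>

locale ergodic_kernel = invariant_kernel +
  fixes A \<rho> :: real
  assumes A_nonneg: "0 \<le> A" and rho: "0 < \<rho>" "\<rho> < 1"
    and ergodic: "wbound S W N h \<Longrightarrow> x \<in> space S \<Longrightarrow>
      \<bar>kernel_act (kernel_pow S Q n) h x - (\<integral>y. h y \<partial>\<pi>)\<bar> \<le> A * \<rho> ^ n * N * W x"
begin

text \<open>The sum of the geometric series; it bounds the norm of the operator that solves the
  Poisson equation.\<close>

definition "D = A / (1 - \<rho>)"

lemma geometric_sums: "(\<lambda>n. A * \<rho> ^ n * N * w) sums (N * D * w)"
proof -
  have "(\<lambda>n. \<rho> ^ n) sums (1 / (1 - \<rho>))"
    using rho by (intro geometric_sums) simp
  from sums_mult[OF this, of "A * N * w"] show ?thesis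
    by (simp add: D_def mult_ac)
qed

lemma poisson_summable:
  assumes h: "wbound S W N h" and x: "x \<in> space S"
  shows "summable (\<lambda>k. \<bar>kernel_act (kernel_pow S Q k) h x - (\<integral>y. h y \<partial>\<pi>)\<bar>)"
  using ergodic[OF h x]
  by (intro summable_comparison_test'[OF sums_summable[OF geometric_sums[of N "W x"]]]) auto

lemma poisson_sums:
  assumes h: "wbound S W N h" and x: "x \<in> space S"
  shows "(\<lambda>k. kernel_act (kernel_pow S Q k) h x - (\<integral>y. h y \<partial>\<pi>)) sums poisson_sol S \<pi> Q h x"
  unfolding poisson_sol_def by (intro summable_sums summable_rabs_cancel[OF poisson_summable[OF h x]])

lemma wbound_poisson:
  assumes h: "wbound S W N h"
  shows "wbound S W (N * D) (poisson_sol S \<pi> Q h)"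
  unfolding wbound_def
proof (intro conjI ballI)
  have "kernel_act (kernel_pow S Q k) h \<in> borel_measurable S" for k
    using wbound_act_pow[OF l_less h wbound_N_nonneg[OF h]] by (rule wbound_measurable)
  then show "poisson_sol S \<pi> Q h \<in> borel_measurable S"
    unfolding poisson_sol_def by (intro borel_measurable_suminf) simp
  fix x assume x: "x \<in> space S"
  have "\<bar>poisson_sol S \<pi> Q h x\<bar> \<le> (\<Sum>k. \<bar>kernel_act (kernel_pow S Q k) h x - (\<integral>y. h y \<partial>\<pi>)\<bar>)"
    unfolding poisson_sol_def by (rule summable_rabs[OF poisson_summable[OF h x]])
  also have "\<dots> \<le> N * D * W x"
    using ergodic[OF h x] summable_sums[OF poisson_summable[OF h x]] geometric_sums by (rule sums_le)
  finally show "\<bar>poisson_sol S \<pi> Q h x\<bar> \<le> N * D * W x" .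
qed

text \<open>Sum and integral may be exchanged for any measure that integrates \<open>W\<close>,
  since the terms are dominated by a geometric series. With \<pi> this centres the Poisson solution,
  with \<open>Q x\<close> it yields the Poisson equation.\<close>

lemma integral_poisson_suminf:
  assumes h: "wbound S W N h" and sets: "sets M = sets S" and int: "\<And>M' g. wbound S W M' g \<Longrightarrow> integrable M g"
  shows "(\<lambda>k. \<integral>x. kernel_act (kernel_pow S Q k) h x - (\<integral>y. h y \<partial>\<pi>) \<partial>M) sums (\<integral>x. poisson_sol S \<pi> Q h x \<partial>M)"
  unfolding poisson_sol_def
proof (rule sums_integral)
  have sp: "space M = space S" using sets by (rule sets_eq_imp_space_eq)
  have b: "wbound S W (N * (1 + b / (1 - l)) + \<bar>\<integral>y. h y \<partial>\<pi>\<bar>) (\<lambda>x. kernel_act (kernel_pow S Q k) h x - (\<integral>y. h y \<partial>\<pi>))" for k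
    using wbound_diff[OF wbound_act_pow[OF l_less h wbound_N_nonneg[OF h], of k] wbound_const] .
  then show "integrable M (\<lambda>x. kernel_act (kernel_pow S Q k) h x - (\<integral>y. h y \<partial>\<pi>))" for k
    by (rule int)
  show "AE x in M. summable (\<lambda>k. norm (kernel_act (kernel_pow S Q k) h x - (\<integral>y. h y \<partial>\<pi>)))"
    using poisson_summable[OF h] by (auto simp: sp)
  show "summable (\<lambda>k. \<integral>x. norm (kernel_act (kernel_pow S Q k) h x - (\<integral>y. h y \<partial>\<pi>)) \<partial>M)"
  proof (rule summable_comparison_test'[OF sums_summable[OF geometric_sums[of N "\<integral>x. W x \<partial>M"]]])
    fix k
    have "(\<integral>x. norm (kernel_act (kernel_pow S Q k) h x - (\<integral>y. h y \<partial>\<pi>)) \<partial>M) \<le> (\<integral>x. A * \<rho> ^ k * N * W x \<partial>M)"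
      using ergodic[OF h] int[OF b] int[OF wbound_W] by (intro integral_mono) (auto simp: sp)
    then show "norm (\<integral>x. norm (kernel_act (kernel_pow S Q k) h x - (\<integral>y. h y \<partial>\<pi>)) \<partial>M) \<le> A * \<rho> ^ k * N * (\<integral>x. W x \<partial>M)"
      by (simp add: integral_nonneg_AE)
  qed
qed

lemma pi_poisson:
  assumes h: "wbound S W N h"
  shows "(\<integral>x. poisson_sol S \<pi> Q h x \<partial>\<pi>) = 0"
proof -
  have "(\<integral>x. kernel_act (kernel_pow S Q k) h x - (\<integral>y. h y \<partial>\<pi>) \<partial>\<pi>) = 0" for k
    using integrable_pi[OF wbound_act_pow[OF l_less h wbound_N_nonneg[OF h]]] pi_act_pow[OF h]
    by (simp add: \<pi>.prob_space)
  then have "(\<lambda>k. 0) sums (\<integral>x. poisson_sol S \<pi> Q h x \<partial>\<pi>)"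
    using integral_poisson_suminf[OF h sets_pi integrable_pi] by simp
  then show ?thesis
    using sums_unique by fastforce
qed

text \<open>Applying \<open>Q\<close> shifts the defining series by one place, so exactly its zeroth
  term is lost.\<close>

lemma act_poisson:
  assumes h: "wbound S W N h" and x: "x \<in> space S"
  shows "kernel_act Q (poisson_sol S \<pi> Q h) x = poisson_sol S \<pi> Q h x - (h x - (\<integral>y. h y \<partial>\<pi>))"
proof -
  have N: "0 \<le> N" by (rule wbound_N_nonneg[OF h])
  have "(\<integral>y. kernel_act (kernel_pow S Q k) h y - (\<integral>y. h y \<partial>\<pi>) \<partial>Q x) =
      kernel_act (kernel_pow S Q (Suc k)) h x - (\<integral>y. h y \<partial>\<pi>)" for k
    using act_diff[OF wbound_act_pow[OF l_less h N, of k] wbound_const x] act_const[OF x]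
      act_pow_Suc_left[OF l_less h N x, of k]
    by (simp add: kernel_act_def[of Q] del: kernel_pow.simps)
  then have "(\<lambda>k. kernel_act (kernel_pow S Q (Suc k)) h x - (\<integral>y. h y \<partial>\<pi>)) sums kernel_act Q (poisson_sol S \<pi> Q h) x"
    using integral_poisson_suminf[OF h markov_kernelD(2)[OF kernel x] integrable_wbound[OF _ x]]
    by (simp add: kernel_act_def[of Q] del: kernel_pow.simps)
  moreover have "(\<lambda>k. kernel_act (kernel_pow S Q (Suc k)) h x - (\<integral>y. h y \<partial>\<pi>)) sums
      (poisson_sol S \<pi> Q h x - (h x - (\<integral>y. h y \<partial>\<pi>)))"
    using poisson_sums[OF h x] act_pow_0[OF wbound_measurable[OF h] x]
    by (subst sums_Suc_iff) (simp del: kernel_pow.simps)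
  ultimately show ?thesis
    by (rule sums_unique2)
qed

lemma poisson_diff:
  assumes h: "wbound S W N h" and h': "wbound S W N' h'" and x: "x \<in> space S"
  shows "poisson_sol S \<pi> Q (\<lambda>x. h x - h' x) x = poisson_sol S \<pi> Q h x - poisson_sol S \<pi> Q h' x"
proof -
  have "kernel_act (kernel_pow S Q k) (\<lambda>x. h x - h' x) x - (\<integral>y. h y - h' y \<partial>\<pi>) =
    (kernel_act (kernel_pow S Q k) h x - (\<integral>y. h y \<partial>\<pi>)) - (kernel_act (kernel_pow S Q k) h' x - (\<integral>y. h' y \<partial>\<pi>))" for k
  proof -
    interpret Pk: drift_kernel S W "kernel_pow S Q k" "l ^ k" "b / (1 - l)"
      by (rule drift_kernel_pow[OF l_less])
    show ?thesis
      using Pk.act_diff[OF h h' x] integrable_pi[OF h] integrable_pi[OF h'] by simp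
  qed
  then show ?thesis
    using sums_diff[OF poisson_sums[OF h x] poisson_sums[OF h' x]] poisson_sums[OF wbound_diff[OF h h'] x]
    by (auto intro: sums_unique2)
qed

lemma poisson_const: "x \<in> space S \<Longrightarrow> poisson_sol S \<pi> Q (\<lambda>_. c) x = 0"
proof -
  assume x: "x \<in> space S"
  have "kernel_act (kernel_pow S Q k) (\<lambda>_. c) x = c" for k
  proof -
    interpret Pk: drift_kernel S W "kernel_pow S Q k" "l ^ k" "b / (1 - l)"
      by (rule drift_kernel_pow[OF l_less])
    show ?thesis by (rule Pk.act_const[OF x])
  qed
  then show ?thesis
    by (simp add: poisson_sol_def \<pi>.prob_space)
qed

text \<open>The solution operator inverts coboundaries up to a constant: its series for
  \<open>kernel_act Q g\<close> is the one for \<open>g\<close> without the zeroth term.\<close>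

lemma poisson_coboundary:
  assumes g: "wbound S W N g" and x: "x \<in> space S"
  shows "poisson_sol S \<pi> Q (\<lambda>x. kernel_act Q g x - g x) x = (\<integral>y. g y \<partial>\<pi>) - g x"
proof -
  have N: "0 \<le> N" by (rule wbound_N_nonneg[OF g])
  have Qg: "wbound S W (N * (l + b)) (kernel_act Q g)" by (rule wbound_act[OF g N])
  have tr: "poisson_sol S \<pi> Q (kernel_act Q g) x = poisson_sol S \<pi> Q g x - (g x - (\<integral>y. g y \<partial>\<pi>))"
  proof (rule sums_unique2[OF poisson_sums[OF Qg x]])
    have "(\<lambda>k. kernel_act (kernel_pow S Q (Suc k)) g x - (\<integral>y. g y \<partial>\<pi>)) sums
        (poisson_sol S \<pi> Q g x - (g x - (\<integral>y. g y \<partial>\<pi>)))"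
      using poisson_sums[OF g x] act_pow_0[OF wbound_measurable[OF g] x]
      by (subst sums_Suc_iff) (simp del: kernel_pow.simps)
    then show "(\<lambda>k. kernel_act (kernel_pow S Q k) (kernel_act Q g) x - (\<integral>y. kernel_act Q g y \<partial>\<pi>)) sums
        (poisson_sol S \<pi> Q g x - (g x - (\<integral>y. g y \<partial>\<pi>)))"
      using act_pow_Suc[OF l_less g N x] pi_act[OF g] by (simp del: kernel_pow.simps)
  qed
  show ?thesis
    using poisson_diff[OF Qg g x] tr by simp
qed

end

text \<open>With \<open>T1\<close>, \<open>T2\<close> the two Poisson operators, the proof rests on the resolvent identity
  \<open>T1 f - T2 f = T1 (Q1 - Q2) T2 f\<close>.\<close>

lemma poisson_kernel_diff:
  assumes e1: "ergodic_kernel S W Q1 l b \<pi> A \<rho>" and e2: "ergodic_kernel S W Q2 l b \<pi> A \<rho>"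
    and close: "\<And>M g x. wbound S W M g \<Longrightarrow> x \<in> space S \<Longrightarrow> \<bar>kernel_act Q1 g x - kernel_act Q2 g x\<bar> \<le> \<delta> * M * W x"
    and f: "wbound S W N f" and x: "x \<in> space S"
  shows "\<bar>poisson_sol S \<pi> Q1 f x - poisson_sol S \<pi> Q2 f x\<bar> \<le> (A / (1 - \<rho>)) * (\<delta> * (N * (A / (1 - \<rho>)))) * W x"
proof -
  interpret E1: ergodic_kernel S W Q1 l b \<pi> A \<rho> by fact
  interpret E2: ergodic_kernel S W Q2 l b \<pi> A \<rho> by fact
  define g where "g = poisson_sol S \<pi> Q2 f"
  have g: "wbound S W (N * E2.D) g"
    unfolding g_def by (rule E2.wbound_poisson[OF f])
  note ng = E1.wbound_N_nonneg[OF g]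
  have d: "wbound S W (\<delta> * (N * E2.D)) (\<lambda>y. kernel_act Q1 g y - kernel_act Q2 g y)"
    unfolding wbound_def using close[OF g] E1.act_measurable[OF wbound_measurable[OF g]] E2.act_measurable[OF wbound_measurable[OF g]]
    by auto
  \<comment> \<open>By the Poisson equation for \<open>Q2\<close>, the difference of the two kernels
    applied to \<open>g\<close> is \<open>u - v\<close>. The solution operator of \<open>Q1\<close>
    sends \<open>u\<close> to \<open>- g\<close>, because \<open>g\<close> has mean 0 under \<pi>,
    and it sends \<open>v\<close> to minus the solution for \<open>f\<close>.\<close>
  define u where "u y = kernel_act Q1 g y - g y" for y
  define v where "v y = (\<integral>y. f y \<partial>\<pi>) - f y" for y
  have u: "wbound S W (N * E2.D * (l + b) + N * E2.D) u"
    unfolding u_def by (rule wbound_diff[OF E1.wbound_act[OF g ng] g])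
  have v: "wbound S W (\<bar>\<integral>y. f y \<partial>\<pi>\<bar> + N) v"
    unfolding v_def by (rule wbound_diff[OF E1.wbound_const f])
  have eq: "kernel_act Q1 g y - kernel_act Q2 g y = u y - v y" if "y \<in> space S" for y
    using E2.act_poisson[OF f that] by (simp add: u_def v_def g_def)
  have "poisson_sol S \<pi> Q1 (\<lambda>y. kernel_act Q1 g y - kernel_act Q2 g y) x = poisson_sol S \<pi> Q1 (\<lambda>y. u y - v y) x"
  proof -
    have "kernel_act (kernel_pow S Q1 k) (\<lambda>y. kernel_act Q1 g y - kernel_act Q2 g y) x = kernel_act (kernel_pow S Q1 k) (\<lambda>y. u y - v y) x" for k
    proof -
      interpret Pk: drift_kernel S W "kernel_pow S Q1 k" "l ^ k" "b / (1 - l)"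
        by (rule E1.drift_kernel_pow[OF E1.l_less])
      show ?thesis by (rule Pk.act_cong[OF eq x])
    qed
    moreover have "(\<integral>y. kernel_act Q1 g y - kernel_act Q2 g y \<partial>\<pi>) = (\<integral>y. u y - v y \<partial>\<pi>)"
      using eq by (intro Bochner_Integration.integral_cong) (auto simp: E1.space_pi)
    ultimately show ?thesis by (simp add: poisson_sol_def)
  qed
  also have "\<dots> = poisson_sol S \<pi> Q1 u x - poisson_sol S \<pi> Q1 v x"
    by (rule E1.poisson_diff[OF u v x])
  also have "poisson_sol S \<pi> Q1 u x = - g x"
    unfolding u_def using E1.poisson_coboundary[OF g x] E2.pi_poisson[OF f] by (simp add: g_def)
  also have "poisson_sol S \<pi> Q1 v x = - poisson_sol S \<pi> Q1 f x"
    unfolding v_def using E1.poisson_diff[OF E1.wbound_const f x] E1.poisson_const[OF x] by simp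
  finally have "poisson_sol S \<pi> Q1 f x - poisson_sol S \<pi> Q2 f x =
      poisson_sol S \<pi> Q1 (\<lambda>y. kernel_act Q1 g y - kernel_act Q2 g y) x"
    by (simp add: g_def)
  then show ?thesis
    using wboundD[OF E1.wbound_poisson[OF d] x] by (simp add: E1.D_def E2.D_def mult_ac)
qed

section \<open>Drift and ergodicity for powers of the Lyapunov function\<close>

lemma powr_le_tangent:
  fixes t r :: real
  assumes "0 < t" "0 \<le> r" "r \<le> 1"
  shows "t powr r \<le> r * t + (1 - r)"
proof -
  have "exp ((1 - r) *\<^sub>R 0 + r *\<^sub>R ln t) \<le> (1 - r) * exp 0 + r * exp (ln t)"
    using assms by (intro convex_onD[OF exp_convex]) auto
  then show ?thesis
    using assms by (simp add: powr_def)
qed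

text \<open>Jensen's inequality for a concave power, obtained by integrating its tangent at
  \<open>a\<close>. That \<open>a\<close> is at least 1, so that the tangent exists, follows from
  \<open>V \<ge> 1\<close>.\<close>

lemma nn_integral_powr_le:
  fixes V :: "'a \<Rightarrow> real"
  assumes "prob_space M" and V [measurable]: "V \<in> borel_measurable M" and V1: "\<And>x. x \<in> space M \<Longrightarrow> 1 \<le> V x"
    and r: "0 \<le> r" "r \<le> 1" and a: "0 \<le> a" and le: "(\<integral>\<^sup>+x. ennreal (V x) \<partial>M) \<le> ennreal a"
  shows "(\<integral>\<^sup>+x. ennreal (V x powr r) \<partial>M) \<le> ennreal (a powr r)"
proof -
  interpret prob_space M by fact
  have "(\<integral>\<^sup>+x. 1 \<partial>M) \<le> (\<integral>\<^sup>+x. ennreal (V x) \<partial>M)"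
    using V1 by (intro nn_integral_mono) auto
  then have "1 \<le> (\<integral>\<^sup>+x. ennreal (V x) \<partial>M)"
    by (simp add: emeasure_space_1)
  from order_trans[OF this le] have "ennreal 1 \<le> ennreal a"
    by (simp only: ennreal_1)
  then have a1: "1 \<le> a" by (subst (asm) ennreal_le_iff) (rule a)
  have pt: "V x powr r \<le> (r * a powr r / a) * V x + (1 - r) * a powr r" if "x \<in> space M" for x
  proof -
    have "V x powr r = a powr r * (V x / a) powr r"
      using V1[OF that] a1 by (simp add: powr_divide)
    also have "\<dots> \<le> a powr r * (r * (V x / a) + (1 - r))"
      using V1[OF that] a1 r by (intro mult_left_mono powr_le_tangent) auto
    finally show ?thesis by (simp add: algebra_simps)
  qed
  have "(\<integral>\<^sup>+x. ennreal (V x powr r) \<partial>M) \<le>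
      (\<integral>\<^sup>+x. ennreal (r * a powr r / a) * ennreal (V x) + ennreal ((1 - r) * a powr r) \<partial>M)"
  proof (rule nn_integral_mono)
    fix x assume x: "x \<in> space M"
    have "ennreal (r * a powr r / a) * ennreal (V x) + ennreal ((1 - r) * a powr r) =
        ennreal ((r * a powr r / a) * V x + (1 - r) * a powr r)"
      using r a1 V1[OF x] by (subst ennreal_mult[symmetric] ennreal_plus[symmetric]; simp)+
    then show "ennreal (V x powr r) \<le> ennreal (r * a powr r / a) * ennreal (V x) + ennreal ((1 - r) * a powr r)"
      using pt[OF x] by (simp add: ennreal_leI)
  qed
  also have "\<dots> = ennreal (r * a powr r / a) * (\<integral>\<^sup>+x. ennreal (V x) \<partial>M) + ennreal ((1 - r) * a powr r)"
    by (simp add: nn_integral_add nn_integral_cmult emeasure_space_1)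
  also have "\<dots> \<le> ennreal (r * a powr r / a) * ennreal a + ennreal ((1 - r) * a powr r)"
    by (intro add_right_mono mult_left_mono le) simp
  also have "\<dots> = ennreal ((r * a powr r / a) * a + (1 - r) * a powr r)"
    using r a1 by (subst ennreal_mult[symmetric] ennreal_plus[symmetric]; simp)+
  also have "(r * a powr r / a) * a + (1 - r) * a powr r = a powr r"
    using a1 by (simp add: algebra_simps)
  finally show ?thesis .
qed

text \<open>By Jensen, \<open>V powr r\<close> inherits the drift with the constants
  \<open>l powr r\<close> and \<open>b powr r\<close>, while the minorization does not involve
  \<open>V\<close> at all. For \<open>r > 0\<close> the new drift factor is again below 1, and one
  pair of constants serves the whole of \<open>L\<close>.\<close>

lemma ergodic_family_powr:
  fixes S :: "'a measure" and P :: "'t \<Rightarrow> 'a \<Rightarrow> 'a measure" and V :: "'a \<Rightarrow> real"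
  assumes V [measurable]: "V \<in> borel_measurable S" and V1: "\<And>x. x \<in> space S \<Longrightarrow> 1 \<le> V x"
    and ker: "\<And>\<theta>. \<theta> \<in> L \<Longrightarrow> markov_kernel S (P \<theta>)"
    and \<pi>: "prob_space \<pi>" "sets \<pi> = sets S" "\<And>\<theta>. \<theta> \<in> L \<Longrightarrow> bind \<pi> (P \<theta>) = \<pi>"
    and small: "C \<in> sets S" "e > 0" "prob_space \<phi>" "sets \<phi> = sets S" "measure \<phi> C > 0"
      "\<forall>A\<in>sets S. \<forall>\<theta>\<in>L. \<forall>x\<in>C. measure (P \<theta> x) A \<ge> e * measure \<phi> A"
    and l: "0 \<le> l" "l < 1" and b: "0 < b"
    and drift: "\<forall>\<theta>\<in>L.
          (\<forall>x\<in>space S - C. (\<integral>\<^sup>+y. ennreal (V y) \<partial>P \<theta> x) \<le> ennreal (l * V x)) \<and>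
          (\<forall>x\<in>C. (\<integral>\<^sup>+y. ennreal (V y) \<partial>P \<theta> x) \<le> ennreal b)"
    and r: "0 < r" "r \<le> 1"
  shows "\<exists>A \<rho>. \<forall>\<theta>\<in>L. ergodic_kernel S (\<lambda>x. V x powr r) (P \<theta>) (l powr r) (b powr r) \<pi> A \<rho>"
proof -
  have W1: "1 \<le> V x powr r" if "x \<in> space S" for x
    using V1[OF that] r by (simp add: ge_one_powr_ge_zero)
  have l': "0 \<le> l powr r" "l powr r < 1"
    using l r powr_less_mono2[of r l 1] by auto
  have dr: "drift_kernel S (\<lambda>x. V x powr r) (P \<theta>) (l powr r) (b powr r)"
    and dout: "x \<in> space S - C \<Longrightarrow> (\<integral>\<^sup>+y. ennreal (V y powr r) \<partial>P \<theta> x) \<le> ennreal (l powr r * V x powr r)"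
    if \<theta>: "\<theta> \<in> L" for \<theta> x
  proof -
    have Pr: "(\<integral>\<^sup>+y. ennreal (V y powr r) \<partial>P \<theta> x) \<le> ennreal (a powr r)"
      if "x \<in> space S" "0 \<le> a" "(\<integral>\<^sup>+y. ennreal (V y) \<partial>P \<theta> x) \<le> ennreal a" for x a
    proof -
      note Px = markov_kernelD[OF ker[OF \<theta>] that(1)]
      show ?thesis
        using r that(2,3) V1 V by (intro nn_integral_powr_le[OF Px(1)]) (auto simp: Px measurable_cong_sets[OF Px(2) refl])
    qed
    have V0: "0 \<le> V x" if "x \<in> space S" for x using V1[OF that] by simp
    show out: "(\<integral>\<^sup>+y. ennreal (V y powr r) \<partial>P \<theta> x) \<le> ennreal (l powr r * V x powr r)" if "x \<in> space S - C" for x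
      using Pr[of x "l * V x"] drift \<theta> that l V0[of x] by (auto simp: powr_mult)
    show "drift_kernel S (\<lambda>x. V x powr r) (P \<theta>) (l powr r) (b powr r)"
    proof
      fix x assume x: "x \<in> space S"
      show "(\<integral>\<^sup>+y. ennreal (V y powr r) \<partial>P \<theta> x) \<le> ennreal (l powr r * V x powr r + b powr r)"
      proof (cases "x \<in> C")
        case True
        then show ?thesis
          using Pr[OF x, of b] drift \<theta> b by (auto intro: order_trans ennreal_leI)
      next
        case False
        then show ?thesis
          using out[of x] x by (auto intro: order_trans ennreal_leI)
      qed
    qed (use ker[OF \<theta>] W1 l' in auto)
  qed
  have sm: "small_kernel S (\<lambda>x. V x powr r) (P \<theta>) (l powr r) (b powr r) C \<phi> e" if "\<theta> \<in> L" for \<theta>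
    by (intro small_kernel.intro small_kernel_axioms.intro dr[OF that] dout[OF that] small(1-5) l'(2))
      (use small(6) that in blast)+
  have inv: "invariant_kernel S (\<lambda>x. V x powr r) (P \<theta>) (l powr r) (b powr r) \<pi>" if "\<theta> \<in> L" for \<theta>
    by (intro invariant_kernel.intro invariant_kernel_axioms.intro dr[OF that] \<pi>(1,2) \<pi>(3)[OF that] l'(2))
  have b': "0 < b powr r" using b by simp
  have "\<exists>A \<rho>. 0 \<le> A \<and> 0 < \<rho> \<and> \<rho> < 1 \<and> (\<forall>\<theta>\<in>L. \<forall>N h x n. wbound S (\<lambda>x. V x powr r) N h \<longrightarrow> x \<in> space S \<longrightarrow>
      \<bar>kernel_act (kernel_pow S (P \<theta>) n) h x - (\<integral>y. h y \<partial>\<pi>)\<bar> \<le> A * \<rho> ^ n * N * V x powr r)"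
    by (rule uniform_geometric_ergodicity[OF sm inv b'])
  then obtain A \<rho> where A: "0 \<le> A \<and> 0 < \<rho> \<and> \<rho> < 1 \<and> (\<forall>\<theta>\<in>L. \<forall>N h x n. wbound S (\<lambda>x. V x powr r) N h \<longrightarrow> x \<in> space S \<longrightarrow>
      \<bar>kernel_act (kernel_pow S (P \<theta>) n) h x - (\<integral>y. h y \<partial>\<pi>)\<bar> \<le> A * \<rho> ^ n * N * V x powr r)"
    by (elim exE)
  have "ergodic_kernel S (\<lambda>x. V x powr r) (P \<theta>) (l powr r) (b powr r) \<pi> A \<rho>" if "\<theta> \<in> L" for \<theta>
    by (rule ergodic_kernel.intro[OF inv[OF that] ergodic_kernel_axioms.intro]) (use A that in blast)+
  then show ?thesis by blast
qed

section \<open>Families of kernels depending on a parameter\<close>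

text \<open>A single constant acts as bound and as Lipschitz modulus. One existential then suffices
  when such families are multiplied, acted on by the kernels, or sent to their Poisson
  solutions.\<close>

definition lipfam :: "'a measure \<Rightarrow> 'p::real_normed_vector set \<Rightarrow> ('a \<Rightarrow> real) \<Rightarrow> real \<Rightarrow> ('p \<Rightarrow> 'a \<Rightarrow> real) \<Rightarrow> bool" where
  "lipfam S L W N h \<longleftrightarrow> 0 \<le> N \<and> (\<forall>\<theta>\<in>L. wbound S W N (h \<theta>)) \<and>
     (\<forall>\<theta>\<in>L. \<forall>\<theta>'\<in>L. \<forall>x\<in>space S. \<bar>h \<theta> x - h \<theta>' x\<bar> \<le> N * norm (\<theta> - \<theta>') * W x)"

lemma lipfamD:
  assumes "lipfam S L W N h"
  shows "0 \<le> N" "\<theta> \<in> L \<Longrightarrow> wbound S W N (h \<theta>)"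
    "\<theta> \<in> L \<Longrightarrow> \<theta>' \<in> L \<Longrightarrow> x \<in> space S \<Longrightarrow> \<bar>h \<theta> x - h \<theta>' x\<bar> \<le> N * norm (\<theta> - \<theta>') * W x"
  using assms by (auto simp: lipfam_def)

lemma lipfam_diff:
  assumes h: "lipfam S L W N h" and g: "lipfam S L W N' g"
  shows "lipfam S L W (N + N') (\<lambda>\<theta> x. h \<theta> x - g \<theta> x)"
  unfolding lipfam_def
proof (intro conjI ballI wbound_diff)
  fix \<theta> \<theta>' x assume "\<theta> \<in> L" "\<theta>' \<in> L" "x \<in> space S"
  from lipfamD(3)[OF h this] lipfamD(3)[OF g this]
  show "\<bar>h \<theta> x - g \<theta> x - (h \<theta>' x - g \<theta>' x)\<bar> \<le> (N + N') * norm (\<theta> - \<theta>') * W x"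
    by (simp add: distrib_right abs_le_iff)
qed (use lipfamD[OF h] lipfamD[OF g] in auto)

lemma lipfam_mult:
  assumes h: "lipfam S L W N h" and g: "lipfam S L W' N' g"
    and W: "\<And>x. x \<in> space S \<Longrightarrow> 0 \<le> W x" "\<And>x. x \<in> space S \<Longrightarrow> 0 \<le> W' x"
  shows "lipfam S L (\<lambda>x. W x * W' x) (2 * N * N') (\<lambda>\<theta> x. h \<theta> x * g \<theta> x)"
  unfolding lipfam_def
proof (intro conjI ballI)
  note N = lipfamD(1)[OF h] lipfamD(1)[OF g]
  show "0 \<le> 2 * N * N'" using N by simp
  fix \<theta> assume \<theta>: "\<theta> \<in> L"
  note bh = wboundD[OF lipfamD(2)[OF h]] and bg = wboundD[OF lipfamD(2)[OF g]]
  show "wbound S (\<lambda>x. W x * W' x) (2 * N * N') (\<lambda>x. h \<theta> x * g \<theta> x)"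
    unfolding wbound_def
  proof (intro conjI ballI)
    show "(\<lambda>x. h \<theta> x * g \<theta> x) \<in> borel_measurable S"
      using wbound_measurable[OF lipfamD(2)[OF h \<theta>]] wbound_measurable[OF lipfamD(2)[OF g \<theta>]] by simp
    fix x assume x: "x \<in> space S"
    have "\<bar>h \<theta> x * g \<theta> x\<bar> \<le> (N * W x) * (N' * W' x)"
      unfolding abs_mult using bh[OF \<theta> x] bg[OF \<theta> x] N W[OF x] by (intro mult_mono) auto
    moreover have "0 \<le> (N * W x) * (N' * W' x)" using N W[OF x] by simp
    ultimately show "\<bar>h \<theta> x * g \<theta> x\<bar> \<le> 2 * N * N' * (W x * W' x)"
      by (simp add: mult_ac)
  qed
  fix \<theta>' x assume \<theta>': "\<theta>' \<in> L" and x: "x \<in> space S"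
  have "h \<theta> x * g \<theta> x - h \<theta>' x * g \<theta>' x = h \<theta> x * (g \<theta> x - g \<theta>' x) + (h \<theta> x - h \<theta>' x) * g \<theta>' x"
    by (simp add: algebra_simps)
  also have "\<bar>\<dots>\<bar> \<le> \<bar>h \<theta> x\<bar> * \<bar>g \<theta> x - g \<theta>' x\<bar> + \<bar>h \<theta> x - h \<theta>' x\<bar> * \<bar>g \<theta>' x\<bar>"
    by (metis abs_mult abs_triangle_ineq)
  also have "\<dots> \<le> (N * W x) * (N' * norm (\<theta> - \<theta>') * W' x) + (N * norm (\<theta> - \<theta>') * W x) * (N' * W' x)"
    using bh[OF \<theta> x] bg[OF \<theta>' x] lipfamD(3)[OF h \<theta> \<theta>' x] lipfamD(3)[OF g \<theta> \<theta>' x] N W[OF x]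
    by (intro add_mono mult_mono) auto
  finally show "\<bar>h \<theta> x * g \<theta> x - h \<theta>' x * g \<theta>' x\<bar> \<le> 2 * N * N' * norm (\<theta> - \<theta>') * (W x * W' x)"
    by (simp add: algebra_simps)
qed

locale ergodic_family =
  fixes S :: "'a measure" and W :: "'a \<Rightarrow> real" and P :: "'p::real_normed_vector \<Rightarrow> 'a \<Rightarrow> 'a measure" and L :: "'p set"
    and l b :: real and \<pi> :: "'a measure" and A \<rho> c :: real
  assumes kernels: "\<theta> \<in> L \<Longrightarrow> ergodic_kernel S W (P \<theta>) l b \<pi> A \<rho>"
    and c_nonneg: "0 \<le> c" and L_nonempty: "L \<noteq> {}"
    and Lipschitz: "\<theta> \<in> L \<Longrightarrow> \<theta>' \<in> L \<Longrightarrow> wbound S W N g \<Longrightarrow> x \<in> space S \<Longrightarrow>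
      \<bar>kernel_act (P \<theta>) g x - kernel_act (P \<theta>') g x\<bar> \<le> c * norm (\<theta> - \<theta>') * N * W x"
begin

lemma constants_nonneg: "0 \<le> l" "0 \<le> b" "0 \<le> A" "\<rho> < 1"
proof -
  obtain \<theta> where "\<theta> \<in> L" using L_nonempty by auto
  then interpret E: ergodic_kernel S W "P \<theta>" l b \<pi> A \<rho> by (rule kernels)
  show "0 \<le> l" "0 \<le> b" "0 \<le> A" "\<rho> < 1"
    using E.l_nonneg E.b_nonneg E.A_nonneg E.rho by auto
qed

lemma lipfam_const:
  assumes f: "wbound S W N f" and L: "\<theta> \<in> L"
  shows "lipfam S L W N (\<lambda>_. f)"
proof -
  interpret E: ergodic_kernel S W "P \<theta>" l b \<pi> A \<rho> by (rule kernels[OF L])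
  show ?thesis
    unfolding lipfam_def using f E.wbound_N_nonneg[OF f] E.W_nonneg by auto
qed

lemma lipfam_act:
  assumes h: "lipfam S L W N h"
  shows "lipfam S L W (N * (l + b) + c * N) (\<lambda>\<theta>. kernel_act (P \<theta>) (h \<theta>))"
  unfolding lipfam_def
proof (intro conjI ballI)
  note N = lipfamD(1)[OF h]
  {
    fix \<theta> assume \<theta>: "\<theta> \<in> L"
    interpret E: ergodic_kernel S W "P \<theta>" l b \<pi> A \<rho> by (rule kernels[OF \<theta>])
    show "wbound S W (N * (l + b) + c * N) (kernel_act (P \<theta>) (h \<theta>))"
      using N c_nonneg E.W_nonneg by (intro wbound_mono[OF E.wbound_act[OF lipfamD(2)[OF h \<theta>] N]]) auto
    fix \<theta>' x assume \<theta>': "\<theta>' \<in> L" and x: "x \<in> space S"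
    have d: "wbound S W (N * norm (\<theta> - \<theta>')) (\<lambda>x. h \<theta> x - h \<theta>' x)"
      unfolding wbound_def
      using lipfamD(3)[OF h \<theta> \<theta>'] wbound_measurable[OF lipfamD(2)[OF h \<theta>]] wbound_measurable[OF lipfamD(2)[OF h \<theta>']] by auto
    have "\<bar>kernel_act (P \<theta>) (h \<theta>) x - kernel_act (P \<theta>) (h \<theta>') x\<bar> \<le> (N * norm (\<theta> - \<theta>')) * (l + b) * W x"
      using wboundD[OF E.wbound_act[OF d] x] N E.act_diff[OF lipfamD(2)[OF h \<theta>] lipfamD(2)[OF h \<theta>'] x] by simp
    moreover have "\<bar>kernel_act (P \<theta>) (h \<theta>') x - kernel_act (P \<theta>') (h \<theta>') x\<bar> \<le> c * norm (\<theta> - \<theta>') * N * W x"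
      by (rule Lipschitz[OF \<theta> \<theta>' lipfamD(2)[OF h \<theta>'] x])
    ultimately show "\<bar>kernel_act (P \<theta>) (h \<theta>) x - kernel_act (P \<theta>') (h \<theta>') x\<bar>
        \<le> (N * (l + b) + c * N) * norm (\<theta> - \<theta>') * W x"
      by (simp add: algebra_simps)
  }
  show "0 \<le> N * (l + b) + c * N"
    using N c_nonneg constants_nonneg by simp
qed

text \<open>The difference is split so that first only the function changes and then only the
  kernel. The former part is bounded by linearity of the solution operator, the latter by
  \<open>poisson_kernel_diff\<close>.\<close>

lemma lipfam_poisson:
  assumes h: "lipfam S L W N h"
  shows "\<exists>N'. lipfam S L W N' (\<lambda>\<theta>. poisson_sol S \<pi> (P \<theta>) (h \<theta>))"
proof -
  note N = lipfamD(1)[OF h]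
  define D where "D = A / (1 - \<rho>)"
  have D: "0 \<le> D" using constants_nonneg by (simp add: D_def)
  have "lipfam S L W (N * D + D * (c * (N * D))) (\<lambda>\<theta>. poisson_sol S \<pi> (P \<theta>) (h \<theta>))"
    unfolding lipfam_def
  proof (intro conjI ballI)
    show "0 \<le> N * D + D * (c * (N * D))" using N D c_nonneg by simp
    fix \<theta> assume \<theta>: "\<theta> \<in> L"
    interpret E: ergodic_kernel S W "P \<theta>" l b \<pi> A \<rho> by (rule kernels[OF \<theta>])
    have ED: "E.D = D" by (simp add: E.D_def D_def)
    show "wbound S W (N * D + D * (c * (N * D))) (poisson_sol S \<pi> (P \<theta>) (h \<theta>))"
      using N c_nonneg D E.W_nonneg by (intro wbound_mono[OF E.wbound_poisson[OF lipfamD(2)[OF h \<theta>]]]) (auto simp: ED)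
    fix \<theta>' x assume \<theta>': "\<theta>' \<in> L" and x: "x \<in> space S"
    have d: "wbound S W (N * norm (\<theta> - \<theta>')) (\<lambda>x. h \<theta> x - h \<theta>' x)"
      unfolding wbound_def
      using lipfamD(3)[OF h \<theta> \<theta>'] wbound_measurable[OF lipfamD(2)[OF h \<theta>]] wbound_measurable[OF lipfamD(2)[OF h \<theta>']] by auto
    have "\<bar>poisson_sol S \<pi> (P \<theta>) (h \<theta>) x - poisson_sol S \<pi> (P \<theta>) (h \<theta>') x\<bar> \<le> (N * norm (\<theta> - \<theta>')) * D * W x"
      using wboundD[OF E.wbound_poisson[OF d] x] E.poisson_diff[OF lipfamD(2)[OF h \<theta>] lipfamD(2)[OF h \<theta>'] x] by (simp add: ED)
    moreover have "\<bar>poisson_sol S \<pi> (P \<theta>) (h \<theta>') x - poisson_sol S \<pi> (P \<theta>') (h \<theta>') x\<bar>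
        \<le> D * ((c * norm (\<theta> - \<theta>')) * (N * D)) * W x"
      unfolding D_def using Lipschitz[OF \<theta> \<theta>']
      by (intro poisson_kernel_diff[OF kernels[OF \<theta>] kernels[OF \<theta>'] _ lipfamD(2)[OF h \<theta>'] x]) auto
    ultimately show "\<bar>poisson_sol S \<pi> (P \<theta>) (h \<theta>) x - poisson_sol S \<pi> (P \<theta>') (h \<theta>') x\<bar>
        \<le> (N * D + D * (c * (N * D))) * norm (\<theta> - \<theta>') * W x"
      by (simp add: algebra_simps)
  qed
  then show ?thesis by blast
qed

lemma lipfam_pi_continuous:
  assumes h: "lipfam S L W N h"
  shows "continuous_on L (\<lambda>\<theta>. \<integral>x. h \<theta> x \<partial>\<pi>)"
proof -
  obtain \<theta>\<^sub>0 where "\<theta>\<^sub>0 \<in> L" using L_nonempty by auto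
  then interpret E: ergodic_kernel S W "P \<theta>\<^sub>0" l b \<pi> A \<rho> by (rule kernels)
  have "\<bar>(\<integral>x. h \<theta> x \<partial>\<pi>) - (\<integral>x. h \<theta>' x \<partial>\<pi>)\<bar> \<le> N * E.B * norm (\<theta> - \<theta>')" if \<theta>: "\<theta> \<in> L" "\<theta>' \<in> L" for \<theta> \<theta>'
  proof -
    have d: "wbound S W (N * norm (\<theta> - \<theta>')) (\<lambda>x. h \<theta> x - h \<theta>' x)"
      unfolding wbound_def
      using lipfamD(3)[OF h \<theta>] wbound_measurable[OF lipfamD(2)[OF h]] \<theta> by auto
    show ?thesis
      using E.abs_pi_le[OF d] E.integrable_pi[OF lipfamD(2)[OF h \<theta>(1)]] E.integrable_pi[OF lipfamD(2)[OF h \<theta>(2)]]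
      by (simp add: mult_ac)
  qed
  then have "(N * E.B)-lipschitz_on L (\<lambda>\<theta>. \<integral>x. h \<theta> x \<partial>\<pi>)"
    using lipfamD(1)[OF h] E.B_nonneg by (intro lipschitz_onI) (auto simp: dist_norm)
  then show ?thesis by (rule lipschitz_on_continuous_on)
qed

end

text \<open>The parameter is replaced by the first member of a countable dense sequence at distance
  below \<open>1 / Suc n\<close>; this leaves a countable case distinction, and continuity gives the
  limit. The lemma is needed because measurability is known for each fixed parameter, whereas the
  chain carries a random one.\<close>

lemma Caratheodory_measurable:
  fixes h :: "'p::euclidean_space \<Rightarrow> 'a \<Rightarrow> real"
  assumes L: "L \<in> sets borel"
    and meas: "\<And>\<theta>. \<theta> \<in> L \<Longrightarrow> h \<theta> \<in> borel_measurable S"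
    and cont: "\<And>x. x \<in> space S \<Longrightarrow> continuous_on L (\<lambda>\<theta>. h \<theta> x)"
  shows "(\<lambda>(\<theta>, x). if \<theta> \<in> L then h \<theta> x else 0) \<in> borel_measurable (borel \<Otimes>\<^sub>M S)"
proof (cases "L = {}")
  case False
  obtain T where T: "countable T" "T \<subseteq> L" "L \<subseteq> closure T"
    using separable[of L] by auto
  then have "T \<noteq> {}" using False by auto
  define t where "t = from_nat_into T"
  have tT: "range t = T" unfolding t_def using T(1) \<open>T \<noteq> {}\<close> by (simp add: range_from_nat_into)
  have tL: "t j \<in> L" for j using tT T(2) by auto
  define J where "J n \<theta> = (LEAST j. dist (t j) \<theta> < 1 / real (Suc n))" for n \<theta>
  have J: "dist (t (J n \<theta>)) \<theta> < 1 / real (Suc n)" if "\<theta> \<in> L" for n \<theta>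
  proof -
    have "\<theta> \<in> closure T" using T(3) that by auto
    then obtain y where "y \<in> T" "dist y \<theta> < 1 / real (Suc n)"
      by (meson closure_approachable of_nat_0_less_iff zero_less_Suc zero_less_divide_1_iff)
    then obtain j where "dist (t j) \<theta> < 1 / real (Suc n)" using tT by auto
    then show ?thesis unfolding J_def by (rule LeastI)
  qed
  have Jm [measurable]: "J n \<in> measurable borel (count_space UNIV)" for n
    unfolding J_def by measurable
  note [measurable] = L
  have hm [measurable]: "h (t j) \<in> borel_measurable S" for j by (rule meas[OF tL])
  show ?thesis
  proof (rule borel_measurable_LIMSEQ_real)
    fix n
    have "(\<lambda>z. h (t (J n (fst z))) (snd z)) \<in> borel_measurable (borel \<Otimes>\<^sub>M S)"
      by (rule measurable_compose_countable'[where I=UNIV and g="\<lambda>z. J n (fst z)" and f="\<lambda>j z. h (t j) (snd z)"])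
        (auto intro!: measurable_compose[OF measurable_snd hm] measurable_compose[OF measurable_fst Jm])
    then show "(\<lambda>z. if fst z \<in> L then h (t (J n (fst z))) (snd z) else 0) \<in> borel_measurable (borel \<Otimes>\<^sub>M S)"
      by measurable
  next
    fix z :: "'p \<times> 'a" assume z: "z \<in> space (borel \<Otimes>\<^sub>M S)"
    show "(\<lambda>n. if fst z \<in> L then h (t (J n (fst z))) (snd z) else 0) \<longlonglongrightarrow> (case z of (\<theta>, x) \<Rightarrow> if \<theta> \<in> L then h \<theta> x else 0)"
    proof (cases "fst z \<in> L")
      case True
      have "(\<lambda>n. t (J n (fst z))) \<longlonglongrightarrow> fst z"
      proof (rule metric_LIMSEQ_I)
        fix r :: real assume "0 < r"
        then obtain N where N: "1 / real (Suc N) < r"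
          using nat_approx_posE by blast
        have "dist (t (J n (fst z))) (fst z) < r" if "n \<ge> N" for n
        proof -
          have "1 / real (Suc n) \<le> 1 / real (Suc N)" using that by (intro divide_left_mono) auto
          then show ?thesis using J[OF True, of n] N by linarith
        qed
        then show "\<exists>no. \<forall>n\<ge>no. dist (t (J n (fst z))) (fst z) < r" by blast
      qed
      then have "(\<lambda>n. h (t (J n (fst z))) (snd z)) \<longlonglongrightarrow> h (fst z) (snd z)"
        using z True tL by (intro continuous_on_tendsto_compose[OF cont]) (auto simp: space_pair_measure)
      then show ?thesis using True by (simp add: split_beta)
    qed (simp add: split_beta)
  qed
qed simp

section \<open>A martingale central limit theorem with a mixed limit\<close>

lemma LIMSEQ_average:
  fixes x :: "nat \<Rightarrow> real"
  assumes x: "x \<longlonglongrightarrow> L"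
  shows "(\<lambda>n. (\<Sum>k<n. x k) / real n) \<longlonglongrightarrow> L"
proof (rule LIMSEQ_I)
  fix e :: real assume e: "0 < e"
  from LIMSEQ_D[OF x, of "e / 2"] e obtain N where N: "\<And>k. k \<ge> N \<Longrightarrow> \<bar>x k - L\<bar> < e / 2"
    by auto
  define K where "K = (\<Sum>k<N. \<bar>x k - L\<bar>)"
  obtain M where M: "real M > 2 * K / e" using reals_Archimedean2 by blast
  show "\<exists>no. \<forall>n\<ge>no. norm ((\<Sum>k<n. x k) / real n - L) < e"
  proof (intro exI[of _ "max (Suc N) (Suc M)"] allI impI)
    fix n assume n: "max (Suc N) (Suc M) \<le> n"
    then have n0: "0 < real n" by auto
    have "(\<Sum>k<n. \<bar>x k - L\<bar>) = K + (\<Sum>k=N..<n. \<bar>x k - L\<bar>)"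
      unfolding K_def using n by (simp add: lessThan_atLeast0 sum.atLeastLessThan_concat)
    also have "\<dots> \<le> K + (\<Sum>k=N..<n. e / 2)"
      using N by (intro add_left_mono sum_mono) (auto intro: less_imp_le)
    also have "\<dots> \<le> K + real n * (e / 2)"
      using e n by (simp add: mult_right_mono)
    also have "\<dots> < real n * e"
    proof -
      have "2 * K / e < real n" using M n by linarith
      then show ?thesis using e by (simp add: field_simps)
    qed
    finally have "(\<Sum>k<n. \<bar>x k - L\<bar>) < real n * e" .
    moreover have "\<bar>(\<Sum>k<n. x k - L)\<bar> \<le> (\<Sum>k<n. \<bar>x k - L\<bar>)" by (rule sum_abs)
    ultimately have "\<bar>(\<Sum>k<n. x k) - real n * L\<bar> < real n * e" by (simp add: sum_subtractf)
    moreover have "(\<Sum>k<n. x k) / real n - L = ((\<Sum>k<n. x k) - real n * L) / real n"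
      using n0 by (simp add: field_simps)
    ultimately show "norm ((\<Sum>k<n. x k) / real n - L) < e"
      using n0 by (simp add: field_simps)
  qed
qed

text \<open>Martingale properties are stated below as vanishing integrals over the sets of
  \<open>F\<close>. They say that the conditional expectation is zero, so they extend to complex
  multipliers that are measurable for \<open>F\<close>, with real and imaginary part treated
  separately.\<close>

lemma integral_mult_subalgebra_zero:
  fixes g :: "'w \<Rightarrow> real" and Y :: "'w \<Rightarrow> complex"
  assumes M: "prob_space M" and sub: "subalgebra M F" and g: "integrable M g"
    and zero: "\<And>A. A \<in> sets F \<Longrightarrow> (\<integral>\<omega>. indicator A \<omega> * g \<omega> \<partial>M) = 0"
    and Y: "Y \<in> borel_measurable F" and Yg: "integrable M (\<lambda>\<omega>. Y \<omega> * of_real (g \<omega>))"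
  shows "(\<integral>\<omega>. Y \<omega> * of_real (g \<omega>) \<partial>M) = 0"
proof -
  interpret prob_space M by fact
  interpret finite_measure_subalgebra M F by unfold_locales (rule sub)
  have ae: "AE \<omega> in M. real_cond_exp M F g \<omega> = 0"
    using zero g by (intro real_cond_exp_charact) (auto simp: set_lebesgue_integral_def)
  have real: "(\<integral>\<omega>. y \<omega> * g \<omega> \<partial>M) = 0" if "y \<in> borel_measurable F" "integrable M (\<lambda>\<omega>. y \<omega> * g \<omega>)" for y
  proof -
    have "(\<integral>\<omega>. y \<omega> * g \<omega> \<partial>M) = (\<integral>\<omega>. y \<omega> * real_cond_exp M F g \<omega> \<partial>M)"
      using real_cond_exp_intg(2)[OF that(2,1)] g by auto
    also have "\<dots> = 0"
      using ae by (intro integral_eq_zero_AE) auto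
    finally show ?thesis .
  qed
  have "(\<integral>\<omega>. Re (Y \<omega> * of_real (g \<omega>)) \<partial>M) = 0" "(\<integral>\<omega>. Im (Y \<omega> * of_real (g \<omega>)) \<partial>M) = 0"
    using real[of "\<lambda>\<omega>. Re (Y \<omega>)"] real[of "\<lambda>\<omega>. Im (Y \<omega>)"] Y integrable_Re[OF Yg] integrable_Im[OF Yg] by auto
  then show ?thesis
    unfolding integral_Re[OF Yg] integral_Im[OF Yg] by (intro complex_eqI) simp_all
qed

section \<open>Taylor estimates for complex exponentials\<close>

lemma norm_iexp_minus_one: "norm (exp (\<i> * complex_of_real y) - 1) \<le> min 2 \<bar>y\<bar>"
  using iexp_approx1[of y 0] norm_triangle_ineq4[of "exp (\<i> * complex_of_real y)" 1] by simp

text \<open>Interpolates between the bound 2 and the linear bound. Where an increment is multiplied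
  by a corrector, only its power \<eta> is integrable together with it.\<close>

lemma norm_iexp_minus_one_powr:
  assumes "0 < \<eta>" "\<eta> \<le> 1"
  shows "norm (exp (\<i> * complex_of_real y) - 1) \<le> 2 * \<bar>y\<bar> powr \<eta>"
proof (cases "\<bar>y\<bar> \<le> 1")
  case True
  have "\<bar>y\<bar> \<le> \<bar>y\<bar> powr \<eta>"
    using powr_mono'[of \<eta> 1 "\<bar>y\<bar>"] assms True by (cases "y = 0") auto
  then show ?thesis using norm_iexp_minus_one[of y] by auto
next
  case False
  then have "1 \<le> \<bar>y\<bar> powr \<eta>" using assms by (simp add: ge_one_powr_ge_zero)
  then show ?thesis using norm_iexp_minus_one[of y] by auto
qed

text \<open>Interpolates between the Taylor remainders of second and third order, so that moments of
  an order \<open>p > 2\<close> suffice.\<close>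

lemma norm_iexp_second_order:
  assumes "2 < p" "p \<le> 3"
  shows "norm (exp (\<i> * complex_of_real y) - (1 + \<i> * of_real y - of_real (y\<^sup>2 / 2))) \<le> \<bar>y\<bar> powr p"
proof -
  have eq: "(\<Sum>k\<le>2. (\<i> * complex_of_real y) ^ k / fact k) = 1 + \<i> * of_real y - of_real (y\<^sup>2 / 2)"
    by (simp add: numeral_2_eq_2 power_mult_distrib)
  show ?thesis
  proof (cases "\<bar>y\<bar> \<le> 1")
    case True
    have "norm (exp (\<i> * complex_of_real y) - (1 + \<i> * of_real y - of_real (y\<^sup>2 / 2))) \<le> \<bar>y\<bar> ^ Suc 2 / fact (Suc 2)"
      using iexp_approx1[of y 2] unfolding eq .
    also have "\<dots> \<le> \<bar>y\<bar> ^ 3" by (simp add: eval_nat_numeral mult.assoc[symmetric])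
    also have "\<dots> \<le> \<bar>y\<bar> powr p"
      using powr_mono'[of p 3 "\<bar>y\<bar>"] assms True by (cases "y = 0") (auto simp: powr_numeral)
    finally show ?thesis .
  next
    case False
    have "norm (exp (\<i> * complex_of_real y) - (1 + \<i> * of_real y - of_real (y\<^sup>2 / 2))) \<le> 2 * \<bar>y\<bar> ^ 2 / fact 2"
      using iexp_approx2[of y 2] unfolding eq .
    also have "\<dots> = \<bar>y\<bar> powr 2" using False by (simp add: powr_numeral eval_nat_numeral)
    also have "\<dots> \<le> \<bar>y\<bar> powr p" using assms False by (intro powr_mono) auto
    finally show ?thesis .
  qed
qed

lemma exp_minus_one_bounds:
  fixes x X :: real
  assumes "0 \<le> x" "x \<le> X"
  shows "exp x - 1 \<le> x * exp X" "exp x - 1 - x \<le> x\<^sup>2 * exp X"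
proof -
  have "1 - x \<le> exp (- x)" using exp_ge_add_one_self[of "- x"] by simp
  from mult_left_mono[OF this, of "exp x"] have 1: "exp x - 1 \<le> x * exp x"
    by (simp add: exp_minus algebra_simps)
  also have "\<dots> \<le> x * exp X" using assms by (intro mult_left_mono) auto
  finally show "exp x - 1 \<le> x * exp X" .
  have "exp x - 1 - x \<le> x * (exp x - 1)" using 1 by (simp add: algebra_simps)
  also have "\<dots> \<le> x * (x * exp X)"
    using assms \<open>exp x - 1 \<le> x * exp X\<close> by (intro mult_left_mono) auto
  finally show "exp x - 1 - x \<le> x\<^sup>2 * exp X" by (simp add: power2_eq_square)
qed

text \<open>In the application \<open>x\<close> is the compensator of \<open>y\<^sup>2 / 2\<close>.
  The bracket keeps the terms whose conditional mean is zero or nearly so: the linear term, where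
  \<open>exp x\<close> may stay as a factor because it is known one step earlier, and the difference
  of compensator and half the square.\<close>

lemma norm_exp_compensated:
  fixes x X y p :: real
  assumes x: "0 \<le> x" "x \<le> X" and p: "2 < p" "p \<le> 3"
  shows "norm (exp (\<i> * of_real y + of_real x) - 1 - (of_real (exp x) * \<i> * of_real y + of_real (x - y\<^sup>2 / 2)))
    \<le> exp X * (x\<^sup>2 + x * y\<^sup>2 + \<bar>y\<bar> powr p)"
proof -
  define q where "q = complex_of_real (y\<^sup>2 / 2)"
  have q: "complex_of_real ((exp x - 1) * (y\<^sup>2 / 2)) = (complex_of_real (exp x) - 1) * q"
    "complex_of_real (x - y\<^sup>2 / 2) = complex_of_real x - q"
    by (simp_all add: q_def)
  define R where "R = exp (\<i> * complex_of_real y) - (1 + \<i> * of_real y - of_real (y\<^sup>2 / 2))"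
  have "exp (\<i> * of_real y + of_real x) = complex_of_real (exp x) * (1 + \<i> * of_real y - q + R)"
    by (simp add: R_def q_def exp_add exp_of_real mult.commute)
  then have "exp (\<i> * of_real y + of_real x) - 1 - (of_real (exp x) * \<i> * of_real y + of_real (x - y\<^sup>2 / 2)) =
      of_real (exp x - 1 - x) - of_real ((exp x - 1) * (y\<^sup>2 / 2)) + of_real (exp x) * R"
    unfolding q by (simp add: algebra_simps)
  also have "norm \<dots> \<le> norm (complex_of_real (exp x - 1 - x)) + norm (complex_of_real ((exp x - 1) * (y\<^sup>2 / 2))) + norm (complex_of_real (exp x) * R)"
    by (meson add_right_mono norm_triangle_ineq norm_triangle_ineq4 order_trans)
  also have "norm (complex_of_real (exp x - 1 - x)) = exp x - 1 - x"
    using exp_ge_add_one_self[of x] by (subst norm_of_real) linarith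
  also have "norm (complex_of_real ((exp x - 1) * (y\<^sup>2 / 2))) = (exp x - 1) * (y\<^sup>2 / 2)"
    using exp_ge_add_one_self[of x] x by (subst norm_of_real) simp
  also have "norm (complex_of_real (exp x) * R) \<le> exp X * \<bar>y\<bar> powr p"
    unfolding norm_mult R_def using norm_iexp_second_order[OF p, of y] x by (intro mult_mono) auto
  also have "exp x - 1 - x \<le> x\<^sup>2 * exp X" by (rule exp_minus_one_bounds[OF x])
  also have "(exp x - 1) * (y\<^sup>2 / 2) \<le> (x * exp X) * y\<^sup>2"
  proof (intro mult_mono)
    show "exp x - 1 \<le> x * exp X" by (rule exp_minus_one_bounds[OF x])
  qed (use x in auto)
  finally show ?thesis by (simp add: algebra_simps)
qed

lemma norm_exp_complex_minus_one:
  fixes x X y \<eta> :: real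
  assumes x: "0 \<le> x" "x \<le> X" and \<eta>: "0 < \<eta>" "\<eta> \<le> 1"
  shows "norm (exp (\<i> * of_real y + of_real x) - 1) \<le> exp X * (x + 2 * \<bar>y\<bar> powr \<eta>)"
proof -
  have "exp (\<i> * of_real y + of_real x) - 1 = complex_of_real (exp x) * (exp (\<i> * of_real y) - 1) + of_real (exp x - 1)"
    by (simp add: exp_add exp_of_real algebra_simps)
  also have "norm \<dots> \<le> norm (complex_of_real (exp x) * (exp (\<i> * of_real y) - 1)) + norm (complex_of_real (exp x - 1))"
    by (rule norm_triangle_ineq)
  also have "norm (complex_of_real (exp x - 1)) = exp x - 1"
    using exp_ge_add_one_self[of x] x by (subst norm_of_real) simp
  also have "norm (complex_of_real (exp x) * (exp (\<i> * of_real y) - 1)) \<le> exp X * (2 * \<bar>y\<bar> powr \<eta>)"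
    unfolding norm_mult using norm_iexp_minus_one_powr[OF \<eta>, of y] x by (intro mult_mono) auto
  also have "exp x - 1 \<le> x * exp X" by (rule exp_minus_one_bounds[OF x])
  finally show ?thesis by (simp add: algebra_simps)
qed

text \<open>The \<open>U k\<close> are correctors: the conditional variance of the \<open>k\<close>-th increment is \<open>s k\<close>
  up to a coboundary and a small remainder.\<close>

locale mds_clt = prob_space M for M :: "'w measure" +
  fixes F :: "nat \<Rightarrow> 'w measure" and D U r s :: "nat \<Rightarrow> 'w \<Rightarrow> real" and c p \<eta> CD CU :: real
  assumes subalg: "subalgebra M (F k)"
    and filtration: "j \<le> k \<Longrightarrow> sets (F j) \<subseteq> sets (F k)"
    and D_adapted: "D k \<in> borel_measurable (F k)"
    and s_adapted: "s k \<in> borel_measurable (F k)"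
    and s_bounds: "0 \<le> s k \<omega>" "s k \<omega> \<le> c"
    and U_int: "integrable M (U k)" and U_bound: "(\<integral>\<omega>. \<bar>U k \<omega>\<bar> \<partial>M) \<le> CU"
    and r_int: "integrable M (r k)"
    and D_int: "integrable M (\<lambda>\<omega>. \<bar>D k \<omega>\<bar> powr p)" and D_bound: "(\<integral>\<omega>. \<bar>D k \<omega>\<bar> powr p \<partial>M) \<le> CD"
    and p: "2 < p" "p \<le> 3" and \<eta>: "0 < \<eta>" "\<eta> \<le> 1"
    and DU_int: "integrable M (\<lambda>\<omega>. \<bar>D k \<omega>\<bar> powr \<eta> * \<bar>U k \<omega>\<bar>)"
    and DU_bound: "(\<integral>\<omega>. \<bar>D k \<omega>\<bar> powr \<eta> * \<bar>U k \<omega>\<bar> \<partial>M) \<le> CU"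
    and mds: "A \<in> sets (F k) \<Longrightarrow> (\<integral>\<omega>. indicator A \<omega> * D (Suc k) \<omega> \<partial>M) = 0"
    and var: "A \<in> sets (F k) \<Longrightarrow>
      (\<integral>\<omega>. indicator A \<omega> * ((D (Suc k) \<omega>)\<^sup>2 - s k \<omega> - U k \<omega> + U (Suc k) \<omega> - r (Suc k) \<omega>) \<partial>M) = 0"
    and r_small: "(\<lambda>n. (\<Sum>k<n. \<integral>\<omega>. \<bar>r (Suc k) \<omega>\<bar> \<partial>M) / real n) \<longlonglongrightarrow> 0"
begin

lemma measurable_F_mono: "f \<in> borel_measurable (F j) \<Longrightarrow> j \<le> k \<Longrightarrow> f \<in> borel_measurable (F k)"
  using subalg filtration[of j k] by (intro measurable_from_subalg[of "F k" "F j"]) (auto simp: subalgebra_def)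

lemma measurable_F_M: "f \<in> borel_measurable (F j) \<Longrightarrow> f \<in> borel_measurable M"
  by (rule measurable_from_subalg[OF subalg])

lemma D_meas [measurable]: "D k \<in> borel_measurable M"
  by (rule measurable_F_M[OF D_adapted])

lemma s_meas [measurable]: "s k \<in> borel_measurable M"
  by (rule measurable_F_M[OF s_adapted])

lemma U_meas [measurable]: "U k \<in> borel_measurable M"
  using U_int by auto

lemma c_nonneg: "0 \<le> c"
  using s_bounds by (rule order_trans)

lemma powr_le_one_plus: "0 \<le> a \<Longrightarrow> a \<le> q \<Longrightarrow> \<bar>y::real\<bar> powr a \<le> 1 + \<bar>y\<bar> powr q"
  using powr_mono[of a q "\<bar>y\<bar>"] powr_le1[of a "\<bar>y\<bar>"] by (cases "\<bar>y\<bar> \<le> 1") (auto simp: add_increasing add_increasing2)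

lemma D_sq_int: "integrable M (\<lambda>\<omega>. (D k \<omega>)\<^sup>2)" and D_sq_bound: "(\<integral>\<omega>. (D k \<omega>)\<^sup>2 \<partial>M) \<le> 1 + CD"
  and D_int1: "integrable M (D k)"
proof -
  have le: "(D k \<omega>)\<^sup>2 \<le> 1 + \<bar>D k \<omega>\<bar> powr p" for \<omega>
    using powr_le_one_plus[of 2 p "D k \<omega>"] p by (cases "D k \<omega> = 0") (auto simp: powr_numeral)
  have i: "integrable M (\<lambda>\<omega>. 1 + \<bar>D k \<omega>\<bar> powr p)" using D_int by simp
  show sq: "integrable M (\<lambda>\<omega>. (D k \<omega>)\<^sup>2)"
    using le by (intro Bochner_Integration.integrable_bound[OF i]) auto
  have "(\<integral>\<omega>. (D k \<omega>)\<^sup>2 \<partial>M) \<le> (\<integral>\<omega>. 1 + \<bar>D k \<omega>\<bar> powr p \<partial>M)"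
    using le by (intro integral_mono sq i) auto
  also have "\<dots> \<le> 1 + CD" using D_int D_bound by (simp add: prob_space)
  finally show "(\<integral>\<omega>. (D k \<omega>)\<^sup>2 \<partial>M) \<le> 1 + CD" .
  have "\<bar>D k \<omega>\<bar> \<le> 1 + \<bar>D k \<omega>\<bar> powr p" for \<omega>
    using powr_le_one_plus[of 1 p "D k \<omega>"] p by (cases "D k \<omega> = 0") auto
  then show "integrable M (D k)"
    by (intro Bochner_Integration.integrable_bound[OF i]) auto
qed

lemma CD_nonneg: "0 \<le> CD"
  using D_bound[of 0] by (rule order_trans[rotated]) simp

lemma CU_nonneg: "0 \<le> CU"
  using U_bound[of 0] by (rule order_trans[rotated]) simp

lemma D_orthogonal:
  assumes Y: "Y \<in> borel_measurable (F k)" and YD: "integrable M (\<lambda>\<omega>. Y \<omega> * D (Suc k) \<omega>)"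
  shows "(\<integral>\<omega>. Y \<omega> * D (Suc k) \<omega> \<partial>M) = 0"
proof -
  have "(\<integral>\<omega>. complex_of_real (Y \<omega>) * of_real (D (Suc k) \<omega>) \<partial>M) = 0"
    using Y integrable_of_real[OF YD, where 'a=complex]
    by (intro integral_mult_subalgebra_zero[OF prob_space_axioms subalg[of k] D_int1 mds]) auto
  then have "complex_of_real (\<integral>\<omega>. Y \<omega> * D (Suc k) \<omega> \<partial>M) = 0"
    by (simp add: integral_complex_of_real[symmetric])
  then show ?thesis by simp
qed

text \<open>Orthogonality of the increments; the linear growth keeps the normalised sums bounded in
  mean square.\<close>

lemma partial_sum_sq:
  "integrable M (\<lambda>\<omega>. (\<Sum>k<n. D (Suc k) \<omega>)\<^sup>2) \<and> (\<integral>\<omega>. (\<Sum>k<n. D (Suc k) \<omega>)\<^sup>2 \<partial>M) \<le> real n * (1 + CD)"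
proof (induction n)
  case (Suc n)
  define S where "S \<omega> = (\<Sum>k<n. D (Suc k) \<omega>)" for \<omega>
  have SF: "S \<in> borel_measurable (F n)"
    unfolding S_def by (intro borel_measurable_sum measurable_F_mono[OF D_adapted]) auto
  have [measurable]: "S \<in> borel_measurable M" by (rule measurable_F_M[OF SF])
  have i1: "integrable M (\<lambda>\<omega>. (S \<omega>)\<^sup>2)" using Suc by (simp add: S_def)
  have SD: "integrable M (\<lambda>\<omega>. S \<omega> * D (Suc n) \<omega>)"
  proof (rule Bochner_Integration.integrable_bound[OF Bochner_Integration.integrable_add[OF i1 D_sq_int[of "Suc n"]]])
    show "AE \<omega> in M. norm (S \<omega> * D (Suc n) \<omega>) \<le> norm ((S \<omega>)\<^sup>2 + (D (Suc n) \<omega>)\<^sup>2)"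
    proof (rule AE_I2)
      fix \<omega>
      have "2 * (\<bar>S \<omega>\<bar> * \<bar>D (Suc n) \<omega>\<bar>) \<le> (S \<omega>)\<^sup>2 + (D (Suc n) \<omega>)\<^sup>2"
        using sum_squares_bound[of "\<bar>S \<omega>\<bar>" "\<bar>D (Suc n) \<omega>\<bar>"] by simp
      then have "\<bar>S \<omega>\<bar> * \<bar>D (Suc n) \<omega>\<bar> \<le> (S \<omega>)\<^sup>2 + (D (Suc n) \<omega>)\<^sup>2"
        using mult_nonneg_nonneg[OF abs_ge_zero[of "S \<omega>"] abs_ge_zero[of "D (Suc n) \<omega>"]] by linarith
      then show "norm (S \<omega> * D (Suc n) \<omega>) \<le> norm ((S \<omega>)\<^sup>2 + (D (Suc n) \<omega>)\<^sup>2)"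
        by (simp add: abs_mult)
    qed
  qed auto
  have eq: "(\<Sum>k<Suc n. D (Suc k) \<omega>)\<^sup>2 = (S \<omega>)\<^sup>2 + 2 * (S \<omega> * D (Suc n) \<omega>) + (D (Suc n) \<omega>)\<^sup>2" for \<omega>
    by (simp add: S_def power2_eq_square algebra_simps)
  show ?case
    unfolding eq using i1 SD D_sq_int[of "Suc n"] D_orthogonal[OF SF SD] D_sq_bound[of "Suc n"] Suc
    by (simp add: S_def algebra_simps)
qed simp

section \<open>Compensated exponentials with multiplier and weight frozen at time
  \<open>m\<close>\<close>

context
  fixes m :: nat and v \<xi> :: "'w \<Rightarrow> real" and cv :: real
  assumes v: "v \<in> borel_measurable (F m)" "\<And>\<omega>. \<bar>v \<omega>\<bar> \<le> cv"
    and \<xi>: "\<xi> \<in> borel_measurable (F m)" "\<And>\<omega>. 0 \<le> \<xi> \<omega>" "\<And>\<omega>. \<xi> \<omega> \<le> 1"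
begin

text \<open>The compensated characteristic exponential of the martingale after time
  \<open>m\<close>: the real summand offsets the decay of the characteristic function, so that the
  expectation is almost constant in \<open>k\<close>. The normalisation is by the final
  \<open>n\<close> throughout.\<close>

definition W :: "nat \<Rightarrow> nat \<Rightarrow> 'w \<Rightarrow> complex" where
  "W n k \<omega> = exp (\<i> * of_real (v \<omega> * (\<Sum>j=m..<k. D (Suc j) \<omega>) / sqrt (real n)) +
     of_real ((v \<omega>)\<^sup>2 * (\<Sum>j=m..<k. s j \<omega>) / (2 * real n)))"

text \<open>An upper bound for the compensating exponent, as long as it has at most \<open>n\<close>
  summands.\<close>

definition "X = cv\<^sup>2 * c / 2"

lemma X_nonneg: "0 \<le> X"
  using c_nonneg by (simp add: X_def)

lemma v_sq: "(v \<omega>)\<^sup>2 \<le> cv\<^sup>2"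
  using v(2)[of \<omega>] by (rule abs_le_square_iff[THEN iffD1, OF order_trans[OF _ abs_ge_self]])

lemma W_meas_F: "m \<le> k \<Longrightarrow> W n k \<in> borel_measurable (F k)"
  unfolding W_def
  by (intro measurable_compose[OF _ borel_measurable_exp] borel_measurable_add borel_measurable_times borel_measurable_const
      measurable_compose[OF _ borel_measurable_of_real] borel_measurable_divide borel_measurable_power borel_measurable_sum
      measurable_F_mono[OF v(1)] measurable_F_mono[OF D_adapted] measurable_F_mono[OF s_adapted]) auto

lemma xv_meas: "\<xi> \<in> borel_measurable M" "v \<in> borel_measurable M"
  using measurable_F_M[OF \<xi>(1)] measurable_F_M[OF v(1)] .

lemma W_meas: "W n k \<in> borel_measurable M"
  unfolding W_def using xv_meas by measurable

lemma norm_W_le: "k \<le> n \<Longrightarrow> norm (W n k \<omega>) \<le> exp X"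
proof -
  assume k: "k \<le> n"
  have "(v \<omega>)\<^sup>2 * (\<Sum>j=m..<k. s j \<omega>) / (2 * real n) \<le> X"
  proof (cases "n = 0")
    case False
    have "(\<Sum>j=m..<k. s j \<omega>) \<le> (\<Sum>j=m..<k. c)" by (intro sum_mono s_bounds)
    also have "\<dots> \<le> real n * c" using k c_nonneg by (simp add: mult_right_mono)
    finally have "(v \<omega>)\<^sup>2 * (\<Sum>j=m..<k. s j \<omega>) \<le> cv\<^sup>2 * (real n * c)"
      using v_sq[of \<omega>] by (intro mult_mono sum_nonneg s_bounds) auto
    then show ?thesis using False by (simp add: X_def field_simps)
  qed (simp add: X_nonneg)
  then show ?thesis by (simp add: W_def)
qed

lemma W_Suc: "m \<le> k \<Longrightarrow> W n (Suc k) \<omega> = W n k \<omega> *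
    exp (\<i> * of_real (v \<omega> * D (Suc k) \<omega> / sqrt (real n)) + of_real ((v \<omega>)\<^sup>2 * s k \<omega> / (2 * real n)))"
  unfolding W_def by (simp add: exp_add[symmetric] field_simps add_divide_distrib)

text \<open>The factor with \<open>U k\<close> absorbs the coboundary in the conditional variance, so that \<open>W'\<close> is a
  martingale in \<open>k\<close> up to an error that stays small when summed over \<open>k < n\<close>.\<close>

definition W' :: "nat \<Rightarrow> nat \<Rightarrow> 'w \<Rightarrow> complex" where
  "W' n k \<omega> = of_real (\<xi> \<omega>) * (W n k \<omega> * (1 - of_real ((v \<omega>)\<^sup>2 / (2 * real n) * U k \<omega>)))"

text \<open>The error of one step of \<open>W'\<close>: the Taylor remainder for
  \<open>x \<le> X / n\<close> and \<open>y\<close> of the size of the increment divided by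
  \<open>sqrt n\<close>, then the remainder \<open>r\<close> of the variance, then the product of
  the corrector with the deviation of the one-step factor from 1.\<close>

definition remainder_bound :: "nat \<Rightarrow> nat \<Rightarrow> 'w \<Rightarrow> real" where
  "remainder_bound n k \<omega> = exp X * (exp X * ((X / n)\<^sup>2 + X / n * (cv\<^sup>2 / n * (D (Suc k) \<omega>)\<^sup>2)
       + cv powr p * n powr (- p / 2) * \<bar>D (Suc k) \<omega>\<bar> powr p)
     + cv\<^sup>2 / (2 * real n) * \<bar>r (Suc k) \<omega>\<bar>
     + cv\<^sup>2 / (2 * real n) * (exp X * (X / n * \<bar>U (Suc k) \<omega>\<bar>
         + 2 * cv powr \<eta> * n powr (- \<eta> / 2) * (\<bar>D (Suc k) \<omega>\<bar> powr \<eta> * \<bar>U (Suc k) \<omega>\<bar>))))"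

text \<open>Let \<open>E\<close> be the one-step factor of \<open>W\<close> and \<open>q\<close> the
  factor in front of the corrector. The increment of \<open>W'\<close> is \<open>w * (E - 1 - q * (U
  (Suc k) - U k) - q * (E - 1) * U (Suc k))\<close>. Expanding \<open>E - 1\<close> produces
  \<open>q\<close> times the difference of \<open>s k\<close> and the squared increment; together
  with the difference of the correctors this is the centred expression of the hypothesis
  \<open>var\<close>, up to \<open>r\<close>.\<close>

lemma W'_step:
  assumes k: "m \<le> k" "k < n"
  shows "\<exists>R. W' n (Suc k) \<omega> - W' n k \<omega> =
      (of_real (\<xi> \<omega>) * W n k \<omega> * of_real (exp ((v \<omega>)\<^sup>2 * s k \<omega> / (2 * real n))) * \<i> * of_real (v \<omega> / sqrt n)) * of_real (D (Suc k) \<omega>)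
      - (of_real (\<xi> \<omega>) * W n k \<omega> * of_real ((v \<omega>)\<^sup>2 / (2 * real n))) *
          of_real ((D (Suc k) \<omega>)\<^sup>2 - s k \<omega> - U k \<omega> + U (Suc k) \<omega> - r (Suc k) \<omega>) + R
     \<and> norm R \<le> remainder_bound n k \<omega>"
proof -
  have n: "0 < real n" using k by simp
  define y where "y = v \<omega> * D (Suc k) \<omega> / sqrt (real n)"
  define x where "x = (v \<omega>)\<^sup>2 * s k \<omega> / (2 * real n)"
  define q where "q = (v \<omega>)\<^sup>2 / (2 * real n)"
  define E where "E = exp (\<i> * complex_of_real y + of_real x)"
  define w where "w = of_real (\<xi> \<omega>) * W n k \<omega>"
  define err where "err = E - 1 - (of_real (exp x) * \<i> * of_real y + of_real (x - y\<^sup>2 / 2))"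
  define R where "R = w * err - w * of_real (q * r (Suc k) \<omega>) - w * of_real q * (E - 1) * of_real (U (Suc k) \<omega>)"
  have ysq: "y\<^sup>2 / 2 = q * (D (Suc k) \<omega>)\<^sup>2"
    using n by (simp add: y_def q_def power_mult_distrib power_divide)
  have xq: "x = q * s k \<omega>" by (simp add: x_def q_def)
  have x0: "0 \<le> x" using s_bounds[of k \<omega>] by (simp add: x_def)
  have q0: "0 \<le> q" by (simp add: q_def)
  have qle: "q \<le> cv\<^sup>2 / (2 * real n)"
    unfolding q_def using v_sq[of \<omega>] n by (intro divide_right_mono) auto
  have xle: "x \<le> X / n"
  proof -
    have "x \<le> cv\<^sup>2 / (2 * real n) * c"
      unfolding xq using qle q0 s_bounds[of k \<omega>] by (intro mult_mono) auto
    then show ?thesis by (simp add: X_def)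
  qed
  have "X / n \<le> X" using X_nonneg k by (simp add: divide_le_eq mult_le_cancel_left1)
  then have xX: "x \<le> X" using xle by simp
  have wle: "norm w \<le> exp X"
  proof -
    have "norm w = \<xi> \<omega> * norm (W n k \<omega>)" using \<xi>(2)[of \<omega>] by (simp add: w_def norm_mult)
    also have "\<dots> \<le> 1 * exp X" using \<xi>(2,3)[of \<omega>] norm_W_le[of k n \<omega>] k by (intro mult_mono) auto
    finally show ?thesis by simp
  qed
  have yle: "\<bar>y\<bar> powr a \<le> cv powr a * n powr (- a / 2) * \<bar>D (Suc k) \<omega>\<bar> powr a" if "0 \<le> a" for a
  proof -
    have sq: "sqrt (real n) powr a = real n powr (a / 2)"
      using n by (simp add: powr_half_sqrt[symmetric] powr_powr)
    have "\<bar>y\<bar> powr a = \<bar>v \<omega>\<bar> powr a * \<bar>D (Suc k) \<omega>\<bar> powr a / sqrt (real n) powr a"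
      using n by (simp add: y_def abs_mult powr_mult powr_divide)
    also have "\<dots> = \<bar>v \<omega>\<bar> powr a * n powr (- a / 2) * \<bar>D (Suc k) \<omega>\<bar> powr a"
      unfolding sq by (simp add: powr_minus_divide)
    also have "\<dots> \<le> cv powr a * n powr (- a / 2) * \<bar>D (Suc k) \<omega>\<bar> powr a"
      using v(2)[of \<omega>] that by (intro mult_right_mono powr_mono2) auto
    finally show ?thesis .
  qed
  have y2: "y\<^sup>2 \<le> cv\<^sup>2 / n * (D (Suc k) \<omega>)\<^sup>2"
    using n ysq mult_right_mono[OF qle, of "(D (Suc k) \<omega>)\<^sup>2"] by (simp add: field_simps)
  have errle: "norm err \<le> exp X * ((X / n)\<^sup>2 + X / n * (cv\<^sup>2 / n * (D (Suc k) \<omega>)\<^sup>2)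
       + cv powr p * n powr (- p / 2) * \<bar>D (Suc k) \<omega>\<bar> powr p)"
  proof -
    have "norm err \<le> exp X * (x\<^sup>2 + x * y\<^sup>2 + \<bar>y\<bar> powr p)"
      unfolding err_def E_def by (rule norm_exp_compensated[OF x0 xX p])
    also have "\<dots> \<le> exp X * ((X / n)\<^sup>2 + X / n * (cv\<^sup>2 / n * (D (Suc k) \<omega>)\<^sup>2)
       + cv powr p * n powr (- p / 2) * \<bar>D (Suc k) \<omega>\<bar> powr p)"
      using x0 xle y2 yle[of p] p X_nonneg by (intro mult_left_mono add_mono power_mono mult_mono) auto
    finally show ?thesis .
  qed
  have E1le: "norm (E - 1) \<le> exp X * (X / n + 2 * cv powr \<eta> * n powr (- \<eta> / 2) * \<bar>D (Suc k) \<omega>\<bar> powr \<eta>)"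
  proof -
    have "norm (E - 1) \<le> exp X * (x + 2 * \<bar>y\<bar> powr \<eta>)"
      unfolding E_def by (rule norm_exp_complex_minus_one[OF x0 xX \<eta>])
    also have "\<dots> \<le> exp X * (X / n + 2 * (cv powr \<eta> * n powr (- \<eta> / 2) * \<bar>D (Suc k) \<omega>\<bar> powr \<eta>))"
      using xle yle[of \<eta>] \<eta> by (intro mult_left_mono add_mono) auto
    finally show ?thesis by (simp add: mult.assoc)
  qed
  have "norm R \<le> norm (w * err) + norm (w * of_real (q * r (Suc k) \<omega>)) + norm (w * of_real q * (E - 1) * of_real (U (Suc k) \<omega>))"
    unfolding R_def by (meson add_right_mono norm_triangle_ineq4 order_trans)
  also have "\<dots> = norm w * (norm err + q * \<bar>r (Suc k) \<omega>\<bar> + q * (norm (E - 1) * \<bar>U (Suc k) \<omega>\<bar>))"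
    using q0 by (simp add: norm_mult abs_mult distrib_left mult_ac)
  also have "\<dots> \<le> exp X * (exp X * ((X / n)\<^sup>2 + X / n * (cv\<^sup>2 / n * (D (Suc k) \<omega>)\<^sup>2)
       + cv powr p * n powr (- p / 2) * \<bar>D (Suc k) \<omega>\<bar> powr p)
     + cv\<^sup>2 / (2 * real n) * \<bar>r (Suc k) \<omega>\<bar>
     + cv\<^sup>2 / (2 * real n) * ((exp X * (X / n + 2 * cv powr \<eta> * n powr (- \<eta> / 2) * \<bar>D (Suc k) \<omega>\<bar> powr \<eta>)) * \<bar>U (Suc k) \<omega>\<bar>))"
    using q0 X_nonneg by (intro mult_mono add_mono wle errle qle E1le order_refl abs_ge_zero) (auto intro!: mult_nonneg_nonneg add_nonneg_nonneg)
  also have "\<dots> = remainder_bound n k \<omega>"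
    by (simp add: remainder_bound_def algebra_simps)
  finally have Rle: "norm R \<le> remainder_bound n k \<omega>" .
  have "W' n (Suc k) \<omega> - W' n k \<omega> = w * (E - 1 - of_real q * (E - 1) * of_real (U (Suc k) \<omega>) - of_real (q * U (Suc k) \<omega>) + of_real (q * U k \<omega>))"
    unfolding W'_def W_Suc[OF k(1)] w_def E_def x_def y_def q_def by (simp add: algebra_simps)
  also have "E - 1 = of_real (exp x) * \<i> * of_real y + of_real (q * (s k \<omega> - (D (Suc k) \<omega>)\<^sup>2)) + err"
    unfolding err_def ysq xq[symmetric] by (simp add: xq right_diff_distrib)
  finally have 1: "W' n (Suc k) \<omega> - W' n k \<omega> = w * (of_real (exp x) * \<i> * of_real y + of_real (q * (s k \<omega> - (D (Suc k) \<omega>)\<^sup>2)) + err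
     - of_real q * (E - 1) * of_real (U (Suc k) \<omega>) - of_real (q * U (Suc k) \<omega>) + of_real (q * U k \<omega>))"
    by (simp add: err_def ysq xq algebra_simps)
  define G where "G = (D (Suc k) \<omega>)\<^sup>2 - s k \<omega> - U k \<omega> + U (Suc k) \<omega> - r (Suc k) \<omega>"
  have "W' n (Suc k) \<omega> - W' n k \<omega> = w * of_real (exp x) * \<i> * of_real y - w * of_real q * of_real G + R"
    unfolding 1 R_def G_def by (simp add: algebra_simps)
  moreover have "complex_of_real y = of_real (v \<omega> / sqrt n) * of_real (D (Suc k) \<omega>)"
    by (simp add: y_def)
  ultimately have "W' n (Suc k) \<omega> - W' n k \<omega> =
      (w * of_real (exp x) * \<i> * of_real (v \<omega> / sqrt n)) * of_real (D (Suc k) \<omega>) - w * of_real q * of_real G + R"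
    by (simp only: mult.assoc)
  then show ?thesis
    using Rle unfolding w_def x_def q_def G_def by blast
qed

lemma W'_int: "k \<le> n \<Longrightarrow> integrable M (W' n k)"
proof -
  note [measurable] = xv_meas W_meas
  assume k: "k \<le> n"
  have i: "integrable M (\<lambda>\<omega>. exp X * (1 + cv\<^sup>2 / (2 * real n) * \<bar>U k \<omega>\<bar>))"
    using U_int by simp
  show ?thesis
  proof (rule Bochner_Integration.integrable_bound[OF i])
    show "W' n k \<in> borel_measurable M" unfolding W'_def by measurable
    show "AE \<omega> in M. norm (W' n k \<omega>) \<le> norm (exp X * (1 + cv\<^sup>2 / (2 * real n) * \<bar>U k \<omega>\<bar>))"
    proof (rule AE_I2)
      fix \<omega>
      have q: "(v \<omega>)\<^sup>2 / (2 * real n) \<le> cv\<^sup>2 / (2 * real n)"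
        using v_sq[of \<omega>] by (intro divide_right_mono) auto
      have "norm (1 - complex_of_real ((v \<omega>)\<^sup>2 / (2 * real n) * U k \<omega>)) \<le> 1 + (v \<omega>)\<^sup>2 / (2 * real n) * \<bar>U k \<omega>\<bar>"
        by (rule order_trans[OF norm_triangle_ineq4]) (simp add: norm_mult norm_divide norm_power abs_mult)
      also have "\<dots> \<le> 1 + cv\<^sup>2 / (2 * real n) * \<bar>U k \<omega>\<bar>"
        using q by (intro add_left_mono mult_right_mono) auto
      finally have 1: "norm (1 - complex_of_real ((v \<omega>)\<^sup>2 / (2 * real n) * U k \<omega>)) \<le> 1 + cv\<^sup>2 / (2 * real n) * \<bar>U k \<omega>\<bar>" .
      have "norm (W' n k \<omega>) = \<xi> \<omega> * (norm (W n k \<omega>) * norm (1 - complex_of_real ((v \<omega>)\<^sup>2 / (2 * real n) * U k \<omega>)))"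
        using \<xi>(2)[of \<omega>] by (simp add: W'_def norm_mult)
      also have "\<dots> \<le> 1 * (exp X * (1 + cv\<^sup>2 / (2 * real n) * \<bar>U k \<omega>\<bar>))"
        using \<xi>(2,3)[of \<omega>] 1 norm_W_le[OF k, of \<omega>] by (intro mult_mono) auto
      also have "\<dots> \<le> norm (exp X * (1 + cv\<^sup>2 / (2 * real n) * \<bar>U k \<omega>\<bar>))" by simp
      finally show "norm (W' n k \<omega>) \<le> norm (exp X * (1 + cv\<^sup>2 / (2 * real n) * \<bar>U k \<omega>\<bar>))" .
    qed
  qed
qed

text \<open>The expected \<open>remainder_bound\<close> with the moment bounds inserted, apart from
  the term with \<open>r\<close>: that one is not small uniformly in \<open>k\<close>, only on
  average.\<close>

definition step_bound :: "nat \<Rightarrow> real" where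
  "step_bound n = exp X * (exp X * ((X / n)\<^sup>2 + X / n * (cv\<^sup>2 / n * (1 + CD)) + cv powr p * n powr (- p / 2) * CD)
     + cv\<^sup>2 / (2 * real n) * (exp X * (X / n * CU + 2 * cv powr \<eta> * n powr (- \<eta> / 2) * CU)))"

lemma remainder_int: "integrable M (remainder_bound n k)"
  and remainder_le: "(\<integral>\<omega>. remainder_bound n k \<omega> \<partial>M) \<le> step_bound n + exp X * (cv\<^sup>2 / (2 * real n)) * (\<integral>\<omega>. \<bar>r (Suc k) \<omega>\<bar> \<partial>M)"
proof -
  note [simp] = D_sq_int D_int U_int r_int DU_int
  show "integrable M (remainder_bound n k)"
    unfolding remainder_bound_def by simp
  have "(\<integral>\<omega>. remainder_bound n k \<omega> \<partial>M) = exp X * (exp X * ((X / n)\<^sup>2 + X / n * (cv\<^sup>2 / n * (\<integral>\<omega>. (D (Suc k) \<omega>)\<^sup>2 \<partial>M))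
       + cv powr p * n powr (- p / 2) * (\<integral>\<omega>. \<bar>D (Suc k) \<omega>\<bar> powr p \<partial>M))
     + cv\<^sup>2 / (2 * real n) * (\<integral>\<omega>. \<bar>r (Suc k) \<omega>\<bar> \<partial>M)
     + cv\<^sup>2 / (2 * real n) * (exp X * (X / n * (\<integral>\<omega>. \<bar>U (Suc k) \<omega>\<bar> \<partial>M)
         + 2 * cv powr \<eta> * n powr (- \<eta> / 2) * (\<integral>\<omega>. \<bar>D (Suc k) \<omega>\<bar> powr \<eta> * \<bar>U (Suc k) \<omega>\<bar> \<partial>M))))"
    unfolding remainder_bound_def by (simp add: prob_space)
  also have "\<dots> \<le> exp X * (exp X * ((X / n)\<^sup>2 + X / n * (cv\<^sup>2 / n * (1 + CD))
       + cv powr p * n powr (- p / 2) * CD)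
     + cv\<^sup>2 / (2 * real n) * (\<integral>\<omega>. \<bar>r (Suc k) \<omega>\<bar> \<partial>M)
     + cv\<^sup>2 / (2 * real n) * (exp X * (X / n * CU
         + 2 * cv powr \<eta> * n powr (- \<eta> / 2) * CU)))"
    using X_nonneg by (intro mult_left_mono add_mono D_sq_bound D_bound U_bound DU_bound order_refl) auto
  also have "\<dots> = step_bound n + exp X * (cv\<^sup>2 / (2 * real n)) * (\<integral>\<omega>. \<bar>r (Suc k) \<omega>\<bar> \<partial>M)"
    by (simp add: step_bound_def algebra_simps)
  finally show "(\<integral>\<omega>. remainder_bound n k \<omega> \<partial>M) \<le> step_bound n + exp X * (cv\<^sup>2 / (2 * real n)) * (\<integral>\<omega>. \<bar>r (Suc k) \<omega>\<bar> \<partial>M)" .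
qed

lemma bounded_F_mult_int:
  fixes Y :: "'w \<Rightarrow> complex" and g :: "'w \<Rightarrow> real"
  assumes [measurable]: "Y \<in> borel_measurable M" and Y: "\<And>\<omega>. norm (Y \<omega>) \<le> C" and g: "integrable M g"
  shows "integrable M (\<lambda>\<omega>. Y \<omega> * of_real (g \<omega>))"
proof (rule Bochner_Integration.integrable_bound)
  show "integrable M (\<lambda>\<omega>. C * \<bar>g \<omega>\<bar>)" using g by simp
  show "(\<lambda>\<omega>. Y \<omega> * of_real (g \<omega>)) \<in> borel_measurable M" using g by measurable
  show "AE \<omega> in M. norm (Y \<omega> * of_real (g \<omega>)) \<le> norm (C * \<bar>g \<omega>\<bar>)"
    using Y order_trans[OF norm_ge_zero Y] by (auto simp: norm_mult abs_mult intro!: mult_right_mono)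
qed

lemma norm_xi_W_le: "k \<le> n \<Longrightarrow> norm (complex_of_real (\<xi> \<omega>) * W n k \<omega>) \<le> exp X"
  using mult_mono[OF \<xi>(3)[of \<omega>] norm_W_le[of k n \<omega>]] \<xi>(2)[of \<omega>] by (simp add: norm_mult)

text \<open>The two leading terms of the step have bounded multipliers that are known at time
  \<open>k\<close>. They integrate to zero, one by the martingale property and the other by the
  variance hypothesis.\<close>

lemma W'_step_expectation:
  assumes k: "m \<le> k" "k < n"
  shows "norm ((\<integral>\<omega>. W' n (Suc k) \<omega> \<partial>M) - (\<integral>\<omega>. W' n k \<omega> \<partial>M))
    \<le> step_bound n + exp X * (cv\<^sup>2 / (2 * real n)) * (\<integral>\<omega>. \<bar>r (Suc k) \<omega>\<bar> \<partial>M)"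
proof -
  note [measurable] = xv_meas W_meas
  define Y1 where "Y1 \<omega> = of_real (\<xi> \<omega>) * W n k \<omega> * of_real (exp ((v \<omega>)\<^sup>2 * s k \<omega> / (2 * real n))) * \<i> * of_real (v \<omega> / sqrt n)" for \<omega>
  define Y2 where "Y2 \<omega> = of_real (\<xi> \<omega>) * W n k \<omega> * of_real ((v \<omega>)\<^sup>2 / (2 * real n))" for \<omega>
  define G where "G \<omega> = (D (Suc k) \<omega>)\<^sup>2 - s k \<omega> - U k \<omega> + U (Suc k) \<omega> - r (Suc k) \<omega>" for \<omega>
  define R where "R \<omega> = W' n (Suc k) \<omega> - W' n k \<omega> - Y1 \<omega> * of_real (D (Suc k) \<omega>) + Y2 \<omega> * of_real (G \<omega>)" for \<omega>
  have n: "0 < real n" using k by simp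
  have v\<xi>F: "v \<in> borel_measurable (F k)" "\<xi> \<in> borel_measurable (F k)"
    using measurable_F_mono[OF v(1) k(1)] measurable_F_mono[OF \<xi>(1) k(1)] by auto
  have YF: "Y1 \<in> borel_measurable (F k)" "Y2 \<in> borel_measurable (F k)"
    using v\<xi>F W_meas_F[OF k(1), of n] s_adapted[of k] unfolding Y1_def Y2_def by measurable
  have Y1le: "norm (Y1 \<omega>) \<le> exp X * exp X * (cv / sqrt n)" for \<omega>
  proof -
    have "(v \<omega>)\<^sup>2 * s k \<omega> / (2 * real n) \<le> cv\<^sup>2 * c / (2 * real n)"
      using v_sq[of \<omega>] s_bounds[of k \<omega>] n by (intro divide_right_mono mult_mono) auto
    also have "\<dots> = X / n" by (simp add: X_def)
    also have "\<dots> \<le> X" using X_nonneg k by (simp add: divide_le_eq mult_le_cancel_left1)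
    finally have 1: "exp ((v \<omega>)\<^sup>2 * s k \<omega> / (2 * real n)) \<le> exp X" by simp
    have "norm (Y1 \<omega>) = norm (complex_of_real (\<xi> \<omega>) * W n k \<omega>) * exp ((v \<omega>)\<^sup>2 * s k \<omega> / (2 * real n)) * (\<bar>v \<omega>\<bar> / sqrt n)"
      unfolding Y1_def by (simp add: norm_mult norm_divide del: of_real_exp)
    also have "\<dots> \<le> exp X * exp X * (cv / sqrt n)"
      using 1 norm_xi_W_le[of k n \<omega>] k v(2)[of \<omega>] n by (intro mult_mono divide_right_mono) auto
    finally show ?thesis .
  qed
  have Y2le: "norm (Y2 \<omega>) \<le> exp X * (cv\<^sup>2 / (2 * real n))" for \<omega>
  proof -
    have "norm (Y2 \<omega>) = norm (complex_of_real (\<xi> \<omega>) * W n k \<omega>) * ((v \<omega>)\<^sup>2 / (2 * real n))"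
      unfolding Y2_def by (simp add: norm_mult norm_divide norm_power)
    also have "\<dots> \<le> exp X * (cv\<^sup>2 / (2 * real n))"
      using norm_xi_W_le[of k n \<omega>] k v_sq[of \<omega>] n by (intro mult_mono divide_right_mono) auto
    finally show ?thesis .
  qed
  have s_int: "integrable M (s k)"
    using s_bounds by (intro integrable_const_bound[where B=c]) auto
  have G_int: "integrable M G"
    unfolding G_def using D_sq_int[of "Suc k"] s_int U_int r_int by auto
  have i1: "integrable M (\<lambda>\<omega>. Y1 \<omega> * of_real (D (Suc k) \<omega>))"
    by (rule bounded_F_mult_int[OF measurable_F_M[OF YF(1)] Y1le D_int1])
  have i2: "integrable M (\<lambda>\<omega>. Y2 \<omega> * of_real (G \<omega>))"
    by (rule bounded_F_mult_int[OF measurable_F_M[OF YF(2)] Y2le G_int])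
  have z1: "(\<integral>\<omega>. Y1 \<omega> * of_real (D (Suc k) \<omega>) \<partial>M) = 0"
    by (rule integral_mult_subalgebra_zero[OF prob_space_axioms subalg D_int1 mds YF(1) i1])
  have z2: "(\<integral>\<omega>. Y2 \<omega> * of_real (G \<omega>) \<partial>M) = 0"
    using var by (intro integral_mult_subalgebra_zero[OF prob_space_axioms subalg G_int _ YF(2) i2]) (simp add: G_def)
  have Rle: "norm (R \<omega>) \<le> remainder_bound n k \<omega>" for \<omega>
  proof -
    obtain R' where R': "W' n (Suc k) \<omega> - W' n k \<omega> = Y1 \<omega> * of_real (D (Suc k) \<omega>) - Y2 \<omega> * of_real (G \<omega>) + R'" "norm R' \<le> remainder_bound n k \<omega>"
      using W'_step[OF k, of \<omega>] unfolding Y1_def Y2_def G_def by blast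
    then have "R \<omega> = R'" unfolding R_def by simp
    then show ?thesis using R'(2) by simp
  qed
  have w1: "integrable M (W' n (Suc k))" and w2: "integrable M (W' n k)"
    using k by (auto intro!: W'_int)
  have "(\<integral>\<omega>. R \<omega> \<partial>M) = (\<integral>\<omega>. W' n (Suc k) \<omega> \<partial>M) - (\<integral>\<omega>. W' n k \<omega> \<partial>M)"
    unfolding R_def using w1 w2 i1 i2 z1 z2 by simp
  then have "norm ((\<integral>\<omega>. W' n (Suc k) \<omega> \<partial>M) - (\<integral>\<omega>. W' n k \<omega> \<partial>M)) \<le> (\<integral>\<omega>. norm (R \<omega>) \<partial>M)"
    using integral_norm_bound[of M R] by simp
  also have "\<dots> \<le> (\<integral>\<omega>. remainder_bound n k \<omega> \<partial>M)"
    using w1 w2 i1 i2 Rle by (intro integral_mono remainder_int) (auto simp: R_def)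
  finally show ?thesis
    using remainder_le[of n k] by linarith
qed

text \<open>The slowest terms are of order \<open>n powr (1 - p / 2)\<close> and
  \<open>n powr (- \<eta> / 2)\<close>; this is where \<open>p > 2\<close> and
  \<open>\<eta> > 0\<close> enter.\<close>

lemma step_bound_sum: "(\<lambda>n. real n * step_bound n) \<longlonglongrightarrow> 0"
proof -
  have pw: "(\<lambda>n. real n powr a) \<longlonglongrightarrow> 0" if "a < 0" for a
    using that by (intro tendsto_neg_powr filterlim_real_sequentially)
  have "(\<lambda>n. exp X * (exp X * (X\<^sup>2 * (1 / n) + X * cv\<^sup>2 * (1 + CD) * (1 / n) + cv powr p * CD * n powr (1 - p / 2))
     + cv\<^sup>2 / 2 * (exp X * (X * CU * (1 / n) + 2 * cv powr \<eta> * CU * n powr (- \<eta> / 2))))) \<longlonglongrightarrow>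
     exp X * (exp X * (X\<^sup>2 * 0 + X * cv\<^sup>2 * (1 + CD) * 0 + cv powr p * CD * 0)
     + cv\<^sup>2 / 2 * (exp X * (X * CU * 0 + 2 * cv powr \<eta> * CU * 0)))"
    using p \<eta> by (intro tendsto_intros pw lim_1_over_n) auto
  then have lim: "(\<lambda>n. exp X * (exp X * (X\<^sup>2 * (1 / n) + X * cv\<^sup>2 * (1 + CD) * (1 / n) + cv powr p * CD * n powr (1 - p / 2))
     + cv\<^sup>2 / 2 * (exp X * (X * CU * (1 / n) + 2 * cv powr \<eta> * CU * n powr (- \<eta> / 2))))) \<longlonglongrightarrow> 0"
    by simp
  show ?thesis
  proof (rule Lim_transform_eventually[OF lim])
    show "\<forall>\<^sub>F n in sequentially. exp X * (exp X * (X\<^sup>2 * (1 / n) + X * cv\<^sup>2 * (1 + CD) * (1 / n) + cv powr p * CD * n powr (1 - p / 2))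
     + cv\<^sup>2 / 2 * (exp X * (X * CU * (1 / n) + 2 * cv powr \<eta> * CU * n powr (- \<eta> / 2)))) = real n * step_bound n"
      using eventually_gt_at_top[of 0]
    proof eventually_elim
      case (elim n)
      have 1: "n powr (1 - p / 2) = n * n powr (- p / 2)"
        using elim by (simp add: powr_add[symmetric] powr_mult_base)
      have 2: "real n \<noteq> 0" using elim by simp
      show ?case
        unfolding 1 step_bound_def using 2 by (simp add: power2_eq_square field_simps)
    qed
  qed
qed

text \<open>The steps of \<open>W'\<close> are summed from \<open>m\<close>, where \<open>W\<close>
  equals 1, up to \<open>n\<close>. Removing the corrector at the two ends costs terms of order
  \<open>1 / n\<close>.\<close>

lemma W_expectation: "(\<lambda>n. (\<integral>\<omega>. of_real (\<xi> \<omega>) * W n n \<omega> \<partial>M)) \<longlonglongrightarrow> (\<integral>\<omega>. of_real (\<xi> \<omega>) \<partial>M)"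
proof -
  note [measurable] = xv_meas W_meas
  define g where "g n = real n * step_bound n + exp X * (cv\<^sup>2 / 2) * ((\<Sum>k<n. \<integral>\<omega>. \<bar>r (Suc k) \<omega>\<bar> \<partial>M) / n)
    + cv\<^sup>2 * exp X * CU * (1 / n)" for n :: nat
  have "g \<longlonglongrightarrow> 0 + exp X * (cv\<^sup>2 / 2) * 0 + cv\<^sup>2 * exp X * CU * 0"
    unfolding g_def by (intro tendsto_intros step_bound_sum r_small lim_1_over_n)
  then have g0: "g \<longlonglongrightarrow> 0" by simp
  have \<xi>int: "integrable M \<xi>" using \<xi> by (intro integrable_const_bound[where B=1]) auto
  have UW: "norm ((\<integral>\<omega>. of_real (\<xi> \<omega>) * W n k \<omega> \<partial>M) - (\<integral>\<omega>. W' n k \<omega> \<partial>M)) \<le> cv\<^sup>2 / (2 * real n) * (exp X * CU)" if k: "k \<le> n" for n k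
  proof -
    have Wi: "integrable M (\<lambda>\<omega>. of_real (\<xi> \<omega>) * W n k \<omega>)"
      using norm_xi_W_le[OF k] by (intro integrable_const_bound[where B="exp X"]) auto
    have "norm ((\<integral>\<omega>. of_real (\<xi> \<omega>) * W n k \<omega> \<partial>M) - (\<integral>\<omega>. W' n k \<omega> \<partial>M)) = norm (\<integral>\<omega>. of_real (\<xi> \<omega>) * W n k \<omega> - W' n k \<omega> \<partial>M)"
      using Wi W'_int[OF k] by simp
    also have "\<dots> \<le> (\<integral>\<omega>. norm (of_real (\<xi> \<omega>) * W n k \<omega> - W' n k \<omega>) \<partial>M)"
      by (rule integral_norm_bound)
    also have "\<dots> \<le> (\<integral>\<omega>. cv\<^sup>2 / (2 * real n) * (exp X * \<bar>U k \<omega>\<bar>) \<partial>M)"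
    proof (rule integral_mono)
      fix \<omega>
      have "of_real (\<xi> \<omega>) * W n k \<omega> - W' n k \<omega> = of_real (\<xi> \<omega>) * W n k \<omega> * of_real ((v \<omega>)\<^sup>2 / (2 * real n) * U k \<omega>)"
        by (simp add: W'_def algebra_simps)
      also have "norm \<dots> = norm (of_real (\<xi> \<omega>) * W n k \<omega>) * ((v \<omega>)\<^sup>2 / (2 * real n) * \<bar>U k \<omega>\<bar>)"
        by (subst norm_mult, subst norm_of_real) (simp add: abs_mult)
      also have "\<dots> \<le> exp X * (cv\<^sup>2 / (2 * real n) * \<bar>U k \<omega>\<bar>)"
        using norm_xi_W_le[OF k] v_sq[of \<omega>] by (intro mult_mono divide_right_mono) auto
      finally show "norm (of_real (\<xi> \<omega>) * W n k \<omega> - W' n k \<omega>) \<le> cv\<^sup>2 / (2 * real n) * (exp X * \<bar>U k \<omega>\<bar>)"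
        by (simp add: mult_ac)
    qed (use Wi W'_int[OF k] U_int in auto)
    also have "\<dots> \<le> cv\<^sup>2 / (2 * real n) * (exp X * CU)"
      using U_bound[of k] by (simp add: mult_left_mono divide_right_mono)
    finally show ?thesis .
  qed
  have main: "norm ((\<integral>\<omega>. of_real (\<xi> \<omega>) * W n n \<omega> \<partial>M) - (\<integral>\<omega>. of_real (\<xi> \<omega>) \<partial>M)) \<le> g n" if n: "m \<le> n" for n
  proof -
    have "norm ((\<integral>\<omega>. W' n n \<omega> \<partial>M) - (\<integral>\<omega>. W' n m \<omega> \<partial>M)) =
        norm (\<Sum>k=m..<n. (\<integral>\<omega>. W' n (Suc k) \<omega> \<partial>M) - (\<integral>\<omega>. W' n k \<omega> \<partial>M))"
      by (simp only: sum_Suc_diff'[OF n, of "\<lambda>k. \<integral>\<omega>. W' n k \<omega> \<partial>M"])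
    also have "\<dots> \<le> (\<Sum>k=m..<n. step_bound n + exp X * (cv\<^sup>2 / (2 * real n)) * (\<integral>\<omega>. \<bar>r (Suc k) \<omega>\<bar> \<partial>M))"
      by (intro sum_norm_le W'_step_expectation) auto
    also have "\<dots> \<le> (\<Sum>k<n. step_bound n + exp X * (cv\<^sup>2 / (2 * real n)) * (\<integral>\<omega>. \<bar>r (Suc k) \<omega>\<bar> \<partial>M))"
    proof (rule sum_mono2)
      have "0 \<le> step_bound n" unfolding step_bound_def using X_nonneg CD_nonneg CU_nonneg by simp
      then show "0 \<le> step_bound n + exp X * (cv\<^sup>2 / (2 * real n)) * (\<integral>\<omega>. \<bar>r (Suc k) \<omega>\<bar> \<partial>M)" for k by simp
    qed auto
    also have "\<dots> = real n * step_bound n + exp X * (cv\<^sup>2 / 2) * ((\<Sum>k<n. \<integral>\<omega>. \<bar>r (Suc k) \<omega>\<bar> \<partial>M) / n)"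
      by (simp only: sum.distrib sum_distrib_left[symmetric]) simp
    finally have 1: "norm ((\<integral>\<omega>. W' n n \<omega> \<partial>M) - (\<integral>\<omega>. W' n m \<omega> \<partial>M)) \<le> real n * step_bound n + exp X * (cv\<^sup>2 / 2) * ((\<Sum>k<n. \<integral>\<omega>. \<bar>r (Suc k) \<omega>\<bar> \<partial>M) / n)" .
    have Wm: "W n m \<omega> = 1" for \<omega> by (simp add: W_def)
    have 2: "norm ((\<integral>\<omega>. of_real (\<xi> \<omega>) \<partial>M) - (\<integral>\<omega>. W' n m \<omega> \<partial>M)) \<le> cv\<^sup>2 / (2 * real n) * (exp X * CU)"
      using UW[OF n] by (simp add: Wm)
    have 3: "norm ((\<integral>\<omega>. of_real (\<xi> \<omega>) * W n n \<omega> \<partial>M) - (\<integral>\<omega>. W' n n \<omega> \<partial>M)) \<le> cv\<^sup>2 / (2 * real n) * (exp X * CU)"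
      by (rule UW) simp
    define a where "a = (\<integral>\<omega>. of_real (\<xi> \<omega>) * W n n \<omega> \<partial>M)"
    define b where "b = (\<integral>\<omega>. complex_of_real (\<xi> \<omega>) \<partial>M)"
    have "norm (a - b) = norm ((a - (\<integral>\<omega>. W' n n \<omega> \<partial>M)) + ((\<integral>\<omega>. W' n n \<omega> \<partial>M) - (\<integral>\<omega>. W' n m \<omega> \<partial>M)) - (b - (\<integral>\<omega>. W' n m \<omega> \<partial>M)))" by simp
    also have "\<dots> \<le> norm (a - (\<integral>\<omega>. W' n n \<omega> \<partial>M)) + norm ((\<integral>\<omega>. W' n n \<omega> \<partial>M) - (\<integral>\<omega>. W' n m \<omega> \<partial>M)) + norm (b - (\<integral>\<omega>. W' n m \<omega> \<partial>M))"
      by (meson add_right_mono norm_triangle_ineq norm_triangle_ineq4 order_trans)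
    finally have "norm (a - b) \<le> cv\<^sup>2 / (2 * real n) * (exp X * CU) + (real n * step_bound n + exp X * (cv\<^sup>2 / 2) * ((\<Sum>k<n. \<integral>\<omega>. \<bar>r (Suc k) \<omega>\<bar> \<partial>M) / n)) + cv\<^sup>2 / (2 * real n) * (exp X * CU)"
      using 1 2 3 unfolding a_def b_def by linarith
    also have "\<dots> = g n" by (simp add: g_def)
    finally show ?thesis unfolding a_def b_def .
  qed
  have "(\<lambda>n. norm ((\<integral>\<omega>. of_real (\<xi> \<omega>) * W n n \<omega> \<partial>M) - (\<integral>\<omega>. of_real (\<xi> \<omega>) \<partial>M))) \<longlonglongrightarrow> 0"
    using main by (intro tendsto_sandwich[OF _ _ tendsto_const g0]) (auto simp: eventually_sequentially intro!: exI[of _ m])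
  then show ?thesis
    using tendsto_norm_zero_iff LIM_zero_cancel by blast
qed

end

lemma abs_one_minus_exp:
  fixes w X :: real
  assumes "w \<le> X" "0 \<le> X"
  shows "\<bar>exp w - 1\<bar> \<le> \<bar>w\<bar> * exp X"
proof (cases "0 \<le> w")
  case True
  then show ?thesis
    using exp_minus_one_bounds(1)[of w X] assms by (simp add: abs_of_nonneg)
next
  case False
  have "1 + w \<le> exp w" by (rule exp_ge_add_one_self)
  moreover have "\<bar>w\<bar> * 1 \<le> \<bar>w\<bar> * exp X" using assms by (intro mult_left_mono) auto
  moreover have "exp w \<le> 1" using False by simp
  ultimately show ?thesis using False by linarith
qed

lemma norm_iexp_diff: "norm (exp (\<i> * complex_of_real x) - exp (\<i> * of_real y)) \<le> \<bar>x - y\<bar>"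
proof -
  have "exp (\<i> * complex_of_real x) - exp (\<i> * of_real y) = exp (\<i> * of_real y) * (exp (\<i> * of_real (x - y)) - 1)"
    by (simp add: exp_add[symmetric] algebra_simps)
  then show ?thesis
    using norm_iexp_minus_one[of "x - y"] by (simp add: norm_mult)
qed

text \<open>Both limits are replaced by their values at time \<open>m\<close>. The averages of
  \<open>s\<close> converge to \<open>slim\<close>, which is close to \<open>s m\<close>, so the
  weight \<open>\<xi> m\<close> almost cancels the compensator in \<open>W\<close>, and the weighted
  \<open>W\<close> is close to the plain exponential. \<open>W_expectation\<close> gives the limit
  in \<open>n\<close> for fixed \<open>m\<close>; the remaining errors vanish as \<open>m\<close>
  grows.\<close>

theorem mixed_clt:
  assumes u: "\<And>m. u m \<in> borel_measurable (F m)" "\<And>m \<omega>. \<bar>u m \<omega>\<bar> \<le> cu"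
    and ulim [measurable]: "ulim \<in> borel_measurable M" and u_conv: "AE \<omega> in M. (\<lambda>m. u m \<omega>) \<longlonglongrightarrow> ulim \<omega>"
    and slim [measurable]: "slim \<in> borel_measurable M" and s_conv: "AE \<omega> in M. (\<lambda>m. s m \<omega>) \<longlonglongrightarrow> slim \<omega>"
  shows "(\<lambda>n. \<integral>\<omega>. exp (\<i> * complex_of_real (ulim \<omega> * (\<Sum>k<n. D (Suc k) \<omega>) / sqrt (real n))) \<partial>M)
    \<longlonglongrightarrow> (\<integral>\<omega>. complex_of_real (exp (- ((ulim \<omega>)\<^sup>2 * slim \<omega> / 2))) \<partial>M)"
proof -
  define S where "S n \<omega> = (\<Sum>k<n. D (Suc k) \<omega>)" for n \<omega>
  have Sm [measurable]: "S n \<in> borel_measurable M" for n unfolding S_def by measurable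
  have um [measurable]: "u m \<in> borel_measurable M" for m by (rule measurable_F_M[OF u(1)])
  have cu: "0 \<le> cu" using u(2)[of undefined undefined] by linarith
  define XX where "XX = cu\<^sup>2 * c / 2"
  have XX: "0 \<le> XX" using c_nonneg by (simp add: XX_def)
  define \<xi> where "\<xi> m \<omega> = exp (- ((u m \<omega>)\<^sup>2 * s m \<omega> / 2))" for m \<omega>
  define \<xi>l where "\<xi>l \<omega> = exp (- ((ulim \<omega>)\<^sup>2 * slim \<omega> / 2))" for \<omega>
  have \<xi>F: "\<xi> m \<in> borel_measurable (F m)" for m
    unfolding \<xi>_def using u(1)[of m] s_adapted[of m] by measurable
  have \<xi>01: "0 \<le> \<xi> m \<omega>" "\<xi> m \<omega> \<le> 1" for m \<omega>
    unfolding \<xi>_def using s_bounds[of m \<omega>] by auto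
  have [measurable]: "\<xi> m \<in> borel_measurable M" for m by (rule measurable_F_M[OF \<xi>F])
  have [measurable]: "\<xi>l \<in> borel_measurable M" unfolding \<xi>l_def by measurable
  have ae: "AE \<omega> in M. (\<lambda>m. u m \<omega>) \<longlonglongrightarrow> ulim \<omega> \<and> (\<lambda>m. s m \<omega>) \<longlonglongrightarrow> slim \<omega> \<and> \<bar>ulim \<omega>\<bar> \<le> cu \<and> 0 \<le> slim \<omega> \<and> slim \<omega> \<le> c"
    using u_conv s_conv
  proof eventually_elim
    case (elim \<omega>)
    have "\<bar>ulim \<omega>\<bar> \<le> cu"
      using tendsto_rabs[OF elim(1)] u(2) by (intro LIMSEQ_le_const2) auto
    moreover have "0 \<le> slim \<omega>" "slim \<omega> \<le> c"
      using elim(2) s_bounds by (auto intro: LIMSEQ_le_const LIMSEQ_le_const2)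
    ultimately show ?case using elim by simp
  qed
  define \<delta> where "\<delta> m = (\<integral>\<omega>. (ulim \<omega> - u m \<omega>)\<^sup>2 \<partial>M)" for m
  have usq: "AE \<omega> in M. norm ((ulim \<omega> - u m \<omega>)\<^sup>2) \<le> (2 * cu)\<^sup>2" for m
    using ae
  proof eventually_elim
    case (elim \<omega>)
    have "\<bar>ulim \<omega> - u m \<omega>\<bar> \<le> 2 * cu" using elim u(2)[of m \<omega>] by linarith
    then show ?case using power_mono[of "\<bar>ulim \<omega> - u m \<omega>\<bar>" "2 * cu" 2] by simp
  qed
  have \<delta>int: "integrable M (\<lambda>\<omega>. (ulim \<omega> - u m \<omega>)\<^sup>2)" for m
    by (rule integrable_const_bound[OF usq]) measurable
  have "\<delta> \<longlonglongrightarrow> (\<integral>\<omega>. 0 \<partial>M)"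
    unfolding \<delta>_def
  proof (rule integral_dominated_convergence[where w="\<lambda>_. (2 * cu)\<^sup>2"])
    show "AE \<omega> in M. (\<lambda>m. (ulim \<omega> - u m \<omega>)\<^sup>2) \<longlonglongrightarrow> 0"
      using ae
    proof eventually_elim
      case (elim \<omega>)
      then have "(\<lambda>m. (ulim \<omega> - u m \<omega>)\<^sup>2) \<longlonglongrightarrow> (ulim \<omega> - ulim \<omega>)\<^sup>2" by (intro tendsto_intros) auto
      then show ?case by simp
    qed
  qed (use usq in auto)
  then have \<delta>0: "\<delta> \<longlonglongrightarrow> 0" by simp
  have \<delta>nn: "0 \<le> \<delta> m" for m by (simp add: \<delta>_def)
  \<comment> \<open>The root of the mean square distance balances the two summands of the estimate
    \<open>p1\<close> below. The summand \<open>1 / Suc m\<close> keeps \<open>t m\<close> positive,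
    since it occurs as a divisor.\<close>
  define t where "t m = sqrt (\<delta> m) + 1 / real (Suc m)" for m
  have t: "0 < t m" "\<delta> m \<le> (t m)\<^sup>2" for m
  proof -
    show "0 < t m" using \<delta>nn[of m] by (simp add: t_def add_nonneg_pos)
    have "(sqrt (\<delta> m))\<^sup>2 \<le> (t m)\<^sup>2" using \<delta>nn[of m] by (intro power_mono) (auto simp: t_def)
    then show "\<delta> m \<le> (t m)\<^sup>2" using \<delta>nn[of m] by simp
  qed
  have "t \<longlonglongrightarrow> sqrt 0 + 0"
    unfolding t_def by (intro tendsto_intros \<delta>0 LIMSEQ_inverse_real_of_nat[unfolded inverse_eq_divide])
  then have t0: "t \<longlonglongrightarrow> 0" by simp
  have sdiff: "AE \<omega> in M. norm \<bar>slim \<omega> - s m \<omega>\<bar> \<le> c" for m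
    using ae
  proof eventually_elim
    case (elim \<omega>) then show ?case using s_bounds[of m \<omega>] by auto
  qed
  have s0: "(\<lambda>m. \<integral>\<omega>. \<bar>slim \<omega> - s m \<omega>\<bar> \<partial>M) \<longlonglongrightarrow> 0"
  proof -
    have "(\<lambda>m. \<integral>\<omega>. \<bar>slim \<omega> - s m \<omega>\<bar> \<partial>M) \<longlonglongrightarrow> (\<integral>\<omega>. 0 \<partial>M)"
    proof (rule integral_dominated_convergence[where w="\<lambda>_. c"])
      show "AE \<omega> in M. (\<lambda>m. \<bar>slim \<omega> - s m \<omega>\<bar>) \<longlonglongrightarrow> 0"
        using ae
      proof eventually_elim
        case (elim \<omega>)
        then have "(\<lambda>m. \<bar>slim \<omega> - s m \<omega>\<bar>) \<longlonglongrightarrow> \<bar>slim \<omega> - slim \<omega>\<bar>" by (intro tendsto_intros) auto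
        then show ?case by simp
      qed
    qed (use sdiff in auto)
    then show ?thesis by simp
  qed
  have \<xi>l1: "AE \<omega> in M. 0 \<le> \<xi>l \<omega> \<and> \<xi>l \<omega> \<le> 1"
    using ae by eventually_elim (auto simp: \<xi>l_def)
  have \<xi>diff: "AE \<omega> in M. norm \<bar>\<xi> m \<omega> - \<xi>l \<omega>\<bar> \<le> 1" for m
    using \<xi>l1
  proof eventually_elim
    case (elim \<omega>) then show ?case using \<xi>01[of m \<omega>] by auto
  qed
  have \<xi>0: "(\<lambda>m. \<integral>\<omega>. \<bar>\<xi> m \<omega> - \<xi>l \<omega>\<bar> \<partial>M) \<longlonglongrightarrow> 0"
  proof -
    have "(\<lambda>m. \<integral>\<omega>. \<bar>\<xi> m \<omega> - \<xi>l \<omega>\<bar> \<partial>M) \<longlonglongrightarrow> (\<integral>\<omega>. 0 \<partial>M)"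
    proof (rule integral_dominated_convergence[where w="\<lambda>_. 1"])
      show "AE \<omega> in M. (\<lambda>m. \<bar>\<xi> m \<omega> - \<xi>l \<omega>\<bar>) \<longlonglongrightarrow> 0"
        using ae
      proof eventually_elim
        case (elim \<omega>)
        then have "(\<lambda>m. \<bar>\<xi> m \<omega> - \<xi>l \<omega>\<bar>) \<longlonglongrightarrow> \<bar>\<xi>l \<omega> - \<xi>l \<omega>\<bar>" unfolding \<xi>_def \<xi>l_def by (intro tendsto_intros) auto
        then show ?case by simp
      qed
    qed (use \<xi>diff in auto)
    then show ?thesis by simp
  qed
  define K where "K = exp XX * (cu\<^sup>2 / 2)"
  have K: "0 \<le> K" by (simp add: K_def)
  \<comment> \<open>The sum starts at \<open>m\<close> but is divided by \<open>n\<close>; the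
    missing head contributes a term of order \<open>1 / n\<close>.\<close>
  define av where "av m n \<omega> = (\<Sum>j=m..<n. s j \<omega>) / real n" for m n \<omega>
  have av01: "0 \<le> av m n \<omega>" "av m n \<omega> \<le> c" for m n \<omega>
  proof -
    show "0 \<le> av m n \<omega>" unfolding av_def by (intro divide_nonneg_nonneg sum_nonneg s_bounds) auto
    have "(\<Sum>j=m..<n. s j \<omega>) \<le> (\<Sum>j=m..<n. c)" by (intro sum_mono s_bounds)
    also have "\<dots> \<le> real n * c" using c_nonneg by (simp add: mult_right_mono)
    finally show "av m n \<omega> \<le> c" unfolding av_def using c_nonneg by (cases "n = 0") (simp_all add: pos_divide_le_eq mult.commute)
  qed
  have [measurable]: "av m n \<in> borel_measurable M" for m n unfolding av_def by measurable
  have avdiff: "AE \<omega> in M. norm \<bar>av m n \<omega> - slim \<omega>\<bar> \<le> c" for m n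
    using ae
  proof eventually_elim
    case (elim \<omega>) then show ?case using av01[of m n \<omega>] by auto
  qed
  have av0: "(\<lambda>n. \<integral>\<omega>. \<bar>av m n \<omega> - slim \<omega>\<bar> \<partial>M) \<longlonglongrightarrow> 0" for m
  proof -
    have "(\<lambda>n. \<integral>\<omega>. \<bar>av m n \<omega> - slim \<omega>\<bar> \<partial>M) \<longlonglongrightarrow> (\<integral>\<omega>. 0 \<partial>M)"
    proof (rule integral_dominated_convergence[where w="\<lambda>_. c"])
      show "AE \<omega> in M. (\<lambda>n. \<bar>av m n \<omega> - slim \<omega>\<bar>) \<longlonglongrightarrow> 0"
        using ae
      proof eventually_elim
        case (elim \<omega>)
        have "(\<lambda>n. (\<Sum>j<n. s j \<omega>) / real n - (\<Sum>j<m. s j \<omega>) * (1 / real n)) \<longlonglongrightarrow> slim \<omega> - (\<Sum>j<m. s j \<omega>) * 0"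
          using elim by (intro tendsto_intros LIMSEQ_average lim_1_over_n) auto
        then have "(\<lambda>n. (\<Sum>j<n. s j \<omega>) / real n - (\<Sum>j<m. s j \<omega>) * (1 / real n)) \<longlonglongrightarrow> slim \<omega>" by simp
        moreover have "\<forall>\<^sub>F n in sequentially. (\<Sum>j<n. s j \<omega>) / real n - (\<Sum>j<m. s j \<omega>) * (1 / real n) = av m n \<omega>"
          using eventually_ge_at_top[of m]
        proof eventually_elim
          case (elim n)
          have "(\<Sum>j<n. s j \<omega>) = (\<Sum>j<m. s j \<omega>) + (\<Sum>j=m..<n. s j \<omega>)"
            using elim by (simp add: lessThan_atLeast0 sum.atLeastLessThan_concat)
          then show ?case by (simp add: av_def add_divide_distrib)
        qed
        ultimately have "(\<lambda>n. av m n \<omega>) \<longlonglongrightarrow> slim \<omega>" by (rule Lim_transform_eventually)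
        then have "(\<lambda>n. \<bar>av m n \<omega> - slim \<omega>\<bar>) \<longlonglongrightarrow> \<bar>slim \<omega> - slim \<omega>\<bar>" by (intro tendsto_intros)
        then show ?case by simp
      qed
    qed (use avdiff in auto)
    then show ?thesis by simp
  qed
  have S_int: "integrable M (S m)" for m
    unfolding S_def using D_int1 by simp
  define E1 where "E1 n = (\<integral>\<omega>. exp (\<i> * complex_of_real (ulim \<omega> * S n \<omega> / sqrt (real n))) \<partial>M)" for n
  define E2 where "E2 = (\<integral>\<omega>. complex_of_real (\<xi>l \<omega>) \<partial>M)"
  define w where "w m n = norm ((\<integral>\<omega>. of_real (\<xi> m \<omega>) * W m (u m) n n \<omega> \<partial>M) - (\<integral>\<omega>. complex_of_real (\<xi> m \<omega>) \<partial>M))" for m n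
  \<comment> \<open>\<open>a m\<close> collects the errors that are uniform in \<open>n\<close>, and
    \<open>b m n\<close> those that vanish for fixed \<open>m\<close> as \<open>n\<close>
    grows.\<close>
  define a where "a m = t m / 2 * (2 + CD) + K * (\<integral>\<omega>. \<bar>slim \<omega> - s m \<omega>\<bar> \<partial>M) + (\<integral>\<omega>. \<bar>\<xi> m \<omega> - \<xi>l \<omega>\<bar> \<partial>M)" for m
  define b where "b m n = cu * (\<integral>\<omega>. \<bar>S m \<omega>\<bar> \<partial>M) * (1 / sqrt (real n)) + K * (\<integral>\<omega>. \<bar>av m n \<omega> - slim \<omega>\<bar> \<partial>M) + w m n" for m n
  have a0: "a \<longlonglongrightarrow> 0"
  proof -
    have "a \<longlonglongrightarrow> 0 / 2 * (2 + CD) + K * 0 + 0"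
      unfolding a_def by (intro tendsto_intros t0 s0 \<xi>0) auto
    then show ?thesis by simp
  qed
  have b0: "b m \<longlonglongrightarrow> 0" for m
  proof -
    have "w m \<longlonglongrightarrow> 0"
      unfolding w_def using W_expectation[OF u(1)[of m] u(2)[of m] \<xi>F[of m] \<xi>01(1)[of m] \<xi>01(2)[of m]]
      by (intro tendsto_norm_zero LIM_zero)
    moreover have "(\<lambda>n. 1 / sqrt (real n)) \<longlonglongrightarrow> 0"
      by (intro tendsto_divide_0[OF tendsto_const] filterlim_at_top_imp_at_infinity
          filterlim_compose[OF sqrt_at_top filterlim_real_sequentially])
    ultimately have "b m \<longlonglongrightarrow> cu * (\<integral>\<omega>. \<bar>S m \<omega>\<bar> \<partial>M) * 0 + K * 0 + 0"
      unfolding b_def by (intro tendsto_intros av0)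
    then show ?thesis by simp
  qed
  have main: "norm (E1 n - E2) \<le> a m + b m n" if n: "m \<le> n" "0 < n" for m n
  proof -
    have Wm: "W m (u m) n n \<in> borel_measurable M"
      by (rule W_meas[OF u(1)[of m] u(2)[of m] \<xi>F[of m] \<xi>01(1)[of m] \<xi>01(2)[of m]])
    note [measurable] = Wm
    have Wle: "norm (of_real (\<xi> m \<omega>) * W m (u m) n n \<omega>) \<le> exp XX" for \<omega>
      using norm_xi_W_le[OF u(1)[of m] u(2)[of m] \<xi>F[of m] \<xi>01(1)[of m] \<xi>01(2)[of m], of n n \<omega>]
      unfolding X_def[OF u(1)[of m] u(2)[of m] \<xi>F[of m] \<xi>01(1)[of m] \<xi>01(2)[of m]] XX_def by simp
    have Wi: "integrable M (\<lambda>\<omega>. of_real (\<xi> m \<omega>) * W m (u m) n n \<omega>)"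
      using Wle by (intro integrable_const_bound[where B="exp XX"]) auto
    define e1 where "e1 \<omega> = exp (\<i> * complex_of_real (ulim \<omega> * S n \<omega> / sqrt (real n)))" for \<omega>
    define e2 where "e2 \<omega> = exp (\<i> * complex_of_real (u m \<omega> * S n \<omega> / sqrt (real n)))" for \<omega>
    define e3 where "e3 \<omega> = of_real (\<xi> m \<omega>) * W m (u m) n n \<omega>" for \<omega>
    have e12: "integrable M e1" "integrable M e2" unfolding e1_def e2_def
      by (intro integrable_const_bound[where B=1], simp, measurable)+
    have e3: "integrable M e3" unfolding e3_def by (rule Wi)
    have \<xi>i: "integrable M (\<xi> m)" using \<xi>01[of m] by (intro integrable_const_bound[where B=1]) auto
    have \<xi>li: "integrable M \<xi>l" using \<xi>l1 by (intro integrable_const_bound[where B=1]) auto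
    have p1: "norm (e1 \<omega> - e2 \<omega>) \<le> t m / 2 * ((S n \<omega>)\<^sup>2 / n) + (ulim \<omega> - u m \<omega>)\<^sup>2 / (2 * t m)" for \<omega>
    proof -
      have "norm (e1 \<omega> - e2 \<omega>) \<le> \<bar>ulim \<omega> * S n \<omega> / sqrt (real n) - u m \<omega> * S n \<omega> / sqrt (real n)\<bar>"
        unfolding e1_def e2_def by (rule norm_iexp_diff)
      also have "\<dots> = \<bar>ulim \<omega> - u m \<omega>\<bar> * \<bar>S n \<omega> / sqrt n\<bar>"
        by (simp only: abs_mult[symmetric] left_diff_distrib times_divide_eq_right diff_divide_distrib)
      \<comment> \<open>A weighted inequality between arithmetic and geometric mean: it separates
        the normalised sum, whose second moment is bounded in \<open>n\<close>, from the
        approximation error of the multiplier.\<close>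
      also have "\<dots> \<le> t m / 2 * (S n \<omega> / sqrt n)\<^sup>2 + (ulim \<omega> - u m \<omega>)\<^sup>2 / (2 * t m)"
      proof -
        define p q where "p = \<bar>ulim \<omega> - u m \<omega>\<bar>" and "q = \<bar>S n \<omega> / sqrt n\<bar>"
        have "0 \<le> (p - t m * q)\<^sup>2" by simp
        then have "2 * t m * (p * q) \<le> (t m * q)\<^sup>2 + p\<^sup>2"
          by (simp add: power2_eq_square algebra_simps)
        then have "p * q \<le> ((t m * q)\<^sup>2 + p\<^sup>2) / (2 * t m)"
          using t(1)[of m] by (simp add: pos_le_divide_eq mult_ac)
        also have "\<dots> = t m / 2 * q\<^sup>2 + p\<^sup>2 / (2 * t m)"
          using t(1)[of m] by (simp add: field_simps power2_eq_square)
        finally show ?thesis unfolding p_def q_def by (simp only: power2_abs)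
      qed
      also have "(S n \<omega> / sqrt n)\<^sup>2 = (S n \<omega>)\<^sup>2 / n" by (simp add: power_divide)
      finally show ?thesis .
    qed
    have i1: "(\<integral>\<omega>. norm (e1 \<omega> - e2 \<omega>) \<partial>M) \<le> t m / 2 * (2 + CD)"
    proof -
      have Sint: "integrable M (\<lambda>\<omega>. (S n \<omega>)\<^sup>2)" and Sle: "(\<integral>\<omega>. (S n \<omega>)\<^sup>2 \<partial>M) \<le> real n * (1 + CD)"
        using partial_sum_sq[of n] by (auto simp: S_def)
      have "(\<integral>\<omega>. norm (e1 \<omega> - e2 \<omega>) \<partial>M) \<le> (\<integral>\<omega>. t m / 2 * ((S n \<omega>)\<^sup>2 / n) + (ulim \<omega> - u m \<omega>)\<^sup>2 / (2 * t m) \<partial>M)"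
        using e12 Sint \<delta>int[of m] p1 by (intro integral_mono) auto
      also have "\<dots> = t m / 2 * ((\<integral>\<omega>. (S n \<omega>)\<^sup>2 \<partial>M) / n) + \<delta> m / (2 * t m)"
        using Sint \<delta>int[of m] by (simp add: \<delta>_def)
      also have "\<dots> \<le> t m / 2 * (1 + CD) + t m / 2"
      proof (rule add_mono)
        show "t m / 2 * ((\<integral>\<omega>. (S n \<omega>)\<^sup>2 \<partial>M) / n) \<le> t m / 2 * (1 + CD)"
          using Sle n t(1)[of m] by (intro mult_left_mono) (auto simp: divide_le_eq mult.commute)
        show "\<delta> m / (2 * t m) \<le> t m / 2"
          using t[of m] by (simp add: divide_le_eq power2_eq_square)
      qed
      also have "\<dots> = t m / 2 * (2 + CD)" by (simp add: field_simps)
      finally show ?thesis .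
    qed
    have p2: "norm (e2 \<omega> - e3 \<omega>) \<le> cu * \<bar>S m \<omega>\<bar> * (1 / sqrt n) + K * \<bar>av m n \<omega> - s m \<omega>\<bar>" for \<omega>
    proof -
      define y where "y = u m \<omega> * (\<Sum>j=m..<n. D (Suc j) \<omega>) / sqrt n"
      define z where "z = u m \<omega> * S m \<omega> / sqrt n"
      \<comment> \<open>The exponent that is left when the weight \<open>\<xi> m\<close> meets the
        compensator of \<open>W\<close>.\<close>
      define q where "q = (u m \<omega>)\<^sup>2 / 2 * (av m n \<omega> - s m \<omega>)"
      have "S n \<omega> = S m \<omega> + (\<Sum>j=m..<n. D (Suc j) \<omega>)"
        unfolding S_def using n by (simp add: lessThan_atLeast0 sum.atLeastLessThan_concat)
      then have "u m \<omega> * S n \<omega> / sqrt n = y + z"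
        by (simp add: y_def z_def algebra_simps add_divide_distrib)
      then have e2': "e2 \<omega> = exp (\<i> * of_real y) * exp (\<i> * of_real z)"
        unfolding e2_def by (simp add: exp_add[symmetric] distrib_left)
      have "(u m \<omega>)\<^sup>2 * (\<Sum>j=m..<n. s j \<omega>) / (2 * real n) = (u m \<omega>)\<^sup>2 / 2 * av m n \<omega>"
        by (simp add: av_def)
      then have "W m (u m) n n \<omega> = exp (\<i> * of_real y) * of_real (exp ((u m \<omega>)\<^sup>2 / 2 * av m n \<omega>))"
        unfolding W_def[OF u(1)[of m] u(2)[of m] \<xi>F[of m] \<xi>01(1)[of m] \<xi>01(2)[of m]] y_def
        by (simp only: exp_add exp_of_real)
      then have e3': "e3 \<omega> = exp (\<i> * of_real y) * of_real (exp q)"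
      proof -
        have "\<xi> m \<omega> * exp ((u m \<omega>)\<^sup>2 / 2 * av m n \<omega>) = exp q"
          unfolding \<xi>_def q_def by (simp add: exp_add[symmetric] algebra_simps)
        then have "complex_of_real (\<xi> m \<omega>) * of_real (exp ((u m \<omega>)\<^sup>2 / 2 * av m n \<omega>)) = of_real (exp q)"
          by (simp only: of_real_mult[symmetric])
        then show ?thesis
          unfolding e3_def \<open>W m (u m) n n \<omega> = _\<close> by (subst mult.left_commute) (simp only:)
      qed
      have "e2 \<omega> - e3 \<omega> = exp (\<i> * of_real y) * ((exp (\<i> * of_real z) - 1) - of_real (exp q - 1))"
        unfolding e2' e3' by (simp add: algebra_simps)
      then have "norm (e2 \<omega> - e3 \<omega>) = norm ((exp (\<i> * of_real z) - 1) - of_real (exp q - 1))"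
        by (simp only: norm_mult norm_exp_i_times)
      also have "\<dots> \<le> norm (exp (\<i> * complex_of_real z) - 1) + norm (complex_of_real (exp q - 1))"
        by (rule norm_triangle_ineq4)
      also have "\<dots> \<le> \<bar>z\<bar> + \<bar>exp q - 1\<bar>"
        using norm_iexp_minus_one[of z] by (subst norm_of_real) simp
      also have "\<bar>exp q - 1\<bar> \<le> \<bar>q\<bar> * exp XX"
      proof (rule abs_one_minus_exp)
        have "q \<le> (u m \<omega>)\<^sup>2 / 2 * c"
          unfolding q_def using av01[of m n \<omega>] s_bounds[of m \<omega>] by (intro mult_left_mono) auto
        also have "\<dots> \<le> cu\<^sup>2 / 2 * c"
          using u(2)[of m \<omega>] c_nonneg cu by (intro mult_right_mono divide_right_mono) (auto simp: abs_le_square_iff[symmetric])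
        finally show "q \<le> XX" by (simp add: XX_def)
      qed (rule XX)
      also have "\<bar>z\<bar> \<le> cu * \<bar>S m \<omega>\<bar> * (1 / sqrt n)"
        unfolding z_def using u(2)[of m \<omega>] by (auto simp: abs_mult intro!: mult_right_mono divide_right_mono)
      also have "\<bar>q\<bar> * exp XX \<le> K * \<bar>av m n \<omega> - s m \<omega>\<bar>"
      proof -
        have "\<bar>q\<bar> \<le> cu\<^sup>2 / 2 * \<bar>av m n \<omega> - s m \<omega>\<bar>"
          unfolding q_def abs_mult using u(2)[of m \<omega>] cu
          by (intro mult_right_mono) (auto simp: abs_le_square_iff[symmetric])
        then show ?thesis unfolding K_def by (simp add: mult_ac)
      qed
      finally show ?thesis by simp
    qed
    have avl: "integrable M (\<lambda>\<omega>. \<bar>av m n \<omega> - slim \<omega>\<bar>)"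
      by (rule integrable_const_bound[OF avdiff]) measurable
    have sl: "integrable M (\<lambda>\<omega>. \<bar>slim \<omega> - s m \<omega>\<bar>)"
      by (rule integrable_const_bound[OF sdiff]) measurable
    have i2: "(\<integral>\<omega>. norm (e2 \<omega> - e3 \<omega>) \<partial>M) \<le> cu * (\<integral>\<omega>. \<bar>S m \<omega>\<bar> \<partial>M) * (1 / sqrt n)
        + K * ((\<integral>\<omega>. \<bar>av m n \<omega> - slim \<omega>\<bar> \<partial>M) + (\<integral>\<omega>. \<bar>slim \<omega> - s m \<omega>\<bar> \<partial>M))"
    proof -
      have "(\<integral>\<omega>. norm (e2 \<omega> - e3 \<omega>) \<partial>M) \<le> (\<integral>\<omega>. cu * \<bar>S m \<omega>\<bar> * (1 / sqrt n) + K * (\<bar>av m n \<omega> - slim \<omega>\<bar> + \<bar>slim \<omega> - s m \<omega>\<bar>) \<partial>M)"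
      proof (rule integral_mono)
        fix \<omega>
        have "K * \<bar>av m n \<omega> - s m \<omega>\<bar> \<le> K * (\<bar>av m n \<omega> - slim \<omega>\<bar> + \<bar>slim \<omega> - s m \<omega>\<bar>)"
          using K by (intro mult_left_mono) auto
        then show "norm (e2 \<omega> - e3 \<omega>) \<le> cu * \<bar>S m \<omega>\<bar> * (1 / sqrt n) + K * (\<bar>av m n \<omega> - slim \<omega>\<bar> + \<bar>slim \<omega> - s m \<omega>\<bar>)"
          using p2[of \<omega>] by linarith
      qed (use e12 e3 S_int[of m] avl sl in auto)
      then show ?thesis using S_int[of m] avl sl by simp
    qed
    have i4: "norm ((\<integral>\<omega>. complex_of_real (\<xi> m \<omega>) \<partial>M) - E2) \<le> (\<integral>\<omega>. \<bar>\<xi> m \<omega> - \<xi>l \<omega>\<bar> \<partial>M)"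
    proof -
      have "(\<integral>\<omega>. complex_of_real (\<xi> m \<omega>) \<partial>M) - E2 = complex_of_real (\<integral>\<omega>. \<xi> m \<omega> - \<xi>l \<omega> \<partial>M)"
        unfolding E2_def using \<xi>i \<xi>li by simp
      then show ?thesis by (simp only: norm_of_real) (rule integral_abs_bound)
    qed
    have n12: "norm (E1 n - (\<integral>\<omega>. e2 \<omega> \<partial>M)) \<le> t m / 2 * (2 + CD)"
      using integral_norm_bound[of M "\<lambda>\<omega>. e1 \<omega> - e2 \<omega>"] e12 i1 unfolding E1_def e1_def[symmetric] by simp
    have n23: "norm ((\<integral>\<omega>. e2 \<omega> \<partial>M) - (\<integral>\<omega>. e3 \<omega> \<partial>M)) \<le> cu * (\<integral>\<omega>. \<bar>S m \<omega>\<bar> \<partial>M) * (1 / sqrt n)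
        + K * ((\<integral>\<omega>. \<bar>av m n \<omega> - slim \<omega>\<bar> \<partial>M) + (\<integral>\<omega>. \<bar>slim \<omega> - s m \<omega>\<bar> \<partial>M))"
      using integral_norm_bound[of M "\<lambda>\<omega>. e2 \<omega> - e3 \<omega>"] e12 e3 i2 by simp
    have n34: "norm ((\<integral>\<omega>. e3 \<omega> \<partial>M) - (\<integral>\<omega>. complex_of_real (\<xi> m \<omega>) \<partial>M)) = w m n"
      by (simp add: w_def e3_def)
    define c1 c2 c3 where "c1 = (\<integral>\<omega>. e2 \<omega> \<partial>M)" and "c2 = (\<integral>\<omega>. e3 \<omega> \<partial>M)" and "c3 = (\<integral>\<omega>. complex_of_real (\<xi> m \<omega>) \<partial>M)"
    have "norm (E1 n - E2) \<le> norm (E1 n - c1) + norm (c1 - c2) + norm (c2 - c3) + norm (c3 - E2)"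
      using norm_triangle_ineq[of "E1 n - c1" "c1 - E2"] norm_triangle_ineq[of "c1 - c2" "c2 - E2"] norm_triangle_ineq[of "c2 - c3" "c3 - E2"]
      by simp
    then show ?thesis
      using n12 n23 n34 i4 by (simp add: c1_def c2_def c3_def a_def b_def distrib_left)
  qed
  have "(\<lambda>n. E1 n - E2) \<longlonglongrightarrow> 0"
  proof (rule LIMSEQ_I)
    fix e :: real assume e: "0 < e"
    from order_tendstoD(2)[OF a0, of "e / 2"] e obtain m where m: "a m < e / 2"
      using eventually_happens by fastforce
    from order_tendstoD(2)[OF b0[of m], of "e / 2"] e have "eventually (\<lambda>n. b m n < e / 2) sequentially" by simp
    then have "eventually (\<lambda>n. norm (E1 n - E2 - 0) < e) sequentially"
      using eventually_ge_at_top[of m] eventually_gt_at_top[of 0]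
    proof eventually_elim
      case (elim n)
      then show ?case using main[of m n] m by simp
    qed
    then show "\<exists>no. \<forall>n\<ge>no. norm (E1 n - E2 - 0) < e" by (simp add: eventually_sequentially)
  qed
  then show ?thesis
    unfolding E1_def E2_def S_def \<xi>l_def by (rule LIM_zero_cancel)
qed

end

section \<open>The chain with reprojections\<close>

text \<open>A pullback: the events of time \<open>k\<close> are then literally preimages of
  measurable sets of histories, which is the form of the Markov property in
  \<open>markov_chain\<close>.\<close>

definition chain_filtration :: "'w measure \<Rightarrow> 's measure \<Rightarrow> (nat \<Rightarrow> 'w \<Rightarrow> 's) \<Rightarrow> nat \<Rightarrow> 'w measure" where
  "chain_filtration M S Z k = vimage_algebra (space M) (\<lambda>\<omega>. \<lambda>i\<in>{..k}. Z i \<omega>) (PiM {..k} (\<lambda>_. S))"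

section \<open>The Markov property relative to events of the past\<close>

locale markov_process =
  fixes M :: "'w measure" and St :: "'s measure" and R :: "'s \<Rightarrow> 's measure" and z\<^sub>0 :: 's and Z :: "nat \<Rightarrow> 'w \<Rightarrow> 's"
  assumes chain: "markov_chain M St R z\<^sub>0 Z"
begin

sublocale prob_space M
  using chain by (simp add: markov_chain_def)

lemma R_kernel: "markov_kernel St R"
  using chain by (simp add: markov_chain_def)

lemma Z_meas [measurable]: "Z n \<in> measurable M St"
  using chain by (simp add: markov_chain_def)

lemma Z_space: "\<omega> \<in> space M \<Longrightarrow> Z n \<omega> \<in> space St"
  using measurable_space[OF Z_meas] .

definition F :: "nat \<Rightarrow> 'w measure" where "F = chain_filtration M St Z"

lemma history_meas: "(\<lambda>\<omega>. \<lambda>i\<in>{..k}. Z i \<omega>) \<in> measurable M (PiM {..k} (\<lambda>_. St))"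
  by (intro measurable_restrict) simp

lemma space_F: "space (F k) = space M"
  by (simp add: F_def chain_filtration_def)

lemma sets_F: "sets (F k) = {(\<lambda>\<omega>. \<lambda>i\<in>{..k}. Z i \<omega>) -` B \<inter> space M | B. B \<in> sets (PiM {..k} (\<lambda>_. St))}"
  unfolding F_def chain_filtration_def
  by (rule sets_vimage_algebra2) (use measurable_space[OF history_meas] in auto)

lemma F_subalgebra: "subalgebra M (F k)"
  unfolding subalgebra_def space_F sets_F using measurable_sets[OF history_meas] by auto

lemma Z_meas_F: "j \<le> k \<Longrightarrow> Z j \<in> measurable (F k) St"
proof -
  assume j: "j \<le> k"
  have "(\<lambda>\<omega>. \<lambda>i\<in>{..k}. Z i \<omega>) \<in> measurable (F k) (PiM {..k} (\<lambda>_. St))"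
    unfolding F_def chain_filtration_def
    by (rule measurable_vimage_algebra1) (use measurable_space[OF history_meas] in auto)
  moreover have "(\<lambda>p. p j) \<in> measurable (PiM {..k} (\<lambda>_. St)) St"
    using j by (intro measurable_component_singleton) auto
  ultimately have "(\<lambda>\<omega>. (\<lambda>i\<in>{..k}. Z i \<omega>) j) \<in> measurable (F k) St"
    by (rule measurable_compose)
  then show ?thesis using j by simp
qed

lemma F_mono: "j \<le> k \<Longrightarrow> sets (F j) \<subseteq> sets (F k)"
proof -
  assume j: "j \<le> k"
  have "(\<lambda>\<omega>. \<lambda>i\<in>{..j}. Z i \<omega>) \<in> measurable (F k) (PiM {..j} (\<lambda>_. St))"
    using j by (intro measurable_restrict Z_meas_F) auto
  from measurable_sets[OF this] show ?thesis
    by (auto simp: sets_F[of j] space_F)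
qed

lemma F_sets_M: "A \<in> sets (F k) \<Longrightarrow> A \<in> sets M"
  using F_subalgebra[of k] by (auto simp: subalgebra_def)

text \<open>Retains the present state, so that integrands may depend on both ends of a
  transition.\<close>

definition pair_kernel :: "'s \<Rightarrow> ('s \<times> 's) measure" where
  "pair_kernel z = distr (R z) (St \<Otimes>\<^sub>M St) (Pair z)"

lemma pair_kernel_meas: "pair_kernel \<in> measurable St (subprob_algebra (St \<Otimes>\<^sub>M St))"
  unfolding pair_kernel_def
  by (rule measurable_distr2[OF _ measurable_prob_algebraD[OF R_kernel]]) simp

text \<open>The Markov property as an equality of measures on pairs of states, restricted to an
  event of the past. It is checked on rectangles, which are stable under intersection and generate
  the product; integrals of arbitrary functions of a transition follow from it.\<close>

lemma chain_step_bind: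
  assumes A: "A \<in> sets (F k)"
  shows "distr (density M (indicator A)) (St \<Otimes>\<^sub>M St) (\<lambda>\<omega>. (Z k \<omega>, Z (Suc k) \<omega>)) =
    bind (distr (density M (indicator A)) St (Z k)) pair_kernel" (is "?N1 = ?N2")
proof -
  have AM [measurable]: "A \<in> sets M" by (rule F_sets_M[OF A])
  obtain B where B: "B \<in> sets (PiM {..k} (\<lambda>_. St))" "A = (\<lambda>\<omega>. \<lambda>i\<in>{..k}. Z i \<omega>) -` B \<inter> space M"
    using A by (auto simp: sets_F)
  let ?\<mu> = "distr (density M (indicator A)) St (Z k)"
  have ne: "space St \<noteq> {}" using Z_space not_empty by blast
  have pk: "pair_kernel \<in> measurable ?\<mu> (subprob_algebra (St \<Otimes>\<^sub>M St))"
    using pair_kernel_meas by simp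
  have rect: "emeasure ?N1 (a \<times> b) = emeasure ?N2 (a \<times> b)" if a: "a \<in> sets St" and b: "b \<in> sets St" for a b
  proof -
    note [measurable] = a b
    have ab: "a \<times> b \<in> sets (St \<Otimes>\<^sub>M St)" by simp
    \<comment> \<open>The condition on the present state is moved into the event of the past, so
      that the assumed identity applies with \<open>b\<close> as the event of the next
      state.\<close>
    define B' where "B' = B \<inter> {p \<in> space (PiM {..k} (\<lambda>_. St)). p k \<in> a}"
    have B': "B' \<in> sets (PiM {..k} (\<lambda>_. St))"
    proof -
      have "(\<lambda>p. p k) \<in> measurable (PiM {..k} (\<lambda>_. St)) St"
        by (intro measurable_component_singleton) simp
      from measurable_sets[OF this a] show ?thesis
        unfolding B'_def using B(1) by (intro sets.Int) (auto simp: vimage_def Int_def conj_commute)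
    qed
    have hist: "(\<lambda>i\<in>{..k}. Z i \<omega>) \<in> B' \<longleftrightarrow> \<omega> \<in> A \<and> Z k \<omega> \<in> a" if "\<omega> \<in> space M" for \<omega>
      using that measurable_space[OF history_meas that, of k] by (auto simp: B'_def B(2))
    have "emeasure ?N1 (a \<times> b) = emeasure M {\<omega> \<in> space M. (\<lambda>i\<in>{..k}. Z i \<omega>) \<in> B' \<and> Z (Suc k) \<omega> \<in> b}"
    proof -
      have "emeasure ?N1 (a \<times> b) = emeasure (density M (indicator A)) ((\<lambda>\<omega>. (Z k \<omega>, Z (Suc k) \<omega>)) -` (a \<times> b) \<inter> space M)"
        by (subst emeasure_distr) auto
      also have "\<dots> = (\<integral>\<^sup>+\<omega>. indicator A \<omega> * indicator ((\<lambda>\<omega>. (Z k \<omega>, Z (Suc k) \<omega>)) -` (a \<times> b) \<inter> space M) \<omega> \<partial>M)"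
        by (rule emeasure_density) measurable
      also have "\<dots> = (\<integral>\<^sup>+\<omega>. indicator {\<omega> \<in> space M. (\<lambda>i\<in>{..k}. Z i \<omega>) \<in> B' \<and> Z (Suc k) \<omega> \<in> b} \<omega> \<partial>M)"
        using hist by (intro nn_integral_cong) (auto split: split_indicator)
      also have "\<dots> = emeasure M {\<omega> \<in> space M. (\<lambda>i\<in>{..k}. Z i \<omega>) \<in> B' \<and> Z (Suc k) \<omega> \<in> b}"
        using measurable_sets[OF history_meas B'] hist
        by (intro nn_integral_indicator) (simp add: vimage_def Int_def conj_commute pred_def[symmetric])
      finally show ?thesis .
    qed
    also have "\<dots> = (\<integral>\<^sup>+\<omega>. indicator B' (\<lambda>i\<in>{..k}. Z i \<omega>) * emeasure (R (Z k \<omega>)) b \<partial>M)"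
      using chain B' b unfolding markov_chain_def by blast
    also have "\<dots> = (\<integral>\<^sup>+\<omega>. indicator A \<omega> * (indicator a (Z k \<omega>) * emeasure (R (Z k \<omega>)) b) \<partial>M)"
      using hist by (intro nn_integral_cong) (auto split: split_indicator)
    also have "\<dots> = (\<integral>\<^sup>+z. indicator a z * emeasure (R z) b \<partial>?\<mu>)"
    proof -
      have [measurable]: "(\<lambda>z. emeasure (R z) b) \<in> borel_measurable St"
        by (rule measurable_compose[OF measurable_prob_algebraD[OF R_kernel] measurable_emeasure_subprob_algebra[OF b]])
      show ?thesis
        by (subst nn_integral_distr, measurable, subst nn_integral_density) auto
    qed
    also have "\<dots> = (\<integral>\<^sup>+z. emeasure (pair_kernel z) (a \<times> b) \<partial>?\<mu>)"
    proof (rule nn_integral_cong)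
      fix z assume "z \<in> space ?\<mu>"
      then have z: "z \<in> space St" by simp
      note Rz = markov_kernelD[OF R_kernel z]
      have "Pair z \<in> measurable (R z) (St \<Otimes>\<^sub>M St)"
        using z by (simp add: measurable_cong_sets[OF Rz(2) refl])
      then have "emeasure (pair_kernel z) (a \<times> b) = emeasure (R z) (Pair z -` (a \<times> b) \<inter> space (R z))"
        unfolding pair_kernel_def by (rule emeasure_distr[OF _ ab])
      also have "Pair z -` (a \<times> b) \<inter> space (R z) = (if z \<in> a then b else {})"
        using sets.sets_into_space[OF b] by (auto simp: Rz)
      finally show "indicator a z * emeasure (R z) b = emeasure (pair_kernel z) (a \<times> b)"
        by simp
    qed
    also have "\<dots> = emeasure ?N2 (a \<times> b)"
      using ne by (intro emeasure_bind[OF _ pk ab, symmetric]) simp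
    finally show ?thesis .
  qed
  have sets2: "sets ?N2 = sets (St \<Otimes>\<^sub>M St)"
    using ne by (intro sets_bind[where N="St \<Otimes>\<^sub>M St"]) (auto simp: pair_kernel_def)
  show ?thesis
  proof (rule measure_eqI_generator_eq[where A="\<lambda>_. space St \<times> space St", OF Int_stable_pair_measure_generator[of St St]])
    show "{a \<times> b |a b. a \<in> sets St \<and> b \<in> sets St} \<subseteq> Pow (space St \<times> space St)"
      using sets.space_closed[of St] by blast
    show "emeasure ?N1 E = emeasure ?N2 E" if "E \<in> {a \<times> b |a b. a \<in> sets St \<and> b \<in> sets St}" for E
      using that rect by auto
    show "sets ?N1 = sigma_sets (space St \<times> space St) {a \<times> b |a b. a \<in> sets St \<and> b \<in> sets St}"
      "sets ?N2 = sigma_sets (space St \<times> space St) {a \<times> b |a b. a \<in> sets St \<and> b \<in> sets St}"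
      by (simp_all add: sets2 sets_pair_measure)
    show "range (\<lambda>_::nat. space St \<times> space St) \<subseteq> {a \<times> b |a b. a \<in> sets St \<and> b \<in> sets St}" by auto
    show "emeasure ?N1 (space St \<times> space St) \<noteq> \<infinity>" for i :: nat
    proof -
      have "emeasure ?N1 (space St \<times> space St) \<le> emeasure M (space M)"
      proof -
        have "emeasure ?N1 (space St \<times> space St) = emeasure (density M (indicator A)) ((\<lambda>\<omega>. (Z k \<omega>, Z (Suc k) \<omega>)) -` (space St \<times> space St) \<inter> space M)"
          by (subst emeasure_distr) auto
        also have "\<dots> = (\<integral>\<^sup>+\<omega>. indicator A \<omega> * indicator ((\<lambda>\<omega>. (Z k \<omega>, Z (Suc k) \<omega>)) -` (space St \<times> space St) \<inter> space M) \<omega> \<partial>M)"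
          by (rule emeasure_density) measurable
        also have "\<dots> \<le> (\<integral>\<^sup>+\<omega>. 1 \<partial>M)"
          by (intro nn_integral_mono) (auto split: split_indicator)
        finally show ?thesis by simp
      qed
      then show ?thesis by (auto simp: emeasure_space_1 top_unique)
    qed
  qed auto
qed

lemma chain_step_nn:
  assumes A: "A \<in> sets (F k)" and h [measurable]: "h \<in> borel_measurable (St \<Otimes>\<^sub>M St)"
  shows "(\<integral>\<^sup>+\<omega>. indicator A \<omega> * h (Z k \<omega>, Z (Suc k) \<omega>) \<partial>M) =
    (\<integral>\<^sup>+\<omega>. indicator A \<omega> * (\<integral>\<^sup>+z. h (Z k \<omega>, z) \<partial>R (Z k \<omega>)) \<partial>M)"
proof -
  have [measurable]: "A \<in> sets M" by (rule F_sets_M[OF A])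
  have [measurable]: "(\<lambda>z. \<integral>\<^sup>+z'. h (z, z') \<partial>R z) \<in> borel_measurable St"
    using nn_integral_measurable_subprob_algebra2[of "\<lambda>z z'. h (z, z')" St St R] measurable_prob_algebraD[OF R_kernel] by simp
  have pk: "pair_kernel \<in> measurable (distr (density M (indicator A)) St (Z k)) (subprob_algebra (St \<Otimes>\<^sub>M St))"
    using pair_kernel_meas by simp
  have "(\<integral>\<^sup>+\<omega>. indicator A \<omega> * h (Z k \<omega>, Z (Suc k) \<omega>) \<partial>M) =
      (\<integral>\<^sup>+p. h p \<partial>distr (density M (indicator A)) (St \<Otimes>\<^sub>M St) (\<lambda>\<omega>. (Z k \<omega>, Z (Suc k) \<omega>)))"
    by (subst nn_integral_distr, measurable, subst nn_integral_density) auto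
  also have "\<dots> = (\<integral>\<^sup>+z. \<integral>\<^sup>+p. h p \<partial>pair_kernel z \<partial>distr (density M (indicator A)) St (Z k))"
    unfolding chain_step_bind[OF A] by (rule nn_integral_bind[OF h pk])
  also have "\<dots> = (\<integral>\<^sup>+z. \<integral>\<^sup>+z'. h (z, z') \<partial>R z \<partial>distr (density M (indicator A)) St (Z k))"
  proof (rule nn_integral_cong)
    fix z assume "z \<in> space (distr (density M (indicator A)) St (Z k))"
    then have z: "z \<in> space St" by simp
    note Rz = markov_kernelD[OF R_kernel z]
    have "Pair z \<in> measurable (R z) (St \<Otimes>\<^sub>M St)"
      using z by (simp add: measurable_cong_sets[OF Rz(2) refl])
    then show "(\<integral>\<^sup>+p. h p \<partial>pair_kernel z) = (\<integral>\<^sup>+z'. h (z, z') \<partial>R z)"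
      unfolding pair_kernel_def by (intro nn_integral_distr) auto
  qed
  also have "\<dots> = (\<integral>\<^sup>+\<omega>. indicator A \<omega> * (\<integral>\<^sup>+z. h (Z k \<omega>, z) \<partial>R (Z k \<omega>)) \<partial>M)"
    by (subst nn_integral_distr, measurable, subst nn_integral_density) auto
  finally show ?thesis .
qed

lemma chain_step_integral:
  fixes h :: "'s \<times> 's \<Rightarrow> real"
  assumes A: "A \<in> sets (F k)" and h [measurable]: "h \<in> borel_measurable (St \<Otimes>\<^sub>M St)"
    and int: "integrable M (\<lambda>\<omega>. indicator A \<omega> * h (Z k \<omega>, Z (Suc k) \<omega>))"
  shows "(\<integral>\<omega>. indicator A \<omega> * h (Z k \<omega>, Z (Suc k) \<omega>) \<partial>M) =
    (\<integral>\<omega>. indicator A \<omega> * (\<integral>z. h (Z k \<omega>, z) \<partial>R (Z k \<omega>)) \<partial>M)"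
    and "integrable M (\<lambda>\<omega>. indicator A \<omega> * (\<integral>z. h (Z k \<omega>, z) \<partial>R (Z k \<omega>)))"
proof -
  have [measurable]: "A \<in> sets M" by (rule F_sets_M[OF A])
  have ne: "space St \<noteq> {}" using Z_space not_empty by blast
  let ?\<mu> = "distr (density M (indicator A)) St (Z k)"
  have pk: "pair_kernel \<in> measurable ?\<mu> (subprob_algebra (St \<Otimes>\<^sub>M St))"
    using pair_kernel_meas by simp
  have inner: "(\<integral>p. h p \<partial>pair_kernel z) = (\<integral>z'. h (z, z') \<partial>R z)" if z: "z \<in> space St" for z
  proof -
    note Rz = markov_kernelD[OF R_kernel z]
    have "Pair z \<in> measurable (R z) (St \<Otimes>\<^sub>M St)"
      using z by (simp add: measurable_cong_sets[OF Rz(2) refl])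
    then show ?thesis
      unfolding pair_kernel_def by (intro integral_distr) auto
  qed
  have [measurable]: "(\<lambda>z. \<integral>p. h p \<partial>pair_kernel z) \<in> borel_measurable St"
    by (rule measurable_compose[OF pair_kernel_meas integral_measurable_subprob_algebra[OF h]])
  have dens: "density M (indicator A) = density M (\<lambda>\<omega>. ennreal (indicator A \<omega>))"
    by (rule density_cong) (auto split: split_indicator)
  have dI: "(\<integral>\<omega>. g \<omega> \<partial>density M (indicator A)) = (\<integral>\<omega>. indicator A \<omega> * g \<omega> \<partial>M)" if "g \<in> borel_measurable M" for g :: "'w \<Rightarrow> real"
    unfolding dens using that by (subst integral_real_density) auto
  have dint: "integrable (density M (indicator A)) g \<longleftrightarrow> integrable M (\<lambda>\<omega>. indicator A \<omega> * g \<omega>)" if "g \<in> borel_measurable M" for g :: "'w \<Rightarrow> real"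
    unfolding dens using that by (subst integrable_real_density) auto
  have fin: "(\<integral>\<^sup>+z. \<integral>\<^sup>+p. ennreal \<bar>h p\<bar> \<partial>pair_kernel z \<partial>?\<mu>) < \<infinity>"
  proof -
    have "(\<integral>\<^sup>+z. \<integral>\<^sup>+p. ennreal \<bar>h p\<bar> \<partial>pair_kernel z \<partial>?\<mu>) = (\<integral>\<^sup>+p. ennreal \<bar>h p\<bar> \<partial>bind ?\<mu> pair_kernel)"
      by (rule nn_integral_bind[OF _ pk, symmetric]) simp
    also have "\<dots> = (\<integral>\<^sup>+\<omega>. indicator A \<omega> * ennreal \<bar>h (Z k \<omega>, Z (Suc k) \<omega>)\<bar> \<partial>M)"
      unfolding chain_step_bind[OF A, symmetric] by (subst nn_integral_distr, measurable, subst nn_integral_density) auto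
    also have "\<dots> = (\<integral>\<^sup>+\<omega>. ennreal (norm (indicator A \<omega> * h (Z k \<omega>, Z (Suc k) \<omega>))) \<partial>M)"
      by (intro nn_integral_cong) (auto split: split_indicator)
    also have "\<dots> < \<infinity>" using int by (simp add: integrable_iff_bounded)
    finally show ?thesis .
  qed
  have "(\<integral>\<omega>. indicator A \<omega> * h (Z k \<omega>, Z (Suc k) \<omega>) \<partial>M) =
      (\<integral>p. h p \<partial>distr (density M (indicator A)) (St \<Otimes>\<^sub>M St) (\<lambda>\<omega>. (Z k \<omega>, Z (Suc k) \<omega>)))"
    by (subst integral_distr) (auto simp: dI)
  also have "\<dots> = (\<integral>z. \<integral>p. h p \<partial>pair_kernel z \<partial>?\<mu>)"
    unfolding chain_step_bind[OF A] using ne by (intro integral_bind_kernel(3)[OF pk _ h fin]) simp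
  also have "\<dots> = (\<integral>\<omega>. indicator A \<omega> * (\<integral>p. h p \<partial>pair_kernel (Z k \<omega>)) \<partial>M)"
    by (subst integral_distr) (auto simp: dI)
  also have "\<dots> = (\<integral>\<omega>. indicator A \<omega> * (\<integral>z. h (Z k \<omega>, z) \<partial>R (Z k \<omega>)) \<partial>M)"
    by (intro Bochner_Integration.integral_cong) (auto simp: inner Z_space)
  finally show "(\<integral>\<omega>. indicator A \<omega> * h (Z k \<omega>, Z (Suc k) \<omega>) \<partial>M) =
    (\<integral>\<omega>. indicator A \<omega> * (\<integral>z. h (Z k \<omega>, z) \<partial>R (Z k \<omega>)) \<partial>M)" .
  have "integrable ?\<mu> (\<lambda>z. \<integral>p. h p \<partial>pair_kernel z)"
    using ne by (intro integral_bind_kernel(2)[OF pk _ h fin]) simp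
  then have "integrable M (\<lambda>\<omega>. indicator A \<omega> * (\<integral>p. h p \<partial>pair_kernel (Z k \<omega>)))"
    by (subst (asm) integrable_distr_eq) (auto simp: dint)
  then show "integrable M (\<lambda>\<omega>. indicator A \<omega> * (\<integral>z. h (Z k \<omega>, z) \<partial>R (Z k \<omega>)))"
    by (subst Bochner_Integration.integrable_cong[OF refl, where g="\<lambda>\<omega>. indicator A \<omega> * (\<integral>p. h p \<partial>pair_kernel (Z k \<omega>))"]) (auto simp: inner Z_space)
qed

text \<open>Turns relations that hold almost surely under every single transition law into
  recursions along almost every path.\<close>

lemma chain_step_AE:
  assumes G: "G \<in> sets (St \<Otimes>\<^sub>M St)" and ae: "\<And>z. z \<in> space St \<Longrightarrow> AE z' in R z. (z, z') \<in> G"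
  shows "AE \<omega> in M. (Z k \<omega>, Z (Suc k) \<omega>) \<in> G"
proof -
  note [measurable] = G
  have sp: "space M \<in> sets (F k)" using sets.top[of "F k"] by (simp add: space_F)
  have "(\<integral>\<^sup>+\<omega>. indicator (space M) \<omega> * indicator (- G) (Z k \<omega>, Z (Suc k) \<omega>) \<partial>M) =
    (\<integral>\<^sup>+\<omega>. indicator (space M) \<omega> * (\<integral>\<^sup>+z. indicator (- G) (Z k \<omega>, z) \<partial>R (Z k \<omega>)) \<partial>M)"
    by (rule chain_step_nn[OF sp]) measurable
  also have "\<dots> = (\<integral>\<^sup>+\<omega>. 0 \<partial>M)"
  proof (rule nn_integral_cong)
    fix \<omega> assume "\<omega> \<in> space M"
    then have "Z k \<omega> \<in> space St" by (rule Z_space)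
    from ae[OF this] have "(\<integral>\<^sup>+z. indicator (- G) (Z k \<omega>, z) \<partial>R (Z k \<omega>)) = (\<integral>\<^sup>+z. 0 \<partial>R (Z k \<omega>))"
      by (intro nn_integral_cong_AE) (auto elim!: eventually_mono)
    then show "indicator (space M) \<omega> * (\<integral>\<^sup>+z. indicator (- G) (Z k \<omega>, z) \<partial>R (Z k \<omega>)) = 0" by simp
  qed
  also have "\<dots> = 0" by simp
  finally have "AE \<omega> in M. indicator (space M) \<omega> * indicator (- G) (Z k \<omega>, Z (Suc k) \<omega>) = (0::ennreal)"
    by (subst (asm) nn_integral_0_iff_AE) auto
  then show ?thesis
    by (rule AE_mp) (rule AE_I2, auto split: split_indicator_asm)
qed

end

abbreviation (input) "st_param z \<equiv> fst (snd z)"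
abbreviation (input) "st_kappa z \<equiv> fst (snd (snd z))"
abbreviation (input) "st_nu z \<equiv> snd (snd (snd z))"

text \<open>The value 0 at the cemetery is a dummy.\<close>

definition st_val :: "'x \<times> 'p::real_normed_vector option \<times> nat \<times> nat \<Rightarrow> 'p" where
  "st_val z = (case st_param z of Some t \<Rightarrow> t | None \<Rightarrow> 0)"

lemma pred_eq_nat:
  fixes f g :: "'a \<Rightarrow> nat"
  assumes [measurable]: "f \<in> measurable N (count_space UNIV)" "g \<in> measurable N (count_space UNIV)"
  shows "Measurable.pred N (\<lambda>p. f p = g p)"
proof -
  have "(\<lambda>p. f p = g p) = (\<lambda>p. \<exists>n. f p = n \<and> g p = n)" by auto
  also have "Measurable.pred N \<dots>" by measurable
  finally show ?thesis .
qed

section \<open>Pathwise recursions of counters and parameter\<close>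

locale sa_chain =
  fixes S :: "'x measure" and \<Theta> :: "'p::euclidean_space set"
    and P :: "'p \<Rightarrow> 'x \<Rightarrow> 'x measure" and H :: "'p \<Rightarrow> 'x \<Rightarrow> 'p"
    and proj :: "'x \<times> 'p option \<Rightarrow> 'x \<times> 'p" and \<gamma> :: "nat \<Rightarrow> real" and K :: "nat \<Rightarrow> 'p set"
    and M :: "'w measure" and Z :: "nat \<Rightarrow> 'w \<Rightarrow> 'x \<times> 'p option \<times> nat \<times> nat" and z\<^sub>0
  assumes open_Theta: "open \<Theta>"
    and P_kernel: "\<theta> \<in> \<Theta> \<Longrightarrow> markov_kernel S (P \<theta>)"
    and H_meas: "(\<lambda>(\<theta>, x). H \<theta> x) \<in> borel_measurable (restrict_space borel \<Theta> \<Otimes>\<^sub>M S)"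
    and coverage: "compact_coverage \<Theta> K"
    and sa_chain: "markov_chain M (state_space S \<Theta>) (reproj_kernel S \<Theta> P H proj \<gamma> K) z\<^sub>0 Z"
begin

abbreviation "St \<equiv> state_space S \<Theta>"
abbreviation "R \<equiv> reproj_kernel S \<Theta> P H proj \<gamma> K"

sublocale markov_process M St R z\<^sub>0 Z
  by unfold_locales (rule sa_chain)

lemma Theta_borel [measurable]: "\<Theta> \<in> sets borel"
  using open_Theta by simp

lemma space_St: "z \<in> space St \<longleftrightarrow> fst z \<in> space S \<and> st_param z \<in> insert None (Some ` \<Theta>)"
  by (cases z) (auto simp: state_space_def space_pair_measure)

lemma st_meas [measurable]:
  "fst \<in> measurable St S" "(\<lambda>z. st_param z) \<in> measurable St (cem_space \<Theta>)"
  "(\<lambda>z. st_kappa z) \<in> measurable St (count_space UNIV)" "(\<lambda>z. st_nu z) \<in> measurable St (count_space UNIV)"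
  unfolding state_space_def by measurable

lemma cem_sets_Some: "L \<in> sets borel \<Longrightarrow> L \<subseteq> \<Theta> \<Longrightarrow> Some ` L \<in> sets (cem_space \<Theta>)"
  by (auto simp: sets_cem_space sets_restrict_space_iff inj_vimage_image_eq)

lemma cem_sets_None: "{None} \<in> sets (cem_space \<Theta>)"
  by (auto simp: sets_cem_space vimage_def)

lemma st_val_meas [measurable]: "st_val \<in> borel_measurable St"
proof -
  have "case_option 0 (\<lambda>t. t) \<in> borel_measurable (cem_space \<Theta>)"
  proof (rule measurableI)
    fix C :: "'p set" assume C: "C \<in> sets borel"
    have "Some -` (case_option 0 (\<lambda>t. t) -` C \<inter> space (cem_space \<Theta>)) = \<Theta> \<inter> C"
      by (auto simp: vimage_def)
    then show "case_option 0 (\<lambda>t. t) -` C \<inter> space (cem_space \<Theta>) \<in> sets (cem_space \<Theta>)"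
      using C by (auto simp: sets_cem_space sets_restrict_space)
  qed simp
  then show ?thesis
    unfolding st_val_def by (rule measurable_compose[OF st_meas(2)])
qed

lemma K_props: "compact (K q)" "K q \<subseteq> \<Theta>" "K q \<subseteq> K (Suc q)" "\<theta> \<in> \<Theta> \<Longrightarrow> \<exists>q. \<theta> \<in> interior (K q)"
proof -
  show "compact (K q)" "K q \<subseteq> \<Theta>" "K q \<subseteq> K (Suc q)"
    using coverage interior_subset unfolding compact_coverage_def by blast+
  show "\<theta> \<in> \<Theta> \<Longrightarrow> \<exists>q. \<theta> \<in> interior (K q)"
    using coverage unfolding compact_coverage_def by blast
qed

lemma K_mono: "i \<le> j \<Longrightarrow> K i \<subseteq> K j"
  using K_props(3) by (rule lift_Suc_mono_le)

lemma K_borel [measurable]: "K q \<in> sets borel"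
  using K_props(1) by (intro borel_closed compact_imp_closed)

text \<open>The rule for the two counters. It is the same after a reprojection and after an ordinary
  move, so it may be used along the whole path.\<close>

definition trans_rel :: "('x \<times> 'p option \<times> nat \<times> nat) \<Rightarrow> ('x \<times> 'p option \<times> nat \<times> nat) \<Rightarrow> bool" where
  "trans_rel z z' \<longleftrightarrow> (if st_param z' \<in> Some ` K (st_kappa z)
     then st_kappa z' = st_kappa z \<and> st_nu z' = Suc (st_nu z) else st_kappa z' = Suc (st_kappa z) \<and> st_nu z' = 0)"

definition next_state :: "nat \<Rightarrow> nat \<Rightarrow> 'x \<times> 'p option \<Rightarrow> 'x \<times> 'p option \<times> nat \<times> nat" where
  "next_state \<kappa> \<nu> = (\<lambda>(x', \<theta>'). if \<theta>' \<in> Some ` K \<kappa> then (x', \<theta>', \<kappa>, Suc \<nu>) else (x', \<theta>', Suc \<kappa>, 0))"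

lemma next_state_meas [measurable]: "next_state \<kappa> \<nu> \<in> measurable (S \<Otimes>\<^sub>M cem_space \<Theta>) St"
proof -
  have [measurable]: "Some ` K \<kappa> \<in> sets (cem_space \<Theta>)"
    by (intro cem_sets_Some K_borel K_props)
  show ?thesis
    unfolding next_state_def state_space_def split_beta' by measurable
qed

lemma Some_K_pred [measurable]: "Measurable.pred (St \<Otimes>\<^sub>M St) (\<lambda>p. st_param (snd p) \<in> Some ` K (st_kappa (fst p)))"
proof -
  have [measurable]: "Some ` K q \<in> sets (cem_space \<Theta>)" for q
    by (intro cem_sets_Some K_borel K_props)
  have "(\<lambda>p::('x \<times> 'p option \<times> nat \<times> nat) \<times> ('x \<times> 'p option \<times> nat \<times> nat). st_param (snd p) \<in> Some ` K (st_kappa (fst p)))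
      = (\<lambda>p. \<exists>q. st_kappa (fst p) = q \<and> st_param (snd p) \<in> Some ` K q)" by auto
  also have "Measurable.pred (St \<Otimes>\<^sub>M St) \<dots>" by measurable
  finally show ?thesis .
qed

lemma trans_rel_sets: "{p \<in> space (St \<Otimes>\<^sub>M St). trans_rel (fst p) (snd p)} \<in> sets (St \<Otimes>\<^sub>M St)"
proof -
  have 1: "(\<lambda>p. Suc (st_nu (fst p))) \<in> measurable (St \<Otimes>\<^sub>M St) (count_space UNIV)"
    by (intro measurable_compose[OF measurable_compose[OF measurable_fst st_meas(4)]]) simp
  have 2: "(\<lambda>p. Suc (st_kappa (fst p))) \<in> measurable (St \<Otimes>\<^sub>M St) (count_space UNIV)"
    by (intro measurable_compose[OF measurable_compose[OF measurable_fst st_meas(3)]]) simp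
  note [measurable] = pred_eq_nat[OF measurable_compose[OF measurable_snd st_meas(4)] 1]
    pred_eq_nat[OF measurable_compose[OF measurable_snd st_meas(3)] 2]
    pred_eq_nat[OF measurable_compose[OF measurable_snd st_meas(3)] measurable_compose[OF measurable_fst st_meas(3)]]
    pred_eq_nat[OF measurable_compose[OF measurable_snd st_meas(4)] measurable_const[of "0::nat"], simplified]
  show ?thesis
    unfolding trans_rel_def if_bool_eq_disj by measurable
qed

text \<open>All branches of the transition end with the same map; the counter rule can therefore be
  read off without looking at the kernel from which point and parameter are drawn.\<close>

lemma R_eq_distr: "\<exists>N. sets N = sets (S \<Otimes>\<^sub>M cem_space \<Theta>) \<and> R z = distr N St (next_state (st_kappa z) (st_nu z))"
proof -
  obtain x \<theta> \<kappa> \<nu> where z: "z = (x, \<theta>, \<kappa>, \<nu>)" by (cases z)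
  define N where "N = (if \<nu> = 0 then (case proj (x, \<theta>) of (x\<^sub>0, \<theta>\<^sub>0) \<Rightarrow> elem_kernel S \<Theta> P H (\<gamma> \<kappa>) x\<^sub>0 \<theta>\<^sub>0)
        else (case \<theta> of Some t \<Rightarrow> elem_kernel S \<Theta> P H (\<gamma> (\<kappa> + \<nu>)) x t | None \<Rightarrow> return (S \<Otimes>\<^sub>M cem_space \<Theta>) (x, None)))"
  have "sets N = sets (S \<Otimes>\<^sub>M cem_space \<Theta>)"
    by (auto simp: N_def elem_kernel_def split: option.split prod.split)
  moreover have "R z = distr N St (next_state (st_kappa z) (st_nu z))"
    by (simp add: z N_def reproj_kernel_def next_state_def)
  ultimately show ?thesis by blast
qed

lemma trans_AE: "AE \<omega> in M. \<forall>k. trans_rel (Z k \<omega>) (Z (Suc k) \<omega>)"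
proof (rule AE_all_countable[THEN iffD2], rule allI)
  fix k
  have "AE \<omega> in M. (Z k \<omega>, Z (Suc k) \<omega>) \<in> {p \<in> space (St \<Otimes>\<^sub>M St). trans_rel (fst p) (snd p)}"
  proof (rule chain_step_AE[OF trans_rel_sets])
    fix z assume z: "z \<in> space St"
    obtain N where N: "sets N = sets (S \<Otimes>\<^sub>M cem_space \<Theta>)" "R z = distr N St (next_state (st_kappa z) (st_nu z))"
      using R_eq_distr by blast
    have m: "next_state (st_kappa z) (st_nu z) \<in> measurable N St"
      by (simp add: measurable_cong_sets[OF N(1) refl])
    have "{z' \<in> space St. trans_rel z z'} \<in> sets St"
      using measurable_sets[OF measurable_Pair1'[OF z] trans_rel_sets] z
      by (simp add: vimage_def space_pair_measure Int_def conj_commute cong: conj_cong)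
    moreover have "{z' \<in> space St. (z, z') \<in> {p \<in> space (St \<Otimes>\<^sub>M St). trans_rel (fst p) (snd p)}} = {z' \<in> space St. trans_rel z z'}"
      using z by (auto simp: space_pair_measure)
    ultimately have s: "{z' \<in> space St. (z, z') \<in> {p \<in> space (St \<Otimes>\<^sub>M St). trans_rel (fst p) (snd p)}} \<in> sets St"
      by simp
    show "AE z' in R z. (z, z') \<in> {p \<in> space (St \<Otimes>\<^sub>M St). trans_rel (fst p) (snd p)}"
      unfolding N(2) AE_distr_iff[OF m s]
    proof (rule AE_I2)
      fix p assume "p \<in> space N"
      then have "next_state (st_kappa z) (st_nu z) p \<in> space St" by (rule measurable_space[OF m])
      moreover have "trans_rel z (next_state (st_kappa z) (st_nu z) p)"
        by (auto simp: trans_rel_def next_state_def split: prod.split)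
      ultimately show "(z, next_state (st_kappa z) (st_nu z) p) \<in> {p \<in> space (St \<Otimes>\<^sub>M St). trans_rel (fst p) (snd p)}"
        using z by (simp add: space_pair_measure)
    qed
  qed
  then show "AE \<omega> in M. trans_rel (Z k \<omega>) (Z (Suc k) \<omega>)"
    by (rule AE_mp) (auto intro!: AE_I2)
qed

text \<open>\<open>H\<close> is measurable only on \<Theta>. The extension by 0 is Borel on the
  whole product and may be composed with \<open>st_val\<close>, whose dummy value at the cemetery
  can lie outside \<Theta>.\<close>

definition H0 :: "'p \<times> 'x \<Rightarrow> 'p" where "H0 p = (if fst p \<in> \<Theta> then H (fst p) (snd p) else 0)"

lemma H0_meas [measurable]: "H0 \<in> borel_measurable (borel \<Otimes>\<^sub>M S)"
proof -
  let ?P = "borel \<Otimes>\<^sub>M S :: ('p \<times> 'x) measure"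
  have s: "{p \<in> space ?P. fst p \<in> \<Theta>} \<in> sets ?P" by measurable
  have id: "(\<lambda>p. p) \<in> measurable (restrict_space ?P {p. fst p \<in> \<Theta>}) (restrict_space borel \<Theta> \<Otimes>\<^sub>M S)"
  proof (rule measurable_pair)
    show "fst \<circ> (\<lambda>p. p) \<in> measurable (restrict_space ?P {p. fst p \<in> \<Theta>}) (restrict_space borel \<Theta>)"
      unfolding comp_def
      by (rule measurable_restrict_space2) (auto simp: space_restrict_space intro!: measurable_restrict_space1)
    show "snd \<circ> (\<lambda>p. p) \<in> measurable (restrict_space ?P {p. fst p \<in> \<Theta>}) S"
      unfolding comp_def by (rule measurable_restrict_space1) simp
  qed
  have eq: "(\<lambda>(\<theta>, x). H \<theta> x) = (\<lambda>p. H (fst p) (snd p))" by auto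
  have "(\<lambda>p. if fst p \<in> \<Theta> then H (fst p) (snd p) else 0) \<in> borel_measurable ?P"
    by (subst measurable_If_restrict_space_iff[OF s]) (auto intro: measurable_compose[OF id H_meas[unfolded eq]])
  then show ?thesis
    unfolding H0_def[abs_def] .
qed

lemma sa_update_meas:
  assumes t: "t \<in> \<Theta>"
  shows "sa_update \<Theta> H g t \<in> measurable S (cem_space \<Theta>)"
proof (rule measurableI)
  have "(\<lambda>y. H0 (t, y)) \<in> borel_measurable S" by measurable
  then have [measurable]: "H t \<in> borel_measurable S" using t by (simp add: H0_def)
  fix C assume C: "C \<in> sets (cem_space \<Theta>)"
  then have [measurable]: "Some -` C \<in> sets borel"
    using open_Theta by (auto simp: sets_cem_space sets_restrict_space_iff)
  have "sa_update \<Theta> H g t -` C \<inter> space S =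
      {y\<in>space S. t + g *\<^sub>R H t y \<in> \<Theta> \<and> t + g *\<^sub>R H t y \<in> Some -` C \<or> t + g *\<^sub>R H t y \<notin> \<Theta> \<and> None \<in> C}"
    by (auto simp: sa_update_def split: if_splits)
  also have "\<dots> \<in> sets S" by measurable
  finally show "sa_update \<Theta> H g t -` C \<inter> space S \<in> sets S" .
qed (auto simp: sa_update_def)

text \<open>The next state as a function of the newly drawn point, for transitions without
  reprojection from a parameter in \<Theta>; there the draw from \<open>P\<close> is the only source
  of randomness.\<close>

definition post :: "('x \<times> 'p option \<times> nat \<times> nat) \<Rightarrow> 'x \<Rightarrow> 'x \<times> 'p option \<times> nat \<times> nat" where
  "post z y = next_state (st_kappa z) (st_nu z) (y, sa_update \<Theta> H (\<gamma> (st_kappa z + st_nu z)) (st_val z) y)"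

lemma fst_post [simp]: "fst (post z y) = y"
  by (simp add: post_def next_state_def)

lemma param_post [simp]: "st_param (post z y) = sa_update \<Theta> H (\<gamma> (st_kappa z + st_nu z)) (st_val z) y"
  by (simp add: post_def next_state_def)

lemma R_post:
  assumes z: "z \<in> space St" and th: "st_param z \<noteq> None" and nu: "1 \<le> st_nu z"
  shows "R z = distr (P (st_val z) (fst z)) St (post z)" and "post z \<in> measurable (P (st_val z) (fst z)) St"
proof -
  obtain t where t: "st_param z = Some t" using th by auto
  then have t\<Theta>: "t \<in> \<Theta>" and x: "fst z \<in> space S" using z by (auto simp: space_St)
  have v: "st_val z = t" by (simp add: st_val_def t)
  note Px = markov_kernelD[OF P_kernel[OF t\<Theta>] x]
  have m1: "(\<lambda>y. (y, sa_update \<Theta> H (\<gamma> (st_kappa z + st_nu z)) t y)) \<in> measurable (P t (fst z)) (S \<Otimes>\<^sub>M cem_space \<Theta>)"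
    using sa_update_meas[OF t\<Theta>] by (simp add: measurable_cong_sets[OF Px(2) refl])
  show "post z \<in> measurable (P (st_val z) (fst z)) St"
    unfolding v post_def by (rule measurable_compose[OF m1 next_state_meas])
  obtain x \<theta> \<kappa> \<nu> where zz: "z = (x, \<theta>, \<kappa>, \<nu>)" by (cases z)
  have "R z = distr (elem_kernel S \<Theta> P H (\<gamma> (\<kappa> + \<nu>)) x t) St (next_state \<kappa> \<nu>)"
    using t nu by (simp add: zz reproj_kernel_def next_state_def)
  also have "\<dots> = distr (P t x) St (next_state \<kappa> \<nu> \<circ> (\<lambda>y. (y, sa_update \<Theta> H (\<gamma> (\<kappa> + \<nu>)) t y)))"
    unfolding elem_kernel_def using m1 by (intro distr_distr) (auto simp: zz)
  finally show "R z = distr (P (st_val z) (fst z)) St (post z)"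
    unfolding v by (simp add: zz post_def[abs_def] comp_def v[unfolded zz])
qed

text \<open>A value of \<nu> of at least 1 excludes a reprojection, and if the new state is not the
  cemetery, then \<open>sa_update\<close> is the plain stochastic approximation step.\<close>

lemma update_AE:
  "AE \<omega> in M. \<forall>k. st_param (Z k \<omega>) \<noteq> None \<longrightarrow> 1 \<le> st_nu (Z k \<omega>) \<longrightarrow> st_param (Z (Suc k) \<omega>) \<noteq> None \<longrightarrow>
    st_val (Z (Suc k) \<omega>) = st_val (Z k \<omega>) + \<gamma> (st_kappa (Z k \<omega>) + st_nu (Z k \<omega>)) *\<^sub>R H (st_val (Z k \<omega>)) (fst (Z (Suc k) \<omega>))"
proof (rule AE_all_countable[THEN iffD2], rule allI)
  fix k
  define rel where "rel z z' \<longleftrightarrow> (st_param z \<noteq> None \<longrightarrow> 1 \<le> st_nu z \<longrightarrow> st_param z' \<noteq> None \<longrightarrow>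
    st_val z' = st_val z + \<gamma> (st_kappa z + st_nu z) *\<^sub>R H0 (st_val z, fst z'))"
    for z z' :: "'x \<times> 'p option \<times> nat \<times> nat"
  have [measurable]: "{None} \<in> sets (cem_space \<Theta>)" by (rule cem_sets_None)
  have None_eq: "(st_param z \<noteq> None) = (st_param z \<notin> {None})" for z :: "'x \<times> 'p option \<times> nat \<times> nat" by simp
  have [measurable]: "(\<lambda>z. \<gamma> (st_kappa z + st_nu z)) \<in> borel_measurable St"
    by (rule measurable_compose[where N="count_space UNIV"]) measurable
  let ?G = "{p \<in> space (St \<Otimes>\<^sub>M St). rel (fst p) (snd p)}"
  have G: "?G \<in> sets (St \<Otimes>\<^sub>M St)"
    unfolding rel_def None_eq by measurable
  have "AE \<omega> in M. (Z k \<omega>, Z (Suc k) \<omega>) \<in> ?G"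
  proof (rule chain_step_AE[OF G])
    fix z assume z: "z \<in> space St"
    have Gz: "{z' \<in> space St. (z, z') \<in> ?G} \<in> sets St"
      using measurable_sets[OF measurable_Pair1'[OF z] G]
      by (simp add: vimage_def Int_def conj_commute cong: conj_cong)
    show "AE z' in R z. (z, z') \<in> ?G"
    proof (cases "st_param z \<noteq> None \<and> 1 \<le> st_nu z")
      case True
      then have th: "st_param z \<noteq> None" and nu: "1 \<le> st_nu z" by auto
      have v: "st_val z \<in> \<Theta>" using th z by (auto simp: space_St st_val_def)
      show ?thesis
        unfolding R_post(1)[OF z th nu] AE_distr_iff[OF R_post(2)[OF z th nu] Gz]
      proof (rule AE_I2)
        fix y assume "y \<in> space (P (st_val z) (fst z))"
        then have "post z y \<in> space St" by (rule measurable_space[OF R_post(2)[OF z th nu]])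
        moreover have "rel z (post z y)"
          using v by (auto simp: rel_def H0_def st_val_def[of "post z y"] sa_update_def)
        ultimately show "(z, post z y) \<in> ?G" using z by (simp add: space_pair_measure)
      qed
    next
      case False
      show ?thesis
        by (rule AE_I2) (use False z markov_kernelD[OF R_kernel z] in \<open>auto simp: rel_def space_pair_measure\<close>)
    qed
  qed
  then show "AE \<omega> in M. st_param (Z k \<omega>) \<noteq> None \<longrightarrow> 1 \<le> st_nu (Z k \<omega>) \<longrightarrow> st_param (Z (Suc k) \<omega>) \<noteq> None \<longrightarrow>
    st_val (Z (Suc k) \<omega>) = st_val (Z k \<omega>) + \<gamma> (st_kappa (Z k \<omega>) + st_nu (Z k \<omega>)) *\<^sub>R H (st_val (Z k \<omega>)) (fst (Z (Suc k) \<omega>))"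
  proof (rule AE_mp, intro AE_I2 impI)
    fix \<omega> assume \<omega>: "\<omega> \<in> space M" and G': "(Z k \<omega>, Z (Suc k) \<omega>) \<in> ?G" and th: "st_param (Z k \<omega>) \<noteq> None"
      and nu: "1 \<le> st_nu (Z k \<omega>)" and th': "st_param (Z (Suc k) \<omega>) \<noteq> None"
    have "st_val (Z k \<omega>) \<in> \<Theta>" using th Z_space[OF \<omega>, of k] by (auto simp: space_St st_val_def)
    then show "st_val (Z (Suc k) \<omega>) = st_val (Z k \<omega>) + \<gamma> (st_kappa (Z k \<omega>) + st_nu (Z k \<omega>)) *\<^sub>R H (st_val (Z k \<omega>)) (fst (Z (Suc k) \<omega>))"
      using G' th nu th' by (simp add: rel_def H0_def)
  qed
qed

end

section \<open>Localisation to a compact parameter set\<close>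

lemma lipfam_measurable:
  fixes L :: "'p::euclidean_space set"
  assumes h: "lipfam S L W N h" and L: "L \<in> sets borel" and W: "\<And>x. x \<in> space S \<Longrightarrow> 0 \<le> W x"
  shows "(\<lambda>(\<theta>, x). if \<theta> \<in> L then h \<theta> x else 0) \<in> borel_measurable (borel \<Otimes>\<^sub>M S)"
proof (rule Caratheodory_measurable[OF L])
  show "\<theta> \<in> L \<Longrightarrow> h \<theta> \<in> borel_measurable S" for \<theta>
    using lipfamD(2)[OF h] by (rule wbound_measurable)
  fix x assume x: "x \<in> space S"
  have "(N * W x)-lipschitz_on L (\<lambda>\<theta>. h \<theta> x)"
    using lipfamD(1)[OF h] lipfamD(3)[OF h _ _ x] W[OF x]
    by (intro lipschitz_onI) (auto simp: dist_norm mult_ac)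
  then show "continuous_on L (\<lambda>\<theta>. h \<theta> x)" by (rule lipschitz_on_continuous_on)
qed

text \<open>For the exit from \<open>J\<close>: the first term is small enough to be summed over
  \<open>n\<close> steps against bounded moments of \<open>V\<close>, and the second is paid at most
  once per path.\<close>

lemma powr_le_interpolate:
  fixes v s :: real and n :: nat
  assumes v: "0 < v" and n: "0 < n" and s: "0 \<le> s" "s \<le> 1"
  shows "v powr s \<le> n powr (s - 1) * v + n powr s"
proof (cases "v \<le> n")
  case True
  then have "v powr s \<le> n powr s" using v s by (intro powr_mono2) auto
  moreover have "0 \<le> n powr (s - 1) * v" using v by simp
  ultimately show ?thesis by simp
next
  case False
  have "v powr s = v powr (s - 1) * v" using v by (simp add: powr_diff)
  also have "v powr (s - 1) \<le> n powr (s - 1)"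
    using False n s by (intro powr_mono2') auto
  finally have "v powr s \<le> n powr (s - 1) * v" using v by simp
  then show ?thesis by (simp add: add_increasing2)
qed

section \<open>Localising events, moments of the Lyapunov function, step sizes\<close>

locale sa_local = sa_chain S \<Theta> P H proj \<gamma> K M Z z\<^sub>0
  for S :: "'x measure" and \<Theta> :: "'p::euclidean_space set" and P H proj \<gamma> K
    and M :: "'w measure" and Z z\<^sub>0 +
  fixes V :: "'x \<Rightarrow> real" and L :: "'p set" and m :: nat and Rr l b \<beta> CH :: real
  assumes V_meas [measurable]: "V \<in> borel_measurable S" and V1: "x \<in> space S \<Longrightarrow> 1 \<le> V x"
    and L_compact: "compact L" and L_sub: "L \<subseteq> \<Theta>"
    and Rr: "1 \<le> Rr" and l_less: "l < 1" and l_nonneg: "0 \<le> l" and b_nonneg: "0 \<le> b"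
    and driftL: "\<theta> \<in> L \<Longrightarrow> x \<in> space S \<Longrightarrow> (\<integral>\<^sup>+y. ennreal (V y) \<partial>P \<theta> x) \<le> ennreal (l * V x + b)"
    and H_bound: "\<theta> \<in> L \<Longrightarrow> x \<in> space S \<Longrightarrow> norm (H \<theta> x) \<le> CH * V x powr \<beta>"
    and CH: "0 \<le> CH" and \<beta>: "0 \<le> \<beta>"
    and gamma: "decseq \<gamma>" "\<And>k. 0 < \<gamma> k"
begin

text \<open>The condition on \<nu> guarantees that the next transition uses the kernel at the
  present parameter, without reprojection.\<close>

definition good :: "'x \<times> 'p option \<times> nat \<times> nat \<Rightarrow> bool" where
  "good z \<longleftrightarrow> st_param z \<in> Some ` L \<and> 1 \<le> st_nu z"

definition X :: "nat \<Rightarrow> 'w \<Rightarrow> 'x" where "X k \<omega> = fst (Z k \<omega>)"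
definition T :: "nat \<Rightarrow> 'w \<Rightarrow> 'p" where "T k \<omega> = st_val (Z k \<omega>)"

text \<open>Empty before time \<open>m\<close>, so that all sums may start at 0; decreasing from
  then on. Membership is decided by time \<open>k\<close>, so multiplication by the indicator stops
  the chain and preserves martingale differences. The bound on \<open>V\<close> at time
  \<open>m\<close> is the initial moment for the drift.\<close>

definition J :: "nat \<Rightarrow> 'w set" where
  "J k = {\<omega> \<in> space M. m \<le> k \<and> V (X m \<omega>) \<le> Rr \<and> (\<forall>j\<in>{m..k}. good (Z j \<omega>))}"

lemma L_borel [measurable]: "L \<in> sets borel"
  using L_compact by (intro borel_closed compact_imp_closed)

lemma good_pred [measurable]: "Measurable.pred St good"
proof -
  have [measurable]: "Some ` L \<in> sets (cem_space \<Theta>)" by (intro cem_sets_Some L_borel L_sub)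
  show ?thesis unfolding good_def by measurable
qed

lemma X_meas [measurable]: "X k \<in> measurable M S"
  unfolding X_def by measurable

lemma X_meas_F: "j \<le> k \<Longrightarrow> X j \<in> measurable (F k) S"
  unfolding X_def by (rule measurable_compose[OF Z_meas_F st_meas(1)])

lemma T_meas_F: "j \<le> k \<Longrightarrow> T j \<in> borel_measurable (F k)"
  unfolding T_def by (rule measurable_compose[OF Z_meas_F st_val_meas])

lemma X_space: "\<omega> \<in> space M \<Longrightarrow> X k \<omega> \<in> space S"
  using measurable_space[OF X_meas] .

lemma V_pos: "x \<in> space S \<Longrightarrow> 0 < V x"
  using V1[of x] by simp

lemma J_sets_F: "J k \<in> sets (F k)"
proof (cases "m \<le> k")
  case True
  have [measurable]: "X m \<in> measurable (F k) S" using True by (rule X_meas_F)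
  have g: "Measurable.pred (F k) (\<lambda>\<omega>. good (Z j \<omega>))" if "j \<in> {m..k}" for j
    using that by (intro measurable_compose[OF Z_meas_F good_pred]) auto
  have "{\<omega> \<in> space (F k). V (X m \<omega>) \<le> Rr \<and> (\<forall>j\<in>{m..k}. good (Z j \<omega>))} \<in> sets (F k)"
    using g by measurable
  then show ?thesis using True by (simp add: J_def space_F)
next
  case False
  then have "J k = {}" by (auto simp: J_def)
  then show ?thesis by simp
qed

lemma J_sets [measurable]: "J k \<in> sets M"
  by (rule F_sets_M[OF J_sets_F])

lemma J_empty: "k < m \<Longrightarrow> J k = {}"
  by (auto simp: J_def)

lemma J_Suc: "m \<le> k \<Longrightarrow> J (Suc k) \<subseteq> J k"
  by (auto simp: J_def)

lemma J_entry: "\<omega> \<in> J (Suc k) \<Longrightarrow> \<omega> \<notin> J k \<Longrightarrow> Suc k = m \<and> V (X m \<omega>) \<le> Rr"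
  using J_Suc[of k] by (cases "m \<le> k") (auto simp: J_def)

lemma J_D: assumes "\<omega> \<in> J k" shows "T k \<omega> \<in> L" "X k \<omega> \<in> space S" "good (Z k \<omega>)" "\<omega> \<in> space M" "m \<le> k"
proof -
  show g: "good (Z k \<omega>)" and sp: "\<omega> \<in> space M" and "m \<le> k"
    using assms by (auto simp: J_def)
  show "T k \<omega> \<in> L" using g by (auto simp: T_def good_def st_val_def)
  show "X k \<omega> \<in> space S" by (rule X_space[OF sp])
qed

lemma R_integral_good:
  assumes z: "z \<in> space St" and g: "good z"
  shows "(\<And>h::'x \<Rightarrow> real. h \<in> borel_measurable S \<Longrightarrow> (\<integral>z'. h (fst z') \<partial>R z) = (\<integral>y. h y \<partial>P (st_val z) (fst z)))"
    and "(\<And>h::'x \<Rightarrow> ennreal. h \<in> borel_measurable S \<Longrightarrow> (\<integral>\<^sup>+z'. h (fst z') \<partial>R z) = (\<integral>\<^sup>+y. h y \<partial>P (st_val z) (fst z)))"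
proof -
  have p: "st_param z \<noteq> None" "1 \<le> st_nu z" using g by (auto simp: good_def)
  note R = R_post[OF z p]
  show "(\<integral>z'. h (fst z') \<partial>R z) = (\<integral>y. h y \<partial>P (st_val z) (fst z))" if "h \<in> borel_measurable S" for h :: "'x \<Rightarrow> real"
    unfolding R(1) using that by (subst integral_distr[OF R(2)]) (auto intro: measurable_compose[OF st_meas(1)])
  show "(\<integral>\<^sup>+z'. h (fst z') \<partial>R z) = (\<integral>\<^sup>+y. h y \<partial>P (st_val z) (fst z))" if "h \<in> borel_measurable S" for h :: "'x \<Rightarrow> ennreal"
    unfolding R(1) using that by (subst nn_integral_distr[OF R(2)]) (auto intro: measurable_compose[OF st_meas(1)])
qed

text \<open>The fixed point of \<open>c \<mapsto> l * c + b + Rr\<close>: one drift step, plus the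
  contribution of the paths that enter at time \<open>m\<close>.\<close>

definition "Cs = (b + Rr) / (1 - l)"

lemma Cs: "0 \<le> Cs" "l * Cs + b + Rr = Cs" "Rr \<le> Cs" "l * Cs + b \<le> Cs"
proof -
  show 1: "0 \<le> Cs" using b_nonneg Rr l_less by (simp add: Cs_def)
  show 2: "l * Cs + b + Rr = Cs" using l_less by (simp add: Cs_def field_simps)
  have "0 \<le> l * Cs" using 1 l_nonneg by simp
  then show "Rr \<le> Cs" "l * Cs + b \<le> Cs" using 2 b_nonneg Rr by linarith+
qed

lemma EV_step: "(\<integral>\<^sup>+\<omega>. indicator (J k) \<omega> * ennreal (V (X (Suc k) \<omega>)) \<partial>M) \<le>
  ennreal l * (\<integral>\<^sup>+\<omega>. indicator (J k) \<omega> * ennreal (V (X k \<omega>)) \<partial>M) + ennreal b"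
proof -
  have "(\<integral>\<^sup>+\<omega>. indicator (J k) \<omega> * ennreal (V (X (Suc k) \<omega>)) \<partial>M) =
     (\<integral>\<^sup>+\<omega>. indicator (J k) \<omega> * (\<lambda>p. ennreal (V (fst (snd p)))) (Z k \<omega>, Z (Suc k) \<omega>) \<partial>M)"
    by (simp add: X_def)
  also have "\<dots> = (\<integral>\<^sup>+\<omega>. indicator (J k) \<omega> * (\<integral>\<^sup>+z. ennreal (V (fst z)) \<partial>R (Z k \<omega>)) \<partial>M)"
    using measurable_compose[OF measurable_compose[OF measurable_snd st_meas(1)] V_meas]
    by (subst chain_step_nn[OF J_sets_F]) auto
  also have "\<dots> \<le> (\<integral>\<^sup>+\<omega>. ennreal l * (indicator (J k) \<omega> * ennreal (V (X k \<omega>))) + ennreal b \<partial>M)"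
  proof (rule nn_integral_mono)
    fix \<omega> assume \<omega>: "\<omega> \<in> space M"
    show "indicator (J k) \<omega> * (\<integral>\<^sup>+z. ennreal (V (fst z)) \<partial>R (Z k \<omega>)) \<le> ennreal l * (indicator (J k) \<omega> * ennreal (V (X k \<omega>))) + ennreal b"
    proof (cases "\<omega> \<in> J k")
      case True
      have "(\<integral>\<^sup>+z. ennreal (V (fst z)) \<partial>R (Z k \<omega>)) = (\<integral>\<^sup>+y. ennreal (V y) \<partial>P (st_val (Z k \<omega>)) (fst (Z k \<omega>)))"
        by (rule R_integral_good(2)[OF Z_space[OF \<omega>] J_D(3)[OF True]]) simp
      also have "\<dots> \<le> ennreal (l * V (X k \<omega>) + b)"
        using driftL[OF J_D(1,2)[OF True]] by (simp add: T_def X_def)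
      also have "\<dots> = ennreal l * ennreal (V (X k \<omega>)) + ennreal b"
        using l_nonneg b_nonneg V_pos[OF X_space[OF \<omega>, of k]] by (simp add: ennreal_mult)
      finally show ?thesis using True by simp
    qed simp
  qed
  also have "\<dots> = ennreal l * (\<integral>\<^sup>+\<omega>. indicator (J k) \<omega> * ennreal (V (X k \<omega>)) \<partial>M) + ennreal b"
    by (subst nn_integral_add) (auto simp: nn_integral_cmult emeasure_space_1)
  finally show ?thesis .
qed

text \<open>Paths enter only at time \<open>m\<close>, with \<open>V\<close> at most
  \<open>Rr\<close>. All others in \<open>J (Suc k)\<close> were already in \<open>J k\<close>,
  where the parameter lies in \<open>L\<close> and the drift applies.\<close>

lemma EV: "(\<integral>\<^sup>+\<omega>. indicator (J k) \<omega> * ennreal (V (X k \<omega>)) \<partial>M) \<le> ennreal Cs"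
proof (induction k)
  have entry: "(\<integral>\<^sup>+\<omega>. indicator (J k - A) \<omega> * ennreal (V (X k \<omega>)) \<partial>M) \<le> ennreal Rr"
    if "\<And>\<omega>. \<omega> \<in> J k - A \<Longrightarrow> V (X k \<omega>) \<le> Rr" for k A
  proof -
    have "(\<integral>\<^sup>+\<omega>. indicator (J k - A) \<omega> * ennreal (V (X k \<omega>)) \<partial>M) \<le> (\<integral>\<^sup>+\<omega>. ennreal Rr \<partial>M)"
      using that by (intro nn_integral_mono) (auto split: split_indicator intro!: ennreal_leI)
    then show ?thesis by (simp add: emeasure_space_1)
  qed
  {
    case 0
    have "(\<integral>\<^sup>+\<omega>. indicator (J 0 - {}) \<omega> * ennreal (V (X 0 \<omega>)) \<partial>M) \<le> ennreal Rr"
      by (rule entry) (auto simp: J_def)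
    then show ?case using Cs(3) by (auto intro: order_trans ennreal_leI)
  next
    case (Suc k)
    have "(\<integral>\<^sup>+\<omega>. indicator (J (Suc k)) \<omega> * ennreal (V (X (Suc k) \<omega>)) \<partial>M) \<le>
      (\<integral>\<^sup>+\<omega>. indicator (J k) \<omega> * ennreal (V (X (Suc k) \<omega>)) + indicator (J (Suc k) - J k) \<omega> * ennreal (V (X (Suc k) \<omega>)) \<partial>M)"
      by (intro nn_integral_mono) (auto split: split_indicator)
    also have "\<dots> = (\<integral>\<^sup>+\<omega>. indicator (J k) \<omega> * ennreal (V (X (Suc k) \<omega>)) \<partial>M) + (\<integral>\<^sup>+\<omega>. indicator (J (Suc k) - J k) \<omega> * ennreal (V (X (Suc k) \<omega>)) \<partial>M)"
      by (rule nn_integral_add) measurable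
    also have "\<dots> \<le> (ennreal l * ennreal Cs + ennreal b) + ennreal Rr"
      using J_entry by (intro add_mono order_trans[OF EV_step] mult_left_mono Suc entry) fastforce+
    also have "\<dots> = ennreal Cs"
      using Cs(1) l_nonneg b_nonneg Rr by (simp add: ennreal_mult[symmetric] ennreal_plus[symmetric] Cs(2) del: ennreal_plus)
    finally show ?case .
  }
qed

lemma EV_Suc: "(\<integral>\<^sup>+\<omega>. indicator (J k) \<omega> * ennreal (V (X (Suc k) \<omega>)) \<partial>M) \<le> ennreal Cs"
proof -
  have "ennreal l * (\<integral>\<^sup>+\<omega>. indicator (J k) \<omega> * ennreal (V (X k \<omega>)) \<partial>M) + ennreal b \<le> ennreal l * ennreal Cs + ennreal b"
    by (intro add_right_mono mult_left_mono EV) simp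
  also have "\<dots> = ennreal (l * Cs + b)"
    using Cs(1) l_nonneg b_nonneg by (simp add: ennreal_mult)
  also have "\<dots> \<le> ennreal Cs" by (intro ennreal_leI Cs)
  finally show ?thesis using EV_step[of k] by (rule order_trans[rotated])
qed

text \<open>The integrability criterion for increments, correctors and remainders. The moment at
  time \<open>Suc k\<close> is controlled on \<open>J k\<close> already, whether or not the path
  leaves at that moment.\<close>

lemma dominated_J:
  assumes [measurable]: "\<phi> \<in> borel_measurable M" and c: "0 \<le> c"
    and le: "AE \<omega> in M. \<bar>\<phi> \<omega>\<bar> \<le> c * (indicator (J k) \<omega> * (V (X k \<omega>) + V (X (Suc k) \<omega>)))"
  shows "integrable M \<phi>" "(\<integral>\<omega>. \<bar>\<phi> \<omega>\<bar> \<partial>M) \<le> 2 * c * Cs"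
proof -
  have "(\<integral>\<^sup>+\<omega>. ennreal \<bar>\<phi> \<omega>\<bar> \<partial>M) \<le> (\<integral>\<^sup>+\<omega>. ennreal c * (indicator (J k) \<omega> * ennreal (V (X k \<omega>)) + indicator (J k) \<omega> * ennreal (V (X (Suc k) \<omega>))) \<partial>M)"
  proof (rule nn_integral_mono_AE)
    show "AE \<omega> in M. ennreal \<bar>\<phi> \<omega>\<bar> \<le> ennreal c * (indicator (J k) \<omega> * ennreal (V (X k \<omega>)) + indicator (J k) \<omega> * ennreal (V (X (Suc k) \<omega>)))"
      using le AE_space
    proof eventually_elim
      case (elim \<omega>)
      have v: "0 \<le> V (X k \<omega>)" "0 \<le> V (X (Suc k) \<omega>)" using V_pos[OF X_space[OF elim(2)]] by (auto intro: less_imp_le)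
      have "ennreal c * (indicator (J k) \<omega> * ennreal (V (X k \<omega>)) + indicator (J k) \<omega> * ennreal (V (X (Suc k) \<omega>)))
        = ennreal (c * (indicator (J k) \<omega> * (V (X k \<omega>) + V (X (Suc k) \<omega>))))"
        using c v by (simp add: ennreal_mult split: split_indicator)
      then show ?case using elim(1) by (simp add: ennreal_leI)
    qed
  qed
  also have "\<dots> = ennreal c * ((\<integral>\<^sup>+\<omega>. indicator (J k) \<omega> * ennreal (V (X k \<omega>)) \<partial>M) + (\<integral>\<^sup>+\<omega>. indicator (J k) \<omega> * ennreal (V (X (Suc k) \<omega>)) \<partial>M))"
    by (subst nn_integral_cmult, measurable, subst nn_integral_add) auto
  also have "\<dots> \<le> ennreal c * (ennreal Cs + ennreal Cs)"
    by (intro mult_left_mono add_mono EV EV_Suc) simp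
  also have "\<dots> = ennreal (2 * c * Cs)"
    using c Cs(1) by (simp add: ennreal_mult[symmetric] ennreal_plus[symmetric] del: ennreal_plus)
  finally have fin: "(\<integral>\<^sup>+\<omega>. ennreal \<bar>\<phi> \<omega>\<bar> \<partial>M) \<le> ennreal (2 * c * Cs)" .
  then show int: "integrable M \<phi>"
    by (auto simp: integrable_iff_bounded intro: le_less_trans)
  have "ennreal (\<integral>\<omega>. \<bar>\<phi> \<omega>\<bar> \<partial>M) \<le> ennreal (2 * c * Cs)"
    using fin int by (subst nn_integral_eq_integral[symmetric]) auto
  then show "(\<integral>\<omega>. \<bar>\<phi> \<omega>\<bar> \<partial>M) \<le> 2 * c * Cs"
    using c Cs(1) by (subst (asm) ennreal_le_iff) auto
qed

text \<open>On \<open>J k\<close> the new point is drawn from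
  \<open>P (T k \<omega>) (X k \<omega>)\<close>, so conditioning is integration against this
  kernel. The integrand is cut off outside \<open>L\<close>, since measurability in the parameter is
  available only there.\<close>

lemma step_J:
  fixes G :: "'p \<Rightarrow> 'x \<Rightarrow> 'x \<Rightarrow> real"
  assumes G: "(\<lambda>(\<theta>, x, y). if \<theta> \<in> L then G \<theta> x y else 0) \<in> borel_measurable (borel \<Otimes>\<^sub>M (S \<Otimes>\<^sub>M S))"
    and c: "0 \<le> c" "\<And>\<theta> x y. \<theta> \<in> L \<Longrightarrow> x \<in> space S \<Longrightarrow> y \<in> space S \<Longrightarrow> \<bar>G \<theta> x y\<bar> \<le> c * (V x + V y)"
    and A: "A \<in> sets (F k)"
  shows "(\<integral>\<omega>. indicator A \<omega> * (indicator (J k) \<omega> * G (T k \<omega>) (X k \<omega>) (X (Suc k) \<omega>)) \<partial>M) =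
    (\<integral>\<omega>. indicator A \<omega> * (indicator (J k) \<omega> * (\<integral>y. G (T k \<omega>) (X k \<omega>) y \<partial>P (T k \<omega>) (X k \<omega>))) \<partial>M)"
    and "integrable M (\<lambda>\<omega>. indicator A \<omega> * (indicator (J k) \<omega> * G (T k \<omega>) (X k \<omega>) (X (Suc k) \<omega>)))"
proof -
  define G' where "G' \<theta> x y = (if \<theta> \<in> L then G \<theta> x y else 0)" for \<theta> x y
  have G'_meas [measurable]: "(\<lambda>p. G' (fst p) (fst (snd p)) (snd (snd p))) \<in> borel_measurable (borel \<Otimes>\<^sub>M (S \<Otimes>\<^sub>M S))"
  proof -
    have eq: "(\<lambda>(\<theta>, x, y). if \<theta> \<in> L then G \<theta> x y else 0) = (\<lambda>p. G' (fst p) (fst (snd p)) (snd (snd p)))"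
      by (auto simp: G'_def)
    show ?thesis using G unfolding eq .
  qed
  define h where "h p = (if good (fst p) then G' (st_val (fst p)) (fst (fst p)) (fst (snd p)) else 0)"
    for p :: "('x \<times> 'p option \<times> nat \<times> nat) \<times> ('x \<times> 'p option \<times> nat \<times> nat)"
  have [measurable]: "(\<lambda>p. G' (st_val (fst p)) (fst (fst p)) (fst (snd p))) \<in> borel_measurable (St \<Otimes>\<^sub>M St)"
  proof -
    have "(\<lambda>p. (st_val (fst p), fst (fst p), fst (snd p))) \<in> measurable (St \<Otimes>\<^sub>M St) (borel \<Otimes>\<^sub>M (S \<Otimes>\<^sub>M S))"
      by (intro measurable_Pair measurable_compose[OF measurable_fst st_val_meas]
        measurable_compose[OF measurable_fst st_meas(1)] measurable_compose[OF measurable_snd st_meas(1)])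
    from measurable_compose[OF this G'_meas] show ?thesis by simp
  qed
  have h [measurable]: "h \<in> borel_measurable (St \<Otimes>\<^sub>M St)"
    unfolding h_def[abs_def] by measurable
  have AJ: "A \<inter> J k \<in> sets (F k)" using A J_sets_F by auto
  have [measurable]: "A \<inter> J k \<in> sets M" by (rule F_sets_M[OF AJ])
  have hJ: "indicator (A \<inter> J k) \<omega> * h (Z k \<omega>, Z (Suc k) \<omega>) = indicator A \<omega> * (indicator (J k) \<omega> * G (T k \<omega>) (X k \<omega>) (X (Suc k) \<omega>))" for \<omega>
    using J_D[of \<omega> k] by (auto split: split_indicator simp: h_def G'_def T_def X_def)
  have int: "integrable M (\<lambda>\<omega>. indicator (A \<inter> J k) \<omega> * h (Z k \<omega>, Z (Suc k) \<omega>))"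
  proof (rule dominated_J(1)[OF _ c(1)])
    show "AE \<omega> in M. \<bar>indicator (A \<inter> J k) \<omega> * h (Z k \<omega>, Z (Suc k) \<omega>)\<bar> \<le> c * (indicator (J k) \<omega> * (V (X k \<omega>) + V (X (Suc k) \<omega>)))"
    proof (rule AE_I2)
      fix \<omega> assume \<omega>: "\<omega> \<in> space M"
      show "\<bar>indicator (A \<inter> J k) \<omega> * h (Z k \<omega>, Z (Suc k) \<omega>)\<bar> \<le> c * (indicator (J k) \<omega> * (V (X k \<omega>) + V (X (Suc k) \<omega>)))"
        unfolding hJ using c(2)[OF J_D(1), of \<omega> k "X k \<omega>" "X (Suc k) \<omega>"] X_space[OF \<omega>] V_pos[OF X_space[OF \<omega>]] c(1)
        by (auto split: split_indicator intro!: mult_nonneg_nonneg add_nonneg_nonneg less_imp_le[OF V_pos])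
    qed
  qed measurable
  from int show "integrable M (\<lambda>\<omega>. indicator A \<omega> * (indicator (J k) \<omega> * G (T k \<omega>) (X k \<omega>) (X (Suc k) \<omega>)))"
    by (simp add: hJ)
  have "(\<integral>\<omega>. indicator (A \<inter> J k) \<omega> * h (Z k \<omega>, Z (Suc k) \<omega>) \<partial>M) =
    (\<integral>\<omega>. indicator (A \<inter> J k) \<omega> * (\<integral>z. h (Z k \<omega>, z) \<partial>R (Z k \<omega>)) \<partial>M)"
    by (rule chain_step_integral(1)[OF AJ h int])
  also have "\<dots> = (\<integral>\<omega>. indicator A \<omega> * (indicator (J k) \<omega> * (\<integral>y. G (T k \<omega>) (X k \<omega>) y \<partial>P (T k \<omega>) (X k \<omega>))) \<partial>M)"
  proof (rule Bochner_Integration.integral_cong[OF refl])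
    fix \<omega> assume \<omega>: "\<omega> \<in> space M"
    show "indicator (A \<inter> J k) \<omega> * (\<integral>z. h (Z k \<omega>, z) \<partial>R (Z k \<omega>)) = indicator A \<omega> * (indicator (J k) \<omega> * (\<integral>y. G (T k \<omega>) (X k \<omega>) y \<partial>P (T k \<omega>) (X k \<omega>)))"
    proof (cases "\<omega> \<in> J k")
      case True
      note JD = J_D[OF True]
      have m: "(\<lambda>y. G (T k \<omega>) (X k \<omega>) y) \<in> borel_measurable S"
      proof -
        have "(\<lambda>y. G' (T k \<omega>) (X k \<omega>) y) \<in> borel_measurable S"
        proof -
          have "(\<lambda>y. (T k \<omega>, X k \<omega>, y)) \<in> measurable S (borel \<Otimes>\<^sub>M (S \<Otimes>\<^sub>M S))"
            using JD(2) by (intro measurable_Pair measurable_const measurable_ident) (auto simp: space_pair_measure)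
          from measurable_compose[OF this G'_meas] show ?thesis by simp
        qed
        then show ?thesis using JD(1) by (simp add: G'_def)
      qed
      have "(\<integral>z. h (Z k \<omega>, z) \<partial>R (Z k \<omega>)) = (\<integral>z. G (T k \<omega>) (X k \<omega>) (fst z) \<partial>R (Z k \<omega>))"
        using JD by (simp add: h_def G'_def T_def X_def)
      also have "\<dots> = (\<integral>y. G (T k \<omega>) (X k \<omega>) y \<partial>P (T k \<omega>) (X k \<omega>))"
        using R_integral_good(1)[OF Z_space[OF \<omega>] JD(3) m] by (simp add: T_def X_def)
      finally show ?thesis using True by (simp split: split_indicator)
    qed simp
  qed
  finally show "(\<integral>\<omega>. indicator A \<omega> * (indicator (J k) \<omega> * G (T k \<omega>) (X k \<omega>) (X (Suc k) \<omega>)) \<partial>M) =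
    (\<integral>\<omega>. indicator A \<omega> * (indicator (J k) \<omega> * (\<integral>y. G (T k \<omega>) (X k \<omega>) y \<partial>P (T k \<omega>) (X k \<omega>))) \<partial>M)"
    by (simp add: hJ)
qed

text \<open>On \<open>J k\<close> no reprojection has occurred since time \<open>m\<close>, hence
  \<nu> is at least \<open>Suc (k - m)\<close>. As \<gamma> is nonincreasing, this bounds the step
  size at time \<open>k\<close> for every value of \<kappa>.\<close>

definition gam :: "nat \<Rightarrow> real" where "gam k = (if k < m then 0 else \<gamma> (Suc (k - m)))"

lemma gam_nonneg: "0 \<le> gam k"
  using gamma(2) by (auto simp: gam_def less_imp_le)

lemma step_size_AE:
  "AE \<omega> in M. \<forall>k. \<omega> \<in> J k \<longrightarrow> \<omega> \<in> J (Suc k) \<longrightarrow> norm (T (Suc k) \<omega> - T k \<omega>) \<le> gam k * (CH * V (X (Suc k) \<omega>) powr \<beta>)"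
  using trans_AE update_AE AE_space
proof eventually_elim
  case (elim \<omega>)
  have nu: "Suc (k - m) \<le> st_nu (Z k \<omega>)" if "\<omega> \<in> J k" for k
  proof -
    have "m \<le> k" using J_D(5)[OF that] .
    then show ?thesis using that
    proof (induction k rule: dec_induct)
      case base
      then show ?case using J_D(3)[OF base] by (simp add: good_def)
    next
      case (step j)
      have "\<omega> \<in> J j" using step J_Suc[of j] by auto
      then have "Suc (j - m) \<le> st_nu (Z j \<omega>)" by (rule step.IH)
      moreover have "1 \<le> st_nu (Z (Suc j) \<omega>)" using J_D(3)[OF step.prems] by (simp add: good_def)
      then have "st_nu (Z (Suc j) \<omega>) = Suc (st_nu (Z j \<omega>))"
        using elim(1) by (auto simp: trans_rel_def split: if_splits dest!: spec[of _ j])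
      ultimately show ?case using step(1) by (simp add: Suc_diff_le)
    qed
  qed
  show ?case
  proof (intro allI impI)
    fix k assume k: "\<omega> \<in> J k" "\<omega> \<in> J (Suc k)"
    note g = J_D(3)[OF k(1)] and g' = J_D(3)[OF k(2)]
    have "T (Suc k) \<omega> - T k \<omega> = \<gamma> (st_kappa (Z k \<omega>) + st_nu (Z k \<omega>)) *\<^sub>R H (T k \<omega>) (X (Suc k) \<omega>)"
      using elim(2) g g' by (auto simp: good_def T_def X_def)
    then have "norm (T (Suc k) \<omega> - T k \<omega>) = \<gamma> (st_kappa (Z k \<omega>) + st_nu (Z k \<omega>)) * norm (H (T k \<omega>) (X (Suc k) \<omega>))"
      using gamma(2)[of "st_kappa (Z k \<omega>) + st_nu (Z k \<omega>)"] by simp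
    also have "\<dots> \<le> gam k * (CH * V (X (Suc k) \<omega>) powr \<beta>)"
    proof (intro mult_mono)
      show "\<gamma> (st_kappa (Z k \<omega>) + st_nu (Z k \<omega>)) \<le> gam k"
        using J_D(5)[OF k(1)] decseqD[OF gamma(1), of "Suc (k - m)" "st_kappa (Z k \<omega>) + st_nu (Z k \<omega>)"] nu[OF k(1)]
        by (simp add: gam_def)
      show "norm (H (T k \<omega>) (X (Suc k) \<omega>)) \<le> CH * V (X (Suc k) \<omega>) powr \<beta>"
        by (rule H_bound[OF J_D(1)[OF k(1)] J_D(2)[OF k(2)]])
    qed (auto simp: gam_nonneg)
    finally show "norm (T (Suc k) \<omega> - T k \<omega>) \<le> gam k * (CH * V (X (Suc k) \<omega>) powr \<beta>)" .
  qed
qed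

text \<open>From \<open>m\<close> on the events decrease, so a path leaves at most once. The
  induction subtracts the indicator of \<open>J n\<close>: a path that is still inside has not left
  yet.\<close>

lemma exit_sum: "(\<Sum>k<n. indicator (J k - J (Suc k)) \<omega>) \<le> (1::real)"
proof (cases "m \<le> n")
  case True
  then have "(\<Sum>k<n. indicator (J k - J (Suc k)) \<omega>) \<le> 1 - (if m < n \<or> \<omega> \<in> J m then indicator (J n) \<omega> else 0 :: real)"
  proof (induction n rule: dec_induct)
    case base
    have "(\<Sum>k<m. indicator (J k - J (Suc k)) \<omega>) = (0::real)"
      by (rule sum.neutral) (simp add: J_empty)
    then show ?case by (simp split: split_indicator)
  next
    case (step j)
    then show ?case using J_Suc[of j] by (auto split: split_indicator if_splits)
  qed
  then show ?thesis by (auto split: if_splits split_indicator_asm)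
next
  case False
  have "(\<Sum>k<n. indicator (J k - J (Suc k)) \<omega>) = (0::real)"
    using False by (intro sum.neutral) (simp add: J_empty)
  then show ?thesis by simp
qed

end

context sa_local
begin

lemma drift_kernel_L: "\<theta> \<in> L \<Longrightarrow> drift_kernel S V (P \<theta>) l b"
  using L_sub by unfold_locales (auto simp: P_kernel V1 l_nonneg b_nonneg intro: driftL)

lemma Vpowr_le: "x \<in> space S \<Longrightarrow> a \<le> 1 \<Longrightarrow> V x powr a \<le> V x"
  using powr_mono[of a 1 "V x"] V1[of x] by simp

lemma adapted_J:
  assumes h: "lipfam S L W N h" and W: "\<And>x. x \<in> space S \<Longrightarrow> 0 \<le> W x" and k: "k \<le> i" "j \<le> i"
  shows "(\<lambda>\<omega>. indicator (J k) \<omega> * h (T k \<omega>) (X j \<omega>)) \<in> borel_measurable (F i)"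
proof -
  define h' where "h' \<theta> x = (if \<theta> \<in> L then h \<theta> x else 0)" for \<theta> x
  have eq: "(\<lambda>(\<theta>, x). if \<theta> \<in> L then h \<theta> x else 0) = (\<lambda>p. h' (fst p) (snd p))"
    by (auto simp: h'_def)
  have hm: "(\<lambda>p. h' (fst p) (snd p)) \<in> borel_measurable (borel \<Otimes>\<^sub>M S)"
    using lipfam_measurable[OF h L_borel W] unfolding eq .
  have "(\<lambda>\<omega>. (T k \<omega>, X j \<omega>)) \<in> measurable (F i) (borel \<Otimes>\<^sub>M S)"
    by (intro measurable_Pair T_meas_F X_meas_F k)
  from measurable_compose[OF this hm] have [measurable]: "(\<lambda>\<omega>. h' (T k \<omega>) (X j \<omega>)) \<in> borel_measurable (F i)"
    by simp
  have [measurable]: "J k \<in> sets (F i)" using J_sets_F F_mono[OF k(1)] by auto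
  have "(\<lambda>\<omega>. indicator (J k) \<omega> * h' (T k \<omega>) (X j \<omega>)) \<in> borel_measurable (F i)" by measurable
  moreover have "(\<lambda>\<omega>. indicator (J k) \<omega> * h' (T k \<omega>) (X j \<omega>)) = (\<lambda>\<omega>. indicator (J k) \<omega> * h (T k \<omega>) (X j \<omega>))"
    using J_D(1) by (auto simp: h'_def split: split_indicator)
  ultimately show ?thesis by simp
qed

lemma EV_Suc_int: "integrable M (\<lambda>\<omega>. indicator (J k) \<omega> * V (X (Suc k) \<omega>))"
  and EV_Suc_real: "(\<integral>\<omega>. indicator (J k) \<omega> * V (X (Suc k) \<omega>) \<partial>M) \<le> Cs"
proof -
  have nn: "0 \<le> indicator (J k) \<omega> * V (X (Suc k) \<omega>)" if "\<omega> \<in> space M" for \<omega>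
    using V_pos[OF X_space[OF that, of "Suc k"]] by simp
  show int: "integrable M (\<lambda>\<omega>. indicator (J k) \<omega> * V (X (Suc k) \<omega>))"
  proof (rule dominated_J(1)[where c=1 and k=k])
    show "AE \<omega> in M. \<bar>indicator (J k) \<omega> * V (X (Suc k) \<omega>)\<bar> \<le> 1 * (indicator (J k) \<omega> * (V (X k \<omega>) + V (X (Suc k) \<omega>)))"
      by (rule AE_I2) (use V_pos[OF X_space] in \<open>auto split: split_indicator simp: abs_of_pos less_imp_le\<close>)
  qed auto
  have "ennreal (\<integral>\<omega>. indicator (J k) \<omega> * V (X (Suc k) \<omega>) \<partial>M) = (\<integral>\<^sup>+\<omega>. ennreal (indicator (J k) \<omega> * V (X (Suc k) \<omega>)) \<partial>M)"
    using nn by (intro nn_integral_eq_integral[OF int, symmetric]) auto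
  also have "\<dots> = (\<integral>\<^sup>+\<omega>. indicator (J k) \<omega> * ennreal (V (X (Suc k) \<omega>)) \<partial>M)"
    by (intro nn_integral_cong) (auto split: split_indicator)
  also have "\<dots> \<le> ennreal Cs" by (rule EV_Suc)
  finally show "(\<integral>\<omega>. indicator (J k) \<omega> * V (X (Suc k) \<omega>) \<partial>M) \<le> Cs"
    using Cs(1) by (subst (asm) ennreal_le_iff) auto
qed

end

section \<open>The Poisson decomposition of a Lipschitz family along the stopped chain\<close>

locale sa_lip = sa_local +
  fixes g and N N' s :: real
  assumes lip: "lipfam S L (\<lambda>x. V x powr s) N g"
    and lip_act: "lipfam S L (\<lambda>x. V x powr s) N' (\<lambda>\<theta>. kernel_act (P \<theta>) (g \<theta>))"
    and s: "0 \<le> s" "s < 1" "s + \<beta> \<le> 1"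
begin

definition U where "U k \<omega> = indicator (J k) \<omega> * g (T k \<omega>) (X k \<omega>)"

text \<open>Indexed by the time at which the increment becomes known, as \<open>mds_clt\<close>
  requires; the value at 0 is a dummy.\<close>

definition D where "D k \<omega> = (case k of 0 \<Rightarrow> 0
  | Suc k \<Rightarrow> indicator (J k) \<omega> * (g (T k \<omega>) (X (Suc k) \<omega>) - kernel_act (P (T k \<omega>)) (g (T k \<omega>)) (X k \<omega>)))"

text \<open>What the martingale increment and the telescoping term miss: the change of the parameter
  while the path stays in \<open>J\<close>, the uncompensated value when it leaves, and the value
  when it enters at time \<open>m\<close>.\<close>

definition r where "r k \<omega> = (case k of 0 \<Rightarrow> 0 | Suc k \<Rightarrow> U (Suc k) \<omega> - indicator (J k) \<omega> * g (T k \<omega>) (X (Suc k) \<omega>))"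

lemma D_0 [simp]: "D 0 \<omega> = 0" and r_0 [simp]: "r 0 \<omega> = 0"
  by (simp_all add: D_def r_def)

lemma decomposition:
  "indicator (J k) \<omega> * (g (T k \<omega>) (X k \<omega>) - kernel_act (P (T k \<omega>)) (g (T k \<omega>)) (X k \<omega>)) =
    D (Suc k) \<omega> + U k \<omega> - U (Suc k) \<omega> + r (Suc k) \<omega>"
  by (simp add: D_def U_def r_def algebra_simps)

lemma N_nonneg: "0 \<le> N" "0 \<le> N'"
  using lipfamD(1)[OF lip] lipfamD(1)[OF lip_act] .

lemma g_bound: "\<theta> \<in> L \<Longrightarrow> x \<in> space S \<Longrightarrow> \<bar>g \<theta> x\<bar> \<le> N * V x powr s"
  using wboundD[OF lipfamD(2)[OF lip]] .

lemma act_bound: "\<theta> \<in> L \<Longrightarrow> x \<in> space S \<Longrightarrow> \<bar>kernel_act (P \<theta>) (g \<theta>) x\<bar> \<le> N' * V x powr s"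
  using wboundD[OF lipfamD(2)[OF lip_act]] .

lemma U_adapted: "U k \<in> borel_measurable (F k)"
  unfolding U_def by (rule adapted_J[OF lip]) auto

lemma gSuc_adapted: "(\<lambda>\<omega>. indicator (J k) \<omega> * g (T k \<omega>) (X (Suc k) \<omega>)) \<in> borel_measurable (F (Suc k))"
  by (rule adapted_J[OF lip]) auto

lemma D_adapted: "D k \<in> borel_measurable (F k)"
proof (cases k)
  case (Suc j)
  have "(\<lambda>\<omega>. indicator (J j) \<omega> * g (T j \<omega>) (X (Suc j) \<omega>) - indicator (J j) \<omega> * kernel_act (P (T j \<omega>)) (g (T j \<omega>)) (X j \<omega>)) \<in> borel_measurable (F (Suc j))"
    by (intro borel_measurable_diff gSuc_adapted adapted_J[OF lip_act]) auto
  then show ?thesis by (simp add: Suc D_def[abs_def] right_diff_distrib)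
qed (simp add: D_def[abs_def])

lemma measurable_M: "f \<in> borel_measurable (F k) \<Longrightarrow> f \<in> borel_measurable M"
  by (rule measurable_from_subalg[OF F_subalgebra])

lemma U_meas [measurable]: "U k \<in> borel_measurable M" and D_meas [measurable]: "D k \<in> borel_measurable M"
  and gSuc_meas [measurable]: "(\<lambda>\<omega>. indicator (J k) \<omega> * g (T k \<omega>) (X (Suc k) \<omega>)) \<in> borel_measurable M"
  using measurable_M[OF U_adapted] measurable_M[OF D_adapted] measurable_M[OF gSuc_adapted] .

lemma U_le: "\<bar>U k \<omega>\<bar> \<le> indicator (J k) \<omega> * (N * V (X k \<omega>) powr s)"
  using g_bound[OF J_D(1,2)] by (auto simp: U_def split: split_indicator)

lemma D_le: "\<omega> \<in> space M \<Longrightarrow> \<bar>D (Suc k) \<omega>\<bar> \<le> indicator (J k) \<omega> * ((N + N') * (V (X k \<omega>) powr s + V (X (Suc k) \<omega>) powr s))"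
proof (cases "\<omega> \<in> J k")
  case True
  assume \<omega>: "\<omega> \<in> space M"
  have "\<bar>D (Suc k) \<omega>\<bar> \<le> N * V (X (Suc k) \<omega>) powr s + N' * V (X k \<omega>) powr s"
    using g_bound[OF J_D(1)[OF True] X_space[OF \<omega>, of "Suc k"]] act_bound[OF J_D(1,2)[OF True]] True
    by (simp add: D_def)
  also have "\<dots> \<le> (N + N') * (V (X k \<omega>) powr s + V (X (Suc k) \<omega>) powr s)"
    using N_nonneg by (simp add: algebra_simps)
  finally show ?thesis using True by simp
qed (simp add: D_def)

lemma U_int: "integrable M (U k)" and U_bound: "(\<integral>\<omega>. \<bar>U k \<omega>\<bar> \<partial>M) \<le> 2 * N * Cs"
proof -
  have "AE \<omega> in M. \<bar>U k \<omega>\<bar> \<le> N * (indicator (J k) \<omega> * (V (X k \<omega>) + V (X (Suc k) \<omega>)))"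
  proof (rule AE_I2)
    fix \<omega> assume \<omega>: "\<omega> \<in> space M"
    have "\<bar>U k \<omega>\<bar> \<le> indicator (J k) \<omega> * (N * V (X k \<omega>) powr s)" by (rule U_le)
    also have "\<dots> \<le> indicator (J k) \<omega> * (N * (V (X k \<omega>) + V (X (Suc k) \<omega>)))"
      using Vpowr_le[OF X_space[OF \<omega>, of k], of s] s V_pos[OF X_space[OF \<omega>, of "Suc k"]] N_nonneg
      by (intro mult_left_mono) auto
    finally show "\<bar>U k \<omega>\<bar> \<le> N * (indicator (J k) \<omega> * (V (X k \<omega>) + V (X (Suc k) \<omega>)))" by (simp add: mult_ac)
  qed
  from dominated_J[OF U_meas N_nonneg(1) this] show "integrable M (U k)" "(\<integral>\<omega>. \<bar>U k \<omega>\<bar> \<partial>M) \<le> 2 * N * Cs" .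
qed

lemma gSuc_int: "integrable M (\<lambda>\<omega>. indicator (J k) \<omega> * g (T k \<omega>) (X (Suc k) \<omega>))"
proof (rule dominated_J(1)[OF gSuc_meas N_nonneg(1)])
  show "AE \<omega> in M. \<bar>indicator (J k) \<omega> * g (T k \<omega>) (X (Suc k) \<omega>)\<bar> \<le> N * (indicator (J k) \<omega> * (V (X k \<omega>) + V (X (Suc k) \<omega>)))"
  proof (rule AE_I2)
    fix \<omega> assume \<omega>: "\<omega> \<in> space M"
    show "\<bar>indicator (J k) \<omega> * g (T k \<omega>) (X (Suc k) \<omega>)\<bar> \<le> N * (indicator (J k) \<omega> * (V (X k \<omega>) + V (X (Suc k) \<omega>)))"
    proof (cases "\<omega> \<in> J k")
      case True
      have "\<bar>g (T k \<omega>) (X (Suc k) \<omega>)\<bar> \<le> N * V (X (Suc k) \<omega>) powr s"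
        by (rule g_bound[OF J_D(1)[OF True] X_space[OF \<omega>]])
      also have "\<dots> \<le> N * (V (X k \<omega>) + V (X (Suc k) \<omega>))"
        using Vpowr_le[OF X_space[OF \<omega>, of "Suc k"], of s] s V_pos[OF X_space[OF \<omega>, of k]] N_nonneg
        by (intro mult_left_mono) auto
      finally show ?thesis using True by simp
    qed simp
  qed
qed

lemma r_int: "integrable M (r k)"
  using U_int gSuc_int by (cases k) (auto simp: r_def[abs_def])

text \<open>\<open>step_J\<close> for an integrand that is centred under the kernel.\<close>

lemma martingale_difference:
  assumes A: "A \<in> sets (F k)"
  shows "(\<integral>\<omega>. indicator A \<omega> * D (Suc k) \<omega> \<partial>M) = 0" and "integrable M (\<lambda>\<omega>. indicator A \<omega> * D (Suc k) \<omega>)"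
proof -
  define G where "G \<theta> x y = g \<theta> y - kernel_act (P \<theta>) (g \<theta>) x" for \<theta> x y
  have Wnn: "0 \<le> V x powr s" for x by simp
  define g' where "g' p = (if fst p \<in> L then g (fst p) (snd p) else 0)" for p
  define a' where "a' p = (if fst p \<in> L then kernel_act (P (fst p)) (g (fst p)) (snd p) else 0)" for p
  have eq: "(\<lambda>(\<theta>, x). if \<theta> \<in> L then g \<theta> x else 0) = g'" "(\<lambda>(\<theta>, x). if \<theta> \<in> L then kernel_act (P \<theta>) (g \<theta>) x else 0) = a'"
    by (auto simp: g'_def a'_def)
  have gm: "g' \<in> borel_measurable (borel \<Otimes>\<^sub>M S)" "a' \<in> borel_measurable (borel \<Otimes>\<^sub>M S)"
    using lipfam_measurable[OF lip L_borel Wnn] lipfam_measurable[OF lip_act L_borel Wnn] unfolding eq .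
  have "(\<lambda>p. g' (fst p, snd (snd p)) - a' (fst p, fst (snd p))) \<in> borel_measurable (borel \<Otimes>\<^sub>M (S \<Otimes>\<^sub>M S))"
    by (intro borel_measurable_diff measurable_compose[OF _ gm(1)] measurable_compose[OF _ gm(2)]) measurable
  moreover have "(\<lambda>p. g' (fst p, snd (snd p)) - a' (fst p, fst (snd p))) = (\<lambda>(\<theta>, x, y). if \<theta> \<in> L then G \<theta> x y else 0)"
    by (auto simp: g'_def a'_def G_def)
  ultimately have Gm: "(\<lambda>(\<theta>, x, y). if \<theta> \<in> L then G \<theta> x y else 0) \<in> borel_measurable (borel \<Otimes>\<^sub>M (S \<Otimes>\<^sub>M S))"
    by simp
  have Gle: "\<bar>G \<theta> x y\<bar> \<le> (N + N') * (V x + V y)" if "\<theta> \<in> L" "x \<in> space S" "y \<in> space S" for \<theta> x y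
  proof -
    have "\<bar>G \<theta> x y\<bar> \<le> N * V y powr s + N' * V x powr s"
      using g_bound[OF that(1,3)] act_bound[OF that(1,2)] by (simp add: G_def)
    also have "\<dots> \<le> N * V y + N' * V x"
      using N_nonneg s that by (intro add_mono mult_left_mono Vpowr_le) auto
    also have "\<dots> \<le> (N + N') * (V x + V y)"
      using N_nonneg V_pos[OF that(2)] V_pos[OF that(3)] by (simp add: algebra_simps)
    finally show ?thesis .
  qed
  have N0: "0 \<le> N + N'" using N_nonneg by simp
  note step = step_J[OF Gm N0 Gle A]
  have Deq: "indicator (J k) \<omega> * G (T k \<omega>) (X k \<omega>) (X (Suc k) \<omega>) = D (Suc k) \<omega>" for \<omega>
    by (simp add: D_def G_def)
  show "integrable M (\<lambda>\<omega>. indicator A \<omega> * D (Suc k) \<omega>)"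
    using step(2) by (simp add: Deq)
  have "(\<integral>\<omega>. indicator A \<omega> * D (Suc k) \<omega> \<partial>M) = (\<integral>\<omega>. indicator A \<omega> * (indicator (J k) \<omega> * (\<integral>y. G (T k \<omega>) (X k \<omega>) y \<partial>P (T k \<omega>) (X k \<omega>))) \<partial>M)"
    using step(1) by (simp add: Deq)
  also have "\<dots> = (\<integral>\<omega>. 0 \<partial>M)"
  proof (rule Bochner_Integration.integral_cong[OF refl])
    fix \<omega>
    have "(\<integral>y. G (T k \<omega>) (X k \<omega>) y \<partial>P (T k \<omega>) (X k \<omega>)) = 0" if J: "\<omega> \<in> J k"
    proof -
      interpret Pk: drift_kernel S V "P (T k \<omega>)" l b by (rule drift_kernel_L[OF J_D(1)[OF J]])
      have gb: "wbound S V N (g (T k \<omega>))"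
        unfolding wbound_def
      proof (intro conjI ballI)
        show "g (T k \<omega>) \<in> borel_measurable S"
          by (rule wbound_measurable[OF lipfamD(2)[OF lip J_D(1)[OF J]]])
        fix x assume x: "x \<in> space S"
        have "N * V x powr s \<le> N * V x"
          using N_nonneg s by (intro mult_left_mono Vpowr_le[OF x]) auto
        then show "\<bar>g (T k \<omega>) x\<bar> \<le> N * V x"
          using g_bound[OF J_D(1)[OF J] x] by simp
      qed
      show ?thesis
        using Pk.act_diff[OF gb Pk.wbound_const J_D(2)[OF J]] Pk.act_const[OF J_D(2)[OF J]]
        unfolding G_def kernel_act_def by simp
    qed
    then show "indicator A \<omega> * (indicator (J k) \<omega> * (\<integral>y. G (T k \<omega>) (X k \<omega>) y \<partial>P (T k \<omega>) (X k \<omega>))) = 0"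
      by (auto split: split_indicator)
  qed
  finally show "(\<integral>\<omega>. indicator A \<omega> * D (Suc k) \<omega> \<partial>M) = 0" by simp
qed

text \<open>The cases are staying, leaving, entering and being outside. Staying costs the Lipschitz
  modulus times the step size, a quantity of order \<open>V powr (s + \<beta>)\<close> and hence at
  most of order \<open>V\<close>. Leaving is split by \<open>powr_le_interpolate\<close> at the
  level \<open>n\<close>, which will be the length of the sum.\<close>

lemma r_bound_AE:
  fixes n :: nat
  assumes n: "0 < n"
  shows "AE \<omega> in M. \<bar>r (Suc k) \<omega>\<bar> \<le> (N * CH * gam k + N * n powr (s - 1)) * (indicator (J k) \<omega> * V (X (Suc k) \<omega>))
    + N * n powr s * indicator (J k - J (Suc k)) \<omega> + (if Suc k = m then N * Rr else 0)"
  using step_size_AE AE_space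
proof eventually_elim
  case (elim \<omega>)
  note XS = X_space[OF elim(2), of "Suc k"]
  let ?v = "V (X (Suc k) \<omega>)"
  have v: "1 \<le> ?v" by (rule V1[OF XS])
  have nn: "0 \<le> N * CH * gam k" "0 \<le> N * n powr (s - 1)" "0 \<le> N * n powr s" "0 \<le> N * Rr"
    using N_nonneg CH gam_nonneg[of k] Rr by auto
  have last: "0 \<le> (if Suc k = m then N * Rr else 0)" using nn by simp
  consider "\<omega> \<in> J k" "\<omega> \<in> J (Suc k)" | "\<omega> \<in> J k" "\<omega> \<notin> J (Suc k)" | "\<omega> \<notin> J k" "\<omega> \<in> J (Suc k)" | "\<omega> \<notin> J k" "\<omega> \<notin> J (Suc k)"
    by blast
  then show ?case
  proof cases
    case 1
    have "\<bar>r (Suc k) \<omega>\<bar> = \<bar>g (T (Suc k) \<omega>) (X (Suc k) \<omega>) - g (T k \<omega>) (X (Suc k) \<omega>)\<bar>"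
      using 1 by (simp add: r_def U_def)
    also have "\<dots> \<le> N * norm (T (Suc k) \<omega> - T k \<omega>) * ?v powr s"
      by (rule lipfamD(3)[OF lip J_D(1)[OF 1(2)] J_D(1)[OF 1(1)] XS])
    also have "\<dots> \<le> N * (gam k * (CH * ?v powr \<beta>)) * ?v powr s"
      using elim(1) 1 N_nonneg by (intro mult_right_mono mult_left_mono) auto
    also have "\<dots> = N * CH * gam k * ?v powr (\<beta> + s)"
      by (simp add: powr_add)
    also have "\<dots> \<le> N * CH * gam k * ?v"
      using nn s by (intro mult_left_mono Vpowr_le[OF XS]) auto
    also have "\<dots> \<le> (N * CH * gam k + N * n powr (s - 1)) * ?v"
      using nn v by (simp add: distrib_right)
    finally show ?thesis using 1 last nn by (simp add: add_increasing2)
  next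
    case 2
    have "\<bar>r (Suc k) \<omega>\<bar> = \<bar>g (T k \<omega>) (X (Suc k) \<omega>)\<bar>"
      using 2 by (simp add: r_def U_def)
    also have "\<dots> \<le> N * ?v powr s" by (rule g_bound[OF J_D(1)[OF 2(1)] XS])
    also have "\<dots> \<le> N * (n powr (s - 1) * ?v + n powr s)"
      using N_nonneg v n s by (intro mult_left_mono powr_le_interpolate) auto
    also have "\<dots> \<le> (N * CH * gam k + N * n powr (s - 1)) * ?v + N * n powr s"
    proof -
      have "0 \<le> N * CH * gam k * ?v" using mult_nonneg_nonneg[OF nn(1), of ?v] v by simp
      then show ?thesis by (simp add: distrib_right distrib_left mult.assoc)
    qed
    finally show ?thesis using 2 last by simp
  next
    case 3
    note e = J_entry[OF 3(2,1)]
    have "\<bar>r (Suc k) \<omega>\<bar> = \<bar>g (T (Suc k) \<omega>) (X (Suc k) \<omega>)\<bar>"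
      using 3 by (simp add: r_def U_def)
    also have "\<dots> \<le> N * ?v powr s" by (rule g_bound[OF J_D(1)[OF 3(2)] XS])
    also have "\<dots> \<le> N * Rr"
      using N_nonneg s e Vpowr_le[OF XS, of s] by (intro mult_left_mono) auto
    finally show ?thesis using 3 e by simp
  next
    case 4
    then show ?thesis using last by (simp add: r_def U_def)
  qed
qed

text \<open>One part of the exit cost is small but occurs in each of the \<open>n\<close> terms and
  gives \<open>n * n powr (s - 1)\<close>; the other occurs at most once per path. Both are of order
  \<open>n powr s\<close>.\<close>

lemma r_sum:
  fixes n :: nat
  assumes n: "0 < n"
  shows "(\<Sum>k<n. \<integral>\<omega>. \<bar>r (Suc k) \<omega>\<bar> \<partial>M) \<le> N * CH * Cs * (\<Sum>k<n. gam k) + N * (Cs + 1) * n powr s + N * Rr"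
proof -
  have nn: "0 \<le> N * CH * gam k + N * n powr (s - 1)" "0 \<le> N * n powr s" for k
    using N_nonneg CH gam_nonneg[of k] by auto
  have ex: "integrable M (\<lambda>\<omega>. indicat_real (J k - J (Suc k)) \<omega> :: real)" for k
    by (intro integrable_real_indicator) (auto simp: less_top[symmetric])
  have "(\<Sum>k<n. \<integral>\<omega>. \<bar>r (Suc k) \<omega>\<bar> \<partial>M) \<le> (\<Sum>k<n. (N * CH * gam k + N * n powr (s - 1)) * Cs
     + N * n powr s * (\<integral>\<omega>. indicat_real (J k - J (Suc k)) \<omega> \<partial>M) + (if Suc k = m then N * Rr else 0))"
  proof (rule sum_mono)
    fix k
    have "(\<integral>\<omega>. \<bar>r (Suc k) \<omega>\<bar> \<partial>M) \<le> (\<integral>\<omega>. (N * CH * gam k + N * n powr (s - 1)) * (indicator (J k) \<omega> * V (X (Suc k) \<omega>))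
      + N * n powr s * indicat_real (J k - J (Suc k)) \<omega> + (if Suc k = m then N * Rr else 0) \<partial>M)"
      by (rule integral_mono_AE[OF _ _ r_bound_AE[OF n]]) (use r_int EV_Suc_int ex in auto)
    also have "\<dots> = (N * CH * gam k + N * n powr (s - 1)) * (\<integral>\<omega>. indicator (J k) \<omega> * V (X (Suc k) \<omega>) \<partial>M)
      + N * n powr s * (\<integral>\<omega>. indicat_real (J k - J (Suc k)) \<omega> \<partial>M) + (if Suc k = m then N * Rr else 0)"
      using EV_Suc_int[of k] ex[of k] by (subst Bochner_Integration.integral_add Bochner_Integration.integral_mult_right_zero; simp add: prob_space)+
    also have "\<dots> \<le> (N * CH * gam k + N * n powr (s - 1)) * Cs
      + N * n powr s * (\<integral>\<omega>. indicat_real (J k - J (Suc k)) \<omega> \<partial>M) + (if Suc k = m then N * Rr else 0)"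
      using nn by (intro add_right_mono mult_left_mono EV_Suc_real)
    finally show "(\<integral>\<omega>. \<bar>r (Suc k) \<omega>\<bar> \<partial>M) \<le> (N * CH * gam k + N * n powr (s - 1)) * Cs
      + N * n powr s * (\<integral>\<omega>. indicat_real (J k - J (Suc k)) \<omega> \<partial>M) + (if Suc k = m then N * Rr else 0)" .
  qed
  also have "\<dots> = N * CH * Cs * (\<Sum>k<n. gam k) + N * Cs * (n * n powr (s - 1))
     + N * n powr s * (\<Sum>k<n. \<integral>\<omega>. indicat_real (J k - J (Suc k)) \<omega> \<partial>M) + (\<Sum>k<n. if Suc k = m then N * Rr else 0)"
    by (simp only: sum.distrib distrib_right sum_distrib_left[symmetric] sum_distrib_right[symmetric]) (simp add: mult_ac)
  also have "(\<Sum>k<n. \<integral>\<omega>. indicat_real (J k - J (Suc k)) \<omega> \<partial>M) = (\<integral>\<omega>. (\<Sum>k<n. indicat_real (J k - J (Suc k)) \<omega>) \<partial>M)"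
    by (rule Bochner_Integration.integral_sum[symmetric]) (use ex in simp)
  also have "N * n powr s * (\<integral>\<omega>. (\<Sum>k<n. indicat_real (J k - J (Suc k)) \<omega>) \<partial>M) \<le> N * n powr s * (\<integral>\<omega>. 1 \<partial>M)"
    using nn(2) exit_sum ex by (intro mult_left_mono integral_mono) auto
  also have "(\<Sum>k<n. if Suc k = m then N * Rr else 0) \<le> N * Rr"
  proof -
    have "(\<Sum>k<n. if Suc k = m then N * Rr else 0) = (\<Sum>k\<in>{k \<in> {..<n}. Suc k = m}. N * Rr)"
      by (rule sum.inter_filter[symmetric]) simp
    also have "\<dots> = card {k \<in> {..<n}. Suc k = m} * (N * Rr)" by simp
    also have "\<dots> \<le> 1 * (N * Rr)"
    proof (rule mult_right_mono)
      have "{k \<in> {..<n}. Suc k = m} \<subseteq> {m - 1}" by auto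
      then have "card {k \<in> {..<n}. Suc k = m} \<le> card {m - 1}" by (rule card_mono[rotated]) simp
      then show "real (card {k \<in> {..<n}. Suc k = m}) \<le> 1" by simp
    qed (use N_nonneg Rr in simp)
    finally show ?thesis by simp
  qed
  also have "real n * n powr (s - 1) = n powr s"
    using n by (simp add: powr_diff)
  finally show ?thesis
    by (simp add: prob_space algebra_simps)
qed

end

lemma powr_add_le:
  fixes u w q :: real
  assumes "0 \<le> u" "0 \<le> w" "0 \<le> q"
  shows "(u + w) powr q \<le> 2 powr q * (u powr q + w powr q)"
proof -
  have "(u + w) powr q \<le> (2 * max u w) powr q"
    using assms by (intro powr_mono2) auto
  also have "\<dots> = 2 powr q * max u w powr q" using assms by (simp add: powr_mult)
  also have "max u w powr q \<le> u powr q + w powr q"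
    by (auto simp: max_def)
  finally show ?thesis by simp
qed

text \<open>For the product of a power of an increment with the corrector: \<open>u\<close> and
  \<open>w\<close> stand for \<open>V powr a\<close> before and after the step, and the corrector
  after the step is of order \<open>w\<^sup>2\<close>.\<close>

lemma powr_add_mult_sq_le:
  fixes u w q :: real
  assumes "0 < u" "0 < w" "0 \<le> q"
  shows "(u + w) powr q * w\<^sup>2 \<le> 2 powr q * (u powr (q + 2) + w powr (q + 2))"
proof -
  have "(u + w) powr q * w\<^sup>2 \<le> (2 * max u w) powr q * (max u w)\<^sup>2"
    using assms by (intro mult_mono powr_mono2 power_mono) auto
  also have "\<dots> = 2 powr q * max u w powr (q + 2)"
  proof -
    have "0 < max u w" using assms by simp
    then show ?thesis by (simp add: powr_mult powr_add powr_numeral)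
  qed
  also have "max u w powr (q + 2) \<le> u powr (q + 2) + w powr (q + 2)"
    by (auto simp: max_def)
  finally show ?thesis by simp
qed

section \<open>The limit theorem on one compact set, up to the probability of leaving it\<close>

locale sa_clt = sa_local +
  fixes \<pi> f and Nf a l1 b1 A1 \<rho>1 c1 l2 b2 A2 \<rho>2 c2 :: real
  assumes E1: "ergodic_family S (\<lambda>x. V x powr a) P L l1 b1 \<pi> A1 \<rho>1 c1"
    and E2: "ergodic_family S (\<lambda>x. V x powr (2 * a)) P L l2 b2 \<pi> A2 \<rho>2 c2"
    and f_bound: "wbound S (\<lambda>x. V x powr a) Nf f"
    and a: "0 < a" "2 * a + \<beta> \<le> 1" "2 * a < 1"
    and gam_small: "(\<lambda>n. (\<Sum>k<n. gam k) / sqrt (real n)) \<longlonglongrightarrow> 0"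
begin

sublocale E1: ergodic_family S "\<lambda>x. V x powr a" P L l1 b1 \<pi> A1 \<rho>1 c1 by (rule E1)
sublocale E2: ergodic_family S "\<lambda>x. V x powr (2 * a)" P L l2 b2 \<pi> A2 \<rho>2 c2 by (rule E2)

definition fh where "fh \<theta> = poisson_sol S \<pi> (P \<theta>) f"
definition Pf where "Pf \<theta> = kernel_act (P \<theta>) (fh \<theta>)"
definition gv where "gv \<theta> x = kernel_act (P \<theta>) (\<lambda>y. fh \<theta> y * fh \<theta> y) x - Pf \<theta> x * Pf \<theta> x"
text \<open>The corrector: its Poisson equation exchanges the conditional variance for its mean
  under \<pi>.\<close>

definition gh where "gh \<theta> = poisson_sol S \<pi> (P \<theta>) (gv \<theta>)"
definition sig2 where "sig2 \<theta> = (\<integral>x. gv \<theta> x \<partial>\<pi>)"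
definition pf where "pf = (\<integral>x. f x \<partial>\<pi>)"

lemma powr_double: "(\<lambda>x. V x powr a * V x powr a) = (\<lambda>x. V x powr (2 * a))"
  by (simp add: powr_add[symmetric])

lemma fh_lip: "\<exists>N. lipfam S L (\<lambda>x. V x powr a) N fh"
proof -
  obtain \<theta> where "\<theta> \<in> L" using E1.L_nonempty by auto
  from E1.lipfam_poisson[OF E1.lipfam_const[OF f_bound this]] show ?thesis
    unfolding fh_def[abs_def] .
qed

lemma Pf_lip: "\<exists>N. lipfam S L (\<lambda>x. V x powr a) N Pf"
  using fh_lip E1.lipfam_act unfolding Pf_def[abs_def] by blast

lemma fh_sq_lip: "\<exists>N. lipfam S L (\<lambda>x. V x powr (2 * a)) N (\<lambda>\<theta> x. fh \<theta> x * fh \<theta> x)"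
proof -
  obtain N where N: "lipfam S L (\<lambda>x. V x powr a) N fh" using fh_lip by blast
  from lipfam_mult[OF N N] show ?thesis unfolding powr_double by auto
qed

lemma Pf_sq_lip: "\<exists>N. lipfam S L (\<lambda>x. V x powr (2 * a)) N (\<lambda>\<theta> x. Pf \<theta> x * Pf \<theta> x)"
proof -
  obtain N where N: "lipfam S L (\<lambda>x. V x powr a) N Pf" using Pf_lip by blast
  from lipfam_mult[OF N N] show ?thesis unfolding powr_double by auto
qed

lemma gv_lip: "\<exists>N. lipfam S L (\<lambda>x. V x powr (2 * a)) N gv"
proof -
  obtain N1 where "lipfam S L (\<lambda>x. V x powr (2 * a)) N1 (\<lambda>\<theta> x. fh \<theta> x * fh \<theta> x)" using fh_sq_lip by blast
  from E2.lipfam_act[OF this] obtain N3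
    where N3: "lipfam S L (\<lambda>x. V x powr (2 * a)) N3 (\<lambda>\<theta>. kernel_act (P \<theta>) (\<lambda>x. fh \<theta> x * fh \<theta> x))" by blast
  obtain N2 where N2: "lipfam S L (\<lambda>x. V x powr (2 * a)) N2 (\<lambda>\<theta> x. Pf \<theta> x * Pf \<theta> x)" using Pf_sq_lip by blast
  from lipfam_diff[OF N3 N2] show ?thesis unfolding gv_def[abs_def] by blast
qed

lemma gh_lip: "\<exists>N. lipfam S L (\<lambda>x. V x powr (2 * a)) N gh"
  using gv_lip E2.lipfam_poisson unfolding gh_def[abs_def] by blast

lemma kernel_facts:
  assumes \<theta>: "\<theta> \<in> L"
  shows "ergodic_kernel S (\<lambda>x. V x powr a) (P \<theta>) l1 b1 \<pi> A1 \<rho>1" "ergodic_kernel S (\<lambda>x. V x powr (2 * a)) (P \<theta>) l2 b2 \<pi> A2 \<rho>2"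
  by (rule E1.kernels[OF \<theta>], rule E2.kernels[OF \<theta>])

lemma Pf_eq: "\<theta> \<in> L \<Longrightarrow> x \<in> space S \<Longrightarrow> fh \<theta> x - Pf \<theta> x = f x - pf"
  using ergodic_kernel.act_poisson[OF kernel_facts(1) f_bound] by (simp add: Pf_def fh_def pf_def)

lemma gh_eq: "\<theta> \<in> L \<Longrightarrow> x \<in> space S \<Longrightarrow> gh \<theta> x - kernel_act (P \<theta>) (gh \<theta>) x = gv \<theta> x - sig2 \<theta>"
proof -
  assume \<theta>: "\<theta> \<in> L" and x: "x \<in> space S"
  obtain N where "lipfam S L (\<lambda>x. V x powr (2 * a)) N gv" using gv_lip by blast
  from lipfamD(2)[OF this \<theta>] show ?thesis
    using ergodic_kernel.act_poisson[OF kernel_facts(2)[OF \<theta>] _ x] by (simp add: gh_def sig2_def)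
qed

lemma gv_eq:
  assumes \<theta>: "\<theta> \<in> L" and x: "x \<in> space S"
  shows "(\<integral>y. (fh \<theta> y - Pf \<theta> x)\<^sup>2 \<partial>P \<theta> x) = gv \<theta> x"
proof -
  interpret K1: ergodic_kernel S "\<lambda>x. V x powr a" "P \<theta>" l1 b1 \<pi> A1 \<rho>1 by (rule kernel_facts[OF \<theta>])
  interpret K2: ergodic_kernel S "\<lambda>x. V x powr (2 * a)" "P \<theta>" l2 b2 \<pi> A2 \<rho>2 by (rule kernel_facts[OF \<theta>])
  interpret Px: prob_space "P \<theta> x" by (rule markov_kernelD(1)[OF K1.kernel x])
  obtain N where N: "lipfam S L (\<lambda>x. V x powr a) N fh" using fh_lip by blast
  obtain N1 where N1: "lipfam S L (\<lambda>x. V x powr (2 * a)) N1 (\<lambda>\<theta> x. fh \<theta> x * fh \<theta> x)" using fh_sq_lip by blast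
  have i1: "integrable (P \<theta> x) (fh \<theta>)" by (rule K1.integrable_wbound[OF lipfamD(2)[OF N \<theta>] x])
  have i2: "integrable (P \<theta> x) (\<lambda>y. fh \<theta> y * fh \<theta> y)" by (rule K2.integrable_wbound[OF lipfamD(2)[OF N1 \<theta>] x])
  have "(\<integral>y. (fh \<theta> y - Pf \<theta> x)\<^sup>2 \<partial>P \<theta> x) = (\<integral>y. fh \<theta> y * fh \<theta> y - 2 * Pf \<theta> x * fh \<theta> y + Pf \<theta> x * Pf \<theta> x \<partial>P \<theta> x)"
    by (intro Bochner_Integration.integral_cong) (auto simp: power2_eq_square algebra_simps)
  also have "\<dots> = (\<integral>y. fh \<theta> y * fh \<theta> y \<partial>P \<theta> x) - 2 * Pf \<theta> x * (\<integral>y. fh \<theta> y \<partial>P \<theta> x) + Pf \<theta> x * Pf \<theta> x"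
    using i1 i2 by (simp add: Px.prob_space)
  also have "(\<integral>y. fh \<theta> y \<partial>P \<theta> x) = Pf \<theta> x" by (simp add: Pf_def kernel_act_def)
  finally show ?thesis by (simp add: gv_def kernel_act_def)
qed

text \<open>Invariance of \<pi> removes the kernel in front of the squared Poisson solution, which
  turns the mean conditional variance into the asymptotic variance.\<close>

lemma sig2_asym_var: "\<theta> \<in> L \<Longrightarrow> sig2 \<theta> = asym_var S \<pi> (P \<theta>) f"
proof -
  assume \<theta>: "\<theta> \<in> L"
  interpret K2: ergodic_kernel S "\<lambda>x. V x powr (2 * a)" "P \<theta>" l2 b2 \<pi> A2 \<rho>2 by (rule kernel_facts[OF \<theta>])
  obtain N1 where N1: "lipfam S L (\<lambda>x. V x powr (2 * a)) N1 (\<lambda>\<theta> x. fh \<theta> x * fh \<theta> x)" using fh_sq_lip by blast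
  obtain N2 where N2: "lipfam S L (\<lambda>x. V x powr (2 * a)) N2 (\<lambda>\<theta> x. Pf \<theta> x * Pf \<theta> x)" using Pf_sq_lip by blast
  note i = K2.integrable_pi[OF lipfamD(2)[OF N1 \<theta>]] K2.integrable_pi[OF lipfamD(2)[OF N2 \<theta>]]
    K2.integrable_pi[OF K2.wbound_act[OF lipfamD(2)[OF N1 \<theta>] lipfamD(1)[OF N1]]]
  show ?thesis
    unfolding sig2_def gv_def asym_var_def fh_def[symmetric] Pf_def[symmetric] power2_eq_square
    using i K2.pi_act[OF lipfamD(2)[OF N1 \<theta>]] by simp
qed

lemma sig2_nonneg: "\<theta> \<in> L \<Longrightarrow> 0 \<le> sig2 \<theta>"
proof -
  assume \<theta>: "\<theta> \<in> L"
  interpret K2: ergodic_kernel S "\<lambda>x. V x powr (2 * a)" "P \<theta>" l2 b2 \<pi> A2 \<rho>2 by (rule kernel_facts[OF \<theta>])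
  have "0 \<le> gv \<theta> x" if "x \<in> space S" for x
    unfolding gv_eq[OF \<theta> that, symmetric] by simp
  then show ?thesis
    unfolding sig2_def by (intro integral_nonneg_AE AE_I2) (simp add: K2.space_pi)
qed

lemma sig2_continuous: "continuous_on L sig2"
  using gv_lip E2.lipfam_pi_continuous unfolding sig2_def[abs_def] by blast

text \<open>Some upper bound; it exists because \<open>sig2\<close> is continuous on the compact set
  \<open>L\<close>.\<close>

definition cs where "cs = (SOME c. \<forall>\<theta>\<in>L. sig2 \<theta> \<le> c)"

lemma sig2_le: "\<theta> \<in> L \<Longrightarrow> sig2 \<theta> \<le> cs"
proof -
  have "compact (sig2 ` L)" by (rule compact_continuous_image[OF sig2_continuous L_compact])
  then have "bdd_above (sig2 ` L)" by (intro bounded_imp_bdd_above compact_imp_bounded)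
  then have "\<exists>c. \<forall>\<theta>\<in>L. sig2 \<theta> \<le> c" by (auto simp: bdd_above_def)
  from someI_ex[OF this] show "\<theta> \<in> L \<Longrightarrow> sig2 \<theta> \<le> cs" by (simp add: cs_def)
qed

definition sk where "sk k \<omega> = indicator (J k) \<omega> * sig2 (T k \<omega>)"

text \<open>Continuity of \<open>sig2\<close> is known on \<open>L\<close> only; the cut-off is
  Borel on the whole space and may be composed with the random parameter.\<close>

definition sig2L where "sig2L \<theta> = indicator L \<theta> *\<^sub>R sig2 \<theta>"

lemma sig2L_meas [measurable]: "sig2L \<in> borel_measurable borel"
  unfolding sig2L_def[abs_def] by (rule borel_measurable_continuous_on_indicator[OF L_borel sig2_continuous])

lemma sk_eq: "sk k \<omega> = indicator (J k) \<omega> * sig2L (T k \<omega>)"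
  using J_D(1) by (auto simp: sk_def sig2L_def split: split_indicator)

lemma sk_adapted: "sk k \<in> borel_measurable (F k)"
proof -
  note [measurable] = T_meas_F[OF order_refl] J_sets_F
  show ?thesis unfolding sk_eq[abs_def] by measurable
qed

lemma sk_bounds: "0 \<le> sk k \<omega>" "sk k \<omega> \<le> max 0 cs"
  using sig2_nonneg[OF J_D(1)[of \<omega> k]] sig2_le[OF J_D(1)[of \<omega> k]] by (auto simp: sk_def split: split_indicator)

text \<open>With \<open>a * p \<le> 1\<close> and \<open>a * (\<eta> + 2) \<le> 1\<close>, the p-th
  power of an increment, and its power \<eta> times the corrector of order
  \<open>V powr (2 * a)\<close>, are dominated by values of \<open>V\<close>, whose moments are
  bounded. The gap \<open>2 * a < 1\<close> leaves room for \<open>p > 2\<close> and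
  \<open>\<eta> > 0\<close>.\<close>

definition p where "p = min 3 (1 / a)"
definition \<eta> where "\<eta> = min 1 (1 / a - 2)"

lemma p_\<eta>: "2 < p" "p \<le> 3" "0 < \<eta>" "\<eta> \<le> 1" "a * p \<le> 1" "a * (\<eta> + 2) \<le> 1"
proof -
  have "2 < 1 / a" using a by (simp add: field_simps)
  then show "2 < p" "p \<le> 3" "0 < \<eta>" "\<eta> \<le> 1" by (auto simp: p_def \<eta>_def)
  have "a * p \<le> a * (1 / a)" using a by (intro mult_left_mono) (auto simp: p_def)
  then show "a * p \<le> 1" using a by simp
  have "a * (\<eta> + 2) \<le> a * (1 / a)" using a by (intro mult_left_mono) (auto simp: \<eta>_def)
  then show "a * (\<eta> + 2) \<le> 1" using a by simp
qed

definition Jinf where "Jinf = (\<Inter>k\<in>{m..}. J k)"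

lemma Jinf_sets [measurable]: "Jinf \<in> sets M"
  unfolding Jinf_def by (intro sets.countable_INT') auto

text \<open>Outside \<open>Jinf\<close> the stopped sums are eventually constant, so only \<open>Jinf\<close> matters in the limit.\<close>

theorem local_clt:
  fixes \<theta>_lim :: "'c \<Rightarrow> 'b" and \<psi> :: "real \<Rightarrow> real" and \<sigma>2 :: "'c \<Rightarrow> real"
  assumes \<theta>_lim [measurable]: "\<theta>_lim \<in> borel_measurable M"
    and conv: "AE \<omega> in M. (\<lambda>k. T k \<omega>) \<longlonglongrightarrow> \<theta>_lim \<omega>"
    and \<psi>: "continuous_on UNIV \<psi>" "\<And>x. \<bar>\<psi> x\<bar> \<le> cu"
    and \<sigma>2 [measurable]: "\<sigma>2 \<in> borel_measurable M" and \<sigma>2_nn: "AE \<omega> in M. 0 \<le> \<sigma>2 \<omega>"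
    and \<sigma>2_eq: "\<And>\<omega>. \<theta>_lim \<omega> \<in> L \<Longrightarrow> \<sigma>2 \<omega> = sig2 (\<theta>_lim \<omega>)"
  shows "\<exists>e. e \<longlonglongrightarrow> 0 \<and> (\<forall>n. norm ((\<integral>\<omega>. exp (\<i> * complex_of_real (\<psi> (\<sigma>2 \<omega>) * (\<Sum>k=1..n. f (X k \<omega>) - pf) / sqrt (real n))) \<partial>M)
    - (\<integral>\<omega>. complex_of_real (exp (- ((\<psi> (\<sigma>2 \<omega>))\<^sup>2 * \<sigma>2 \<omega> / 2))) \<partial>M)) \<le> e n + 4 * prob (space M - Jinf))"
proof -
  obtain N1 where N1: "lipfam S L (\<lambda>x. V x powr a) N1 fh" using fh_lip by blast
  obtain N1' where N1': "lipfam S L (\<lambda>x. V x powr a) N1' Pf" using Pf_lip by blast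
  obtain N2 where N2: "lipfam S L (\<lambda>x. V x powr (2 * a)) N2 gh" using gh_lip by blast
  obtain N3 where N3: "lipfam S L (\<lambda>x. V x powr (2 * a)) N3 gv" using gv_lip by blast
  \<comment> \<open>\<open>A\<close> is the decomposition of \<open>f\<close> through its Poisson
    solution, at exponent \<open>a\<close>; \<open>B\<close> is that of the conditional variance, at
    exponent \<open>2 * a\<close>.\<close>
  interpret A: sa_lip S \<Theta> P H proj \<gamma> K M Z z\<^sub>0 V L m Rr l b \<beta> CH fh N1 N1' a
    using N1 N1' a \<beta> by unfold_locales (auto simp: Pf_def[abs_def])
  interpret B: sa_lip S \<Theta> P H proj \<gamma> K M Z z\<^sub>0 V L m Rr l b \<beta> CH gh N2 "N2 * (l2 + b2) + c2 * N2" "2 * a"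
    using N2 E2.lipfam_act[OF N2] a \<beta> by unfold_locales auto
  define c1' where "c1' = (N1 + N1') powr p * 2 powr p"
  define c2' where "c2' = (N1 + N1') powr \<eta> * 2 powr \<eta> * N2"
  have c': "0 \<le> c1'" "0 \<le> c2'" using B.N_nonneg by (auto simp: c1'_def c2'_def)
  have NN: "0 \<le> N1 + N1'" using A.N_nonneg by simp
  have Vpos: "0 < V (X k \<omega>) powr a" if "\<omega> \<in> space M" for k \<omega>
    using V_pos[OF X_space[OF that, of k]] by simp
  have Da: "\<bar>A.D (Suc k) \<omega>\<bar> powr q \<le> indicator (J k) \<omega> * ((N1 + N1') powr q * (V (X k \<omega>) powr a + V (X (Suc k) \<omega>) powr a) powr q)"
    if "\<omega> \<in> space M" "0 < q" for k \<omega> q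
  proof (cases "\<omega> \<in> J k")
    case True
    have "\<bar>A.D (Suc k) \<omega>\<bar> powr q \<le> ((N1 + N1') * (V (X k \<omega>) powr a + V (X (Suc k) \<omega>) powr a)) powr q"
      using A.D_le[OF that(1), of k] True that(2) by (intro powr_mono2) auto
    then show ?thesis using True NN by (simp add: powr_mult)
  qed (simp add: A.D_def)
  have AE1: "AE \<omega> in M. \<bar>\<bar>A.D (Suc k) \<omega>\<bar> powr p\<bar> \<le> c1' * (indicator (J k) \<omega> * (V (X k \<omega>) + V (X (Suc k) \<omega>)))" for k
  proof (rule AE_I2)
    fix \<omega> assume \<omega>: "\<omega> \<in> space M"
    have "(V (X k \<omega>) powr a + V (X (Suc k) \<omega>) powr a) powr p \<le> 2 powr p * ((V (X k \<omega>) powr a) powr p + (V (X (Suc k) \<omega>) powr a) powr p)"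
      using p_\<eta> by (intro powr_add_le) auto
    also have "\<dots> \<le> 2 powr p * (V (X k \<omega>) + V (X (Suc k) \<omega>))"
      unfolding powr_powr using p_\<eta>(5) X_space[OF \<omega>] by (intro mult_left_mono add_mono Vpowr_le) auto
    finally have "(N1 + N1') powr p * (V (X k \<omega>) powr a + V (X (Suc k) \<omega>) powr a) powr p \<le> c1' * (V (X k \<omega>) + V (X (Suc k) \<omega>))"
      unfolding c1'_def mult.assoc by (intro mult_left_mono) auto
    then have "indicator (J k) \<omega> * ((N1 + N1') powr p * (V (X k \<omega>) powr a + V (X (Suc k) \<omega>) powr a) powr p) \<le> indicator (J k) \<omega> * (c1' * (V (X k \<omega>) + V (X (Suc k) \<omega>)))"
      by (intro mult_left_mono) auto
    with Da[OF \<omega>, of p k] p_\<eta>(1) show "\<bar>\<bar>A.D (Suc k) \<omega>\<bar> powr p\<bar> \<le> c1' * (indicator (J k) \<omega> * (V (X k \<omega>) + V (X (Suc k) \<omega>)))"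
      by (simp add: mult.left_commute)
  qed
  have AE2: "AE \<omega> in M. \<bar>\<bar>A.D (Suc k) \<omega>\<bar> powr \<eta> * \<bar>B.U (Suc k) \<omega>\<bar>\<bar> \<le> c2' * (indicator (J k) \<omega> * (V (X k \<omega>) + V (X (Suc k) \<omega>)))" for k
  proof (rule AE_I2)
    fix \<omega> assume \<omega>: "\<omega> \<in> space M"
    define u w where "u = V (X k \<omega>) powr a" and "w = V (X (Suc k) \<omega>) powr a"
    have uw: "0 < u" "0 < w" using Vpos[OF \<omega>] by (auto simp: u_def w_def)
    have w2: "V (X (Suc k) \<omega>) powr (2 * a) = w\<^sup>2"
      by (simp add: w_def power2_eq_square powr_add[symmetric])
    have Ule: "\<bar>B.U (Suc k) \<omega>\<bar> \<le> N2 * w\<^sup>2"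
      using B.U_le[of "Suc k" \<omega>] B.N_nonneg by (auto simp: w2 split: split_indicator_asm intro: order_trans)
    have "\<bar>A.D (Suc k) \<omega>\<bar> powr \<eta> * \<bar>B.U (Suc k) \<omega>\<bar> \<le> (indicator (J k) \<omega> * ((N1 + N1') powr \<eta> * (u + w) powr \<eta>)) * (N2 * w\<^sup>2)"
      using Da[OF \<omega> p_\<eta>(3), of k] Ule unfolding u_def[symmetric] w_def[symmetric] by (intro mult_mono) auto
    also have "\<dots> = indicator (J k) \<omega> * ((N1 + N1') powr \<eta> * N2 * ((u + w) powr \<eta> * w\<^sup>2))"
      by (simp add: mult_ac)
    also have "\<dots> \<le> indicator (J k) \<omega> * ((N1 + N1') powr \<eta> * N2 * (2 powr \<eta> * (u powr (\<eta> + 2) + w powr (\<eta> + 2))))"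
      using uw p_\<eta> B.N_nonneg by (intro mult_left_mono powr_add_mult_sq_le) auto
    also have "\<dots> \<le> indicator (J k) \<omega> * ((N1 + N1') powr \<eta> * N2 * (2 powr \<eta> * (V (X k \<omega>) + V (X (Suc k) \<omega>))))"
      unfolding u_def w_def powr_powr using p_\<eta>(6) X_space[OF \<omega>] B.N_nonneg by (intro mult_left_mono add_mono Vpowr_le) auto
    also have "\<dots> = c2' * (indicator (J k) \<omega> * (V (X k \<omega>) + V (X (Suc k) \<omega>)))"
      by (simp add: c2'_def mult_ac)
    finally show "\<bar>\<bar>A.D (Suc k) \<omega>\<bar> powr \<eta> * \<bar>B.U (Suc k) \<omega>\<bar>\<bar> \<le> c2' * (indicator (J k) \<omega> * (V (X k \<omega>) + V (X (Suc k) \<omega>)))"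
      by simp
  qed
  have Dp_meas: "(\<lambda>\<omega>. \<bar>A.D k \<omega>\<bar> powr q) \<in> borel_measurable M" for k q by measurable
  have DU_meas: "(\<lambda>\<omega>. \<bar>A.D k \<omega>\<bar> powr \<eta> * \<bar>B.U k \<omega>\<bar>) \<in> borel_measurable M" for k by measurable
  note dom1 = dominated_J[OF Dp_meas c'(1) AE1] and dom2 = dominated_J[OF DU_meas c'(2) AE2]
  define CU where "CU = 2 * N2 * Cs + 2 * c2' * Cs"
  have CU: "2 * N2 * Cs \<le> CU" "2 * c2' * Cs \<le> CU" "0 \<le> CU"
    using B.N_nonneg c' Cs(1) by (auto simp: CU_def)
  define DG where "DG \<theta> x y = (fh \<theta> y - Pf \<theta> x)\<^sup>2" for \<theta> x y
  have gvJ_int: "integrable M (\<lambda>\<omega>. indicator (J k) \<omega> * gv (T k \<omega>) (X k \<omega>))" for k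
  proof (rule dominated_J(1)[where c=N3 and k=k])
    show "(\<lambda>\<omega>. indicator (J k) \<omega> * gv (T k \<omega>) (X k \<omega>)) \<in> borel_measurable M"
      by (rule A.measurable_M[OF adapted_J[OF N3]]) auto
    show "AE \<omega> in M. \<bar>indicator (J k) \<omega> * gv (T k \<omega>) (X k \<omega>)\<bar> \<le> N3 * (indicator (J k) \<omega> * (V (X k \<omega>) + V (X (Suc k) \<omega>)))"
    proof (rule AE_I2)
      fix \<omega> assume \<omega>: "\<omega> \<in> space M"
      show "\<bar>indicator (J k) \<omega> * gv (T k \<omega>) (X k \<omega>)\<bar> \<le> N3 * (indicator (J k) \<omega> * (V (X k \<omega>) + V (X (Suc k) \<omega>)))"
      proof (cases "\<omega> \<in> J k")
        case True
        have "\<bar>gv (T k \<omega>) (X k \<omega>)\<bar> \<le> N3 * V (X k \<omega>) powr (2 * a)"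
          by (rule wboundD[OF lipfamD(2)[OF N3 J_D(1)[OF True]] J_D(2)[OF True]])
        also have "\<dots> \<le> N3 * (V (X k \<omega>) + V (X (Suc k) \<omega>))"
          using Vpowr_le[OF X_space[OF \<omega>, of k], of "2 * a"] a V_pos[OF X_space[OF \<omega>, of "Suc k"]] lipfamD(1)[OF N3]
          by (intro mult_left_mono) auto
        finally show ?thesis using True by simp
      qed simp
    qed
  qed (rule lipfamD(1)[OF N3])
  have ind_int: "integrable M (\<lambda>\<omega>. indicator A \<omega> * h \<omega>)" if "A \<in> sets (F k)" "integrable M h" for A k and h :: "'c \<Rightarrow> real"
    using integrable_mult_indicator[OF F_sets_M[OF that(1)] that(2)] by simp
  have DG_step: "(\<integral>\<omega>. indicator A \<omega> * (A.D (Suc k) \<omega>)\<^sup>2 \<partial>M) = (\<integral>\<omega>. indicator A \<omega> * (indicator (J k) \<omega> * gv (T k \<omega>) (X k \<omega>)) \<partial>M)"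
    "integrable M (\<lambda>\<omega>. indicator A \<omega> * (A.D (Suc k) \<omega>)\<^sup>2)"
    if A: "A \<in> sets (F k)" for A k
  proof -
    define g' where "g' p = (if fst p \<in> L then fh (fst p) (snd p) else 0)" for p
    define a' where "a' p = (if fst p \<in> L then Pf (fst p) (snd p) else 0)" for p
    have eq: "(\<lambda>(\<theta>, x). if \<theta> \<in> L then fh \<theta> x else 0) = g'" "(\<lambda>(\<theta>, x). if \<theta> \<in> L then Pf \<theta> x else 0) = a'"
      by (auto simp: g'_def a'_def)
    have gm: "g' \<in> borel_measurable (borel \<Otimes>\<^sub>M S)" "a' \<in> borel_measurable (borel \<Otimes>\<^sub>M S)"
      using lipfam_measurable[OF N1 L_borel] lipfam_measurable[OF N1' L_borel] unfolding eq by auto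
    have "(\<lambda>p. (g' (fst p, snd (snd p)) - a' (fst p, fst (snd p)))\<^sup>2) \<in> borel_measurable (borel \<Otimes>\<^sub>M (S \<Otimes>\<^sub>M S))"
      by (intro borel_measurable_power borel_measurable_diff measurable_compose[OF _ gm(1)] measurable_compose[OF _ gm(2)]) measurable
    moreover have "(\<lambda>p. (g' (fst p, snd (snd p)) - a' (fst p, fst (snd p)))\<^sup>2) = (\<lambda>(\<theta>, x, y). if \<theta> \<in> L then DG \<theta> x y else 0)"
      by (auto simp: g'_def a'_def DG_def)
    ultimately have Gm: "(\<lambda>(\<theta>, x, y). if \<theta> \<in> L then DG \<theta> x y else 0) \<in> borel_measurable (borel \<Otimes>\<^sub>M (S \<Otimes>\<^sub>M S))"
      by simp
    have Gle: "\<bar>DG \<theta> x y\<bar> \<le> (2 * (N1\<^sup>2 + N1'\<^sup>2)) * (V x + V y)" if \<theta>: "\<theta> \<in> L" and x: "x \<in> space S" and y: "y \<in> space S" for \<theta> x y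
    proof -
      have sq: "(V z powr a)\<^sup>2 \<le> V z" if "z \<in> space S" for z
        using Vpowr_le[OF that, of "a + a"] a by (simp add: power2_eq_square powr_add[symmetric])
      have 1: "(fh \<theta> y)\<^sup>2 \<le> N1\<^sup>2 * V y"
      proof -
        have "(fh \<theta> y)\<^sup>2 \<le> (N1 * V y powr a)\<^sup>2"
          using power_mono[OF A.g_bound[OF \<theta> y], of 2] by simp
        also have "\<dots> \<le> N1\<^sup>2 * V y" using sq[OF y] by (simp add: power_mult_distrib mult_left_mono)
        finally show ?thesis .
      qed
      have 2: "(Pf \<theta> x)\<^sup>2 \<le> N1'\<^sup>2 * V x"
      proof -
        have "(Pf \<theta> x)\<^sup>2 \<le> (N1' * V x powr a)\<^sup>2"
          using power_mono[OF wboundD[OF lipfamD(2)[OF N1' \<theta>] x], of 2] by simp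
        also have "\<dots> \<le> N1'\<^sup>2 * V x" using sq[OF x] by (simp add: power_mult_distrib mult_left_mono)
        finally show ?thesis .
      qed
      have "DG \<theta> x y \<le> 2 * ((fh \<theta> y)\<^sup>2 + (Pf \<theta> x)\<^sup>2)"
        using zero_le_power2[of "fh \<theta> y + Pf \<theta> x"] by (simp add: DG_def power2_eq_square algebra_simps)
      also have "\<dots> \<le> 2 * (N1\<^sup>2 * V y + N1'\<^sup>2 * V x)" using 1 2 by simp
      also have "\<dots> \<le> (2 * (N1\<^sup>2 + N1'\<^sup>2)) * (V x + V y)"
        using V_pos[OF x] V_pos[OF y] by (simp add: algebra_simps)
      finally show ?thesis by (simp add: DG_def)
    qed
    note step = step_J[OF Gm _ Gle A]
    have Deq: "indicator (J k) \<omega> * DG (T k \<omega>) (X k \<omega>) (X (Suc k) \<omega>) = (A.D (Suc k) \<omega>)\<^sup>2" for \<omega>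
      by (auto simp: A.D_def DG_def Pf_def split: split_indicator)
    show "integrable M (\<lambda>\<omega>. indicator A \<omega> * (A.D (Suc k) \<omega>)\<^sup>2)"
      using step(2) by (simp add: Deq)
    have "(\<integral>\<omega>. indicator A \<omega> * (A.D (Suc k) \<omega>)\<^sup>2 \<partial>M) = (\<integral>\<omega>. indicator A \<omega> * (indicator (J k) \<omega> * (\<integral>y. DG (T k \<omega>) (X k \<omega>) y \<partial>P (T k \<omega>) (X k \<omega>))) \<partial>M)"
      using step(1) by (simp add: Deq)
    also have "\<dots> = (\<integral>\<omega>. indicator A \<omega> * (indicator (J k) \<omega> * gv (T k \<omega>) (X k \<omega>)) \<partial>M)"
      using gv_eq J_D by (intro Bochner_Integration.integral_cong) (auto simp: DG_def split: split_indicator)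
    finally show "(\<integral>\<omega>. indicator A \<omega> * (A.D (Suc k) \<omega>)\<^sup>2 \<partial>M) = (\<integral>\<omega>. indicator A \<omega> * (indicator (J k) \<omega> * gv (T k \<omega>) (X k \<omega>)) \<partial>M)" .
  qed
  \<comment> \<open>The Poisson equation for \<open>gv\<close> and the decomposition
    \<open>B\<close> express \<open>sk\<close> through \<open>gv\<close>. The bracket thereby
    becomes the squared increment minus its conditional mean, plus a martingale difference of
    \<open>B\<close>.\<close>
  have var: "(\<integral>\<omega>. indicator A \<omega> * ((A.D (Suc k) \<omega>)\<^sup>2 - sk k \<omega> - B.U k \<omega> + B.U (Suc k) \<omega> - B.r (Suc k) \<omega>) \<partial>M) = 0"
    if A: "A \<in> sets (F k)" for A k
  proof -
    have eq: "indicator A \<omega> * ((A.D (Suc k) \<omega>)\<^sup>2 - sk k \<omega> - B.U k \<omega> + B.U (Suc k) \<omega> - B.r (Suc k) \<omega>) =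
      indicator A \<omega> * (A.D (Suc k) \<omega>)\<^sup>2 - indicator A \<omega> * (indicator (J k) \<omega> * gv (T k \<omega>) (X k \<omega>)) + indicator A \<omega> * B.D (Suc k) \<omega>" for \<omega>
    proof -
      have "indicator (J k) \<omega> * gv (T k \<omega>) (X k \<omega>) - sk k \<omega> = indicator (J k) \<omega> * (gh (T k \<omega>) (X k \<omega>) - kernel_act (P (T k \<omega>)) (gh (T k \<omega>)) (X k \<omega>))"
        using gh_eq[OF J_D(1,2)] by (auto simp: sk_def split: split_indicator)
      also have "\<dots> = B.D (Suc k) \<omega> + B.U k \<omega> - B.U (Suc k) \<omega> + B.r (Suc k) \<omega>" by (rule B.decomposition)
      finally have "sk k \<omega> = indicator (J k) \<omega> * gv (T k \<omega>) (X k \<omega>) - (B.D (Suc k) \<omega> + B.U k \<omega> - B.U (Suc k) \<omega> + B.r (Suc k) \<omega>)" by simp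
      then show ?thesis by (simp only:) (simp add: algebra_simps)
    qed
    show ?thesis
      unfolding eq using DG_step[OF A] ind_int[OF A gvJ_int] B.martingale_difference[OF A] by simp
  qed
  have sqrt0: "(\<lambda>n. 1 / sqrt (real n)) \<longlonglongrightarrow> 0"
    by (intro tendsto_divide_0[OF tendsto_const] filterlim_at_top_imp_at_infinity
        filterlim_compose[OF sqrt_at_top filterlim_real_sequentially])
  have pw: "(\<lambda>n. real n powr q) \<longlonglongrightarrow> 0" if "q < 0" for q
    using that by (intro tendsto_neg_powr filterlim_real_sequentially)
  \<comment> \<open>The division is by \<open>n\<close> and not by its root, so the larger exponent
    \<open>2 * a < 1\<close> is affordable here.\<close>
  have r_small: "(\<lambda>n. (\<Sum>k<n. \<integral>\<omega>. \<bar>B.r (Suc k) \<omega>\<bar> \<partial>M) / real n) \<longlonglongrightarrow> 0"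
  proof -
    have "(\<lambda>n. N2 * CH * Cs * ((\<Sum>k<n. gam k) / sqrt n * (1 / sqrt n)) + N2 * (Cs + 1) * n powr (2 * a - 1) + N2 * Rr * (1 / n)) \<longlonglongrightarrow>
      N2 * CH * Cs * (0 * 0) + N2 * (Cs + 1) * 0 + N2 * Rr * 0"
      using a by (intro tendsto_intros gam_small sqrt0 pw lim_1_over_n) auto
    then have lim: "(\<lambda>n. N2 * CH * Cs * ((\<Sum>k<n. gam k) / sqrt n * (1 / sqrt n)) + N2 * (Cs + 1) * n powr (2 * a - 1) + N2 * Rr * (1 / n)) \<longlonglongrightarrow> 0"
      by simp
    show ?thesis
    proof (rule tendsto_sandwich[OF _ _ tendsto_const lim])
      show "\<forall>\<^sub>F n in sequentially. 0 \<le> (\<Sum>k<n. \<integral>\<omega>. \<bar>B.r (Suc k) \<omega>\<bar> \<partial>M) / real n"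
        by (intro always_eventually allI divide_nonneg_nonneg sum_nonneg) auto
      show "\<forall>\<^sub>F n in sequentially. (\<Sum>k<n. \<integral>\<omega>. \<bar>B.r (Suc k) \<omega>\<bar> \<partial>M) / real n \<le> N2 * CH * Cs * ((\<Sum>k<n. gam k) / sqrt n * (1 / sqrt n)) + N2 * (Cs + 1) * n powr (2 * a - 1) + N2 * Rr * (1 / n)"
        using eventually_gt_at_top[of 0]
      proof eventually_elim
        case (elim n)
        have "(\<Sum>k<n. \<integral>\<omega>. \<bar>B.r (Suc k) \<omega>\<bar> \<partial>M) / n \<le> (N2 * CH * Cs * (\<Sum>k<n. gam k) + N2 * (Cs + 1) * n powr (2 * a) + N2 * Rr) / n"
          using B.r_sum[OF elim] by (intro divide_right_mono) auto
        also have "\<dots> = N2 * CH * Cs * ((\<Sum>k<n. gam k) / sqrt n * (1 / sqrt n)) + N2 * (Cs + 1) * n powr (2 * a - 1) + N2 * Rr * (1 / n)"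
          using elim by (simp add: powr_diff add_divide_distrib)
        finally show ?case .
      qed
    qed
  qed
  interpret C: mds_clt M F A.D B.U B.r sk "max 0 cs" p \<eta> "2 * c1' * Cs" CU
  proof
    fix k
    show "subalgebra M (F k)" by (rule F_subalgebra)
    show "j \<le> k \<Longrightarrow> sets (F j) \<subseteq> sets (F k)" for j by (rule F_mono)
    show "A.D k \<in> borel_measurable (F k)" by (rule A.D_adapted)
    show "sk k \<in> borel_measurable (F k)" by (rule sk_adapted)
    show "0 \<le> sk k \<omega>" "sk k \<omega> \<le> max 0 cs" for \<omega> by (rule sk_bounds)+
    show "integrable M (B.U k)" by (rule B.U_int)
    show "(\<integral>\<omega>. \<bar>B.U k \<omega>\<bar> \<partial>M) \<le> CU" using B.U_bound[of k] CU(1) by simp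
    show "integrable M (B.r k)" by (rule B.r_int)
    show "integrable M (\<lambda>\<omega>. \<bar>A.D k \<omega>\<bar> powr p)" "(\<integral>\<omega>. \<bar>A.D k \<omega>\<bar> powr p \<partial>M) \<le> 2 * c1' * Cs"
      using dom1[of "k - 1"] c' Cs(1) p_\<eta>(1) by (cases k; simp)+
    show "2 < p" "p \<le> 3" "0 < \<eta>" "\<eta> \<le> 1" by (rule p_\<eta>)+
    show "integrable M (\<lambda>\<omega>. \<bar>A.D k \<omega>\<bar> powr \<eta> * \<bar>B.U k \<omega>\<bar>)" "(\<integral>\<omega>. \<bar>A.D k \<omega>\<bar> powr \<eta> * \<bar>B.U k \<omega>\<bar> \<partial>M) \<le> CU"
      using dom2[of "k - 1"] CU(2,3) p_\<eta>(3) by (cases k; simp)+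
    show "(\<integral>\<omega>. indicator A \<omega> * A.D (Suc k) \<omega> \<partial>M) = 0" if "A \<in> sets (F k)" for A
      by (rule A.martingale_difference(1)[OF that])
    show "(\<integral>\<omega>. indicator A \<omega> * ((A.D (Suc k) \<omega>)\<^sup>2 - sk k \<omega> - B.U k \<omega> + B.U (Suc k) \<omega> - B.r (Suc k) \<omega>) \<partial>M) = 0"
      if "A \<in> sets (F k)" for A
      by (rule var[OF that])
    show "(\<lambda>n. (\<Sum>k<n. \<integral>\<omega>. \<bar>B.r (Suc k) \<omega>\<bar> \<partial>M) / real n) \<longlonglongrightarrow> 0" by (rule r_small)
  qed
  \<comment> \<open>Off \<open>Jinf\<close> the path leaves \<open>J\<close> for good, so that
    \<open>sk\<close> is eventually 0.\<close>
  define slim where "slim \<omega> = indicator Jinf \<omega> * sig2L (\<theta>_lim \<omega>)" for \<omega>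
  have slim_meas [measurable]: "slim \<in> borel_measurable M" unfolding slim_def[abs_def] by measurable
  have ae_lim: "AE \<omega> in M. (\<lambda>k. sk k \<omega>) \<longlonglongrightarrow> slim \<omega> \<and> (\<omega> \<in> Jinf \<longrightarrow> \<sigma>2 \<omega> = slim \<omega>) \<and> 0 \<le> slim \<omega>"
    using conv
  proof eventually_elim
    case (elim \<omega>)
    show ?case
    proof (cases "\<omega> \<in> Jinf")
      case True
      then have Jk: "\<omega> \<in> J k" if "m \<le> k" for k using that by (auto simp: Jinf_def)
      have ev: "\<forall>\<^sub>F k in sequentially. T k \<omega> \<in> L"
        using eventually_ge_at_top[of m] by eventually_elim (rule J_D(1)[OF Jk])
      have L: "\<theta>_lim \<omega> \<in> L"
        using Lim_in_closed_set[OF compact_imp_closed[OF L_compact] ev _ elim] by simp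
      have "(\<lambda>k. sig2 (T k \<omega>)) \<longlonglongrightarrow> sig2 (\<theta>_lim \<omega>)"
        by (rule continuous_on_tendsto_compose[OF sig2_continuous elim L ev])
      moreover have "\<forall>\<^sub>F k in sequentially. sig2 (T k \<omega>) = sk k \<omega>"
        using eventually_ge_at_top[of m] by eventually_elim (use Jk in \<open>simp add: sk_def\<close>)
      ultimately have "(\<lambda>k. sk k \<omega>) \<longlonglongrightarrow> sig2 (\<theta>_lim \<omega>)" by (rule Lim_transform_eventually)
      then show ?thesis using True L \<sigma>2_eq[OF L] sig2_nonneg[OF L] by (simp add: slim_def sig2L_def)
    next
      case False
      then obtain k0 where k0: "m \<le> k0" "\<omega> \<notin> J k0" by (auto simp: Jinf_def)
      have nJ: "\<omega> \<notin> J k" if "k0 \<le> k" for k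
        using that
      proof (induction k rule: dec_induct)
        case (step j) then show ?case using J_Suc[of j] k0(1) by auto
      qed (rule k0(2))
      have "\<forall>\<^sub>F k in sequentially. 0 = sk k \<omega>"
        using eventually_ge_at_top[of k0] by eventually_elim (use nJ in \<open>simp add: sk_def\<close>)
      then have "(\<lambda>k. sk k \<omega>) \<longlonglongrightarrow> 0" by (rule Lim_transform_eventually[OF tendsto_const])
      then show ?thesis using False by (simp add: slim_def)
    qed
  qed
  have s_conv: "AE \<omega> in M. (\<lambda>k. sk k \<omega>) \<longlonglongrightarrow> slim \<omega>" using ae_lim by eventually_elim simp
  have \<psi>m [measurable]: "\<psi> \<in> borel_measurable borel" by (rule borel_measurable_continuous_onI[OF \<psi>(1)])
  have cu: "0 \<le> cu" using \<psi>(2)[of 0] by linarith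
  have u_adapted: "(\<lambda>\<omega>. \<psi> (sk k \<omega>)) \<in> borel_measurable (F k)" for k
    using sk_adapted[of k] by measurable
  have u_conv: "AE \<omega> in M. (\<lambda>k. \<psi> (sk k \<omega>)) \<longlonglongrightarrow> \<psi> (slim \<omega>)"
    using s_conv by eventually_elim (rule continuous_on_tendsto_compose[OF \<psi>(1)]; simp)
  define Sd where "Sd n \<omega> = (\<Sum>k<n. A.D (Suc k) \<omega>)" for n \<omega>
  \<comment> \<open>\<open>E1\<close> and \<open>E2\<close> belong to the stopped martingale and its
    limit variance \<open>slim\<close>; \<open>G1\<close> and \<open>G2\<close> below belong to the
    actual sums and \<sigma>2. On \<open>Jinf\<close> the variances agree and the sums differ by at
    most \<open>Qb\<close> and \<open>Rm\<close>.\<close>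
  define E1 where "E1 n = (\<integral>\<omega>. exp (\<i> * complex_of_real (\<psi> (slim \<omega>) * Sd n \<omega> / sqrt (real n))) \<partial>M)" for n
  define E2 where "E2 = (\<integral>\<omega>. complex_of_real (exp (- ((\<psi> (slim \<omega>))\<^sup>2 * slim \<omega> / 2))) \<partial>M)"
  have lim1: "E1 \<longlonglongrightarrow> E2"
    unfolding E1_def E2_def Sd_def
  proof (rule C.mixed_clt[where u="\<lambda>k \<omega>. \<psi> (sk k \<omega>)" and cu=cu])
    show "(\<lambda>\<omega>. \<psi> (sk k \<omega>)) \<in> borel_measurable (F k)" for k by (rule u_adapted)
    show "\<bar>\<psi> (sk k \<omega>)\<bar> \<le> cu" for k \<omega> by (rule \<psi>(2))
    show "(\<lambda>\<omega>. \<psi> (slim \<omega>)) \<in> borel_measurable M" by measurable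
    show "AE \<omega> in M. (\<lambda>k. \<psi> (sk k \<omega>)) \<longlonglongrightarrow> \<psi> (slim \<omega>)" by (rule u_conv)
    show "slim \<in> borel_measurable M" by measurable
    show "AE \<omega> in M. (\<lambda>k. sk k \<omega>) \<longlonglongrightarrow> slim \<omega>" by (rule s_conv)
  qed
  have [measurable]: "f \<in> borel_measurable S" by (rule wbound_measurable[OF f_bound])
  define y where "y k \<omega> = f (X k \<omega>) - pf" for k \<omega>
  have y_meas [measurable]: "y k \<in> borel_measurable M" for k unfolding y_def[abs_def] by measurable
  define Sf where "Sf n \<omega> = (\<Sum>k=1..n. y k \<omega>)" for n \<omega>
  \<comment> \<open>The terms before time \<open>m\<close>, about whose moments nothing is known.
    They do not depend on \<open>n\<close>, so bounded convergence disposes of them after division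
    by \<open>sqrt n\<close>, whereas \<open>Rm\<close> is estimated in mean. The term
    \<open>y 0\<close> appears because the sums start at 1 and the decomposition at 0.\<close>
  define Qb where "Qb \<omega> = \<bar>y 0 \<omega>\<bar> + (\<Sum>k<m. \<bar>y k \<omega>\<bar>)" for \<omega>
  define Rm where "Rm n \<omega> = \<bar>indicator (J n) \<omega> * y n \<omega>\<bar> + \<bar>A.U 0 \<omega>\<bar> + \<bar>A.U n \<omega>\<bar> + (\<Sum>k<n. \<bar>A.r (Suc k) \<omega>\<bar>)" for n \<omega>
  have [measurable]: "Sf n \<in> borel_measurable M" "Sd n \<in> borel_measurable M" "Qb \<in> borel_measurable M" for n
    unfolding Sf_def[abs_def] Sd_def[abs_def] Qb_def[abs_def] by measurable
  have Qb0: "0 \<le> Qb \<omega>" for \<omega> unfolding Qb_def by (intro add_nonneg_nonneg sum_nonneg) auto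
  have diff: "\<bar>Sf n \<omega> - Sd n \<omega>\<bar> \<le> Qb \<omega> + Rm n \<omega>" if \<omega>: "\<omega> \<in> Jinf" and n: "m \<le> n" for n \<omega>
  proof -
    have Jk: "\<omega> \<in> J k" if "m \<le> k" for k using that \<omega> by (auto simp: Jinf_def)
    have "indicator (J k) \<omega> * y k \<omega> = A.D (Suc k) \<omega> + (A.U k \<omega> - A.U (Suc k) \<omega>) + A.r (Suc k) \<omega>" for k
    proof -
      have "indicator (J k) \<omega> * y k \<omega> = indicator (J k) \<omega> * (fh (T k \<omega>) (X k \<omega>) - kernel_act (P (T k \<omega>)) (fh (T k \<omega>)) (X k \<omega>))"
        using Pf_eq[OF J_D(1,2)] by (auto simp: y_def Pf_def split: split_indicator)
      then show ?thesis using A.decomposition[of k \<omega>] by simp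
    qed
    then have "(\<Sum>k<n. indicator (J k) \<omega> * y k \<omega>) = Sd n \<omega> + (A.U 0 \<omega> - A.U n \<omega>) + (\<Sum>k<n. A.r (Suc k) \<omega>)"
      using sum_lessThan_telescope'[of "\<lambda>k. A.U k \<omega>" n] by (simp add: sum.distrib Sd_def)
    moreover have "(\<Sum>k<n. indicator (J k) \<omega> * y k \<omega>) = (\<Sum>k<n. y k \<omega>) - (\<Sum>k<m. y k \<omega>)"
    proof -
      have split: "(\<Sum>k<n. h k) = (\<Sum>k<m. h k) + (\<Sum>k=m..<n. h k)" for h :: "nat \<Rightarrow> real"
        using n by (simp add: lessThan_atLeast0 sum.atLeastLessThan_concat)
      have "(\<Sum>k<m. indicator (J k) \<omega> * y k \<omega>) = 0" by (rule sum.neutral) (simp add: J_empty)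
      moreover have "(\<Sum>k=m..<n. indicator (J k) \<omega> * y k \<omega>) = (\<Sum>k=m..<n. y k \<omega>)"
        using Jk by (intro sum.cong) auto
      ultimately show ?thesis using split[of "\<lambda>k. indicator (J k) \<omega> * y k \<omega>"] split[of "\<lambda>k. y k \<omega>"] by simp
    qed
    moreover have "Sf n \<omega> = (\<Sum>k<n. y k \<omega>) + y n \<omega> - y 0 \<omega>"
    proof -
      have "(\<Sum>k<Suc n. y k \<omega>) = y 0 \<omega> + (\<Sum>k=1..n. y k \<omega>)"
        by (simp only: lessThan_Suc_atMost atMost_atLeast0 sum.atLeast_Suc_atMost[of 0 n] One_nat_def)
      then show ?thesis by (simp add: Sf_def)
    qed
    ultimately have "Sf n \<omega> - Sd n \<omega> = (\<Sum>k<m. y k \<omega>) - y 0 \<omega> + y n \<omega> + A.U 0 \<omega> - A.U n \<omega> + (\<Sum>k<n. A.r (Suc k) \<omega>)"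
      by simp
    moreover have "\<bar>\<Sum>k<m. y k \<omega>\<bar> \<le> (\<Sum>k<m. \<bar>y k \<omega>\<bar>)" "\<bar>\<Sum>k<n. A.r (Suc k) \<omega>\<bar> \<le> (\<Sum>k<n. \<bar>A.r (Suc k) \<omega>\<bar>)"
      by (rule sum_abs)+
    moreover have "indicator (J n) \<omega> * y n \<omega> = y n \<omega>" using Jk[OF n] by simp
    ultimately show ?thesis unfolding Qb_def Rm_def by linarith
  qed
  have yJ: "integrable M (\<lambda>\<omega>. indicator (J n) \<omega> * y n \<omega>)" "(\<integral>\<omega>. \<bar>indicator (J n) \<omega> * y n \<omega>\<bar> \<partial>M) \<le> 2 * (Nf + \<bar>pf\<bar>) * Cs" for n
  proof -
    obtain \<theta> where \<theta>: "\<theta> \<in> L" using E1.L_nonempty by auto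
    interpret K1: ergodic_kernel S "\<lambda>x. V x powr a" "P \<theta>" l1 b1 \<pi> A1 \<rho>1 by (rule kernel_facts[OF \<theta>])
    have Nf: "0 \<le> Nf" by (rule K1.wbound_N_nonneg[OF f_bound])
    have "AE \<omega> in M. \<bar>indicator (J n) \<omega> * y n \<omega>\<bar> \<le> (Nf + \<bar>pf\<bar>) * (indicator (J n) \<omega> * (V (X n \<omega>) + V (X (Suc n) \<omega>)))"
    proof (rule AE_I2)
      fix \<omega> assume \<omega>: "\<omega> \<in> space M"
      note XS = X_space[OF \<omega>, of n]
      have "\<bar>y n \<omega>\<bar> \<le> Nf * V (X n \<omega>) powr a + \<bar>pf\<bar> * 1"
        using wboundD[OF f_bound XS] by (simp add: y_def)
      also have "\<dots> \<le> Nf * V (X n \<omega>) + \<bar>pf\<bar> * V (X n \<omega>)"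
        using Nf Vpowr_le[OF XS, of a] a V1[OF XS] by (intro add_mono mult_left_mono) auto
      also have "\<dots> \<le> (Nf + \<bar>pf\<bar>) * (V (X n \<omega>) + V (X (Suc n) \<omega>))"
        using Nf V_pos[OF X_space[OF \<omega>, of "Suc n"]] by (simp add: algebra_simps)
      finally show "\<bar>indicator (J n) \<omega> * y n \<omega>\<bar> \<le> (Nf + \<bar>pf\<bar>) * (indicator (J n) \<omega> * (V (X n \<omega>) + V (X (Suc n) \<omega>)))"
        by (auto split: split_indicator)
    qed
    from dominated_J[OF _ _ this] Nf show "integrable M (\<lambda>\<omega>. indicator (J n) \<omega> * y n \<omega>)"
      "(\<integral>\<omega>. \<bar>indicator (J n) \<omega> * y n \<omega>\<bar> \<partial>M) \<le> 2 * (Nf + \<bar>pf\<bar>) * Cs" by auto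
  qed
  have Rm_int: "integrable M (Rm n)" for n
    unfolding Rm_def[abs_def] using yJ(1)[of n] A.U_int A.r_int by simp
  have Rm_nn: "0 \<le> Rm n \<omega>" for n \<omega> unfolding Rm_def by (intro add_nonneg_nonneg sum_nonneg) auto
  \<comment> \<open>The exit cost \<open>n powr a\<close> is below \<open>sqrt n\<close> because
    \<open>a < 1 / 2\<close>, and the step sizes are handled by \<open>gam_small\<close>.\<close>
  have Rm_lim: "(\<lambda>n. cu / sqrt (real n) * (\<integral>\<omega>. Rm n \<omega> \<partial>M)) \<longlonglongrightarrow> 0"
  proof -
    have "(\<lambda>n. cu * ((2 * (Nf + \<bar>pf\<bar>) * Cs + 4 * N1 * Cs + N1 * Rr) * (1 / sqrt n) + N1 * CH * Cs * ((\<Sum>k<n. gam k) / sqrt n)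
       + N1 * (Cs + 1) * n powr (a - 1 / 2))) \<longlonglongrightarrow>
      cu * ((2 * (Nf + \<bar>pf\<bar>) * Cs + 4 * N1 * Cs + N1 * Rr) * 0 + N1 * CH * Cs * 0 + N1 * (Cs + 1) * 0)"
      using a by (intro tendsto_intros sqrt0 gam_small pw) auto
    then have lim: "(\<lambda>n. cu * ((2 * (Nf + \<bar>pf\<bar>) * Cs + 4 * N1 * Cs + N1 * Rr) * (1 / sqrt n) + N1 * CH * Cs * ((\<Sum>k<n. gam k) / sqrt n)
       + N1 * (Cs + 1) * n powr (a - 1 / 2))) \<longlonglongrightarrow> 0" by simp
    show ?thesis
    proof (rule tendsto_sandwich[OF _ _ tendsto_const lim])
      show "\<forall>\<^sub>F n in sequentially. 0 \<le> cu / sqrt (real n) * (\<integral>\<omega>. Rm n \<omega> \<partial>M)"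
        using cu Rm_nn by (intro always_eventually allI mult_nonneg_nonneg integral_nonneg_AE) auto
      show "\<forall>\<^sub>F n in sequentially. cu / sqrt (real n) * (\<integral>\<omega>. Rm n \<omega> \<partial>M) \<le> cu * ((2 * (Nf + \<bar>pf\<bar>) * Cs + 4 * N1 * Cs + N1 * Rr) * (1 / sqrt n)
          + N1 * CH * Cs * ((\<Sum>k<n. gam k) / sqrt n) + N1 * (Cs + 1) * n powr (a - 1 / 2))"
        using eventually_gt_at_top[of 0]
      proof eventually_elim
        case (elim n)
        have "(\<integral>\<omega>. Rm n \<omega> \<partial>M) = (\<integral>\<omega>. \<bar>indicator (J n) \<omega> * y n \<omega>\<bar> \<partial>M) + (\<integral>\<omega>. \<bar>A.U 0 \<omega>\<bar> \<partial>M) + (\<integral>\<omega>. \<bar>A.U n \<omega>\<bar> \<partial>M) + (\<Sum>k<n. \<integral>\<omega>. \<bar>A.r (Suc k) \<omega>\<bar> \<partial>M)"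
          unfolding Rm_def using yJ(1)[of n] A.U_int A.r_int by simp
        also have "\<dots> \<le> 2 * (Nf + \<bar>pf\<bar>) * Cs + 2 * N1 * Cs + 2 * N1 * Cs + (N1 * CH * Cs * (\<Sum>k<n. gam k) + N1 * (Cs + 1) * n powr a + N1 * Rr)"
          by (intro add_mono yJ A.U_bound A.r_sum elim)
        finally have "cu / sqrt n * (\<integral>\<omega>. Rm n \<omega> \<partial>M) \<le> cu / sqrt n * (2 * (Nf + \<bar>pf\<bar>) * Cs + 2 * N1 * Cs + 2 * N1 * Cs + (N1 * CH * Cs * (\<Sum>k<n. gam k) + N1 * (Cs + 1) * n powr a + N1 * Rr))"
          using cu by (intro mult_left_mono) auto
        also have "\<dots> = cu * ((2 * (Nf + \<bar>pf\<bar>) * Cs + 4 * N1 * Cs + N1 * Rr) * (1 / sqrt n)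
          + N1 * CH * Cs * ((\<Sum>k<n. gam k) / sqrt n) + N1 * (Cs + 1) * (n powr a / sqrt n))"
          by (simp add: algebra_simps add_divide_distrib)
        also have "n powr a / sqrt n = n powr (a - 1 / 2)"
          using elim by (simp add: powr_diff powr_half_sqrt)
        finally show ?case .
      qed
    qed
  qed
  have Q_int: "integrable M (\<lambda>\<omega>. min 2 (cu * Qb \<omega> / sqrt (real n)))" for n
    using Qb0 cu by (intro integrable_const_bound[where B=2]) auto
  have Q_lim: "(\<lambda>n. \<integral>\<omega>. min 2 (cu * Qb \<omega> / sqrt (real n)) \<partial>M) \<longlonglongrightarrow> 0"
  proof -
    have "(\<lambda>n. \<integral>\<omega>. min 2 (cu * Qb \<omega> / sqrt (real n)) \<partial>M) \<longlonglongrightarrow> (\<integral>\<omega>. 0 \<partial>M)"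
    proof (rule integral_dominated_convergence[where w="\<lambda>_. 2"])
      show "AE \<omega> in M. (\<lambda>n. min 2 (cu * Qb \<omega> / sqrt (real n))) \<longlonglongrightarrow> 0"
      proof (rule AE_I2)
        fix \<omega>
        have "(\<lambda>n. min 2 (cu * Qb \<omega> * (1 / sqrt (real n)))) \<longlonglongrightarrow> min 2 (cu * Qb \<omega> * 0)"
          by (intro tendsto_intros sqrt0)
        then show "(\<lambda>n. min 2 (cu * Qb \<omega> / sqrt (real n))) \<longlonglongrightarrow> 0" by simp
      qed
      show "AE \<omega> in M. norm (min 2 (cu * Qb \<omega> / sqrt (real n))) \<le> 2" for n
        using Qb0 cu by auto
    qed auto
    then show ?thesis by simp
  qed
  define e where "e n = norm (E1 n - E2) + (\<integral>\<omega>. min 2 (cu * Qb \<omega> / sqrt (real n)) \<partial>M) + cu / sqrt (real n) * (\<integral>\<omega>. Rm n \<omega> \<partial>M)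
    + (if n < m then 2 else 0)" for n
  have e0: "e \<longlonglongrightarrow> 0"
  proof -
    have "(\<lambda>n. if n < m then 2 else 0 :: real) \<longlonglongrightarrow> 0"
      by (rule tendsto_eventually) (use eventually_ge_at_top[of m] in \<open>eventually_elim, simp\<close>)
    then have "e \<longlonglongrightarrow> 0 + 0 + 0 + 0"
      unfolding e_def by (intro tendsto_add tendsto_norm_zero LIM_zero lim1 Q_lim Rm_lim)
    then show ?thesis by simp
  qed
  define G1 where "G1 n = (\<integral>\<omega>. exp (\<i> * complex_of_real (\<psi> (\<sigma>2 \<omega>) * Sf n \<omega> / sqrt (real n))) \<partial>M)" for n
  define G2 where "G2 = (\<integral>\<omega>. complex_of_real (exp (- ((\<psi> (\<sigma>2 \<omega>))\<^sup>2 * \<sigma>2 \<omega> / 2))) \<partial>M)"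
  have cmpl [measurable]: "space M - Jinf \<in> sets M" by measurable
  have pr: "(\<integral>\<omega>. indicator (space M - Jinf) \<omega> \<partial>M) = prob (space M - Jinf)" by simp
  have ind_c: "integrable M (\<lambda>\<omega>. indicator (space M - Jinf) \<omega> :: real)"
    by (intro integrable_real_indicator) (auto simp: less_top[symmetric])
  have iexp_int: "integrable M (\<lambda>\<omega>. exp (\<i> * complex_of_real (h \<omega>)))" if [measurable]: "h \<in> borel_measurable M" for h
    by (rule integrable_const_bound[where B=1]) auto
  have e_le1: "AE \<omega> in M. norm (complex_of_real (exp (- ((\<psi> (h \<omega>))\<^sup>2 * h \<omega> / 2)))) \<le> 1" if "AE \<omega> in M. 0 \<le> h \<omega>" for h :: "'c \<Rightarrow> real"
    using that by eventually_elim (simp del: of_real_exp)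
  have slim_nn: "AE \<omega> in M. 0 \<le> slim \<omega>" using ae_lim by eventually_elim simp
  have g2i: "integrable M (\<lambda>\<omega>. complex_of_real (exp (- ((\<psi> (\<sigma>2 \<omega>))\<^sup>2 * \<sigma>2 \<omega> / 2))))"
    by (rule integrable_const_bound[OF e_le1[OF \<sigma>2_nn]]) measurable
  have e2i: "integrable M (\<lambda>\<omega>. complex_of_real (exp (- ((\<psi> (slim \<omega>))\<^sup>2 * slim \<omega> / 2))))"
    by (rule integrable_const_bound[OF e_le1[OF slim_nn]]) measurable
  have G1E1: "norm (G1 n - E1 n) \<le> (\<integral>\<omega>. min 2 (cu * Qb \<omega> / sqrt (real n)) \<partial>M) + cu / sqrt (real n) * (\<integral>\<omega>. Rm n \<omega> \<partial>M) + 2 * prob (space M - Jinf)"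
    if n: "m \<le> n" for n
  proof -
    define h1 h2 where "h1 \<omega> = exp (\<i> * complex_of_real (\<psi> (\<sigma>2 \<omega>) * Sf n \<omega> / sqrt (real n)))"
      and "h2 \<omega> = exp (\<i> * complex_of_real (\<psi> (slim \<omega>) * Sd n \<omega> / sqrt (real n)))" for \<omega>
    have h12: "integrable M h1" "integrable M h2"
      unfolding h1_def h2_def by (intro iexp_int; measurable)+
    have "norm (G1 n - E1 n) = norm (\<integral>\<omega>. h1 \<omega> - h2 \<omega> \<partial>M)"
      unfolding G1_def E1_def h1_def[symmetric] h2_def[symmetric] using h12 by simp
    also have "\<dots> \<le> (\<integral>\<omega>. norm (h1 \<omega> - h2 \<omega>) \<partial>M)" by (rule integral_norm_bound)
    also have "\<dots> \<le> (\<integral>\<omega>. min 2 (cu * Qb \<omega> / sqrt (real n)) + cu / sqrt (real n) * Rm n \<omega> + 2 * indicator (space M - Jinf) \<omega> \<partial>M)"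
    proof (rule integral_mono_AE)
      show "AE \<omega> in M. norm (h1 \<omega> - h2 \<omega>) \<le> min 2 (cu * Qb \<omega> / sqrt (real n)) + cu / sqrt (real n) * Rm n \<omega> + 2 * indicator (space M - Jinf) \<omega>"
        using ae_lim AE_space
      proof eventually_elim
        case (elim \<omega>)
        have n2: "norm (h1 \<omega> - h2 \<omega>) \<le> 2"
          unfolding h1_def h2_def by (rule order_trans[OF norm_triangle_ineq4]) (simp only: norm_exp_i_times)
        have nn: "0 \<le> min 2 (cu * Qb \<omega> / sqrt (real n))" "0 \<le> cu / sqrt (real n) * Rm n \<omega>"
          using Qb0[of \<omega>] Rm_nn[of n \<omega>] cu by auto
        show ?case
        proof (cases "\<omega> \<in> Jinf")
          case True
          then have eq: "\<sigma>2 \<omega> = slim \<omega>" using elim by simp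
          have "norm (h1 \<omega> - h2 \<omega>) \<le> \<bar>\<psi> (slim \<omega>) * Sf n \<omega> / sqrt (real n) - \<psi> (slim \<omega>) * Sd n \<omega> / sqrt (real n)\<bar>"
            unfolding h1_def h2_def eq by (rule C.norm_iexp_diff)
          also have "\<dots> = \<bar>\<psi> (slim \<omega>)\<bar> * \<bar>Sf n \<omega> - Sd n \<omega>\<bar> / sqrt (real n)"
          proof -
            have "\<psi> (slim \<omega>) * Sf n \<omega> / sqrt (real n) - \<psi> (slim \<omega>) * Sd n \<omega> / sqrt (real n) = \<psi> (slim \<omega>) * (Sf n \<omega> - Sd n \<omega>) / sqrt (real n)"
              by (simp add: right_diff_distrib diff_divide_distrib)
            then show ?thesis by (simp add: abs_mult)
          qed
          also have "\<dots> \<le> cu * (Qb \<omega> + Rm n \<omega>) / sqrt (real n)"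
            using \<psi>(2)[of "slim \<omega>"] diff[OF True n] cu by (intro divide_right_mono mult_mono) auto
          also have "\<dots> = cu * Qb \<omega> / sqrt (real n) + cu / sqrt (real n) * Rm n \<omega>"
            by (simp add: distrib_left add_divide_distrib)
          finally have "norm (h1 \<omega> - h2 \<omega>) \<le> cu * Qb \<omega> / sqrt (real n) + cu / sqrt (real n) * Rm n \<omega>" .
          then show ?thesis using n2 nn True by (auto simp: min_def)
        next
          case False
          then show ?thesis using n2 nn elim(2) by simp
        qed
      qed
    qed (use h12 Q_int Rm_int ind_c in auto)
    also have "\<dots> = (\<integral>\<omega>. min 2 (cu * Qb \<omega> / sqrt (real n)) \<partial>M) + cu / sqrt (real n) * (\<integral>\<omega>. Rm n \<omega> \<partial>M) + 2 * prob (space M - Jinf)"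
      using Q_int[of n] Rm_int[of n] ind_c pr by (simp del: Bochner_Integration.integral_indicator)
    finally show ?thesis .
  qed
  have G2E2: "norm (G2 - E2) \<le> 2 * prob (space M - Jinf)"
  proof -
    define h1 h2 where "h1 \<omega> = complex_of_real (exp (- ((\<psi> (\<sigma>2 \<omega>))\<^sup>2 * \<sigma>2 \<omega> / 2)))"
      and "h2 \<omega> = complex_of_real (exp (- ((\<psi> (slim \<omega>))\<^sup>2 * slim \<omega> / 2)))" for \<omega>
    have h12: "integrable M h1" "integrable M h2" unfolding h1_def h2_def by (rule g2i, rule e2i)
    have "norm (G2 - E2) = norm (\<integral>\<omega>. h1 \<omega> - h2 \<omega> \<partial>M)"
      unfolding G2_def E2_def h1_def[symmetric] h2_def[symmetric] using h12 by simp
    also have "\<dots> \<le> (\<integral>\<omega>. norm (h1 \<omega> - h2 \<omega>) \<partial>M)" by (rule integral_norm_bound)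
    also have "\<dots> \<le> (\<integral>\<omega>. 2 * indicator (space M - Jinf) \<omega> \<partial>M)"
    proof (rule integral_mono_AE)
      show "AE \<omega> in M. norm (h1 \<omega> - h2 \<omega>) \<le> 2 * indicator (space M - Jinf) \<omega>"
        using ae_lim e_le1[OF \<sigma>2_nn] e_le1[OF slim_nn] AE_space
      proof eventually_elim
        case (elim \<omega>)
        have "norm (h1 \<omega> - h2 \<omega>) \<le> norm (h1 \<omega>) + norm (h2 \<omega>)" by (rule norm_triangle_ineq4)
        then have "norm (h1 \<omega> - h2 \<omega>) \<le> 2" using elim(2,3) unfolding h1_def h2_def by linarith
        then show ?case using elim(1,4) by (cases "\<omega> \<in> Jinf") (auto simp: h1_def h2_def)
      qed
    qed (use h12 ind_c in auto)
    also have "\<dots> = 2 * prob (space M - Jinf)" using pr ind_c by (simp del: Bochner_Integration.integral_indicator)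
    finally show ?thesis .
  qed
  have main: "norm (G1 n - G2) \<le> e n + 4 * prob (space M - Jinf)" for n
  proof (cases "m \<le> n")
    case True
    have "norm (G1 n - G2) \<le> norm (G1 n - E1 n) + norm (E1 n - E2) + norm (G2 - E2)"
      using norm_triangle_ineq[of "G1 n - E1 n" "E1 n - G2"] norm_triangle_ineq4[of "E1 n - E2" "G2 - E2"] by simp
    then show ?thesis using G1E1[OF True] G2E2 True by (simp add: e_def)
  next
    case False
    have "norm (G1 n) \<le> 1"
    proof -
      have "norm (G1 n) \<le> (\<integral>\<omega>. norm (exp (\<i> * complex_of_real (\<psi> (\<sigma>2 \<omega>) * Sf n \<omega> / sqrt (real n)))) \<partial>M)"
        unfolding G1_def by (rule integral_norm_bound)
      also have "\<dots> = (\<integral>\<omega>. 1 \<partial>M)" by (simp only: norm_exp_i_times)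
      finally show ?thesis by (simp add: prob_space)
    qed
    moreover have "norm G2 \<le> 1"
    proof -
      have "norm G2 \<le> (\<integral>\<omega>. norm (complex_of_real (exp (- ((\<psi> (\<sigma>2 \<omega>))\<^sup>2 * \<sigma>2 \<omega> / 2)))) \<partial>M)"
        unfolding G2_def by (rule integral_norm_bound)
      also have "\<dots> \<le> (\<integral>\<omega>. 1 \<partial>M)"
        by (rule integral_mono_AE[OF integrable_norm[OF g2i] _ e_le1[OF \<sigma>2_nn]]) simp
      finally show ?thesis by (simp add: prob_space)
    qed
    ultimately have "norm (G1 n - G2) \<le> 2" using norm_triangle_ineq4[of "G1 n" G2] by simp
    moreover have "0 \<le> (\<integral>\<omega>. min 2 (cu * Qb \<omega> / sqrt (real n)) \<partial>M)" "0 \<le> cu / sqrt (real n) * (\<integral>\<omega>. Rm n \<omega> \<partial>M)"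
      using cu Qb0 Rm_nn by (auto intro!: integral_nonneg_AE mult_nonneg_nonneg)
    moreover have "e n = norm (E1 n - E2) + (\<integral>\<omega>. min 2 (cu * Qb \<omega> / sqrt (real n)) \<partial>M) + cu / sqrt (real n) * (\<integral>\<omega>. Rm n \<omega> \<partial>M) + 2"
      using False unfolding e_def by simp
    ultimately show ?thesis using measure_nonneg[of M "space M - Jinf"] norm_ge_zero[of "E1 n - E2"] by linarith
  qed
  show ?thesis
    using e0 main unfolding G1_def G2_def Sf_def y_def by blast
qed

end

section \<open>From the localised chain to the limit theorem\<close>

lemma wnorm_le_iff:
  assumes W: "\<And>x. x \<in> space S \<Longrightarrow> 0 < W x" and N: "0 \<le> N"
  shows "wnorm S W h \<le> ennreal N \<longleftrightarrow> (\<forall>x\<in>space S. norm (h x) \<le> N * W x)"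
  using W N by (auto simp: wnorm_def SUP_le_iff ennreal_le_iff pos_divide_le_eq)

lemma wspace_wbound:
  assumes f: "f \<in> wspace S W" and W: "\<And>x. x \<in> space S \<Longrightarrow> 0 < W x"
  shows "\<exists>N\<ge>0. wbound S W N f"
proof -
  have "wnorm S W f < \<infinity>" using f by (simp add: wspace_def)
  then obtain N where N: "0 \<le> N" "wnorm S W f = ennreal N"
    by (cases "wnorm S W f") auto
  then have "wnorm S W f \<le> ennreal N" by simp
  then show ?thesis
    using f N(1) by (subst (asm) wnorm_le_iff[OF W N(1)]) (auto simp: wbound_def wspace_def)
qed

lemma wbound_wspace:
  assumes f: "wbound S W N f" and N: "0 \<le> N" and W: "\<And>x. x \<in> space S \<Longrightarrow> 0 < W x"
  shows "f \<in> wspace S W" "wnorm S W f \<le> ennreal N"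
proof -
  show le: "wnorm S W f \<le> ennreal N"
    using f by (subst wnorm_le_iff[OF W N]) (auto simp: wbound_def)
  show "f \<in> wspace S W"
    using f le by (auto simp: wspace_def wbound_def intro: le_less_trans)
qed

text \<open>Kronecker's lemma for the weights \<open>sqrt (Suc k)\<close>: among the first
  \<open>n\<close> terms, those of a tail of the summable series are multiplied by at most
  \<open>sqrt n\<close>, and the finite head disappears after division.\<close>

lemma average_sqrt_tendsto_0:
  fixes g :: "nat \<Rightarrow> real"
  assumes g: "\<And>k. 0 \<le> g k" and sm: "summable (\<lambda>k. real (Suc k) powr (- 1 / 2) * g k)"
  shows "(\<lambda>n. (\<Sum>k<n. g k) / sqrt (real n)) \<longlonglongrightarrow> 0"
proof (rule LIMSEQ_I)
  fix e :: real assume e: "0 < e"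
  define w where "w k = real (Suc k) powr (- 1 / 2) * g k" for k
  have w0: "0 \<le> w k" for k using g by (simp add: w_def)
  have gw: "g k = sqrt (real (Suc k)) * w k" for k
    by (simp add: w_def powr_minus_divide powr_half_sqrt[symmetric])
  have "\<forall>e>0. \<exists>N. \<forall>m\<ge>N. \<forall>n. norm (sum w {m..<n}) < e"
    using sm unfolding summable_Cauchy w_def by simp
  then obtain N where N: "\<And>n. norm (sum w {N..<n}) < e / 2" using e by (meson half_gt_zero order_refl)
  define C where "C = (\<Sum>k<N. g k)"
  obtain M where M: "(2 * C / e)\<^sup>2 < real M" using reals_Archimedean2 by blast
  show "\<exists>no. \<forall>n\<ge>no. norm ((\<Sum>k<n. g k) / sqrt (real n) - 0) < e"
  proof (intro exI[of _ "max (Suc N) (Suc M)"] allI impI)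
    fix n assume n: "max (Suc N) (Suc M) \<le> n"
    then have n0: "0 < sqrt (real n)" by auto
    have "2 * C / e < sqrt (real n)"
    proof (rule real_less_rsqrt)
      show "(2 * C / e)\<^sup>2 < real n" using M n by linarith
    qed
    then have Cn: "C < sqrt (real n) * (e / 2)" using e by (simp add: field_simps)
    have "(\<Sum>k<n. g k) = C + (\<Sum>k=N..<n. g k)"
      unfolding C_def using n by (simp add: lessThan_atLeast0 sum.atLeastLessThan_concat)
    also have "(\<Sum>k=N..<n. g k) \<le> (\<Sum>k=N..<n. sqrt (real n) * w k)"
      unfolding gw using w0 by (intro sum_mono mult_right_mono) auto
    also have "\<dots> = sqrt (real n) * sum w {N..<n}" by (simp add: sum_distrib_left)
    also have "\<dots> \<le> sqrt (real n) * (e / 2)"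
      using N[of n] by (intro mult_left_mono) auto
    finally have "(\<Sum>k<n. g k) < sqrt (real n) * e" using Cn by simp
    moreover have "0 \<le> (\<Sum>k<n. g k)" by (intro sum_nonneg g)
    ultimately show "norm ((\<Sum>k<n. g k) / sqrt (real n) - 0) < e"
      using n0 by (simp add: pos_divide_less_eq mult.commute)
  qed
qed

text \<open>The sums of \<open>gam\<close>; the delay by \<open>m\<close> only shortens them, so the
  undelayed ones dominate.\<close>

lemma delayed_average_tendsto_0:
  fixes \<gamma> :: "nat \<Rightarrow> real"
  assumes pos: "\<And>k. 0 < \<gamma> k" and sm: "summable (\<lambda>k. real (Suc k) powr (- 1 / 2) * \<gamma> (Suc k))"
  shows "(\<lambda>n. (\<Sum>k<n. if k < m then 0 else \<gamma> (Suc (k - m))) / sqrt (real n)) \<longlonglongrightarrow> 0"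
proof (rule tendsto_sandwich[OF _ _ tendsto_const average_sqrt_tendsto_0[of "\<lambda>k. \<gamma> (Suc k)", OF _ sm]])
  show "0 \<le> \<gamma> (Suc k)" for k using pos[of "Suc k"] by simp
  have sum0: "(\<Sum>k<n. if k < m then 0 else \<gamma> (Suc (k - m))) = (\<Sum>k<n - m. \<gamma> (Suc k))" for n
    by (induction n) (auto simp: Suc_diff_le not_less)
  show "\<forall>\<^sub>F n in sequentially. 0 \<le> (\<Sum>k<n. if k < m then 0 else \<gamma> (Suc (k - m))) / sqrt (real n)"
    using pos by (intro always_eventually allI divide_nonneg_nonneg sum_nonneg) (auto intro: less_imp_le)
  show "\<forall>\<^sub>F n in sequentially. (\<Sum>k<n. if k < m then 0 else \<gamma> (Suc (k - m))) / sqrt (real n) \<le> (\<Sum>k<n. \<gamma> (Suc k)) / sqrt (real n)"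
    unfolding sum0 using pos by (intro always_eventually allI divide_right_mono sum_mono2) (auto intro: less_imp_le)
qed

section \<open>Constants on every compact set, and the settling of the chain\<close>

locale sa_global = sa_chain S \<Theta> P H proj \<gamma> K M Z z\<^sub>0
  for S :: "'x measure" and \<Theta> :: "'p::euclidean_space set" and P H proj \<gamma> K
    and M :: "'w measure" and Z z\<^sub>0 +
  fixes V :: "'x \<Rightarrow> real" and \<pi> :: "'x measure" and f :: "'x \<Rightarrow> real" and \<alpha> \<beta> :: real and \<theta>_lim :: "'w \<Rightarrow> 'p"
  assumes prob_pi: "prob_space \<pi>" and sets_pi: "sets \<pi> = sets S"
    and inv_pi: "\<theta> \<in> \<Theta> \<Longrightarrow> bind \<pi> (P \<theta>) = \<pi>"
    and gamma: "decseq \<gamma>" "\<And>k. 0 < \<gamma> k" "summable (\<lambda>k. real (Suc k) powr (- 1 / 2) * \<gamma> (Suc k))"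
    and V_meas [measurable]: "V \<in> borel_measurable S" and V1: "x \<in> space S \<Longrightarrow> 1 \<le> V x"
    and drift_minorization: "compact L \<Longrightarrow> L \<subseteq> \<Theta> \<Longrightarrow>
      \<exists>C \<epsilon> \<phi> \<rho> b.
        C \<in> sets S \<and> \<epsilon> > 0 \<and> prob_space \<phi> \<and> sets \<phi> = sets S \<and> measure \<phi> C > 0 \<and>
        (\<forall>A\<in>sets S. \<forall>\<theta>\<in>L. \<forall>x\<in>C. measure (P \<theta> x) A \<ge> \<epsilon> * measure \<phi> A) \<and>
        0 \<le> \<rho> \<and> \<rho> < 1 \<and> 0 < b \<and>
        (\<forall>\<theta>\<in>L.
          (\<forall>x\<in>space S - C. (\<integral>\<^sup>+y. ennreal (V y) \<partial>P \<theta> x) \<le> ennreal (\<rho> * V x)) \<and>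
          (\<forall>x\<in>C. (\<integral>\<^sup>+y. ennreal (V y) \<partial>P \<theta> x) \<le> ennreal b))"
    and kernel_Lipschitz: "compact L \<Longrightarrow> L \<subseteq> \<Theta> \<Longrightarrow> 0 \<le> r \<Longrightarrow> r \<le> 1 \<Longrightarrow>
      \<exists>C::real. C \<ge> 0 \<and> (\<forall>\<theta>\<in>L. \<forall>\<theta>'\<in>L. \<forall>g\<in>wspace S (\<lambda>x. V x powr r).
        wnorm S (\<lambda>x. V x powr r) (\<lambda>x. kernel_act (P \<theta>) g x - kernel_act (P \<theta>') g x)
          \<le> ennreal C * wnorm S (\<lambda>x. V x powr r) g * ennreal (norm (\<theta> - \<theta>')))"
    and \<beta>: "0 \<le> \<beta>" "\<beta> \<le> 1 / 2" and H_Lip: "W_Lipschitz S \<Theta> (\<lambda>x. V x powr \<beta>) H"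
    and \<alpha>: "0 \<le> \<alpha>" "\<alpha> < (1 - \<beta>) / 2" and f: "f \<in> wspace S (\<lambda>x. V x powr \<alpha>)"
    and lim_meas: "\<theta>_lim \<in> measurable M (restrict_space borel \<Theta>)"
    and lim_conv: "AE \<omega> in M. limsup (\<lambda>n. cem_dist (fst (snd (Z n \<omega>))) (\<theta>_lim \<omega>)) = 0"
begin

lemma W_pos: "x \<in> space S \<Longrightarrow> 0 < V x powr r"
  using V1[of x] by simp

lemma kernel_Lipschitz_wbound:
  assumes L: "compact L" "L \<subseteq> \<Theta>" and r: "0 \<le> r" "r \<le> 1"
  shows "\<exists>c\<ge>0. \<forall>\<theta>\<in>L. \<forall>\<theta>'\<in>L. \<forall>N g x. wbound S (\<lambda>x. V x powr r) N g \<longrightarrow> x \<in> space S \<longrightarrow>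
      \<bar>kernel_act (P \<theta>) g x - kernel_act (P \<theta>') g x\<bar> \<le> c * norm (\<theta> - \<theta>') * N * V x powr r"
proof -
  obtain C where C: "0 \<le> C" "\<And>\<theta> \<theta>' g. \<theta> \<in> L \<Longrightarrow> \<theta>' \<in> L \<Longrightarrow> g \<in> wspace S (\<lambda>x. V x powr r) \<Longrightarrow>
        wnorm S (\<lambda>x. V x powr r) (\<lambda>x. kernel_act (P \<theta>) g x - kernel_act (P \<theta>') g x)
          \<le> ennreal C * wnorm S (\<lambda>x. V x powr r) g * ennreal (norm (\<theta> - \<theta>'))"
    using kernel_Lipschitz[OF L r] by blast
  show ?thesis
  proof (rule exI[of _ C], intro conjI ballI allI impI C(1))
    fix \<theta> \<theta>' N g x assume \<theta>: "\<theta> \<in> L" "\<theta>' \<in> L" and g: "wbound S (\<lambda>x. V x powr r) N g" and x: "x \<in> space S"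
    have "0 \<le> N * V x powr r" using wboundD[OF g x] by linarith
    then have N: "0 \<le> N" using W_pos[OF x, of r] by (simp add: zero_le_mult_iff)
    have gw: "g \<in> wspace S (\<lambda>x. V x powr r)" "wnorm S (\<lambda>x. V x powr r) g \<le> ennreal N"
      by (rule wbound_wspace[OF g N], rule W_pos, assumption)+
    have "wnorm S (\<lambda>x. V x powr r) (\<lambda>x. kernel_act (P \<theta>) g x - kernel_act (P \<theta>') g x) \<le> ennreal C * ennreal N * ennreal (norm (\<theta> - \<theta>'))"
      by (rule order_trans[OF C(2)[OF \<theta> gw(1)]]) (intro mult_right_mono mult_left_mono gw(2), auto)
    also have "\<dots> = ennreal (C * N * norm (\<theta> - \<theta>'))" using C(1) N by (simp add: ennreal_mult)
    finally show "\<bar>kernel_act (P \<theta>) g x - kernel_act (P \<theta>') g x\<bar> \<le> C * norm (\<theta> - \<theta>') * N * V x powr r"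
      using x C(1) N by (subst (asm) wnorm_le_iff[OF W_pos]) (auto simp: mult_ac)
  qed
qed

lemma ergodic_family_exists:
  assumes L: "compact L" "L \<subseteq> \<Theta>" "L \<noteq> {}" and r: "0 < r" "r \<le> 1"
  shows "\<exists>l b A \<rho> c. ergodic_family S (\<lambda>x. V x powr r) P L l b \<pi> A \<rho> c"
proof -
  obtain C \<epsilon> \<phi> l b where *: "C \<in> sets S" "\<epsilon> > 0" "prob_space \<phi>" "sets \<phi> = sets S" "measure \<phi> C > 0"
      "\<forall>A\<in>sets S. \<forall>\<theta>\<in>L. \<forall>x\<in>C. measure (P \<theta> x) A \<ge> \<epsilon> * measure \<phi> A" "0 \<le> l" "l < 1" "0 < b"
      "\<forall>\<theta>\<in>L. (\<forall>x\<in>space S - C. (\<integral>\<^sup>+y. ennreal (V y) \<partial>P \<theta> x) \<le> ennreal (l * V x)) \<and>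
          (\<forall>x\<in>C. (\<integral>\<^sup>+y. ennreal (V y) \<partial>P \<theta> x) \<le> ennreal b)"
    using drift_minorization[OF L(1,2)] by blast
  have k: "markov_kernel S (P \<theta>)" "bind \<pi> (P \<theta>) = \<pi>" if "\<theta> \<in> L" for \<theta>
    using that L(2) P_kernel inv_pi by auto
  obtain A \<rho> where erg: "\<And>\<theta>. \<theta> \<in> L \<Longrightarrow> ergodic_kernel S (\<lambda>x. V x powr r) (P \<theta>) (l powr r) (b powr r) \<pi> A \<rho>"
    using ergodic_family_powr[of V S L P \<pi>, OF V_meas V1 k(1) prob_pi sets_pi k(2) * r] by blast
  obtain c where c: "0 \<le> c" "\<forall>\<theta>\<in>L. \<forall>\<theta>'\<in>L. \<forall>N g x. wbound S (\<lambda>x. V x powr r) N g \<longrightarrow> x \<in> space S \<longrightarrow>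
      \<bar>kernel_act (P \<theta>) g x - kernel_act (P \<theta>') g x\<bar> \<le> c * norm (\<theta> - \<theta>') * N * V x powr r"
    using kernel_Lipschitz_wbound[OF L(1,2), of r] r by auto
  have "ergodic_family S (\<lambda>x. V x powr r) P L (l powr r) (b powr r) \<pi> A \<rho> c"
    by (rule ergodic_family.intro) (use erg c L(3) in blast)+
  then show ?thesis by blast
qed

lemma drift_exists:
  assumes L: "compact L" "L \<subseteq> \<Theta>"
  shows "\<exists>l b. 0 \<le> l \<and> l < 1 \<and> 0 \<le> b \<and> (\<forall>\<theta>\<in>L. \<forall>x\<in>space S. (\<integral>\<^sup>+y. ennreal (V y) \<partial>P \<theta> x) \<le> ennreal (l * V x + b))"
proof -
  obtain C l b where *: "0 \<le> l" "l < 1" "0 < b"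
      "\<forall>\<theta>\<in>L. (\<forall>x\<in>space S - C. (\<integral>\<^sup>+y. ennreal (V y) \<partial>P \<theta> x) \<le> ennreal (l * V x)) \<and>
          (\<forall>x\<in>C. (\<integral>\<^sup>+y. ennreal (V y) \<partial>P \<theta> x) \<le> ennreal b)"
    using drift_minorization[OF L] by blast
  have "(\<integral>\<^sup>+y. ennreal (V y) \<partial>P \<theta> x) \<le> ennreal (l * V x + b)" if "\<theta> \<in> L" "x \<in> space S" for \<theta> x
  proof -
    have "0 \<le> l * V x" using *(1) V1[OF that(2)] by simp
    then have "ennreal (l * V x) \<le> ennreal (l * V x + b)" "ennreal b \<le> ennreal (l * V x + b)"
      using *(3) by (auto intro!: ennreal_leI)
    then show ?thesis
      using *(4) that by (cases "x \<in> C") (auto intro: order_trans)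
  qed
  then show ?thesis using *(1-3) by (intro exI[of _ l] exI[of _ b]) auto
qed

lemma H_bound_exists:
  assumes L: "compact L" "L \<subseteq> \<Theta>"
  shows "\<exists>CH\<ge>0. \<forall>\<theta>\<in>L. \<forall>x\<in>space S. norm (H \<theta> x) \<le> CH * V x powr \<beta>"
proof -
  have "(SUP \<theta>\<in>L. wnorm S (\<lambda>x. V x powr \<beta>) (H \<theta>)) < \<infinity>"
    using H_Lip L unfolding W_Lipschitz_def by blast
  then obtain C where C: "0 \<le> C" "(SUP \<theta>\<in>L. wnorm S (\<lambda>x. V x powr \<beta>) (H \<theta>)) = ennreal C"
    by (cases "(SUP \<theta>\<in>L. wnorm S (\<lambda>x. V x powr \<beta>) (H \<theta>))") auto
  have "wnorm S (\<lambda>x. V x powr \<beta>) (H \<theta>) \<le> ennreal C" if "\<theta> \<in> L" for \<theta>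
    unfolding C(2)[symmetric] using that by (rule SUP_upper)
  then show ?thesis
    using C(1) by (intro exI[of _ C]) (auto simp: wnorm_le_iff[OF W_pos C(1)])
qed

text \<open>The midpoint of \<alpha> and \<open>(1 - \<beta>) / 2\<close>. It is positive even for
  \<alpha> = 0, and because \<alpha> lies strictly below the second number, \<open>2 * a\<close>
  lies strictly below \<open>1 - \<beta>\<close>.\<close>

definition a where "a = (\<alpha> + (1 - \<beta>) / 2) / 2"

lemma a: "0 < a" "\<alpha> \<le> a" "2 * a + \<beta> \<le> 1" "2 * a < 1" "a \<le> 1" "2 * a \<le> 1"
proof -
  note ab = \<alpha> \<beta>
  show "0 < a" using ab unfolding a_def by argo
  show "\<alpha> \<le> a" using ab unfolding a_def by argo
  show "2 * a + \<beta> \<le> 1" using ab unfolding a_def by argo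
  show "2 * a < 1" using ab unfolding a_def by argo
  show "a \<le> 1" using ab unfolding a_def by argo
  show "2 * a \<le> 1" using ab unfolding a_def by argo
qed

lemma f_wbound: "\<exists>Nf. wbound S (\<lambda>x. V x powr a) Nf f"
proof -
  obtain N where N: "0 \<le> N" "wbound S (\<lambda>x. V x powr \<alpha>) N f" using wspace_wbound[OF f W_pos] by blast
  have "wbound S (\<lambda>x. V x powr a) N f"
    unfolding wbound_def
  proof (intro conjI ballI wbound_measurable[OF N(2)])
    fix x assume x: "x \<in> space S"
    have "N * V x powr \<alpha> \<le> N * V x powr a"
      using N(1) a(2) V1[OF x] by (intro mult_left_mono powr_mono) auto
    then show "\<bar>f x\<bar> \<le> N * V x powr a" using wboundD[OF N(2) x] by simp
  qed
  then show ?thesis by blast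
qed

lemma sa_clt_exists:
  assumes ne: "K i \<noteq> {}" and Rr: "1 \<le> Rr"
  shows "\<exists>l b CH Nf l1 b1 A1 \<rho>1 c1 l2 b2 A2 \<rho>2 c2.
    sa_clt S \<Theta> P H proj \<gamma> K M Z z\<^sub>0 V (K i) m Rr l b \<beta> CH \<pi> f Nf a l1 b1 A1 \<rho>1 c1 l2 b2 A2 \<rho>2 c2"
proof -
  note L = K_props(1,2)[of i]
  obtain l b where lb: "0 \<le> l" "l < 1" "0 \<le> b" "\<forall>\<theta>\<in>K i. \<forall>x\<in>space S. (\<integral>\<^sup>+y. ennreal (V y) \<partial>P \<theta> x) \<le> ennreal (l * V x + b)"
    using drift_exists[OF L] by blast
  obtain CH where CH: "0 \<le> CH" "\<forall>\<theta>\<in>K i. \<forall>x\<in>space S. norm (H \<theta> x) \<le> CH * V x powr \<beta>"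
    using H_bound_exists[OF L] by blast
  obtain Nf where Nf: "wbound S (\<lambda>x. V x powr a) Nf f" using f_wbound by blast
  obtain l1 b1 A1 \<rho>1 c1 where E1: "ergodic_family S (\<lambda>x. V x powr a) P (K i) l1 b1 \<pi> A1 \<rho>1 c1"
    using ergodic_family_exists[OF L ne a(1,5)] by blast
  obtain l2 b2 A2 \<rho>2 c2 where E2: "ergodic_family S (\<lambda>x. V x powr (2 * a)) P (K i) l2 b2 \<pi> A2 \<rho>2 c2"
    using ergodic_family_exists[OF L ne _ a(6)] a(1) by auto
  interpret A: sa_local S \<Theta> P H proj \<gamma> K M Z z\<^sub>0 V "K i" m Rr l b \<beta> CH
    using L lb CH Rr \<beta> gamma V1 by unfold_locales auto
  have "sa_clt S \<Theta> P H proj \<gamma> K M Z z\<^sub>0 V (K i) m Rr l b \<beta> CH \<pi> f Nf a l1 b1 A1 \<rho>1 c1 l2 b2 A2 \<rho>2 c2"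
    using E1 E2 Nf a delayed_average_tendsto_0[OF gamma(2,3), of m]
    by (intro sa_clt.intro A.sa_local_axioms sa_clt_axioms.intro) (auto simp: A.gam_def)
  then show ?thesis by blast
qed

lemma K_eventually: "\<theta> \<in> \<Theta> \<Longrightarrow> \<exists>q. \<forall>i\<ge>q. \<theta> \<in> interior (K i)"
proof -
  assume "\<theta> \<in> \<Theta>"
  then obtain q where "\<theta> \<in> interior (K q)" using K_props(4) by blast
  then show ?thesis using K_mono interior_mono by (intro exI[of _ q]) blast
qed

definition av where "av \<theta> = asym_var S \<pi> (P \<theta>) f"

lemma av_K: assumes "K i \<noteq> {}" shows "continuous_on (K i) av" "\<And>\<theta>. \<theta> \<in> K i \<Longrightarrow> 0 \<le> av \<theta>"
proof -
  obtain l b CH Nf l1 b1 A1 \<rho>1 c1 l2 b2 A2 \<rho>2 c2 where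
    "sa_clt S \<Theta> P H proj \<gamma> K M Z z\<^sub>0 V (K i) 0 1 l b \<beta> CH \<pi> f Nf a l1 b1 A1 \<rho>1 c1 l2 b2 A2 \<rho>2 c2"
    using sa_clt_exists[OF assms, of 1 0] by auto
  then interpret A: sa_clt S \<Theta> P H proj \<gamma> K M Z z\<^sub>0 V "K i" 0 1 l b \<beta> CH \<pi> f Nf a l1 b1 A1 \<rho>1 c1 l2 b2 A2 \<rho>2 c2 .
  show "continuous_on (K i) av"
    using A.sig2_continuous by (rule continuous_on_eq) (simp add: A.sig2_asym_var av_def)
  show "\<And>\<theta>. \<theta> \<in> K i \<Longrightarrow> 0 \<le> av \<theta>"
    using A.sig2_nonneg by (simp add: A.sig2_asym_var av_def)
qed

lemma av_nonneg: "\<theta> \<in> \<Theta> \<Longrightarrow> 0 \<le> av \<theta>"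
proof -
  assume "\<theta> \<in> \<Theta>"
  then obtain q where "\<theta> \<in> K q" using K_props(4) interior_subset by blast
  then show ?thesis using av_K(2)[of q] by auto
qed

text \<open>Continuity is a local property, and the interiors of the sets \<open>K q\<close> exhaust
  \<Theta>.\<close>

lemma av_continuous: "continuous_on \<Theta> av"
proof (rule continuous_at_imp_continuous_on, rule ballI)
  fix \<theta> assume "\<theta> \<in> \<Theta>"
  then obtain q where q: "\<theta> \<in> interior (K q)" using K_props(4) by blast
  then have "K q \<noteq> {}" using interior_subset by blast
  from continuous_on_interior[OF av_K(1)[OF this] q] show "isCont av \<theta>" .
qed

definition \<sigma>2 where "\<sigma>2 \<omega> = av (\<theta>_lim \<omega>)"

lemma lim_Theta: "\<omega> \<in> space M \<Longrightarrow> \<theta>_lim \<omega> \<in> \<Theta>"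
  using measurable_space[OF lim_meas] by (auto simp: space_restrict_space)

lemma \<sigma>2_nonneg: "\<omega> \<in> space M \<Longrightarrow> 0 \<le> \<sigma>2 \<omega>"
  unfolding \<sigma>2_def by (intro av_nonneg lim_Theta)

lemma \<sigma>2_meas [measurable]: "\<sigma>2 \<in> borel_measurable M"
  unfolding \<sigma>2_def[abs_def]
  by (rule measurable_compose[OF lim_meas borel_measurable_continuous_on_restrict[OF av_continuous]])

lemma lim_meas' [measurable]: "\<theta>_lim \<in> borel_measurable M"
  using lim_meas by (rule measurable_restrict_space2_iff[THEN iffD1, THEN conjunct1])

lemma cem_dist_tendsto: "AE \<omega> in M. (\<lambda>n. cem_dist (st_param (Z n \<omega>)) (\<theta>_lim \<omega>)) \<longlonglongrightarrow> 0"
  using lim_conv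
proof eventually_elim
  case (elim \<omega>)
  have "liminf (\<lambda>n. cem_dist (st_param (Z n \<omega>)) (\<theta>_lim \<omega>)) \<le> limsup (\<lambda>n. cem_dist (st_param (Z n \<omega>)) (\<theta>_lim \<omega>))"
    by (rule Liminf_le_Limsup) simp
  then show ?case using elim by (intro Liminf_eq_Limsup) auto
qed

text \<open>The cemetery has infinite distance, so a small distance excludes it.\<close>

lemma near_lim:
  assumes "(\<lambda>n. cem_dist (st_param (Z n \<omega>)) (\<theta>_lim \<omega>)) \<longlonglongrightarrow> 0" "0 < d"
  shows "\<forall>\<^sub>F n in sequentially. st_param (Z n \<omega>) = Some (st_val (Z n \<omega>)) \<and> dist (st_val (Z n \<omega>)) (\<theta>_lim \<omega>) < d"
proof -
  have "\<forall>\<^sub>F n in sequentially. cem_dist (st_param (Z n \<omega>)) (\<theta>_lim \<omega>) < ennreal d"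
    using assms by (intro order_tendstoD(2)) auto
  then show ?thesis
  proof eventually_elim
    case (elim n)
    then show ?case
      by (cases "st_param (Z n \<omega>)") (auto simp: st_val_def dist_norm ennreal_less_iff)
  qed
qed

lemma val_tendsto: "AE \<omega> in M. (\<lambda>n. st_val (Z n \<omega>)) \<longlonglongrightarrow> \<theta>_lim \<omega>"
  using cem_dist_tendsto
proof eventually_elim
  case (elim \<omega>)
  show ?case
  proof (rule tendstoI)
    fix d :: real assume "0 < d"
    from near_lim[OF elim this] show "\<forall>\<^sub>F n in sequentially. dist (st_val (Z n \<omega>)) (\<theta>_lim \<omega>) < d"
      by eventually_elim simp
  qed
qed

text \<open>One index serves for the time and for the compact set. The events then increase, and the
  index can be used both as the starting time and as the number of the compact set in
  \<open>local_clt\<close>.\<close>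

definition settled :: "nat \<Rightarrow> 'w set" where
  "settled i = {\<omega> \<in> space M. \<forall>j\<in>{i..}. st_param (Z j \<omega>) \<in> Some ` K i \<and> 1 \<le> st_nu (Z j \<omega>)}"

text \<open>Once the parameter stays in \<open>K q\<close>, every reprojection increases \<open>\<kappa>\<close>, and none occurs after \<open>\<kappa> \<ge> q\<close>.\<close>

lemma settled_AE: "AE \<omega> in M. \<exists>i. \<omega> \<in> settled i"
  using cem_dist_tendsto trans_AE AE_space
proof eventually_elim
  case (elim \<omega>)
  define ka nu where "ka n = st_kappa (Z n \<omega>)" and "nu n = st_nu (Z n \<omega>)" for n
  have tr: "if st_param (Z (Suc n) \<omega>) \<in> Some ` K (ka n) then ka (Suc n) = ka n \<and> nu (Suc n) = Suc (nu n) else ka (Suc n) = Suc (ka n) \<and> nu (Suc n) = 0" for n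
    using elim(2) by (auto simp: trans_rel_def ka_def nu_def)
  have mono: "ka n \<le> ka (Suc n)" for n using tr[of n] by (auto split: if_splits)
  have mono': "n \<le> n' \<Longrightarrow> ka n \<le> ka n'" for n n' using mono by (rule lift_Suc_mono_le)
  obtain q where q: "\<theta>_lim \<omega> \<in> interior (K q)" using K_props(4)[OF lim_Theta[OF elim(3)]] by blast
  then obtain d where d: "0 < d" "ball (\<theta>_lim \<omega>) d \<subseteq> K q" by (auto simp: mem_interior)
  obtain n0 where n0: "\<And>n. n \<ge> n0 \<Longrightarrow> st_param (Z n \<omega>) = Some (st_val (Z n \<omega>)) \<and> dist (st_val (Z n \<omega>)) (\<theta>_lim \<omega>) < d"
    using near_lim[OF elim(1) d(1)] by (auto simp: eventually_sequentially)
  have inK: "st_param (Z n \<omega>) \<in> Some ` K i" if "n0 \<le> n" "q \<le> i" for n i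
  proof -
    have "st_val (Z n \<omega>) \<in> K q" using n0[OF that(1)] d(2) by (auto simp: dist_commute)
    then show ?thesis using n0[OF that(1)] K_mono[OF that(2)] by force
  qed
  have "\<exists>n1\<ge>n0. \<forall>n\<ge>n1. 1 \<le> nu n"
  proof (cases "\<exists>n\<ge>n0. q \<le> ka n")
    case True
    then obtain n where n: "n0 \<le> n" "q \<le> ka n" by auto
    have "1 \<le> nu (Suc j)" if "n \<le> j" for j
      using tr[of j] inK[of "Suc j" "ka j"] n that mono'[OF that] by auto
    then have "1 \<le> nu j" if "Suc n \<le> j" for j using that by (cases j) auto
    then show ?thesis using n(1) by (intro exI[of _ "Suc n"]) auto
  next
    case False
    have "ka n < q" if "n0 \<le> n" for n using False that by (meson not_le)
    then have "ka ` {n0..} \<subseteq> {..<q}" by blast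
    then have bd: "finite (ka ` {n0..})" by (rule finite_subset) simp
    \<comment> \<open>Being monotone and bounded, \<kappa> is constant from the place where it
      attains its maximum, and \<nu> is set to 0 only when \<kappa> increases.\<close>
    define mx where "mx = Max (ka ` {n0..})"
    have "mx \<in> ka ` {n0..}" unfolding mx_def using bd by (intro Max_in) auto
    then obtain n where n: "n0 \<le> n" "ka n = mx" by auto
    have "ka j = mx" if "n \<le> j" for j
      using Max_ge[OF bd, of "ka j"] n that mono'[OF that] by (auto simp: mx_def intro!: antisym)
    then have "1 \<le> nu (Suc j)" if "n \<le> j" for j
      using tr[of j] that by (auto split: if_splits)
    then have "1 \<le> nu j" if "Suc n \<le> j" for j using that by (cases j) auto
    then show ?thesis using n(1) by (intro exI[of _ "Suc n"]) auto
  qed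
  then obtain n1 where n1: "n0 \<le> n1" "\<And>n. n1 \<le> n \<Longrightarrow> 1 \<le> nu n" by blast
  have "\<omega> \<in> settled (max q n1)"
    unfolding settled_def using elim(3) inK n1 by (auto simp: nu_def)
  then show ?case by blast
qed

lemma settled_sets [measurable]: "settled i \<in> sets M"
proof -
  have [measurable]: "Some ` K i \<in> sets (cem_space \<Theta>)" by (intro cem_sets_Some K_borel K_props)
  show ?thesis unfolding settled_def by measurable
qed

lemma settled_prob: "(\<lambda>i. prob (settled i)) \<longlonglongrightarrow> 1"
proof -
  have inc: "incseq settled"
  proof (rule incseq_SucI)
    fix i
    show "settled i \<subseteq> settled (Suc i)"
      unfolding settled_def using K_props(3)[of i] by fastforce
  qed
  have "prob (\<Union>i. settled i) = 1"
    using settled_AE by (intro prob_eq_1[THEN iffD2]) (auto elim!: eventually_mono)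
  moreover have "range settled \<subseteq> sets M" using settled_sets by blast
  ultimately show ?thesis using finite_Lim_measure_incseq[OF _ inc] by simp
qed

definition Tn where "Tn n \<omega> = (\<Sum>k=1..n. f (fst (Z k \<omega>)) - (\<integral>x. f x \<partial>\<pi>))"

text \<open>First the index \<open>i\<close> of a settled event of probability close to 1 is chosen,
  then a level \<open>N\<close> for \<open>V\<close> at time \<open>i\<close>. On the intersection
  the path lies in \<open>Jinf\<close>, and the error in \<open>local_clt\<close> is a null sequence
  plus a multiple of the probability of the complement.\<close>

theorem global_clt:
  fixes \<psi> :: "real \<Rightarrow> real"
  assumes \<psi>: "continuous_on UNIV \<psi>" "\<And>x. \<bar>\<psi> x\<bar> \<le> cu"
  shows "(\<lambda>n. \<integral>\<omega>. exp (\<i> * complex_of_real (\<psi> (\<sigma>2 \<omega>) * Tn n \<omega> / sqrt (real n))) \<partial>M)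
    \<longlonglongrightarrow> (\<integral>\<omega>. complex_of_real (exp (- ((\<psi> (\<sigma>2 \<omega>))\<^sup>2 * \<sigma>2 \<omega> / 2))) \<partial>M)"
    (is "?G1 \<longlonglongrightarrow> ?G2")
proof (rule LIMSEQ_I)
  \<comment> \<open>Each of the two events will miss at most \<open>e / 16\<close>. The factor 4 in
    \<open>local_clt\<close> makes this \<open>e / 2\<close> in total, and the null sequence takes
    the other half.\<close>
  fix e :: real assume e: "0 < e"
  obtain \<omega>0 where "\<omega>0 \<in> space M" using not_empty by auto
  then obtain q where "\<forall>i\<ge>q. \<theta>_lim \<omega>0 \<in> interior (K i)" using K_eventually[OF lim_Theta] by blast
  then have ne: "\<forall>\<^sub>F i in sequentially. K i \<noteq> {}"
    using interior_subset unfolding eventually_sequentially by blast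
  have "\<forall>\<^sub>F i in sequentially. 1 - e / 16 < prob (settled i)"
    using settled_prob e by (intro order_tendstoD(1)) auto
  with ne have "\<forall>\<^sub>F i in sequentially. K i \<noteq> {} \<and> 1 - e / 16 < prob (settled i)"
    by eventually_elim simp
  then obtain i where i: "K i \<noteq> {}" "1 - e / 16 < prob (settled i)"
    using eventually_happens by fastforce
  define VB where "VB n = {\<omega> \<in> space M. V (fst (Z i \<omega>)) \<le> real n}" for n
  have [measurable]: "(\<lambda>\<omega>. V (fst (Z i \<omega>))) \<in> borel_measurable M"
    by (rule measurable_compose[OF measurable_compose[OF Z_meas st_meas(1)] V_meas])
  have VB_sets [measurable]: "VB n \<in> sets M" for n unfolding VB_def by measurable
  have "(\<lambda>n. prob (VB n)) \<longlonglongrightarrow> prob (\<Union>n. VB n)"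
    by (rule finite_Lim_measure_incseq) (auto simp: incseq_def VB_def)
  moreover have "(\<Union>n. VB n) = space M"
    by (auto simp: VB_def intro: real_arch_simple)
  ultimately have "(\<lambda>n. prob (VB n)) \<longlonglongrightarrow> 1" by (simp add: prob_space)
  then have "\<forall>\<^sub>F n in sequentially. 1 - e / 16 < prob (VB n)"
    using e by (intro order_tendstoD(1)) auto
  then have "\<forall>\<^sub>F n in sequentially. 1 \<le> n \<and> 1 - e / 16 < prob (VB n)"
    using eventually_ge_at_top[of 1] by eventually_elim simp
  then obtain N where N: "1 \<le> N" "1 - e / 16 < prob (VB N)"
    using eventually_happens by fastforce
  have Rr: "1 \<le> real N" using N(1) by simp
  obtain l b CH Nf l1 b1 A1 \<rho>1 c1 l2 b2 A2 \<rho>2 c2 where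
    "sa_clt S \<Theta> P H proj \<gamma> K M Z z\<^sub>0 V (K i) i (real N) l b \<beta> CH \<pi> f Nf a l1 b1 A1 \<rho>1 c1 l2 b2 A2 \<rho>2 c2"
    using sa_clt_exists[OF i(1) Rr, of i] by auto
  then interpret A: sa_clt S \<Theta> P H proj \<gamma> K M Z z\<^sub>0 V "K i" i "real N" l b \<beta> CH \<pi> f Nf a l1 b1 A1 \<rho>1 c1 l2 b2 A2 \<rho>2 c2 .
  have sub: "settled i \<inter> VB N \<subseteq> A.Jinf"
    by (auto simp: A.Jinf_def A.J_def A.good_def A.X_def settled_def VB_def)
  have pr: "prob (space M - A.Jinf) \<le> e / 8"
  proof -
    have "prob (space M - A.Jinf) \<le> prob ((space M - settled i) \<union> (space M - VB N))"
      using sub by (intro finite_measure_mono) auto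
    also have "\<dots> \<le> prob (space M - settled i) + prob (space M - VB N)"
      by (intro measure_Un_le) auto
    also have "\<dots> = (1 - prob (settled i)) + (1 - prob (VB N))"
      by (simp add: prob_compl)
    finally show ?thesis using i(2) N(2) by simp
  qed
  have conv: "AE \<omega> in M. (\<lambda>k. A.T k \<omega>) \<longlonglongrightarrow> \<theta>_lim \<omega>"
    using val_tendsto by (simp add: A.T_def)
  have nn: "AE \<omega> in M. 0 \<le> \<sigma>2 \<omega>" by (rule AE_I2) (rule \<sigma>2_nonneg)
  have eq: "\<sigma>2 \<omega> = A.sig2 (\<theta>_lim \<omega>)" if "\<theta>_lim \<omega> \<in> K i" for \<omega>
    using that by (simp add: \<sigma>2_def av_def A.sig2_asym_var)
  obtain er where er: "er \<longlonglongrightarrow> 0" "\<And>n. norm (?G1 n - ?G2) \<le> er n + 4 * prob (space M - A.Jinf)"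
    using A.local_clt[OF lim_meas' conv \<psi> \<sigma>2_meas nn eq] unfolding Tn_def A.X_def A.pf_def by blast
  have "\<forall>\<^sub>F n in sequentially. er n < e / 2"
    using er(1) e by (intro order_tendstoD(2)) auto
  then have "\<forall>\<^sub>F n in sequentially. norm (?G1 n - ?G2) < e"
  proof eventually_elim
    case (elim n)
    then show ?case using er(2)[of n] pr by linarith
  qed
  then show "\<exists>no. \<forall>n\<ge>no. norm (?G1 n - ?G2) < e" by (simp add: eventually_sequentially)
qed

end

section \<open>From characteristic functions to weak convergence\<close>

context sa_global
begin

lemma f_meas [measurable]: "f \<in> borel_measurable S"
  using f by (simp add: wspace_def)

lemma Tn_meas [measurable]: "Tn n \<in> borel_measurable M"
proof -
  have [measurable]: "(\<lambda>\<omega>. f (fst (Z k \<omega>))) \<in> borel_measurable M" for k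
    by (rule measurable_compose[OF measurable_compose[OF Z_meas st_meas(1)] f_meas])
  show ?thesis unfolding Tn_def[abs_def] by measurable
qed

lemma char_distr:
  assumes [measurable]: "h \<in> borel_measurable M"
  shows "char (distr M borel h) t = (\<integral>\<omega>. exp (\<i> * complex_of_real (t * h \<omega>)) \<partial>M)"
  unfolding char_def by (subst integral_distr) auto

lemma real_distribution_distr: "h \<in> borel_measurable M \<Longrightarrow> real_distribution (distr M borel h)"
  by (simp add: real_distribution_def real_distribution_axioms_def prob_space_distr)

text \<open>The limit law is realised on a product space, as the square root of \<sigma>2 times an
  independent standard normal variable.\<close>

lemma mixture_distribution:
  "\<exists>\<mu>. real_distribution \<mu> \<and> (\<forall>t. char \<mu> t = complex_of_real (\<integral>\<omega>. exp (- (1 / 2) * \<sigma>2 \<omega> * t\<^sup>2) \<partial>M))"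
proof -
  interpret N: real_distribution std_normal_distribution by (rule real_dist_normal_dist)
  interpret PP: pair_prob_space M std_normal_distribution ..
  let ?h = "\<lambda>p. sqrt (\<sigma>2 (fst p)) * snd p"
  have snd_m [measurable]: "snd \<in> borel_measurable (M \<Otimes>\<^sub>M std_normal_distribution)"
    using measurable_snd[of M std_normal_distribution] by (simp add: measurable_cong_sets[OF refl N.events_eq_borel])
  have hm: "?h \<in> borel_measurable (M \<Otimes>\<^sub>M std_normal_distribution)" by measurable
  define \<mu> where "\<mu> = distr (M \<Otimes>\<^sub>M std_normal_distribution) borel ?h"
  have rd: "real_distribution \<mu>"
    unfolding \<mu>_def real_distribution_def real_distribution_axioms_def
    using PP.prob_space_distr[OF hm] by simp
  have "char \<mu> t = complex_of_real (\<integral>\<omega>. exp (- (1 / 2) * \<sigma>2 \<omega> * t\<^sup>2) \<partial>M)" for t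
  proof -
    have int: "integrable (M \<Otimes>\<^sub>M std_normal_distribution) (\<lambda>p. exp (\<i> * complex_of_real (t * ?h p)))"
      using hm by (intro PP.integrable_const_bound[where B=1]) auto
    have "char \<mu> t = (\<integral>p. exp (\<i> * complex_of_real (t * ?h p)) \<partial>(M \<Otimes>\<^sub>M std_normal_distribution))"
      unfolding \<mu>_def char_def using hm by (subst integral_distr) auto
    also have "\<dots> = (\<integral>\<omega>. \<integral>z. exp (\<i> * complex_of_real (t * ?h (\<omega>, z))) \<partial>std_normal_distribution \<partial>M)"
      using PP.integral_fst'[OF int] by simp
    also have "\<dots> = (\<integral>\<omega>. complex_of_real (exp (- (1 / 2) * \<sigma>2 \<omega> * t\<^sup>2)) \<partial>M)"
    proof (rule Bochner_Integration.integral_cong[OF refl])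
      fix \<omega> assume \<omega>: "\<omega> \<in> space M"
      have "(\<integral>z. exp (\<i> * complex_of_real (t * ?h (\<omega>, z))) \<partial>std_normal_distribution) = char std_normal_distribution (t * sqrt (\<sigma>2 \<omega>))"
        unfolding char_def by (simp add: mult.assoc)
      also have "\<dots> = complex_of_real (exp (- (1 / 2) * \<sigma>2 \<omega> * t\<^sup>2))"
        using \<sigma>2_nonneg[OF \<omega>] by (simp add: char_std_normal_distribution power_mult_distrib mult.commute)
      finally show "(\<integral>z. exp (\<i> * complex_of_real (t * ?h (\<omega>, z))) \<partial>std_normal_distribution) = complex_of_real (exp (- (1 / 2) * \<sigma>2 \<omega> * t\<^sup>2))" .
    qed
    also have "\<dots> = complex_of_real (\<integral>\<omega>. exp (- (1 / 2) * \<sigma>2 \<omega> * t\<^sup>2) \<partial>M)"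
      by (rule integral_complex_of_real)
    finally show ?thesis .
  qed
  with rd show ?thesis by blast
qed

theorem mixture_clt:
  "\<exists>\<mu>. real_distribution \<mu> \<and> (\<forall>t. char \<mu> t = complex_of_real (\<integral>\<omega>. exp (- (1 / 2) * \<sigma>2 \<omega> * t\<^sup>2) \<partial>M)) \<and>
    weak_conv_m (\<lambda>n. distr M borel (\<lambda>\<omega>. real n powr (- 1 / 2) * Tn n \<omega>)) \<mu>"
proof -
  obtain \<mu> where \<mu>: "real_distribution \<mu>" "\<And>t. char \<mu> t = complex_of_real (\<integral>\<omega>. exp (- (1 / 2) * \<sigma>2 \<omega> * t\<^sup>2) \<partial>M)"
    using mixture_distribution by blast
  \<comment> \<open>This holds for \<open>n = 0\<close> as well, where both sides have the default
    value 0.\<close>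
  have pw: "real n powr (- 1 / 2) = 1 / sqrt (real n)" for n
    using powr_half_sqrt[of "real n"] powr_minus_divide[of "real n" "1/2"] by simp
  have "weak_conv_m (\<lambda>n. distr M borel (\<lambda>\<omega>. real n powr (- 1 / 2) * Tn n \<omega>)) \<mu>"
  proof (rule levy_continuity[OF _ \<mu>(1)])
    show "real_distribution (distr M borel (\<lambda>\<omega>. real n powr (- 1 / 2) * Tn n \<omega>))" for n
      by (rule real_distribution_distr) measurable
    fix t
    have "(\<lambda>n. \<integral>\<omega>. exp (\<i> * complex_of_real (t * Tn n \<omega> / sqrt (real n))) \<partial>M)
      \<longlonglongrightarrow> (\<integral>\<omega>. complex_of_real (exp (- (t\<^sup>2 * \<sigma>2 \<omega> / 2))) \<partial>M)"
      by (rule global_clt[of "\<lambda>_. t" "\<bar>t\<bar>"]) auto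
    moreover have "(\<integral>\<omega>. complex_of_real (exp (- (t\<^sup>2 * \<sigma>2 \<omega> / 2))) \<partial>M) = char \<mu> t"
      unfolding \<mu>(2) integral_complex_of_real by (simp add: mult.commute)
    moreover have "char (distr M borel (\<lambda>\<omega>. real n powr (- 1 / 2) * Tn n \<omega>)) t = (\<integral>\<omega>. exp (\<i> * complex_of_real (t * Tn n \<omega> / sqrt (real n))) \<partial>M)" for n
    proof -
      have m: "(\<lambda>\<omega>. real n powr (- 1 / 2) * Tn n \<omega>) \<in> borel_measurable M" by measurable
      show ?thesis by (simp only: char_distr[OF m]) (simp only: pw, simp)
    qed
    ultimately show "(\<lambda>n. char (distr M borel (\<lambda>\<omega>. real n powr (- 1 / 2) * Tn n \<omega>)) t) \<longlonglongrightarrow> char \<mu> t" by simp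
  qed
  with \<mu> show ?thesis by blast
qed

text \<open>The inverse square root is unbounded near 0, hence the cut-off \<open>d\<close>. Off
  \<open>Bad j\<close> the cut-off is not active, and the exponent of the limit no longer depends on
  \<sigma>2, so that the mixture collapses to a normal law. The events \<open>Bad j\<close> shrink
  to a null set because \<sigma>2 is positive almost surely.\<close>

theorem normalised_clt:
  assumes pos: "AE \<omega> in M. 0 < sqrt (\<sigma>2 \<omega>)"
  shows "weak_conv_m (\<lambda>n. distr M borel (\<lambda>\<omega>. 1 / (sqrt (real n) * sqrt (\<sigma>2 \<omega>)) * Tn n \<omega>)) std_normal_distribution"
proof (rule levy_continuity[OF _ real_dist_normal_dist])
  show "real_distribution (distr M borel (\<lambda>\<omega>. 1 / (sqrt (real n) * sqrt (\<sigma>2 \<omega>)) * Tn n \<omega>))" for n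
    by (rule real_distribution_distr) measurable
  fix t
  define g where "g n \<omega> = exp (\<i> * complex_of_real (t * (1 / (sqrt (real n) * sqrt (\<sigma>2 \<omega>)) * Tn n \<omega>)))" for n \<omega>
  have [measurable]: "g n \<in> borel_measurable M" for n unfolding g_def[abs_def] by measurable
  have g1: "norm (g n \<omega>) = 1" for n \<omega> unfolding g_def by (rule norm_exp_i_times)
  have gi: "integrable M (g n)" for n using g1 by (intro integrable_const_bound[where B=1]) auto
  define c where "c = exp (- t\<^sup>2 / 2)"
  have c: "0 \<le> c" "c \<le> 1" by (auto simp: c_def)
  define Bad where "Bad j = {\<omega> \<in> space M. sqrt (\<sigma>2 \<omega>) < 1 / real (Suc j)}" for j
  have Bad_sets [measurable]: "Bad j \<in> sets M" for j unfolding Bad_def by measurable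
  have "(\<lambda>j. prob (Bad j)) \<longlonglongrightarrow> prob (\<Inter>j. Bad j)"
  proof (rule finite_Lim_measure_decseq)
    show "decseq Bad"
    proof (rule decseq_SucI, rule subsetI)
      fix j \<omega> assume "\<omega> \<in> Bad (Suc j)"
      moreover have "1 / real (Suc (Suc j)) \<le> 1 / real (Suc j)" by (intro divide_left_mono) auto
      ultimately show "\<omega> \<in> Bad j" unfolding Bad_def by auto
    qed
  qed auto
  moreover have "prob (\<Inter>j. Bad j) = 0"
  proof -
    have "AE \<omega> in M. \<omega> \<notin> (\<Inter>j. Bad j)"
      using pos
    proof eventually_elim
      case (elim \<omega>)
      then obtain j where "1 / real (Suc j) < sqrt (\<sigma>2 \<omega>)" using nat_approx_posE by blast
      then show ?case by (auto simp: Bad_def intro!: exI[of _ j])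
    qed
    then show ?thesis by (subst measure_eq_AE[where B="{}"]) auto
  qed
  ultimately have Bad0: "(\<lambda>j. prob (Bad j)) \<longlonglongrightarrow> 0" by simp
  have "(\<lambda>n. \<integral>\<omega>. g n \<omega> \<partial>M) \<longlonglongrightarrow> complex_of_real c"
  proof (rule LIMSEQ_I)
    \<comment> \<open>\<open>Bad j\<close> enters twice with factor 2, so probability below
      \<open>e / 8\<close> costs \<open>e / 2\<close>; the rest is left to
      \<open>global_clt\<close>.\<close>
    fix e :: real assume e: "0 < e"
    have "\<forall>\<^sub>F j in sequentially. prob (Bad j) < e / 8"
      using Bad0 e by (intro order_tendstoD(2)) auto
    then obtain j where j: "prob (Bad j) < e / 8" using eventually_happens by fastforce
    define d where "d = 1 / real (Suc j)"
    have d: "0 < d" by (simp add: d_def)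
    define \<psi> where "\<psi> x = t / max (sqrt x) d" for x
    have \<psi>c: "continuous_on UNIV \<psi>"
      unfolding \<psi>_def using d by (intro continuous_intros) (auto simp: max_def)
    have \<psi>b: "\<bar>\<psi> x\<bar> \<le> \<bar>t\<bar> / d" for x
      unfolding \<psi>_def using d by (auto simp: abs_div intro!: divide_left_mono mult_pos_pos)
    define h where "h n \<omega> = exp (\<i> * complex_of_real (\<psi> (\<sigma>2 \<omega>) * Tn n \<omega> / sqrt (real n)))" for n \<omega>
    define k where "k \<omega> = exp (- ((\<psi> (\<sigma>2 \<omega>))\<^sup>2 * \<sigma>2 \<omega> / 2))" for \<omega>
    have [measurable]: "\<psi> \<in> borel_measurable borel" by (rule borel_measurable_continuous_onI[OF \<psi>c])
    have [measurable]: "h n \<in> borel_measurable M" "k \<in> borel_measurable M" for n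
      unfolding h_def[abs_def] k_def[abs_def] by measurable
    have h1: "norm (h n \<omega>) = 1" for n \<omega> unfolding h_def by (rule norm_exp_i_times)
    have hi: "integrable M (h n)" for n using h1 by (intro integrable_const_bound[where B=1]) auto
    have k1: "0 \<le> k \<omega>" "k \<omega> \<le> 1" if "\<omega> \<in> space M" for \<omega>
      using \<sigma>2_nonneg[OF that] by (auto simp: k_def)
    have ki: "integrable M k" using k1 by (intro integrable_const_bound[where B=1]) auto
    have good: "sqrt (\<sigma>2 \<omega>) \<ge> d" if "\<omega> \<in> space M" "\<omega> \<notin> Bad j" for \<omega>
      using that by (auto simp: Bad_def d_def)
    have gh: "g n \<omega> = h n \<omega>" if "\<omega> \<in> space M" "\<omega> \<notin> Bad j" for n \<omega>
    proof -
      have "max (sqrt (\<sigma>2 \<omega>)) d = sqrt (\<sigma>2 \<omega>)" using good[OF that] by simp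
      then show ?thesis by (simp add: g_def h_def \<psi>_def mult.commute)
    qed
    have kc: "k \<omega> = c" if "\<omega> \<in> space M" "\<omega> \<notin> Bad j" for \<omega>
    proof -
      have m: "max (sqrt (\<sigma>2 \<omega>)) d = sqrt (\<sigma>2 \<omega>)" using good[OF that] by simp
      have "0 < sqrt (\<sigma>2 \<omega>)" using good[OF that] d by linarith
      then have "0 < \<sigma>2 \<omega>" by simp
      then have "(\<psi> (\<sigma>2 \<omega>))\<^sup>2 * \<sigma>2 \<omega> = t\<^sup>2"
        unfolding \<psi>_def m by (simp add: power_divide)
      then show ?thesis by (simp add: k_def c_def)
    qed
    have Bi: "integrable M (\<lambda>\<omega>. indicator (Bad j) \<omega> :: real)"
      by (intro integrable_real_indicator) (auto simp: less_top[symmetric])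
    have d1: "norm ((\<integral>\<omega>. g n \<omega> \<partial>M) - (\<integral>\<omega>. h n \<omega> \<partial>M)) \<le> 2 * prob (Bad j)" for n
    proof -
      have "norm ((\<integral>\<omega>. g n \<omega> \<partial>M) - (\<integral>\<omega>. h n \<omega> \<partial>M)) = norm (\<integral>\<omega>. g n \<omega> - h n \<omega> \<partial>M)"
        using gi hi by simp
      also have "\<dots> \<le> (\<integral>\<omega>. norm (g n \<omega> - h n \<omega>) \<partial>M)" by (rule integral_norm_bound)
      also have "\<dots> \<le> (\<integral>\<omega>. 2 * indicator (Bad j) \<omega> \<partial>M)"
      proof (rule integral_mono)
        fix \<omega> assume \<omega>: "\<omega> \<in> space M"
        have "norm (g n \<omega> - h n \<omega>) \<le> 2"
          using norm_triangle_ineq4[of "g n \<omega>" "h n \<omega>"] g1[of n \<omega>] h1[of n \<omega>] by simp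
        then show "norm (g n \<omega> - h n \<omega>) \<le> 2 * indicator (Bad j) \<omega>"
          using gh[OF \<omega>] by (auto split: split_indicator)
      qed (use gi hi Bi in auto)
      also have "\<dots> = 2 * prob (Bad j)" using Bi by simp
      finally show ?thesis .
    qed
    have d2: "norm ((\<integral>\<omega>. complex_of_real (k \<omega>) \<partial>M) - complex_of_real c) \<le> 2 * prob (Bad j)"
    proof -
      have "(\<integral>\<omega>. complex_of_real (k \<omega>) \<partial>M) - complex_of_real c = complex_of_real (\<integral>\<omega>. k \<omega> - c \<partial>M)"
        using ki by (simp add: prob_space)
      then have "norm ((\<integral>\<omega>. complex_of_real (k \<omega>) \<partial>M) - complex_of_real c) = \<bar>\<integral>\<omega>. k \<omega> - c \<partial>M\<bar>"
        by (simp only: norm_of_real)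
      also have "\<dots> \<le> (\<integral>\<omega>. \<bar>k \<omega> - c\<bar> \<partial>M)" by (rule integral_abs_bound)
      also have "\<dots> \<le> (\<integral>\<omega>. 2 * indicator (Bad j) \<omega> \<partial>M)"
      proof (rule integral_mono)
        fix \<omega> assume \<omega>: "\<omega> \<in> space M"
        show "\<bar>k \<omega> - c\<bar> \<le> 2 * indicator (Bad j) \<omega>"
          using kc[OF \<omega>] k1[OF \<omega>] c by (auto split: split_indicator)
      qed (use ki Bi in auto)
      also have "\<dots> = 2 * prob (Bad j)" using Bi by simp
      finally show ?thesis .
    qed
    have "(\<lambda>n. \<integral>\<omega>. h n \<omega> \<partial>M) \<longlonglongrightarrow> (\<integral>\<omega>. complex_of_real (k \<omega>) \<partial>M)"
      unfolding h_def k_def by (rule global_clt[OF \<psi>c \<psi>b])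
    from LIMSEQ_D[OF this, of "e / 2"] e obtain no
      where no: "\<And>n. n \<ge> no \<Longrightarrow> norm ((\<integral>\<omega>. h n \<omega> \<partial>M) - (\<integral>\<omega>. complex_of_real (k \<omega>) \<partial>M)) < e / 2" by auto
    have "norm ((\<integral>\<omega>. g n \<omega> \<partial>M) - complex_of_real c) < e" if n: "n \<ge> no" for n
    proof -
      define x1 x2 x3 where "x1 = (\<integral>\<omega>. g n \<omega> \<partial>M)" and "x2 = (\<integral>\<omega>. h n \<omega> \<partial>M)" and "x3 = (\<integral>\<omega>. complex_of_real (k \<omega>) \<partial>M)"
      have "norm (x1 - complex_of_real c) \<le> norm (x1 - x2) + norm (x2 - x3) + norm (x3 - complex_of_real c)"
        using norm_triangle_ineq[of "x1 - x2" "x2 - complex_of_real c"] norm_triangle_ineq[of "x2 - x3" "x3 - complex_of_real c"] by simp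
      then show ?thesis
        using d1[of n] d2 no[OF n] j unfolding x1_def x2_def x3_def by linarith
    qed
    then show "\<exists>no. \<forall>n\<ge>no. norm ((\<integral>\<omega>. g n \<omega> \<partial>M) - complex_of_real c) < e" by blast
  qed
  moreover have "char (distr M borel (\<lambda>\<omega>. 1 / (sqrt (real n) * sqrt (\<sigma>2 \<omega>)) * Tn n \<omega>)) t = (\<integral>\<omega>. g n \<omega> \<partial>M)" for n
    unfolding g_def by (rule char_distr) measurable
  ultimately show "(\<lambda>n. char (distr M borel (\<lambda>\<omega>. 1 / (sqrt (real n) * sqrt (\<sigma>2 \<omega>)) * Tn n \<omega>)) t) \<longlonglongrightarrow> char std_normal_distribution t"
    by (simp add: char_std_normal_distribution c_def)
qed

end

theorem theorem9:
  fixes S \<pi> :: "(real ^ 'nx) measure"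
    and \<Theta> :: "(real ^ 'nt) set"
    and P :: "(real ^ 'nt) \<Rightarrow> (real ^ 'nx) \<Rightarrow> (real ^ 'nx) measure"
    and H :: "(real ^ 'nt) \<Rightarrow> (real ^ 'nx) \<Rightarrow> (real ^ 'nt)"
    and K\<^sub>X :: "(real ^ 'nx) set"
    and K :: "nat \<Rightarrow> (real ^ 'nt) set"
    and \<gamma> :: "nat \<Rightarrow> real"
    and proj :: "(real ^ 'nx) \<times> (real ^ 'nt) option \<Rightarrow> (real ^ 'nx) \<times> (real ^ 'nt)"
    and V f :: "(real ^ 'nx) \<Rightarrow> real"
    and \<alpha> \<beta> :: real
    and M :: "'w measure"
    and Z :: "nat \<Rightarrow> 'w \<Rightarrow> (real ^ 'nx) \<times> (real ^ 'nt) option \<times> nat \<times> nat"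
    and x\<^sub>0 :: "(real ^ 'nx)" and \<theta>\<^sub>0 :: "(real ^ 'nt)"
    and \<theta>_lim :: "'w \<Rightarrow> (real ^ 'nt)"
  assumes "countably_generated S"
    and "prob_space \<pi>" and "sets \<pi> = sets S"
    and "open \<Theta>"
    and "\<And>\<theta>. \<theta> \<in> \<Theta> \<Longrightarrow> markov_kernel S (P \<theta>)"
    and "\<And>\<theta>. \<theta> \<in> \<Theta> \<Longrightarrow> kernel_irreducible S \<pi> (P \<theta>)"
    and "\<And>\<theta>. \<theta> \<in> \<Theta> \<Longrightarrow> bind \<pi> (P \<theta>) = \<pi>"
    and "(\<lambda>(\<theta>, x). H \<theta> x) \<in> borel_measurable (restrict_space borel \<Theta> \<Otimes>\<^sub>M S)"
    and "K\<^sub>X \<subseteq> space S"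
    and "compact_coverage \<Theta> K"
    and "decseq \<gamma>" and "\<And>k. \<gamma> k > 0"
    and "summable (\<lambda>k. real (Suc k) powr (- 1 / 2) * \<gamma> (Suc k))"
    and "proj \<in> measurable (S \<Otimes>\<^sub>M cem_space \<Theta>) (S \<Otimes>\<^sub>M restrict_space borel \<Theta>)"
    and "\<And>z. z \<in> space (S \<Otimes>\<^sub>M cem_space \<Theta>) \<Longrightarrow> proj z \<in> K\<^sub>X \<times> K 0"
    and "V \<in> borel_measurable S" and "\<And>x. x \<in> space S \<Longrightarrow> V x \<ge> 1"
    and "bdd_above (V ` K\<^sub>X)"
    and drift_minorization: "\<And>L. compact L \<Longrightarrow> L \<subseteq> \<Theta> \<Longrightarrow>
      \<exists>C \<epsilon> \<phi> \<rho> b.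
        C \<in> sets S \<and> \<epsilon> > 0 \<and> prob_space \<phi> \<and> sets \<phi> = sets S \<and> measure \<phi> C > 0 \<and>
        (\<forall>A\<in>sets S. \<forall>\<theta>\<in>L. \<forall>x\<in>C. measure (P \<theta> x) A \<ge> \<epsilon> * measure \<phi> A) \<and>
        0 \<le> \<rho> \<and> \<rho> < 1 \<and> 0 < b \<and>
        (\<forall>\<theta>\<in>L.
          (\<forall>x\<in>space S - C. (\<integral>\<^sup>+y. ennreal (V y) \<partial>P \<theta> x) \<le> ennreal (\<rho> * V x)) \<and>
          (\<forall>x\<in>C. (\<integral>\<^sup>+y. ennreal (V y) \<partial>P \<theta> x) \<le> ennreal b))"
    and kernel_Lipschitz: "\<And>L r. compact L \<Longrightarrow> L \<subseteq> \<Theta> \<Longrightarrow> 0 \<le> r \<Longrightarrow> r \<le> 1 \<Longrightarrow>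
      \<exists>C::real. C \<ge> 0 \<and> (\<forall>\<theta>\<in>L. \<forall>\<theta>'\<in>L. \<forall>g\<in>wspace S (\<lambda>x. V x powr r).
        wnorm S (\<lambda>x. V x powr r) (\<lambda>x. kernel_act (P \<theta>) g x - kernel_act (P \<theta>') g x)
          \<le> ennreal C * wnorm S (\<lambda>x. V x powr r) g * ennreal (norm (\<theta> - \<theta>')))"
    and "0 \<le> \<beta>" and "\<beta> \<le> 1 / 2"
    and "W_Lipschitz S \<Theta> (\<lambda>x. V x powr \<beta>) H"
    and "0 \<le> \<alpha>" and "\<alpha> < (1 - \<beta>) / 2"
    and "f \<in> wspace S (\<lambda>x. V x powr \<alpha>)"
    and "x\<^sub>0 \<in> space S" and "\<theta>\<^sub>0 \<in> \<Theta>"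
    and "markov_chain M (state_space S \<Theta>) (reproj_kernel S \<Theta> P H proj \<gamma> K) (x\<^sub>0, Some \<theta>\<^sub>0, 0, 0) Z"
    and "\<theta>_lim \<in> measurable M (restrict_space borel \<Theta>)"
    and "AE \<omega> in M. (\<integral>\<^sup>+x. ennreal ((poisson_sol S \<pi> (P (\<theta>_lim \<omega>)) f x)\<^sup>2) \<partial>\<pi>) < \<infinity>"
    and "AE \<omega> in M. (\<integral>\<^sup>+x. ennreal ((kernel_act (P (\<theta>_lim \<omega>))
           (poisson_sol S \<pi> (P (\<theta>_lim \<omega>)) f) x)\<^sup>2) \<partial>\<pi>) < \<infinity>"
    and "AE \<omega> in M. limsup (\<lambda>n. cem_dist (fst (snd (Z n \<omega>))) (\<theta>_lim \<omega>)) = 0"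
  shows "(\<exists>\<mu>. real_distribution \<mu> \<and>
            (\<forall>t. char \<mu> t =
               complex_of_real (\<integral>\<omega>. exp (- (1 / 2) * asym_var S \<pi> (P (\<theta>_lim \<omega>)) f * t\<^sup>2) \<partial>M)) \<and>
            weak_conv_m
              (\<lambda>n. distr M borel (\<lambda>\<omega>. real n powr (- 1 / 2) *
                 (\<Sum>k = 1..n. f (fst (Z k \<omega>)) - (\<integral>x. f x \<partial>\<pi>)))) \<mu>) \<and>
         ((AE \<omega> in M. sqrt (asym_var S \<pi> (P (\<theta>_lim \<omega>)) f) > 0) \<longrightarrow>
            weak_conv_m
              (\<lambda>n. distr M borel (\<lambda>\<omega>. 1 / (sqrt (real n) * sqrt (asym_var S \<pi> (P (\<theta>_lim \<omega>)) f)) *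
                 (\<Sum>k = 1..n. f (fst (Z k \<omega>)) - (\<integral>x. f x \<partial>\<pi>)))) std_normal_distribution)"
proof -
  interpret sa_global S \<Theta> P H proj \<gamma> K M Z "(x\<^sub>0, Some \<theta>\<^sub>0, 0, 0)" V \<pi> f \<alpha> \<beta> \<theta>_lim
  proof (intro sa_global.intro sa_chain.intro sa_global_axioms.intro)
  qed (fact assms)+
  show ?thesis
    using mixture_clt normalised_clt unfolding Tn_def \<sigma>2_def av_def by blast
qed

end
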